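(* Let $U=U(0,1)$ be the open unit ball in $\mathbb{R}^m$ and $1<p<\infty$. There exists a map $$\mathcal{T}:W^1_p(U;\mathcal{Q}_Q(\ell_2))\to L_p(\partial U;\mathcal{Q}_Q(\ell_2))$$ with the following properties. (A) If $f:\overline U\to\mathcal{Q}_Q(\ell_2)$ is Lipschitz then $\mathcal{T}(f)(x)=f(x)$ for every $x\in\partial U$; (B) For every $\varepsilon>0$ there exists $\theta>0$ such that $$\int_{\partial U}\mathcal{G}(\mathcal{T}(f_1),\mathcal{T}(f_2))^p\,d\mathcal{H}^{m-1}\le\theta\int_U\mathcal{G}(f_1,f_2)^p\,d\mathcal{L}^m+\varepsilon\left(\int_U|Df_1|^p\,d\mathcal{L}^m+\int_U|Df_2|^p\,d\mathcal{L}^m\right)$$ whenever $f_1,f_2\in W^1_p(U;\mathcal{Q}_Q(\ell_2))$; (C) There exists $C>0$ such that for every $f\in W^1_p(U;\mathcal{Q}_Q(\ell_2))$, $$\int_{\partial U}|\mathcal{T}(f)|^p\,d\mathcal{H}^{m-1}\le C\left(\int_U|f|^p\,d\mathcal{L}^m+\int_U|Df|^p\,d\mathcal{L}^m\right).$$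
   Context: $Q,m\ge1$ are integers; $\mathbb{R}^m$ has its Euclidean norm; $\ell_2$ is the infinite dimensional separable real Hilbert space. $\mathcal{Q}_Q(\ell_2)$ is the quotient of the $Q$-fold Cartesian product of $\ell_2$ by the permutation action of $S_Q$; the class of $(y_1,\dots,y_Q)$ is $[\![y_1,\dots,y_Q]\!]$, $Q[\![0]\!]=[\![0,\dots,0]\!]$, and $\mathcal{G}([\![y_1,\dots,y_Q]\!],[\![y_1',\dots,y_Q']\!])=\min_{\sigma\in S_Q}\big(\sum_i\|y_i-y'_{\sigma(i)}\|^2\big)^{1/2}$. For a map $f$ with values in $\mathcal{Q}_Q(\ell_2)$, $|f(x)|=\mathcal{G}(f(x),Q[\![0]\!])$. $L_p(U;\mathcal{Q}_Q(\ell_2))$ (resp. $L_p(\partial U;\mathcal{Q}_Q(\ell_2))$): Borel maps $f$ from $U$ (resp. $\partial U$) to $\mathcal{Q}_Q(\ell_2)$ with $\int_U|f|^pd\mathcal{L}^m<\infty$ (resp. $\int_{\partial U}|f|^pd\mathcal{H}^{m-1}<\infty$); on $U$, $d_p(f,g)=(\int_U\mathcal{G}(f,g)^pd\mathcal{L}^m)^{1/p}$. A Borel map $f:U\to\mathcal{Q}_Q(\ell_2)$ is approximately differentiable at $a\in U$ if there are affine maps $A_1,\dots,A_Q:\mathbb{R}^m\to\ell_2$ such that for every $\varepsilon>0$ the set $\{x:\mathcal{G}(f(x),[\![A_1(x),\dots,A_Q(x)]\!])>\varepsilon\|x-a\|\}$ has $m$-dimensional density $0$ at $a$; the unordered tuple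 is unique; with $L_i=A_i-A_i(0)$ put $Df(a)=[\![L_1,\dots,L_Q]\!]$ and $|Df(a)|=\big(\sum_{i=1}^Q\sum_{j=1}^m\|L_i(e_j)\|^2\big)^{1/2}$, $e_1,\dots,e_m$ being the canonical basis of $\mathbb{R}^m$. $W^1_p(U;\mathcal{Q}_Q(\ell_2))$: those $f\in L_p(U;\mathcal{Q}_Q(\ell_2))$ for which there are Lipschitz maps $f_j:\mathbb{R}^m\to\mathcal{Q}_Q(\ell_2)$ with $\sup_j\int_U|Df_j|^pd\mathcal{L}^m<\infty$ and $d_p(f,f_j)\to0$. Lipschitz maps and members of $W^1_p(U;\mathcal{Q}_Q(\ell_2))$ are approximately differentiable $\mathcal{L}^m$-a.e. in $U$. In (A), $\mathcal{T}(f)$ means $\mathcal{T}(f|_U)$. *)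

theory Defs
  imports "HOL-Analysis.Analysis"
begin

section \<open>Unordered tuples\<close>

text \<open>
  The quotient of the \<open>Q\<close>-fold Cartesian product of a type \<open>'a\<close> by the action of the symmetric
  group, where \<open>Q = CARD('q)\<close> and ordered tuples are families indexed by the finite type \<open>'q\<close>.
\<close>

definition same_up_to_perm :: "('q \<Rightarrow> 'a) \<Rightarrow> ('q \<Rightarrow> 'a) \<Rightarrow> bool" where
  "same_up_to_perm y z \<longleftrightarrow> (\<exists>\<sigma>. bij \<sigma> \<and> z = y \<circ> \<sigma>)"

lemma equivp_same_up_to_perm:
  "equivp (same_up_to_perm :: ('q \<Rightarrow> 'a) \<Rightarrow> ('q \<Rightarrow> 'a) \<Rightarrow> bool)" (is "equivp ?R")
proof (rule equivpI)
  show "reflp ?R"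
    by (rule reflpI) (auto simp: same_up_to_perm_def intro!: exI[of _ id])
  show "symp ?R"
  proof (rule sympI)
    fix y z :: "'q \<Rightarrow> 'a"
    assume "same_up_to_perm y z"
    then obtain \<sigma> where \<sigma>: "bij \<sigma>" "z = y \<circ> \<sigma>"
      by (auto simp: same_up_to_perm_def)
    then have "y = z \<circ> inv \<sigma>"
      by (simp add: fun_eq_iff bij_is_surj surj_f_inv_f)
    then show "same_up_to_perm z y"
      unfolding same_up_to_perm_def using bij_imp_bij_inv[OF \<sigma>(1)] by blast
  qed
  show "transp ?R"
  proof (rule transpI)
    fix x y z :: "'q \<Rightarrow> 'a"
    assume "same_up_to_perm x y" "same_up_to_perm y z"
    then obtain \<sigma> \<tau> where "bij \<sigma>" "y = x \<circ> \<sigma>" "bij \<tau>" "z = y \<circ> \<tau>"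
      by (auto simp: same_up_to_perm_def)
    then have "bij (\<sigma> \<circ> \<tau>)" "z = x \<circ> (\<sigma> \<circ> \<tau>)"
      by (auto simp: bij_comp)
    then show "same_up_to_perm x z"
      unfolding same_up_to_perm_def by blast
  qed
qed

lemma same_up_to_perm_sym: "same_up_to_perm y z \<Longrightarrow> same_up_to_perm z y"
  by (rule equivp_symp[OF equivp_same_up_to_perm])

quotient_type ('a, 'q) unordered_tuple = "'q \<Rightarrow> 'a" / same_up_to_perm
  by (rule equivp_same_up_to_perm)

lift_definition unordered :: "('q \<Rightarrow> 'a) \<Rightarrow> ('a, 'q) unordered_tuple" is "\<lambda>y. y" .

definition match_cost :: "('q::finite \<Rightarrow> 'a::metric_space) \<Rightarrow> ('q \<Rightarrow> 'a) \<Rightarrow> real" where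
  "match_cost y z = Min ((\<lambda>\<sigma>. sqrt (\<Sum>i\<in>UNIV. (dist (y i) (z (\<sigma> i)))\<^sup>2)) ` {\<sigma>. bij \<sigma>})"

lemma match_cost_le:
  "bij \<sigma> \<Longrightarrow> match_cost y z \<le> sqrt (\<Sum>i\<in>UNIV. (dist (y i) (z (\<sigma> i)))\<^sup>2)"
  unfolding match_cost_def by (intro Min_le) auto

lemma match_cost_attained:
  obtains \<sigma> where "bij \<sigma>" "match_cost y z = sqrt (\<Sum>i\<in>UNIV. (dist (y i) (z (\<sigma> i)))\<^sup>2)"
proof -
  have "{\<sigma>. bij \<sigma>} \<noteq> ({} :: ('a \<Rightarrow> 'a) set)"
    using bij_id by blast
  then have "match_cost y z \<in> (\<lambda>\<sigma>. sqrt (\<Sum>i\<in>UNIV. (dist (y i) (z (\<sigma> i)))\<^sup>2)) ` {\<sigma>. bij \<sigma>}"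
    unfolding match_cost_def by (intro Min_in) auto
  with that show thesis by auto
qed

lemma match_cost_nonneg: "0 \<le> match_cost y z"
  by (rule match_cost_attained[of y z]) (simp add: sum_nonneg)

lemma match_cost_commute_le: "match_cost z y \<le> match_cost y z"
proof -
  obtain \<sigma> where \<sigma>: "bij \<sigma>" "match_cost y z = sqrt (\<Sum>i\<in>UNIV. (dist (y i) (z (\<sigma> i)))\<^sup>2)"
    by (rule match_cost_attained)
  have "match_cost z y \<le> sqrt (\<Sum>i\<in>UNIV. (dist (z i) (y (inv \<sigma> i)))\<^sup>2)"
    using \<sigma> by (intro match_cost_le bij_imp_bij_inv)
  also have "(\<Sum>i\<in>UNIV. (dist (z i) (y (inv \<sigma> i)))\<^sup>2) = (\<Sum>i\<in>UNIV. (dist (y i) (z (\<sigma> i)))\<^sup>2)"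
    using \<sigma>(1) by (subst sum.reindex_bij_betw[of \<sigma> UNIV UNIV, symmetric])
      (auto simp: dist_commute bij_is_inj)
  finally show ?thesis using \<sigma> by simp
qed

lemma match_cost_commute: "match_cost z y = match_cost y z"
  by (intro antisym match_cost_commute_le)

lemma match_cost_triangle: "match_cost x z \<le> match_cost x y + match_cost y z"
proof -
  obtain \<sigma> where \<sigma>: "bij \<sigma>" "match_cost x y = sqrt (\<Sum>i\<in>UNIV. (dist (x i) (y (\<sigma> i)))\<^sup>2)"
    by (rule match_cost_attained)
  obtain \<tau> where \<tau>: "bij \<tau>" "match_cost y z = sqrt (\<Sum>i\<in>UNIV. (dist (y i) (z (\<tau> i)))\<^sup>2)"
    by (rule match_cost_attained)
  have 2: "(\<Sum>i\<in>UNIV. (dist (y i) (z (\<tau> i)))\<^sup>2) = (\<Sum>i\<in>UNIV. (dist (y (\<sigma> i)) (z (\<tau> (\<sigma> i))))\<^sup>2)"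
    using \<sigma>(1) by (subst sum.reindex_bij_betw[of \<sigma> UNIV UNIV, symmetric]) auto
  have "match_cost x z \<le> L2_set (\<lambda>i. dist (x i) (z ((\<tau> \<circ> \<sigma>) i))) UNIV"
    unfolding L2_set_def using \<sigma> \<tau> by (intro match_cost_le bij_comp)
  also have "\<dots> \<le> L2_set (\<lambda>i. dist (x i) (y (\<sigma> i)) + dist (y (\<sigma> i)) (z (\<tau> (\<sigma> i)))) UNIV"
    by (intro L2_set_mono) (auto simp: dist_triangle)
  also have "\<dots> \<le> L2_set (\<lambda>i. dist (x i) (y (\<sigma> i))) UNIV
      + L2_set (\<lambda>i. dist (y (\<sigma> i)) (z (\<tau> (\<sigma> i)))) UNIV"
    by (rule L2_set_triangle_ineq)
  also have "\<dots> = match_cost x y + match_cost y z"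
    by (simp add: \<sigma> \<tau> L2_set_def 2)
  finally show ?thesis .
qed

lemma match_cost_eq_0_iff: "match_cost y z = 0 \<longleftrightarrow> same_up_to_perm y z"
proof
  assume "match_cost y z = 0"
  moreover obtain \<sigma> where \<sigma>: "bij \<sigma>" "match_cost y z = sqrt (\<Sum>i\<in>UNIV. (dist (y i) (z (\<sigma> i)))\<^sup>2)"
    by (rule match_cost_attained)
  ultimately have "y = z \<circ> \<sigma>"
    by (simp add: sum_nonneg_eq_0_iff fun_eq_iff)
  with \<sigma> have "same_up_to_perm z y"
    by (auto simp: same_up_to_perm_def)
  then show "same_up_to_perm y z"
    by (rule same_up_to_perm_sym)
next
  assume "same_up_to_perm y z"
  then have "same_up_to_perm z y"
    by (rule same_up_to_perm_sym)
  then obtain \<sigma> where "bij \<sigma>" "y = z \<circ> \<sigma>"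
    by (auto simp: same_up_to_perm_def)
  then have "match_cost y z \<le> 0"
    using match_cost_le[of \<sigma> y z] by simp
  with match_cost_nonneg[of y z] show "match_cost y z = 0"
    by linarith
qed

text \<open>
  \<^const>\<open>dist\<close> on unordered tuples is the metric \<open>\<G>\<close>; on a normed space \<open>dist (y i) (z (\<sigma> i))\<close> is
  \<open>norm (y i - z (\<sigma> i))\<close>.
\<close>

instantiation unordered_tuple :: (metric_space, finite) metric_space
begin

lift_definition dist_unordered_tuple ::
    "('a, 'b) unordered_tuple \<Rightarrow> ('a, 'b) unordered_tuple \<Rightarrow> real" is match_cost
proof -
  fix y y' z z' :: "'b \<Rightarrow> 'a"
  assume "same_up_to_perm y y'" "same_up_to_perm z z'"
  then have "match_cost y y' = 0" "match_cost z z' = 0"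
    by (simp_all add: match_cost_eq_0_iff)
  then show "match_cost y z = match_cost y' z'"
    using match_cost_triangle[of y z y'] match_cost_triangle[of y' z z']
      match_cost_triangle[of y' z' y] match_cost_triangle[of y z' z]
      match_cost_commute[of y y'] match_cost_commute[of z z']
    by linarith
qed

definition uniformity_unordered_tuple ::
    "(('a, 'b) unordered_tuple \<times> ('a, 'b) unordered_tuple) filter" where
  "uniformity_unordered_tuple = (INF e\<in>{0<..}. principal {(x, y). dist x y < e})"

definition open_unordered_tuple :: "('a, 'b) unordered_tuple set \<Rightarrow> bool" where
  "open_unordered_tuple S \<longleftrightarrow> (\<forall>x\<in>S. \<forall>\<^sub>F (x', y) in uniformity. x' = x \<longrightarrow> y \<in> S)"

instance
proof
  fix x y z :: "('a, 'b) unordered_tuple"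
  show "dist x y = 0 \<longleftrightarrow> x = y"
    by transfer (rule match_cost_eq_0_iff)
  show "dist x y \<le> dist x z + dist y z"
    by transfer (metis match_cost_triangle match_cost_commute)
qed (simp_all add: uniformity_unordered_tuple_def open_unordered_tuple_def)

end

definition tuple_abs :: "('h::real_normed_vector, 'q::finite) unordered_tuple \<Rightarrow> real" where
  "tuple_abs y = dist y (unordered (\<lambda>_. 0))"


section \<open>Hausdorff measure\<close>

text \<open>
  The normalisation is Federer's: a covering set \<open>S\<close> contributes \<open>\<alpha>(k) (diam S / 2) ^ k\<close>, where
  \<open>\<alpha>(k)\<close> is the volume of the unit ball of \<open>\<real>^k\<close>. Nonempty sets contribute \<open>1\<close> when \<open>k = 0\<close>, so that
  the measure of dimension \<open>0\<close> is the counting measure. Boundedness has to be required explicitly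
  because \<^const>\<open>diameter\<close> is unspecified for unbounded sets.
\<close>

definition hausdorff_gauge :: "nat \<Rightarrow> 'a::metric_space set \<Rightarrow> ennreal" where
  "hausdorff_gauge k S = (if S = {} then 0 else ennreal (unit_ball_vol (real k) * (diameter S / 2) ^ k))"

definition hausdorff_covers :: "real \<Rightarrow> 'a::metric_space set \<Rightarrow> (nat \<Rightarrow> 'a set) set" where
  "hausdorff_covers \<delta> A = {S. A \<subseteq> (\<Union>i. S i) \<and> (\<forall>i. bounded (S i) \<and> diameter (S i) \<le> \<delta>)}"

definition hausdorff_premeasure :: "nat \<Rightarrow> real \<Rightarrow> 'a::metric_space set \<Rightarrow> ennreal" where
  "hausdorff_premeasure k \<delta> A = (INF S\<in>hausdorff_covers \<delta> A. \<Sum>i. hausdorff_gauge k (S i))"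

definition hausdorff_outer :: "nat \<Rightarrow> 'a::metric_space set \<Rightarrow> ennreal" where
  "hausdorff_outer k A = (SUP \<delta>\<in>{0<..}. hausdorff_premeasure k \<delta> A)"

definition hausdorff_measure :: "nat \<Rightarrow> 'a::metric_space measure" where
  "hausdorff_measure k = measure_of UNIV (sets borel) (hausdorff_outer k)"

lemma hausdorff_gauge_empty [simp]: "hausdorff_gauge k {} = 0"
  by (simp add: hausdorff_gauge_def)

lemma hausdorff_covers_antimono: "A \<subseteq> B \<Longrightarrow> hausdorff_covers \<delta> B \<subseteq> hausdorff_covers \<delta> A"
  by (auto simp: hausdorff_covers_def)

lemma hausdorff_premeasure_mono: "A \<subseteq> B \<Longrightarrow> hausdorff_premeasure k \<delta> A \<le> hausdorff_premeasure k \<delta> B"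
  unfolding hausdorff_premeasure_def by (intro INF_superset_mono hausdorff_covers_antimono) auto

lemma hausdorff_premeasure_antimono:
  "\<delta> \<le> \<epsilon> \<Longrightarrow> hausdorff_premeasure k \<epsilon> A \<le> hausdorff_premeasure k \<delta> A"
  unfolding hausdorff_premeasure_def
  by (intro INF_superset_mono) (auto simp: hausdorff_covers_def intro: order_trans)

lemma hausdorff_premeasure_empty: "0 < \<delta> \<Longrightarrow> hausdorff_premeasure k \<delta> {} = 0"
proof -
  assume "0 < \<delta>"
  then have "(\<lambda>_. {}) \<in> hausdorff_covers \<delta> ({} :: 'a set)"
    by (simp add: hausdorff_covers_def)
  then have "hausdorff_premeasure k \<delta> ({} :: 'a set) \<le> (\<Sum>i::nat. hausdorff_gauge k ({} :: 'a set))"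
    unfolding hausdorff_premeasure_def by (rule INF_lower)
  then show ?thesis by simp
qed

lemma hausdorff_premeasure_UN_le:
  fixes A :: "nat \<Rightarrow> 'a::metric_space set"
  shows "hausdorff_premeasure k \<delta> (\<Union>n. A n) \<le> (\<Sum>n. hausdorff_premeasure k \<delta> (A n))"
proof (cases "(\<Sum>n. hausdorff_premeasure k \<delta> (A n)) = \<infinity>")
  case False
  show ?thesis
  proof (rule ennreal_le_epsilon)
    fix e :: real assume e: "0 < e"
    have "\<exists>S\<in>hausdorff_covers \<delta> (A n).
        (\<Sum>i. hausdorff_gauge k (S i)) \<le> hausdorff_premeasure k \<delta> (A n) + ennreal (e * (1/2) ^ Suc n)" for n
    proof -
      have "hausdorff_premeasure k \<delta> (A n) \<le> (\<Sum>n. hausdorff_premeasure k \<delta> (A n))"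
        using sum_le_suminf[OF summableI, of "{n}" "\<lambda>n. hausdorff_premeasure k \<delta> (A n)"] by simp
      with False have "hausdorff_premeasure k \<delta> (A n) \<noteq> \<infinity>"
        by (auto simp: top_unique)
      moreover have "0 < ennreal (e * (1/2) ^ Suc n)"
        using e by simp
      ultimately have "hausdorff_premeasure k \<delta> (A n)
          < hausdorff_premeasure k \<delta> (A n) + ennreal (e * (1/2) ^ Suc n)"
        using ennreal_add_left_cancel_less[of "hausdorff_premeasure k \<delta> (A n)" 0 "ennreal (e * (1/2) ^ Suc n)"]
        by (simp add: top.not_eq_extremum)
      then show ?thesis
        unfolding hausdorff_premeasure_def INF_less_iff by (auto intro: less_imp_le)
    qed
    then obtain S where S: "\<And>n. S n \<in> hausdorff_covers \<delta> (A n)"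
      "\<And>n. (\<Sum>i. hausdorff_gauge k (S n i)) \<le> hausdorff_premeasure k \<delta> (A n) + ennreal (e * (1/2) ^ Suc n)"
      by metis
    define C where "C = case_prod S \<circ> prod_decode"
    have C: "C \<in> hausdorff_covers \<delta> (\<Union>n. A n)"
    proof -
      have "(\<Union>n. A n) \<subseteq> (\<Union>i. C i)"
      proof
        fix x assume "x \<in> (\<Union>n. A n)"
        then obtain n i where "x \<in> S n i"
          using S(1) unfolding hausdorff_covers_def by blast
        then have "x \<in> C (prod_encode (n, i))"
          by (simp add: C_def)
        then show "x \<in> (\<Union>i. C i)" by blast
      qed
      then show ?thesis
        using S(1) by (auto simp: hausdorff_covers_def C_def split_beta)
    qed
    have "hausdorff_premeasure k \<delta> (\<Union>n. A n) \<le> (\<Sum>i. hausdorff_gauge k (C i))"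
      unfolding hausdorff_premeasure_def using C by (rule INF_lower)
    also have "\<dots> = (\<Sum>n. \<Sum>i. hausdorff_gauge k (S n i))"
      using suminf_ennreal_2dimen[of "\<lambda>n. \<Sum>i. hausdorff_gauge k (S n i)" "\<lambda>(n, i). hausdorff_gauge k (S n i)"]
      by (simp add: C_def comp_def split_beta)
    also have "\<dots> \<le> (\<Sum>n. hausdorff_premeasure k \<delta> (A n) + ennreal (e * (1/2) ^ Suc n))"
      by (intro suminf_le S summableI)
    also have "\<dots> = (\<Sum>n. hausdorff_premeasure k \<delta> (A n)) + (\<Sum>n. ennreal (e * (1/2) ^ Suc n))"
      by (rule suminf_add[symmetric]) auto
    also have "(\<Sum>n. ennreal (e * (1/2) ^ Suc n)) = ennreal e"
      using e sums_mult[OF power_half_series, of e] by (intro suminf_ennreal_eq) auto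
    finally show "hausdorff_premeasure k \<delta> (\<Union>n. A n) \<le> (\<Sum>n. hausdorff_premeasure k \<delta> (A n)) + ennreal e" .
  qed
qed auto

lemma hausdorff_outer_UN_le: "hausdorff_outer k (\<Union>n. A n) \<le> (\<Sum>n. hausdorff_outer k (A n))"
proof -
  have "hausdorff_premeasure k \<delta> (\<Union>n. A n) \<le> (\<Sum>n. hausdorff_outer k (A n))" if "0 < \<delta>" for \<delta>
  proof -
    note hausdorff_premeasure_UN_le
    also have "(\<Sum>n. hausdorff_premeasure k \<delta> (A n)) \<le> (\<Sum>n. hausdorff_outer k (A n))"
      unfolding hausdorff_outer_def using that by (intro suminf_le summableI SUP_upper) auto
    finally show ?thesis .
  qed
  then show ?thesis
    unfolding hausdorff_outer_def[of k "\<Union>n. A n"] by (intro SUP_least) auto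
qed

lemma outer_measure_space_hausdorff_outer:
  "outer_measure_space UNIV (hausdorff_outer k :: 'a::metric_space set \<Rightarrow> ennreal)"
  (is "outer_measure_space _ ?H")
  unfolding outer_measure_space_def
proof (intro conjI)
  show "positive UNIV ?H"
    unfolding positive_def hausdorff_outer_def
    by (auto simp: hausdorff_premeasure_empty intro!: antisym SUP_least)
  show "increasing UNIV ?H"
    unfolding increasing_def hausdorff_outer_def by (blast intro: SUP_mono hausdorff_premeasure_mono)
  show "countably_subadditive UNIV ?H"
    unfolding countably_subadditive_def by (blast intro: hausdorff_outer_UN_le)
qed

lemma hausdorff_outer_empty [simp]: "hausdorff_outer k {} = 0"
  using outer_measure_space_hausdorff_outer by (auto simp: outer_measure_space_def positive_def)

lemma hausdorff_outer_mono: "A \<subseteq> B \<Longrightarrow> hausdorff_outer k A \<le> hausdorff_outer k B"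
  using outer_measure_space_hausdorff_outer by (auto simp: outer_measure_space_def increasing_def)

lemma hausdorff_outer_Un_le: "hausdorff_outer k (A \<union> B) \<le> hausdorff_outer k A + hausdorff_outer k B"
proof -
  have "hausdorff_outer k (\<Union>n. binaryset A B n) \<le> (\<Sum>n. hausdorff_outer k (binaryset A B n))"
    by (rule hausdorff_outer_UN_le)
  then show ?thesis
    by (simp add: UN_binaryset_eq suminf_binaryset_eq)
qed

lemma hausdorff_outer_separated:
  assumes d: "0 < d" and sep: "\<And>x y. x \<in> A \<Longrightarrow> y \<in> B \<Longrightarrow> d \<le> dist x y"
  shows "hausdorff_outer k A + hausdorff_outer k B \<le> hausdorff_outer k (A \<union> B)"
proof -
  have small: "hausdorff_premeasure k \<delta> A + hausdorff_premeasure k \<delta> B \<le> hausdorff_outer k (A \<union> B)"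
    if \<delta>: "0 < \<delta>" "\<delta> < d" for \<delta>
  proof -
    have "hausdorff_premeasure k \<delta> A + hausdorff_premeasure k \<delta> B \<le> hausdorff_premeasure k \<delta> (A \<union> B)"
      unfolding hausdorff_premeasure_def[of k \<delta> "A \<union> B"]
    proof (rule INF_greatest)
      fix S assume S: "S \<in> hausdorff_covers \<delta> (A \<union> B)"
      define P where "P X i = (if S i \<inter> X = {} then {} else S i)" for X i
      have P: "P X \<in> hausdorff_covers \<delta> X" if X: "X \<subseteq> A \<union> B" for X
      proof -
        have "X \<subseteq> (\<Union>i. P X i)"
        proof
          fix x assume "x \<in> X"
          moreover have "A \<union> B \<subseteq> (\<Union>i. S i)"
            using S by (simp add: hausdorff_covers_def)
          ultimately have "x \<in> (\<Union>i. S i)"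
            using X by blast
          then obtain i where "x \<in> S i" by blast
          with \<open>x \<in> X\<close> have "x \<in> P X i" by (auto simp: P_def)
          then show "x \<in> (\<Union>i. P X i)" by blast
        qed
        then show ?thesis
          using S \<delta> by (auto simp: hausdorff_covers_def P_def)
      qed
      have disj: "S i \<inter> A = {} \<or> S i \<inter> B = {}" for i
      proof (rule ccontr)
        assume "\<not> ?thesis"
        then obtain x y where xy: "x \<in> S i" "x \<in> A" "y \<in> S i" "y \<in> B" by blast
        have "dist x y \<le> diameter (S i)"
          using S xy by (intro diameter_bounded_bound) (auto simp: hausdorff_covers_def)
        also have "\<dots> \<le> \<delta>"
          using S by (auto simp: hausdorff_covers_def)
        finally show False
          using sep[of x y] xy \<delta> by simp
      qed
      have "hausdorff_premeasure k \<delta> A + hausdorff_premeasure k \<delta> B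
          \<le> (\<Sum>i. hausdorff_gauge k (P A i)) + (\<Sum>i. hausdorff_gauge k (P B i))"
        unfolding hausdorff_premeasure_def using P by (intro add_mono INF_lower) auto
      also have "\<dots> = (\<Sum>i. hausdorff_gauge k (P A i) + hausdorff_gauge k (P B i))"
        by (rule suminf_add) auto
      also have "\<dots> \<le> (\<Sum>i. hausdorff_gauge k (S i))"
      proof (intro suminf_le summableI)
        fix i
        show "hausdorff_gauge k (P A i) + hausdorff_gauge k (P B i) \<le> hausdorff_gauge k (S i)"
          using disj[of i] by (auto simp: P_def)
      qed
      finally show "hausdorff_premeasure k \<delta> A + hausdorff_premeasure k \<delta> B
          \<le> (\<Sum>i. hausdorff_gauge k (S i))" .
    qed
    also have "\<dots> \<le> hausdorff_outer k (A \<union> B)"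
      unfolding hausdorff_outer_def using \<delta> by (intro SUP_upper) auto
    finally show ?thesis .
  qed
  have le: "hausdorff_premeasure k \<delta> A + hausdorff_premeasure k \<epsilon> B \<le> hausdorff_outer k (A \<union> B)"
    if "0 < \<delta>" "0 < \<epsilon>" for \<delta> \<epsilon>
  proof -
    define \<eta> where "\<eta> = min (d / 2) (min \<delta> \<epsilon>)"
    have "hausdorff_premeasure k \<delta> A + hausdorff_premeasure k \<epsilon> B
        \<le> hausdorff_premeasure k \<eta> A + hausdorff_premeasure k \<eta> B"
      by (intro add_mono hausdorff_premeasure_antimono) (auto simp: \<eta>_def)
    also have "\<dots> \<le> hausdorff_outer k (A \<union> B)"
      using that d by (intro small) (auto simp: \<eta>_def)
    finally show ?thesis .
  qed
  have ne: "{0::real<..} \<noteq> {}"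
    using zero_less_one by blast
  have le': "hausdorff_premeasure k \<delta> A + hausdorff_outer k B \<le> hausdorff_outer k (A \<union> B)"
    if "0 < \<delta>" for \<delta>
  proof -
    have "hausdorff_premeasure k \<delta> A + hausdorff_outer k B
        = (SUP \<epsilon>\<in>{0<..}. hausdorff_premeasure k \<delta> A + hausdorff_premeasure k \<epsilon> B)"
      unfolding hausdorff_outer_def using ne by (simp add: ennreal_SUP_add_right)
    also have "\<dots> \<le> hausdorff_outer k (A \<union> B)"
      using that by (intro SUP_least le) auto
    finally show ?thesis .
  qed
  have "hausdorff_outer k A + hausdorff_outer k B
      = (SUP \<delta>\<in>{0<..}. hausdorff_premeasure k \<delta> A + hausdorff_outer k B)"
    unfolding hausdorff_outer_def[of k A] using ne by (simp add: ennreal_SUP_add_left)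
  also have "\<dots> \<le> hausdorff_outer k (A \<union> B)"
    by (intro SUP_least le') auto
  finally show ?thesis .
qed

lemma hausdorff_outer_chain:
  assumes fin: "hausdorff_outer k X < \<infinity>" and R: "\<And>j. R j \<subseteq> X"
    and sep: "\<And>n. \<exists>d>0. \<forall>x\<in>(\<Union>j<n. R j). \<forall>y\<in>R n. d \<le> dist x y"
  shows "(\<Sum>j. hausdorff_outer k (R j)) < \<infinity>"
proof -
  have "(\<Sum>j<n. hausdorff_outer k (R j)) \<le> hausdorff_outer k (\<Union>j<n. R j)" for n
  proof (induction n)
    case (Suc n)
    obtain d where "d > 0" "\<forall>x\<in>(\<Union>j<n. R j). \<forall>y\<in>R n. d \<le> dist x y"
      using sep by blast
    then have "hausdorff_outer k (\<Union>j<n. R j) + hausdorff_outer k (R n)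
        \<le> hausdorff_outer k ((\<Union>j<n. R j) \<union> R n)"
      by (intro hausdorff_outer_separated[of d]) auto
    moreover have "(\<Union>j<n. R j) \<union> R n = (\<Union>j<Suc n. R j)"
      by (auto simp: lessThan_Suc)
    ultimately have "hausdorff_outer k (\<Union>j<n. R j) + hausdorff_outer k (R n)
        \<le> hausdorff_outer k (\<Union>j<Suc n. R j)"
      by simp
    then show ?case
      using order_trans[OF add_right_mono[OF Suc.IH]] by (simp only: sum.lessThan_Suc)
  qed simp
  also have "hausdorff_outer k (\<Union>j<n. R j) \<le> hausdorff_outer k X" for n
    using R by (intro hausdorff_outer_mono) auto
  finally have "(\<Sum>j. hausdorff_outer k (R j)) \<le> hausdorff_outer k X"
    by (intro suminf_le_const summableI)
  with fin show ?thesis by (rule order.strict_trans1[rotated])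
qed

lemma hausdorff_outer_closed:
  fixes F :: "'a::metric_space set"
  assumes F: "closed F"
  shows "hausdorff_outer k (X \<inter> F) + hausdorff_outer k (X - F) \<le> hausdorff_outer k X"
proof (cases "F = {} \<or> hausdorff_outer k X = \<infinity>")
  case False
  then have ne: "F \<noteq> {}" and fin: "hausdorff_outer k X < \<infinity>"
    by (auto simp: less_top)
  define D where "D n = {x\<in>X. 1 / real (Suc n) \<le> infdist x F}" for n
  define R where "R n = D (Suc n) - D n" for n
  have sepR: "\<exists>d>0. \<forall>x\<in>D a. \<forall>y\<in>R b. d \<le> dist x y" if "a < b" for a b
  proof (intro exI conjI ballI)
    show "0 < 1 / real (Suc a) - 1 / real (Suc b)"
      using that frac_less2[of 1 1 "real (Suc a)" "real (Suc b)"] by simp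
    fix x y assume "x \<in> D a" "y \<in> R b"
    then have "1 / real (Suc a) \<le> infdist x F" "infdist y F \<le> 1 / real (Suc b)"
      by (auto simp: D_def R_def)
    with infdist_triangle[of x F y] show "1 / real (Suc a) - 1 / real (Suc b) \<le> dist x y"
      by linarith
  qed
  have mono: "D a \<subseteq> D b" if "a \<le> b" for a b
  proof -
    have "1 / real (Suc b) \<le> 1 / real (Suc a)"
      using that by (simp add: field_simps)
    then show ?thesis by (auto simp: D_def)
  qed
  have sub: "R n \<subseteq> D b" if "Suc n \<le> b" for n b
    using mono[OF that] by (auto simp: R_def)
  have chain: "(\<Sum>j. hausdorff_outer k (R (2 * j + c))) < \<infinity>" for c
  proof (rule hausdorff_outer_chain[OF fin])
    show "R (2 * j + c) \<subseteq> X" for j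
      by (auto simp: R_def D_def)
    fix n
    show "\<exists>d>0. \<forall>x\<in>(\<Union>j<n. R (2 * j + c)). \<forall>y\<in>R (2 * n + c). d \<le> dist x y"
    proof (cases n)
      case 0
      then show ?thesis by (auto intro: exI[of _ 1])
    next
      case (Suc m)
      have "R (2 * j + c) \<subseteq> D (2 * m + c + 1)" if "j < n" for j
        using that Suc by (intro sub) auto
      then have "(\<Union>j<n. R (2 * j + c)) \<subseteq> D (2 * m + c + 1)"
        by blast
      moreover obtain d where "d > 0" "\<forall>x\<in>D (2 * m + c + 1). \<forall>y\<in>R (2 * n + c). d \<le> dist x y"
        using sepR[of "2 * m + c + 1" "2 * n + c"] Suc by auto
      ultimately show ?thesis by blast
    qed
  qed
  define r where "r n = hausdorff_outer k (R n)" for n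
  have rfin: "(\<Sum>n. r n) < \<infinity>"
  proof -
    have *: "(\<Sum>i<n. r i) \<le> (\<Sum>j. r (2 * j + 0)) + (\<Sum>j. r (2 * j + 1))" for n
    proof -
      have "(\<Sum>i<n. r i) \<le> (\<Sum>i<2 * n. r i)"
        by (rule sum_mono2) auto
      also have "\<dots> = (\<Sum>j<n. r (2 * j + 0)) + (\<Sum>j<n. r (2 * j + 1))"
        by (induction n) (auto simp: algebra_simps)
      also have "\<dots> \<le> (\<Sum>j. r (2 * j + 0)) + (\<Sum>j. r (2 * j + 1))"
        by (intro add_mono sum_le_suminf summableI) auto
      finally show ?thesis .
    qed
    have "(\<Sum>n. r n) \<le> (\<Sum>j. r (2 * j + 0)) + (\<Sum>j. r (2 * j + 1))"
      using * by (intro suminf_le_const summableI)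
    also have "\<dots> < \<infinity>"
      using chain[of 0] chain[of 1] by (simp add: r_def)
    finally show ?thesis .
  qed
  have tail: "(\<lambda>n. \<Sum>j. r (j + n)) \<longlonglongrightarrow> 0"
  proof -
    define s where "s n = enn2real (r n)" for n
    have "r n \<noteq> \<infinity>" for n
      using rfin sum_le_suminf[OF summableI, of "{n}" r] by (auto simp: top_unique less_top)
    then have rs: "r n = ennreal (s n)" for n
      by (simp add: s_def less_top)
    have s: "summable s"
    proof (rule summable_suminf_not_top)
      show "(\<Sum>n. ennreal (s n)) \<noteq> top"
        using rfin unfolding rs by (simp add: less_top)
    qed (simp add: s_def)
    have "(\<lambda>n. ennreal (\<Sum>j. s (j + n))) \<longlonglongrightarrow> ennreal 0"
      by (intro tendsto_ennrealI suminf_exist_split2 s)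
    moreover have "(\<Sum>j. r (j + n)) = ennreal (\<Sum>j. s (j + n))" for n
    proof -
      have "summable (\<lambda>j. s (j + n))"
        using s by (simp add: summable_iff_shift)
      moreover have "0 \<le> s j" for j
        by (simp add: s_def)
      ultimately show ?thesis
        unfolding rs by (intro suminf_ennreal2)
    qed
    ultimately show ?thesis by simp
  qed
  have XF: "X - F \<subseteq> D n \<union> (\<Union>j. R (j + n))" for n
  proof
    fix x assume x: "x \<in> X - F"
    then have pos: "0 < infdist x F"
      using F ne by (simp add: infdist_pos_not_in_closed)
    obtain N where "inverse (real (Suc N)) < infdist x F"
      using reals_Archimedean[OF pos] by auto
    then have ex: "x \<in> D N"
      using x by (simp add: D_def inverse_eq_divide)
    show "x \<in> D n \<union> (\<Union>j. R (j + n))"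
    proof (cases "x \<in> D n")
      case False
      define M where "M = (LEAST M. x \<in> D M)"
      have M: "x \<in> D M"
        unfolding M_def using ex by (rule LeastI)
      have "n < M"
        using M False mono[of M n] by (meson not_le subsetD)
      then obtain j where j: "M = Suc (j + n)"
        by (metis add.commute add_Suc_right less_imp_Suc_add)
      have "x \<notin> D (j + n)"
        using not_less_Least[of "j + n" "\<lambda>M. x \<in> D M"] j by (simp add: M_def)
      with M j have "x \<in> R (j + n)" by (simp add: R_def)
      then show ?thesis by blast
    qed simp
  qed
  have main: "hausdorff_outer k (X \<inter> F) + hausdorff_outer k (X - F)
      \<le> hausdorff_outer k X + (\<Sum>j. r (j + n))" for n
  proof -
    have "hausdorff_outer k (X - F) \<le> hausdorff_outer k (D n \<union> (\<Union>j. R (j + n)))"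
      by (intro hausdorff_outer_mono XF)
    also have "\<dots> \<le> hausdorff_outer k (D n) + hausdorff_outer k (\<Union>j. R (j + n))"
      by (rule hausdorff_outer_Un_le)
    also have "\<dots> \<le> hausdorff_outer k (D n) + (\<Sum>j. r (j + n))"
      unfolding r_def by (intro add_left_mono hausdorff_outer_UN_le)
    finally have 1: "hausdorff_outer k (X - F) \<le> hausdorff_outer k (D n) + (\<Sum>j. r (j + n))" .
    have "hausdorff_outer k (X \<inter> F) + hausdorff_outer k (D n) \<le> hausdorff_outer k ((X \<inter> F) \<union> D n)"
    proof (rule hausdorff_outer_separated[of "1 / real (Suc n)"])
      fix x y assume "x \<in> X \<inter> F" "y \<in> D n"
      then show "1 / real (Suc n) \<le> dist x y"
        using infdist_le[of x F y] by (auto simp: D_def dist_commute)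
    qed simp
    also have "\<dots> \<le> hausdorff_outer k X"
      by (intro hausdorff_outer_mono) (auto simp: D_def)
    finally have 2: "hausdorff_outer k (X \<inter> F) + hausdorff_outer k (D n) \<le> hausdorff_outer k X" .
    have "hausdorff_outer k (X \<inter> F) + hausdorff_outer k (X - F)
        \<le> hausdorff_outer k (X \<inter> F) + (hausdorff_outer k (D n) + (\<Sum>j. r (j + n)))"
      by (rule add_left_mono[OF 1])
    also have "\<dots> \<le> hausdorff_outer k X + (\<Sum>j. r (j + n))"
      unfolding add.assoc[symmetric] by (rule add_right_mono[OF 2])
    finally show ?thesis .
  qed
  have "(\<lambda>n. hausdorff_outer k X + (\<Sum>j. r (j + n))) \<longlonglongrightarrow> hausdorff_outer k X + 0"
    by (intro tendsto_add tendsto_const tail)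
  then show ?thesis
    using main by (intro LIMSEQ_le_const) auto
qed auto

lemma measure_space_hausdorff_outer:
  "measure_space UNIV (sets borel) (hausdorff_outer k :: 'a::metric_space set \<Rightarrow> ennreal)"
proof -
  interpret sigma_algebra "UNIV :: 'a set" UNIV
    using sigma_algebra_Pow[of "UNIV :: 'a set"] by simp
  let ?L = "lambda_system UNIV UNIV (hausdorff_outer k :: 'a set \<Rightarrow> ennreal)"
  have L: "measure_space UNIV ?L (hausdorff_outer k)"
    by (rule caratheodory_lemma[OF outer_measure_space_hausdorff_outer])
  then have sL: "sigma_algebra UNIV ?L"
    by (simp add: measure_space_def)
  have "F \<in> ?L" if "closed F" for F :: "'a set"
  proof -
    have "hausdorff_outer k (x \<inter> F) + hausdorff_outer k (x - F) = hausdorff_outer k x" for x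
      using hausdorff_outer_closed[OF that, of k x] hausdorff_outer_Un_le[of k "x \<inter> F" "x - F"]
      by (simp add: Int_Diff_Un order_antisym)
    then show ?thesis
      by (simp add: lambda_system_eq)
  qed
  then have sub: "sets borel \<subseteq> ?L"
    unfolding borel_eq_closed sets_measure_of[OF subset_Pow_Union]
    using sigma_algebra.sigma_sets_subset[OF sL, of "Collect closed"] by (auto simp: sets_measure_of_conv)
  show ?thesis
    using L sub sets.sigma_algebra_axioms[of "borel :: 'a measure"]
    by (auto simp: measure_space_def positive_def countably_additive_def)
qed

lemma emeasure_hausdorff_measure:
  "A \<in> sets borel \<Longrightarrow> emeasure (hausdorff_measure k) A = hausdorff_outer k A"
  unfolding hausdorff_measure_def
  using measure_space_hausdorff_outer[of k, where 'a = 'a]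
  by (intro emeasure_measure_of_sigma) (auto simp: measure_space_def)

lemma sets_hausdorff_measure [simp, measurable_cong]: "sets (hausdorff_measure k) = sets borel"
  unfolding hausdorff_measure_def using sets.sigma_sets_eq[of borel] by simp

lemma space_hausdorff_measure [simp]: "space (hausdorff_measure k) = UNIV"
  by (simp add: hausdorff_measure_def)


section \<open>Approximate differentiability\<close>

definition affine_map :: "('a::real_vector \<Rightarrow> 'b::real_vector) \<Rightarrow> bool" where
  "affine_map A \<longleftrightarrow> linear (\<lambda>x. A x - A 0)"

text \<open>
  The quotient is normalised by the volume of the ball of radius \<open>r\<close>. The predicate is only meant
  for measurable \<open>S\<close>, which is the case below because \<open>f\<close> is Borel on a Borel set \<open>U\<close> and has values
  in a separable space.
\<close>

definition density_zero_at :: "(real^'m::finite) set \<Rightarrow> real^'m \<Rightarrow> bool" where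
  "density_zero_at S a \<longleftrightarrow>
    ((\<lambda>r. measure lebesgue (S \<inter> cball a r) / (unit_ball_vol (real CARD('m)) * r ^ CARD('m)))
      \<longlongrightarrow> 0) (at_right 0)"

definition approx_affine ::
    "(real^'m::finite) set \<Rightarrow> (real^'m \<Rightarrow> ('h::real_normed_vector, 'q::finite) unordered_tuple) \<Rightarrow>
      real^'m \<Rightarrow> ('q \<Rightarrow> real^'m \<Rightarrow> 'h) \<Rightarrow> bool" where
  "approx_affine U f a A \<longleftrightarrow> (\<forall>i. affine_map (A i)) \<and>
    (\<forall>\<epsilon>>0. density_zero_at {x\<in>U. dist (f x) (unordered (\<lambda>i. A i x)) > \<epsilon> * norm (x - a)} a)"

definition approx_differentiable ::
    "(real^'m::finite) set \<Rightarrow> (real^'m \<Rightarrow> ('h::real_normed_vector, 'q::finite) unordered_tuple) \<Rightarrow>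
      real^'m \<Rightarrow> bool" where
  "approx_differentiable U f a \<longleftrightarrow> (\<exists>A. approx_affine U f a A)"

definition approx_deriv ::
    "(real^'m::finite) set \<Rightarrow> (real^'m \<Rightarrow> ('h::real_normed_vector, 'q::finite) unordered_tuple) \<Rightarrow>
      real^'m \<Rightarrow> (real^'m \<Rightarrow> 'h, 'q) unordered_tuple" where
  "approx_deriv U f a =
    (THE D. \<exists>A. approx_affine U f a A \<and> D = unordered (\<lambda>i x. A i x - A i 0))"

lift_definition deriv_norm :: "(real^'m::finite \<Rightarrow> 'h::real_normed_vector, 'q::finite) unordered_tuple \<Rightarrow> real"
  is "\<lambda>L. sqrt (\<Sum>i\<in>UNIV. \<Sum>j\<in>UNIV. (norm (L i (axis j 1)))\<^sup>2)"
proof -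
  fix L L' :: "'q \<Rightarrow> real^'m \<Rightarrow> 'h"
  assume "same_up_to_perm L L'"
  then obtain \<sigma> where "bij \<sigma>" "L' = L \<circ> \<sigma>"
    by (auto simp: same_up_to_perm_def)
  then have "(\<Sum>i\<in>UNIV. \<Sum>j\<in>UNIV. (norm (L' i (axis j 1)))\<^sup>2)
      = (\<Sum>i\<in>UNIV. \<Sum>j\<in>UNIV. (norm (L i (axis j 1)))\<^sup>2)"
    using sum.reindex_bij_betw[of \<sigma> UNIV UNIV "\<lambda>i. \<Sum>j\<in>UNIV. (norm (L i (axis j 1)))\<^sup>2"]
    by simp
  then show "sqrt (\<Sum>i\<in>UNIV. \<Sum>j\<in>UNIV. (norm (L i (axis j 1)))\<^sup>2)
      = sqrt (\<Sum>i\<in>UNIV. \<Sum>j\<in>UNIV. (norm (L' i (axis j 1)))\<^sup>2)"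
    by simp
qed

text \<open>
  The value \<open>0\<close> at points without an approximate derivative is immaterial for the maps considered
  here, which are approximately differentiable almost everywhere.
\<close>

definition abs_deriv ::
    "(real^'m::finite) set \<Rightarrow> (real^'m \<Rightarrow> ('h::real_normed_vector, 'q::finite) unordered_tuple) \<Rightarrow>
      real^'m \<Rightarrow> real" where
  "abs_deriv U f a = (if approx_differentiable U f a then deriv_norm (approx_deriv U f a) else 0)"


section \<open>Lebesgue and Sobolev classes\<close>

text \<open>
  Maps with domain \<open>X\<close> are functions in \<^term>\<open>extensional X\<close>. Integrals take values in
  \<^typ>\<open>ennreal\<close>.
\<close>

definition Lp_maps ::
    "real \<Rightarrow> 'a::topological_space set \<Rightarrow> 'a measure \<Rightarrow>
      ('a \<Rightarrow> ('h::real_normed_vector, 'q::finite) unordered_tuple) set" where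
  "Lp_maps p X M = {f \<in> extensional X. f \<in> borel_measurable (restrict_space borel X) \<and>
    (\<integral>\<^sup>+x\<in>X. ennreal (tuple_abs (f x) powr p) \<partial>M) < \<infinity>}"

definition Lp_dist ::
    "real \<Rightarrow> 'a::euclidean_space set \<Rightarrow> ('a \<Rightarrow> 'b::metric_space) \<Rightarrow> ('a \<Rightarrow> 'b) \<Rightarrow> ennreal" where
  "Lp_dist p U f g =
    (let I = (\<integral>\<^sup>+x\<in>U. ennreal (dist (f x) (g x) powr p) \<partial>lebesgue)
     in if I = \<infinity> then \<infinity> else ennreal (enn2real I powr (1 / p)))"

definition sobolev ::
    "real \<Rightarrow> (real^'m::finite) set \<Rightarrow>
      (real^'m \<Rightarrow> ('h::real_normed_vector, 'q::finite) unordered_tuple) set" where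
  "sobolev p U = {f \<in> Lp_maps p U lebesgue.
    \<exists>F :: nat \<Rightarrow> real^'m \<Rightarrow> ('h, 'q) unordered_tuple.
      (\<forall>j. \<exists>L. L-lipschitz_on UNIV (F j)) \<and>
      (SUP j. \<integral>\<^sup>+x\<in>U. ennreal (abs_deriv UNIV (F j) x powr p) \<partial>lebesgue) < \<infinity> \<and>
      (\<lambda>j. Lp_dist p U f (F j)) \<longlonglongrightarrow> 0}"

end

theory Submission
  imports Defs "HOL-Probability.Probability"
begin

text \<open>
  For a continuously differentiable function \<open>v\<close> integration along rays gives the trace inequality
  \<open>\<delta> \<integral>\<^bsub>S\<^esub> \<bar>v\<bar>\<^sup>p \<le> C (\<integral>\<^bsub>U\<^esub> \<bar>v\<bar>\<^sup>p + \<delta>\<^sup>p \<integral>\<^bsub>U\<^esub> \<bar>\<nabla>v\<bar>\<^sup>p)\<close> for small \<open>\<delta> > 0\<close>, and mollification extends it to Lipschitz functions.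
  Applied to the distance of two members of a sequence of Lipschitz maps with bounded energy that
  converges to \<open>f\<close>, it shows that their restrictions to the sphere form a Cauchy sequence, whose limit is
  the trace of \<open>f\<close>.

  For (B) the energy of the limit, not of the approximating sequence, has to appear on the right. Let
  \<open>\<phi> = \<G>(f\<^sub>1, f\<^sub>2)\<close>. Uniform convexity provides smooth functions converging to \<open>\<phi>\<close> in \<open>U\<close> and to the distance
  of the traces on the sphere, whose gradients converge in \<open>L\<^sub>p\<close> to some \<open>g\<close>; a maximal inequality shows
  that \<open>g\<close> is the approximate gradient of \<open>\<phi>\<close> almost everywhere, so \<open>\<bar>g\<bar>\<close> is bounded by \<open>\<bar>Df\<^sub>1\<bar> + \<bar>Df\<^sub>2\<bar>\<close>
  wherever \<open>f\<^sub>1\<close> and \<open>f\<^sub>2\<close> are approximately differentiable. That this is almost everywhere follows by the same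
  argument for the composition of \<open>f\<close> with charts: near a tuple with \<open>k\<close> distinct values, the tuples with
  exactly \<open>k\<close> distinct values are parametrised by a Lipschitz map with values in a Hilbert space.
\<close>

section \<open>Unordered tuples\<close>

text \<open>Two powers of \<delta> produce (B): division by \<delta> leaves \<delta> powr (p - 1) in
  front of the energies, which is small because p > 1, and \<theta> is a multiple of 1 / \<delta>.
  The main obstacle is that tuples cannot be added, so a map into them can be neither mollified nor
  averaged. Convexity is therefore applied only to real functions (distances) and to compositions
  with charts. The energy of Lipschitz maps is measured by \<open>dir_lip\<close>, built from
  difference quotients alone: it makes sense for metric-valued maps before anything is known about
  differentiability, passes to distances and compositions, and is bounded by a multiple of |Df|
  almost everywhere. Midpoints of almost minimisers take the role of weak compactness: closeness in
  the ball and closeness on the sphere are both convex conditions, so a single sequence satisfies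
  both, and its gradients converge in norm. This is what replaces the bound on the approximating
  energies by the energy of the limit. A limit in Lp is determined only up to a null set; the
  pointwise equality in (A) is obtained by the choice of a representative.\<close>

lemma countable_subbasis_of_dense:
  fixes D :: "'a::metric_space set"
  assumes D: "countable D" and dense: "\<And>x e. 0 < e \<Longrightarrow> \<exists>d\<in>D. dist d x < e"
  shows "\<exists>B :: 'a set set. countable B \<and> open = generate_topology B"
proof -
  define B where "B = (\<lambda>(d, n). ball d (1 / real (Suc n))) ` (D \<times> UNIV)"
  have "countable B"
    unfolding B_def using D by (intro countable_image countable_SIGMA) auto
  moreover have "generate_topology B S" if S: "open S" for S
  proof -
    have "S = \<Union>{b \<in> B. b \<subseteq> S}"
    proof (intro subset_antisym subsetI)
      fix x assume "x \<in> S"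
      then obtain e where e: "0 < e" "ball x e \<subseteq> S"
        using S open_contains_ball by blast
      obtain n where n: "1 / real (Suc n) < e / 2"
        using e(1) nat_approx_posE[of "e/2"] by auto
      obtain d where d: "d \<in> D" "dist d x < 1 / real (Suc n)"
        using dense[of "1 / real (Suc n)"] by auto
      have "ball d (1 / real (Suc n)) \<subseteq> ball x e"
      proof
        fix z assume "z \<in> ball d (1 / real (Suc n))"
        then show "z \<in> ball x e"
          using d(2) n dist_triangle[of x z d] by (simp add: dist_commute)
      qed
      moreover have "ball d (1 / real (Suc n)) \<in> B"
        using d(1) by (auto simp: B_def)
      ultimately show "x \<in> \<Union>{b \<in> B. b \<subseteq> S}"
        using e(2) d(2) by (auto intro!: exI[of _ "ball d (1 / real (Suc n))"])
    qed auto
    then show ?thesis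
      by (metis (mono_tags, lifting) generate_topology.Basis generate_topology.UN mem_Collect_eq)
  qed
  moreover have "open S" if "generate_topology B S" for S
    using that by induction (auto simp: B_def)
  ultimately show ?thesis
    by (intro exI[of _ B]) (auto simp: fun_eq_iff)
qed

lemma countable_dense_tuples:
  fixes D :: "'a set"
  assumes "countable D"
  shows "countable {z :: 'q::finite \<Rightarrow> 'a. range z \<subseteq> D}"
proof -
  have "{z :: 'q \<Rightarrow> 'a. range z \<subseteq> D} = PiE UNIV (\<lambda>_. D)"
    by (auto simp: PiE_def)
  then show ?thesis
    using countable_PiE[of "UNIV :: 'q set" "\<lambda>_. D"] assms by simp
qed

lemma countable_dense_metric:
  obtains D :: "'a::{metric_space, second_countable_topology} set"
    where "countable D" "\<And>x e. 0 < e \<Longrightarrow> \<exists>d\<in>D. dist d x < e"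
proof -
  obtain D :: "'a set" where D: "countable D" "\<And>X. open X \<Longrightarrow> X \<noteq> {} \<Longrightarrow> \<exists>d\<in>D. d \<in> X"
    by (rule countable_dense_setE) auto
  show ?thesis
  proof (rule that[OF D(1)])
    fix x :: 'a and e :: real assume "0 < e"
    then show "\<exists>d\<in>D. dist d x < e"
      using D(2)[of "ball x e"] by (auto simp: dist_commute)
  qed
qed

lemma dist_unordered: "dist (unordered y) (unordered z) = match_cost y z"
  by transfer simp

lemma dist_unordered_le:
  "dist (unordered y) (unordered z) \<le> L2_set (\<lambda>i. dist (y i) (z i)) UNIV"
  using match_cost_le[OF bij_id, of y z] by (simp add: dist_unordered L2_set_def)

lemma dist_unordered_attained:
  obtains \<sigma> where "bij \<sigma>" "dist (unordered y) (unordered z) = L2_set (\<lambda>i. dist (y i) (z (\<sigma> i))) UNIV"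
  using match_cost_attained[of y z] by (auto simp: dist_unordered L2_set_def)

lemma unordered_cases: obtains z where "y = unordered z"
  by transfer (metis equivp_reflp equivp_same_up_to_perm)

lemma unordered_comp_bij: "bij \<sigma> \<Longrightarrow> unordered (z \<circ> \<sigma>) = unordered z"
  by transfer (metis same_up_to_perm_def same_up_to_perm_sym)

text \<open>Second countability makes the distance of two Borel maps with values in tuples a Borel
  function. The tuples with entries in a countable dense set are dense.\<close>

instance unordered_tuple :: ("{metric_space, second_countable_topology}", finite) second_countable_topology
proof
  obtain D :: "'a set" where D: "countable D" "\<And>x e. 0 < e \<Longrightarrow> \<exists>d\<in>D. dist d x < e"
    by (rule countable_dense_metric) auto
  show "\<exists>B :: ('a, 'b) unordered_tuple set set. countable B \<and> open = generate_topology B"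
  proof (rule countable_subbasis_of_dense)
    show "countable (unordered ` {z :: 'b \<Rightarrow> 'a. range z \<subseteq> D})"
      using countable_dense_tuples[OF D(1)] by (rule countable_image)
    fix x :: "('a, 'b) unordered_tuple" and e :: real assume e: "0 < e"
    obtain z where z: "x = unordered z" by (rule unordered_cases)
    \<comment> \<open>The summand 1 turns the bound by \<open>CARD('b)\<close> times
      \<open>r\<close> into a strict inequality.\<close>
    define r where "r = e / (real CARD('b) + 1)"
    have r: "0 < r" using e by (simp add: r_def)
    obtain d where d: "\<And>i. d i \<in> D" "\<And>i. dist (d i) (z i) < r"
    proof -
      have "\<forall>i. \<exists>d. d \<in> D \<and> dist d (z i) < r" using D(2)[OF r] by blast
      then show ?thesis using that by metis
    qed
    have "dist (unordered d) x \<le> L2_set (\<lambda>i. dist (d i) (z i)) UNIV"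
      unfolding z by (rule dist_unordered_le)
    also have "\<dots> \<le> (\<Sum>i\<in>UNIV. dist (d i) (z i))" by (rule L2_set_le_sum) simp
    also have "\<dots> \<le> (\<Sum>i\<in>(UNIV :: 'b set). r)" using d(2) by (intro sum_mono less_imp_le)
    also have "\<dots> < e" using e by (simp add: r_def field_simps)
    finally show "\<exists>d\<in>unordered ` {z :: 'b \<Rightarrow> 'a. range z \<subseteq> D}. dist d x < e"
      using d(1) by blast
  qed
qed

text \<open>Charts take values in a power of the Hilbert space and their gradients in a further
  power; both need a countable base for measurability.\<close>

instance vec :: ("{metric_space, second_countable_topology}", finite) second_countable_topology
proof
  obtain D :: "'a set" where D: "countable D" "\<And>x e. 0 < e \<Longrightarrow> \<exists>d\<in>D. dist d x < e"
    by (rule countable_dense_metric) auto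
  show "\<exists>B :: ('a, 'b) vec set set. countable B \<and> open = generate_topology B"
  proof (rule countable_subbasis_of_dense)
    show "countable (vec_lambda ` {z :: 'b \<Rightarrow> 'a. range z \<subseteq> D})"
      using countable_dense_tuples[OF D(1)] by (rule countable_image)
    fix x :: "('a, 'b) vec" and e :: real assume e: "0 < e"
    define r where "r = e / (real CARD('b) + 1)"
    have r: "0 < r" using e by (simp add: r_def)
    obtain d where d: "\<And>i. d i \<in> D" "\<And>i. dist (d i) (x $ i) < r"
    proof -
      have "\<forall>i. \<exists>d. d \<in> D \<and> dist d (x $ i) < r" using D(2)[OF r] by blast
      then show ?thesis using that by metis
    qed
    have "dist (vec_lambda d) x = L2_set (\<lambda>i. dist (d i) (x $ i)) UNIV"
      by (simp add: dist_vec_def)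
    also have "\<dots> \<le> (\<Sum>i\<in>UNIV. dist (d i) (x $ i))" by (rule L2_set_le_sum) simp
    also have "\<dots> \<le> (\<Sum>i\<in>(UNIV :: 'b set). r)" using d(2) by (intro sum_mono less_imp_le)
    also have "\<dots> < e" using e by (simp add: r_def field_simps)
    finally show "\<exists>d\<in>vec_lambda ` {z :: 'b \<Rightarrow> 'a. range z \<subseteq> D}. dist d x < e"
      using d(1) by blast
  qed
qed

text \<open>
  The sort \<open>{real_inner, polish_space}\<close> does not entail the sort \<open>banach\<close>, which the Bochner
  integral requires; the following copy of the type has it.
\<close>

typedef 'a hilbert_copy = "UNIV :: 'a set"
  morphisms uncopy copy by simp

setup_lifting type_definition_hilbert_copy

instantiation hilbert_copy :: (real_inner) real_inner
begin

lift_definition zero_hilbert_copy :: "'a hilbert_copy" is 0 .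
lift_definition plus_hilbert_copy :: "'a hilbert_copy \<Rightarrow> 'a hilbert_copy \<Rightarrow> 'a hilbert_copy" is "(+)" .
lift_definition minus_hilbert_copy :: "'a hilbert_copy \<Rightarrow> 'a hilbert_copy \<Rightarrow> 'a hilbert_copy" is "(-)" .
lift_definition uminus_hilbert_copy :: "'a hilbert_copy \<Rightarrow> 'a hilbert_copy" is uminus .
lift_definition scaleR_hilbert_copy :: "real \<Rightarrow> 'a hilbert_copy \<Rightarrow> 'a hilbert_copy" is scaleR .
lift_definition inner_hilbert_copy :: "'a hilbert_copy \<Rightarrow> 'a hilbert_copy \<Rightarrow> real" is inner .
lift_definition norm_hilbert_copy :: "'a hilbert_copy \<Rightarrow> real" is norm .
lift_definition dist_hilbert_copy :: "'a hilbert_copy \<Rightarrow> 'a hilbert_copy \<Rightarrow> real" is dist .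
lift_definition sgn_hilbert_copy :: "'a hilbert_copy \<Rightarrow> 'a hilbert_copy" is sgn .

definition uniformity_hilbert_copy :: "('a hilbert_copy \<times> 'a hilbert_copy) filter" where
  "uniformity_hilbert_copy = (INF e\<in>{0<..}. principal {(x, y). dist x y < e})"

definition open_hilbert_copy :: "'a hilbert_copy set \<Rightarrow> bool" where
  "open_hilbert_copy S \<longleftrightarrow> (\<forall>x\<in>S. \<forall>\<^sub>F (x', y) in uniformity. x' = x \<longrightarrow> y \<in> S)"

instance
proof
  show "uniformity = (INF e\<in>{0<..}. principal {(x, y::'a hilbert_copy). dist x y < e})"
    by (rule uniformity_hilbert_copy_def)
  show "open U = (\<forall>x\<in>U. \<forall>\<^sub>F (x', y) in uniformity. x' = x \<longrightarrow> y \<in> U)" for U :: "'a hilbert_copy set"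
    by (rule open_hilbert_copy_def)
qed (transfer; simp add: algebra_simps dist_norm sgn_div_norm inner_commute inner_add_left norm_eq_sqrt_inner)+

end

instance hilbert_copy :: ("{real_inner, complete_space}") banach
proof
  fix X :: "nat \<Rightarrow> 'a hilbert_copy" assume "Cauchy X"
  then have "Cauchy (\<lambda>n. uncopy (X n))"
    unfolding Cauchy_def dist_hilbert_copy.rep_eq .
  then obtain l where "(\<lambda>n. uncopy (X n)) \<longlonglongrightarrow> l"
    using Cauchy_convergent_iff convergent_def by blast
  then have "X \<longlonglongrightarrow> copy l"
    unfolding tendsto_iff dist_hilbert_copy.rep_eq by (simp add: copy_inverse)
  then show "convergent X" by (auto simp: convergent_def)
qed

instance hilbert_copy :: ("{real_inner, second_countable_topology}") second_countable_topology
proof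
  obtain D :: "'a set" where D: "countable D" "\<And>x e. 0 < e \<Longrightarrow> \<exists>d\<in>D. dist d x < e"
    by (rule countable_dense_metric) auto
  show "\<exists>B :: 'a hilbert_copy set set. countable B \<and> open = generate_topology B"
  proof (rule countable_subbasis_of_dense)
    show "countable (copy ` D)" using D(1) by simp
    show "\<exists>d\<in>copy ` D. dist d x < e" if "0 < e" for x :: "'a hilbert_copy" and e
      using D(2)[OF that, of "uncopy x"] by (simp add: dist_hilbert_copy.rep_eq copy_inverse)
  qed
qed

lemma norm_uncopy [simp]: "norm (uncopy x) = norm x"
  by transfer simp

lemma uncopy_linear: "linear uncopy"
  by (rule linearI; transfer; simp)

lemma dist_copy [simp]: "dist (copy x) (copy y) = dist x y"
  by (simp add: dist_hilbert_copy.rep_eq copy_inverse)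

section \<open>The maximal inequality and density points\<close>

text \<open>The disjoint subfamily in Vitali's lemma is countable, possibly finite. \<open>I\<close>
  consists of the codes of its members, so that measures of unions become series over the natural
  numbers.\<close>

lemma Vitali_covering_lemma_sequence:
  fixes a :: "'a \<Rightarrow> 'b::euclidean_space"
  assumes S: "S \<subseteq> (\<Union>i\<in>K. cball (a i) (r i))"
    and r: "\<And>i. i \<in> K \<Longrightarrow> 0 < r i \<and> r i \<le> B"
  obtains I :: "nat set" and f where "\<And>n. n \<in> I \<Longrightarrow> f n \<in> K"
    "disjoint_family_on (\<lambda>n. cball (a (f n)) (r (f n))) I"
    "S \<subseteq> (\<Union>n\<in>I. cball (a (f n)) (5 * r (f n)))"
proof -
  obtain C where C: "countable C" "C \<subseteq> K"
    "pairwise (\<lambda>i j. disjnt (cball (a i) (r i)) (cball (a j) (r j))) C"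
    "S \<subseteq> (\<Union>i\<in>C. cball (a i) (5 * r i))"
    by (rule Vitali_covering_lemma_cballs[OF S r])
  define I where "I = to_nat_on C ` C"
  have f: "from_nat_into C n \<in> C" "to_nat_on C (from_nat_into C n) = n" if "n \<in> I" for n
    using that C(1) by (auto simp: I_def)
  show ?thesis
  proof (rule that[of I "from_nat_into C"])
    show "from_nat_into C n \<in> K" if "n \<in> I" for n
      using f(1)[OF that] C(2) by auto
    show "disjoint_family_on (\<lambda>n. cball (a (from_nat_into C n)) (r (from_nat_into C n))) I"
      unfolding disjoint_family_on_def
    proof (intro ballI impI)
      fix m n assume mn: "m \<in> I" "n \<in> I" "m \<noteq> n"
      then have "from_nat_into C m \<noteq> from_nat_into C n" using f(2) by metis
      then show "cball (a (from_nat_into C m)) (r (from_nat_into C m)) \<inter>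
          cball (a (from_nat_into C n)) (r (from_nat_into C n)) = {}"
        using C(3) f(1) mn by (auto simp: pairwise_def disjnt_def)
    qed
    show "S \<subseteq> (\<Union>n\<in>I. cball (a (from_nat_into C n)) (5 * r (from_nat_into C n)))"
    proof
      fix x assume "x \<in> S"
      then obtain i where i: "i \<in> C" "x \<in> cball (a i) (5 * r i)" using C(4) by auto
      then have "to_nat_on C i \<in> I" "from_nat_into C (to_nat_on C i) = i"
        using C(1) by (auto simp: I_def)
      then show "x \<in> (\<Union>n\<in>I. cball (a (from_nat_into C n)) (5 * r (from_nat_into C n)))"
        using i(2) by (intro UN_I[of "to_nat_on C i"]) auto
    qed
  qed
qed

lemma emeasure_cball_scale:
  fixes a b :: "'a::euclidean_space"
  assumes "0 \<le> c" "0 \<le> r"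
  shows "emeasure lborel (cball a (c * r)) = ennreal (c ^ DIM('a)) * emeasure lborel (cball b r)"
  using assms by (simp add: emeasure_cball power_mult_distrib ennreal_mult' mult_ac)

lemma emeasure_cball_pos_finite:
  fixes a :: "'a::euclidean_space"
  assumes "0 < r"
  shows "emeasure lborel (cball a r) \<noteq> 0" "emeasure lborel (cball a r) < \<infinity>"
proof -
  have "0 < unit_ball_vol (real DIM('a)) * r ^ DIM('a)" using assms by simp
  then show "emeasure lborel (cball a r) \<noteq> 0" "emeasure lborel (cball a r) < \<infinity>"
    using assms by (simp_all add: emeasure_cball ennreal_eq_0_iff not_le del: mult_le_0_iff)
qed

text \<open>Points with a large average on some ball are centres of bad balls. Vitali selects
  disjoint bad balls whose fivefold enlargements cover all these centres; on each of them the volume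
  is at most 1 / c times the integral of \<open>g\<close>. \<open>W\<close> is the union of the
  enlarged balls, a Borel set, so the measurability of the set of bad centres does not
  enter.\<close>

lemma weak_type_maximal_inequality:
  fixes g :: "'a::euclidean_space \<Rightarrow> ennreal"
  assumes [measurable]: "g \<in> borel_measurable borel" and c: "0 < c"
  obtains W where "W \<in> sets borel" "emeasure lborel W \<le> ennreal (5 ^ DIM('a) / c) * (\<integral>\<^sup>+x. g x \<partial>lborel)"
    "\<And>a r. 0 < r \<Longrightarrow> r \<le> 1 \<Longrightarrow> a \<notin> W \<Longrightarrow>
      (\<integral>\<^sup>+x\<in>cball a r. g x \<partial>lborel) \<le> ennreal c * emeasure lborel (cball a r)"
proof -
  define K where "K = {(a, r). 0 < r \<and> r \<le> 1 \<and>
    ennreal c * emeasure lborel (cball a r) < (\<integral>\<^sup>+x\<in>cball a r. g x \<partial>lborel)}"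
  have S: "fst ` K \<subseteq> (\<Union>i\<in>K. cball (fst i) (snd i))"
    by (force simp: K_def)
  obtain I :: "nat set" and f where f: "\<And>n. n \<in> I \<Longrightarrow> f n \<in> K"
    "disjoint_family_on (\<lambda>n. cball (fst (f n)) (snd (f n))) I"
    "fst ` K \<subseteq> (\<Union>n\<in>I. cball (fst (f n)) (5 * snd (f n)))"
    by (rule Vitali_covering_lemma_sequence[OF S, of 1]) (auto simp: K_def)
  \<comment> \<open>Empty sets outside \<open>I\<close> extend the family to all natural numbers
    without changing unions or sums.\<close>
  define X where "X n = (if n \<in> I then cball (fst (f n)) (snd (f n)) else {})" for n
  define Y where "Y n = (if n \<in> I then cball (fst (f n)) (5 * snd (f n)) else {})" for n
  have [measurable]: "X n \<in> sets borel" "Y n \<in> sets borel" for n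
    by (auto simp: X_def Y_def)
  have XY: "emeasure lborel (Y n) \<le> ennreal (5 ^ DIM('a) / c) * (\<integral>\<^sup>+x\<in>X n. g x \<partial>lborel)" for n
  proof (cases "n \<in> I")
    case True
    then have r: "0 < snd (f n)" and
      *: "ennreal c * emeasure lborel (X n) \<le> (\<integral>\<^sup>+x\<in>X n. g x \<partial>lborel)"
      using f(1)[OF True] by (auto simp: K_def X_def split: prod.splits intro: less_imp_le)
    have "emeasure lborel (Y n) = ennreal (5 ^ DIM('a) / c) * (ennreal c * emeasure lborel (X n))"
      using True r c emeasure_cball_scale[of 5 "snd (f n)" "fst (f n)" "fst (f n)"]
      by (simp add: X_def Y_def mult.assoc[symmetric] ennreal_mult'[symmetric])
    also have "\<dots> \<le> ennreal (5 ^ DIM('a) / c) * (\<integral>\<^sup>+x\<in>X n. g x \<partial>lborel)"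
      by (intro mult_left_mono *) auto
    finally show ?thesis .
  qed (simp add: Y_def)
  have disj: "disjoint_family X"
    using f(2) by (auto simp: disjoint_family_on_def X_def)
  show ?thesis
  proof (rule that[of "\<Union>n. Y n"])
    have "emeasure lborel (\<Union>n. Y n) \<le> (\<Sum>n. emeasure lborel (Y n))"
      by (rule emeasure_subadditive_countably) auto
    also have "\<dots> \<le> (\<Sum>n. ennreal (5 ^ DIM('a) / c) * (\<integral>\<^sup>+x\<in>X n. g x \<partial>lborel))"
      by (intro suminf_le XY) auto
    also have "\<dots> = ennreal (5 ^ DIM('a) / c) * (\<Sum>n. \<integral>\<^sup>+x\<in>X n. g x \<partial>lborel)"
      by simp
    also have "(\<Sum>n. \<integral>\<^sup>+x\<in>X n. g x \<partial>lborel) = (\<integral>\<^sup>+x\<in>(\<Union>n. X n). g x \<partial>lborel)"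
      using disj by (subst nn_integral_disjoint_family) auto
    also have "\<dots> \<le> (\<integral>\<^sup>+x. g x \<partial>lborel)"
      by (intro nn_integral_mono) (auto simp: indicator_def)
    finally show "emeasure lborel (\<Union>n. Y n) \<le> ennreal (5 ^ DIM('a) / c) * (\<integral>\<^sup>+x. g x \<partial>lborel)"
      by (simp add: mult_left_mono)
    fix a r assume r: "0 < r" "r \<le> (1::real)" "a \<notin> (\<Union>n. Y n)"
    have "(\<Union>n\<in>I. cball (fst (f n)) (5 * snd (f n))) = (\<Union>n. Y n)"
      by (auto simp: Y_def split: if_splits)
    with r f(3) have "(a, r) \<notin> K" by force
    with r show "(\<integral>\<^sup>+x\<in>cball a r. g x \<partial>lborel) \<le> ennreal c * emeasure lborel (cball a r)"
      by (auto simp: K_def not_less)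
  qed auto
qed

section \<open>Sets of density zero and Lebesgue's density theorem\<close>

lemma density_zero_atI:
  fixes a :: "real^'m::finite"
  assumes "\<And>\<epsilon>. 0 < \<epsilon> \<Longrightarrow> \<exists>r0>0. \<forall>r. 0 < r \<longrightarrow> r < r0 \<longrightarrow>
    emeasure lebesgue (S \<inter> cball a r) \<le> ennreal \<epsilon> * emeasure lborel (cball a r)"
  shows "density_zero_at S a"
  unfolding density_zero_at_def tendsto_iff
proof (intro allI impI)
  fix \<epsilon> :: real assume e: "0 < \<epsilon>"
  then obtain r0 where r0: "0 < r0" "\<And>r. 0 < r \<Longrightarrow> r < r0 \<Longrightarrow>
    emeasure lebesgue (S \<inter> cball a r) \<le> ennreal (\<epsilon> / 2) * emeasure lborel (cball a r)"
    using assms[of "\<epsilon> / 2"] by auto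
  show "\<forall>\<^sub>F r in at_right 0. dist (measure lebesgue (S \<inter> cball a r) /
      (unit_ball_vol (real CARD('m)) * r ^ CARD('m))) 0 < \<epsilon>"
    unfolding eventually_at_right_field
  proof (intro exI[of _ r0] conjI allI impI r0(1))
    fix r assume r: "0 < r" "r < r0"
    define V where "V = unit_ball_vol (real CARD('m)) * r ^ CARD('m)"
    have V: "0 < V" using r by (simp add: V_def)
    have "emeasure lebesgue (S \<inter> cball a r) \<le> ennreal (\<epsilon> / 2 * V)"
      using r0(2)[OF r] e r V unit_ball_vol_nonneg[of "real CARD('m)"]
      by (simp add: V_def emeasure_cball ennreal_mult''[symmetric] ennreal_mult'[symmetric] del: ennreal_half)
    then have "measure lebesgue (S \<inter> cball a r) \<le> \<epsilon> / 2 * V"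
      unfolding measure_def using e V by (intro enn2real_leI) auto
    also have "\<dots> < \<epsilon> * V" using e V by simp
    finally show "dist (measure lebesgue (S \<inter> cball a r) /
      (unit_ball_vol (real CARD('m)) * r ^ CARD('m))) 0 < \<epsilon>"
      using V by (simp add: V_def[symmetric] dist_real_def pos_divide_less_eq)
  qed
qed

lemma density_zero_atD:
  fixes a :: "real^'m::finite"
  assumes "density_zero_at S a" "0 < \<epsilon>" and S: "S \<in> sets lebesgue"
  shows "\<exists>r0>0. \<forall>r. 0 < r \<longrightarrow> r < r0 \<longrightarrow>
    emeasure lebesgue (S \<inter> cball a r) \<le> ennreal \<epsilon> * emeasure lborel (cball a r)"
proof -
  have "\<forall>\<^sub>F r in at_right 0. dist (measure lebesgue (S \<inter> cball a r) /
      (unit_ball_vol (real CARD('m)) * r ^ CARD('m))) 0 < \<epsilon>"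
    using assms unfolding density_zero_at_def tendsto_iff by blast
  then obtain r0 where r0: "0 < r0" "\<And>r. 0 < r \<Longrightarrow> r < r0 \<Longrightarrow> measure lebesgue (S \<inter> cball a r) /
      (unit_ball_vol (real CARD('m)) * r ^ CARD('m)) < \<epsilon>"
    by (auto simp: eventually_at_right_field)
  show ?thesis
  proof (intro exI[of _ r0] conjI allI impI r0(1))
    fix r assume r: "0 < r" "r < r0"
    define V where "V = unit_ball_vol (real CARD('m)) * r ^ CARD('m)"
    have V: "0 < V" using r by (simp add: V_def)
    have "S \<inter> cball a r \<in> lmeasurable"
      using S by (intro bounded_set_imp_lmeasurable) (auto intro: bounded_subset[OF bounded_cball])
    then have "emeasure lebesgue (S \<inter> cball a r) = ennreal (measure lebesgue (S \<inter> cball a r))"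
      by (simp add: emeasure_eq_measure2)
    also have "\<dots> \<le> ennreal (\<epsilon> * V)"
      using r0(2)[OF r] V by (intro ennreal_leI) (simp add: V_def[symmetric] pos_divide_less_eq)
    also have "\<dots> = ennreal \<epsilon> * emeasure lborel (cball a r)"
      using r assms(2) by (simp add: V_def emeasure_cball ennreal_mult')
    finally show "emeasure lebesgue (S \<inter> cball a r) \<le> ennreal \<epsilon> * emeasure lborel (cball a r)" .
  qed
qed

text \<open>The density at \<open>a\<close> sees only small balls around \<open>a\<close>, so
  inclusion within one ball is enough. Measurability is asked of the larger set only, because a set
  outside the sigma-algebra has \<open>emeasure\<close> 0.\<close>

lemma density_zero_at_mono:
  fixes a :: "real^'m::finite"
  assumes T: "density_zero_at T a" "T \<in> sets lebesgue" and sub: "0 < r1" "S \<inter> cball a r1 \<subseteq> T"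
  shows "density_zero_at S a"
proof (rule density_zero_atI)
  fix \<epsilon> :: real assume "0 < \<epsilon>"
  then obtain r0 where r0: "0 < r0" "\<And>r. 0 < r \<Longrightarrow> r < r0 \<Longrightarrow>
    emeasure lebesgue (T \<inter> cball a r) \<le> ennreal \<epsilon> * emeasure lborel (cball a r)"
    using density_zero_atD[OF T(1) _ T(2)] by blast
  show "\<exists>r0>0. \<forall>r. 0 < r \<longrightarrow> r < r0 \<longrightarrow>
    emeasure lebesgue (S \<inter> cball a r) \<le> ennreal \<epsilon> * emeasure lborel (cball a r)"
  proof (intro exI[of _ "min r0 r1"] conjI allI impI)
    fix r assume r: "0 < r" "r < min r0 r1"
    then have "S \<inter> cball a r \<subseteq> T \<inter> cball a r" using sub(2) by auto
    then have "emeasure lebesgue (S \<inter> cball a r) \<le> emeasure lebesgue (T \<inter> cball a r)"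
      using T(2) by (intro emeasure_mono) auto
    also have "\<dots> \<le> ennreal \<epsilon> * emeasure lborel (cball a r)" using r r0(2) by simp
    finally show "emeasure lebesgue (S \<inter> cball a r) \<le> ennreal \<epsilon> * emeasure lborel (cball a r)" .
  qed (use r0(1) sub(1) in auto)
qed

lemma density_zero_at_Un:
  fixes a :: "real^'m::finite"
  assumes S: "density_zero_at S a" "S \<in> sets lebesgue" and T: "density_zero_at T a" "T \<in> sets lebesgue"
  shows "density_zero_at (S \<union> T) a"
proof (rule density_zero_atI)
  fix \<epsilon> :: real assume e: "0 < \<epsilon>"
  obtain r0 where r0: "0 < r0" "\<And>r. 0 < r \<Longrightarrow> r < r0 \<Longrightarrow>
    emeasure lebesgue (T \<inter> cball a r) \<le> ennreal (\<epsilon>/2) * emeasure lborel (cball a r)"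
    using density_zero_atD[OF T(1) _ T(2), of "\<epsilon>/2"] e by auto
  obtain r1 where r1: "0 < r1" "\<And>r. 0 < r \<Longrightarrow> r < r1 \<Longrightarrow>
    emeasure lebesgue (S \<inter> cball a r) \<le> ennreal (\<epsilon>/2) * emeasure lborel (cball a r)"
    using density_zero_atD[OF S(1) _ S(2), of "\<epsilon>/2"] e by auto
  show "\<exists>r0>0. \<forall>r. 0 < r \<longrightarrow> r < r0 \<longrightarrow>
    emeasure lebesgue ((S \<union> T) \<inter> cball a r) \<le> ennreal \<epsilon> * emeasure lborel (cball a r)"
  proof (intro exI[of _ "min r0 r1"] conjI allI impI)
    fix r assume r: "0 < r" "r < min r0 r1"
    have "emeasure lebesgue ((S \<union> T) \<inter> cball a r) \<le>
        emeasure lebesgue (S \<inter> cball a r) + emeasure lebesgue (T \<inter> cball a r)"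
      using S(2) T(2) by (subst Int_Un_distrib2, intro emeasure_subadditive) auto
    also have "\<dots> \<le> ennreal (\<epsilon>/2) * emeasure lborel (cball a r) + ennreal (\<epsilon>/2) * emeasure lborel (cball a r)"
      using r r0(2) r1(2) by (intro add_mono) auto
    also have "\<dots> = ennreal \<epsilon> * emeasure lborel (cball a r)"
      using e by (simp add: distrib_right[symmetric] ennreal_plus[symmetric] del: ennreal_plus)
    finally show "emeasure lebesgue ((S \<union> T) \<inter> cball a r) \<le> ennreal \<epsilon> * emeasure lborel (cball a r)" .
  qed (use r0(1) r1(1) in auto)
qed

text \<open>Borel-Cantelli: the measures are dominated by a geometric series.\<close>

lemma AE_eventually_notin:
  fixes W :: "nat \<Rightarrow> 'a set"
  assumes W: "\<And>n. W n \<in> sets M" "\<And>n. emeasure M (W n) \<le> ennreal (C * (1/2) ^ n)" and C: "0 \<le> C"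
  shows "AE x in M. eventually (\<lambda>n. x \<notin> W n) sequentially"
proof -
  have "AE x in M. eventually (\<lambda>n. x \<in> space M - W n) sequentially"
  proof (rule borel_cantelli_AE1)
    show "emeasure M (W n) < \<infinity>" for n
      using le_less_trans[OF W(2)[of n] ennreal_less_top] by simp
    have "measure M (W n) \<le> C * (1/2) ^ n" for n
      unfolding measure_def using W(2) C by (intro enn2real_leI) auto
    then show "summable (\<lambda>n. measure M (W n))"
      by (intro summable_comparison_test'[OF summable_mult[OF summable_geometric, of "1/2" C], of 0]) auto
  qed (rule W)
  then show ?thesis by (rule AE_mp) (auto intro!: AE_I2 elim: eventually_mono)
qed

text \<open>
  The complement of \<open>E\<close> is approximated from inside by closed sets, which stay away from the points of
  \<open>E\<close>; the maximal inequality controls the rest.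
\<close>

lemma lebesgue_density:
  fixes E :: "(real^'m::finite) set"
  assumes E: "E \<in> sets borel"
  shows "AE a in lborel. a \<in> E \<longrightarrow> density_zero_at (- E) a"
proof -
  have "\<exists>T W. closed T \<and> T \<subseteq> - E \<and> W \<in> sets borel \<and>
      emeasure lborel W \<le> ennreal (5 ^ DIM(real^'m) * (1/2) ^ n) \<and>
      (\<forall>a r. 0 < r \<longrightarrow> r \<le> 1 \<longrightarrow> a \<notin> W \<longrightarrow>
        emeasure lborel ((- E - T) \<inter> cball a r) \<le> ennreal ((1/2)^n) * emeasure lborel (cball a r))" for n
  proof -
    have "- E \<in> sets lebesgue" using E by auto
    \<comment> \<open>The excess (1/4)^n divided by the threshold (1/2)^n of the maximal inequality
      leaves (1/2)^n, which is summable over n.\<close>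
    then obtain T where T: "closed T" "T \<subseteq> - E" "emeasure lebesgue (- E - T) < ennreal ((1/4) ^ n)"
      by (rule sets_lebesgue_inner_closed[where e = "(1/4) ^ n"]) simp
    have m: "- E - T \<in> sets borel" using E T(1) by auto
    obtain W where W: "W \<in> sets borel"
      "emeasure lborel W \<le> ennreal (5 ^ DIM(real^'m) / (1/2) ^ n) * (\<integral>\<^sup>+x. indicator (- E - T) x \<partial>lborel)"
      "\<And>a r. 0 < r \<Longrightarrow> r \<le> 1 \<Longrightarrow> a \<notin> W \<Longrightarrow>
      (\<integral>\<^sup>+x\<in>cball a r. indicator (- E - T) x \<partial>lborel) \<le> ennreal ((1/2) ^ n) * emeasure lborel (cball a r)"
    proof -
      have "indicator (- E - T) \<in> borel_measurable borel" "0 < (1/2::real) ^ n" using m by auto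
      from weak_type_maximal_inequality[OF this] that show ?thesis by blast
    qed
    have "emeasure lborel (- E - T) \<le> ennreal ((1/4) ^ n)"
      using T(3) m by (simp add: less_imp_le)
    then have "emeasure lborel W \<le> ennreal (5 ^ DIM(real^'m) / (1/2) ^ n) * ennreal ((1/4) ^ n)"
      using m by (intro order_trans[OF W(2)] mult_left_mono) auto
    also have "\<dots> = ennreal (5 ^ DIM(real^'m) * (1/2) ^ n)"
      by (simp add: ennreal_mult'[symmetric] field_simps power_mult_distrib[symmetric] flip: power_divide)
    finally have "emeasure lborel W \<le> ennreal (5 ^ DIM(real^'m) * (1/2) ^ n)" .
    moreover have "(\<integral>\<^sup>+x\<in>cball a r. indicator (- E - T) x \<partial>lborel) = emeasure lborel ((- E - T) \<inter> cball a r)" for a r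
    proof -
      have "(\<lambda>x. indicator (- E - T) x * indicator (cball a r) x :: ennreal) = indicator ((- E - T) \<inter> cball a r)"
        by (auto simp: indicator_def fun_eq_iff)
      then show ?thesis using m by simp
    qed
    ultimately show ?thesis using T(1,2) W(1,3) by (intro exI[of _ T] exI[of _ W]) auto
  qed
  then obtain T W where T: "\<And>n. closed (T n)" "\<And>n. T n \<subseteq> - E"
    and W: "\<And>n. W n \<in> sets borel" "\<And>n. emeasure lborel (W n) \<le> ennreal (5 ^ DIM(real^'m) * (1/2) ^ n)"
      "\<And>n a r. 0 < r \<Longrightarrow> r \<le> 1 \<Longrightarrow> a \<notin> W n \<Longrightarrow>
        emeasure lborel ((- E - T n) \<inter> cball a r) \<le> ennreal ((1/2)^n) * emeasure lborel (cball a r)"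
    by metis
  have "AE a in lborel. eventually (\<lambda>n. a \<notin> W n) sequentially"
    using W(1,2) by (intro AE_eventually_notin[where C="5 ^ DIM(real^'m)"]) auto
  then show ?thesis
  proof (rule AE_mp, intro AE_I2 impI)
    fix a assume ev: "eventually (\<lambda>n. a \<notin> W n) sequentially" and a: "a \<in> E"
    show "density_zero_at (- E) a"
    proof (rule density_zero_atI)
      fix \<epsilon> :: real assume "0 < \<epsilon>"
      then have "eventually (\<lambda>n. (1/2::real) ^ n < \<epsilon>) sequentially"
        by (intro order_tendstoD(2)[OF LIMSEQ_realpow_zero]) auto
      then obtain n where n: "(1/2::real) ^ n < \<epsilon>" "a \<notin> W n"
        using eventually_happens'[OF _ eventually_conj[OF _ ev]] by fastforce
      \<comment> \<open>The closed set \<open>T n\<close> has positive distance to \<open>a\<close>,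
        so in small balls - E coincides with the part controlled by the maximal inequality.\<close>
      have "a \<notin> T n" using T(2) a by auto
      then obtain r1 where r1: "0 < r1" "cball a r1 \<inter> T n = {}"
        using T(1)[of n] by (metis Compl_iff closed_def disjoint_eq_subset_Compl open_contains_cball)
      show "\<exists>r0>0. \<forall>r. 0 < r \<longrightarrow> r < r0 \<longrightarrow>
          emeasure lebesgue (- E \<inter> cball a r) \<le> ennreal \<epsilon> * emeasure lborel (cball a r)"
      proof (intro exI[of _ "min r1 1"] conjI allI impI)
        fix r assume r: "0 < r" "r < min r1 1"
        then have "cball a r \<subseteq> cball a r1" by auto
        then have "- E \<inter> cball a r = (- E - T n) \<inter> cball a r" using r1(2) by blast
        then have "emeasure lebesgue (- E \<inter> cball a r) = emeasure lborel ((- E - T n) \<inter> cball a r)"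
          using E T(1) by auto
        also have "\<dots> \<le> ennreal ((1/2)^n) * emeasure lborel (cball a r)"
          using r n(2) by (intro W) auto
        also have "\<dots> \<le> ennreal \<epsilon> * emeasure lborel (cball a r)"
          using n(1) by (intro mult_right_mono ennreal_leI) auto
        finally show "emeasure lebesgue (- E \<inter> cball a r) \<le> ennreal \<epsilon> * emeasure lborel (cball a r)" .
      qed (use r1 in auto)
    qed
  qed
qed

section \<open>Continuously differentiable functions\<close>

lemma nn_integral_lborel_affine:
  fixes h :: "'a::euclidean_space \<Rightarrow> ennreal"
  assumes [measurable]: "h \<in> borel_measurable borel" and c: "c \<noteq> 0"
  shows "(\<integral>\<^sup>+x. h x \<partial>lborel) = ennreal (\<bar>c\<bar> ^ DIM('a)) * (\<integral>\<^sup>+x. h (t + c *\<^sub>R x) \<partial>lborel)"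
  by (subst lborel_affine[OF c, of t]) (simp add: nn_integral_density nn_integral_distr nn_integral_cmult)

lemma norm_sum_scaleR_le:
  fixes h :: "real^'m::finite" and G :: "'h::real_normed_vector^'m"
  shows "norm (\<Sum>i\<in>UNIV. h $ i *\<^sub>R G $ i) \<le> norm h * norm G"
proof -
  have "norm (\<Sum>i\<in>UNIV. h $ i *\<^sub>R G $ i) \<le> (\<Sum>i\<in>UNIV. \<bar>h $ i\<bar> * norm (G $ i))"
    by (rule order_trans[OF norm_sum]) simp
  also have "\<dots> \<le> L2_set (\<lambda>i. \<bar>h $ i\<bar>) UNIV * L2_set (\<lambda>i. norm (G $ i)) UNIV"
    using L2_set_mult_ineq[of "\<lambda>i. \<bar>h $ i\<bar>" "\<lambda>i. norm (G $ i)" UNIV] by simp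
  finally show ?thesis by (simp add: norm_vec_def[of h] norm_vec_def[of G])
qed

text \<open>The gradient is the vector of partial derivatives, not a linear map:
  \<open>'h^'m\<close> is again an inner product space if \<open>'h\<close> is one, so uniform
  convexity applies to gradients, and \<open>norm\<close> is the Euclidean norm.\<close>

definition C1_grad :: "(real^'m::finite \<Rightarrow> 'h::real_normed_vector) \<Rightarrow> (real^'m \<Rightarrow> 'h^'m) \<Rightarrow> bool" where
  "C1_grad v G \<longleftrightarrow> continuous_on UNIV G \<and>
    (\<forall>x. (v has_derivative (\<lambda>h. \<Sum>i\<in>UNIV. h $ i *\<^sub>R G x $ i)) (at x))"

lemma C1_grad_continuous:
  assumes "C1_grad v G"
  shows "continuous_on UNIV v" "continuous_on UNIV G"
proof -
  have "isCont v x" for x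
    using assms has_derivative_continuous unfolding C1_grad_def by blast
  then show "continuous_on UNIV v" by (simp add: continuous_at_imp_continuous_on)
  show "continuous_on UNIV G" using assms by (simp add: C1_grad_def)
qed

lemma C1_grad_diff:
  assumes "C1_grad v G" "C1_grad v' G'"
  shows "C1_grad (\<lambda>x. v x - v' x) (\<lambda>x. G x - G' x)"
  unfolding C1_grad_def
proof (intro conjI allI)
  show "continuous_on UNIV (\<lambda>x. G x - G' x)"
    using assms by (intro continuous_on_diff) (auto simp: C1_grad_def)
  fix x
  have "((\<lambda>x. v x - v' x) has_derivative
      (\<lambda>h. (\<Sum>i\<in>UNIV. h $ i *\<^sub>R G x $ i) - (\<Sum>i\<in>UNIV. h $ i *\<^sub>R G' x $ i))) (at x)"
    using assms by (intro has_derivative_diff) (auto simp: C1_grad_def)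
  then show "((\<lambda>x. v x - v' x) has_derivative (\<lambda>h. \<Sum>i\<in>UNIV. h $ i *\<^sub>R (G x - G' x) $ i)) (at x)"
    by (simp add: scaleR_diff_right sum_subtractf)
qed

lemma C1_grad_midpoint:
  assumes "C1_grad v G" "C1_grad v' G'"
  shows "C1_grad (\<lambda>x. (1/2) *\<^sub>R (v x + v' x)) (\<lambda>x. (1/2) *\<^sub>R (G x + G' x))"
  unfolding C1_grad_def
proof (intro conjI allI)
  show "continuous_on UNIV (\<lambda>x. (1/2) *\<^sub>R (G x + G' x))"
    using assms by (intro continuous_on_scaleR continuous_on_add continuous_on_const) (auto simp: C1_grad_def)
  fix x
  have "((\<lambda>x. (1/2) *\<^sub>R (v x + v' x)) has_derivative
      (\<lambda>h. (1/2) *\<^sub>R ((\<Sum>i\<in>UNIV. h $ i *\<^sub>R G x $ i) + (\<Sum>i\<in>UNIV. h $ i *\<^sub>R G' x $ i)))) (at x)"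
    using assms by (intro has_derivative_scaleR_right has_derivative_add) (auto simp: C1_grad_def)
  moreover have "(1/2) *\<^sub>R ((\<Sum>i\<in>UNIV. h $ i *\<^sub>R G x $ i) + (\<Sum>i\<in>UNIV. h $ i *\<^sub>R G' x $ i)) =
      (\<Sum>i\<in>UNIV. h $ i *\<^sub>R ((1/2) *\<^sub>R (G x + G' x)) $ i)" for h
    by (simp add: sum.distrib[symmetric] scaleR_sum_right scaleR_add_right[symmetric] mult.commute)
  ultimately show "((\<lambda>x. (1/2) *\<^sub>R (v x + v' x)) has_derivative
      (\<lambda>h. \<Sum>i\<in>UNIV. h $ i *\<^sub>R ((1/2) *\<^sub>R (G x + G' x)) $ i)) (at x)"
    by simp
qed

text \<open>Pairing with the unit vector in the direction of the increment reduces the claim to the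
  fundamental theorem of calculus for a real function, so no integral with values in
  \<open>'h\<close> occurs.\<close>

lemma C1_grad_segment:
  fixes v :: "real^'m::finite \<Rightarrow> 'h::real_inner"
  assumes v: "C1_grad v G" and rs: "r \<le> s"
  shows "ennreal (norm (v (a + s *\<^sub>R y) - v (a + r *\<^sub>R y)))
    \<le> (\<integral>\<^sup>+t\<in>{r..s}. ennreal (norm y * norm (G (a + t *\<^sub>R y))) \<partial>lborel)"
proof -
  define d where "d = v (a + s *\<^sub>R y) - v (a + r *\<^sub>R y)"
  define e where "e = sgn d"
  define f where "f t = e \<bullet> (\<Sum>i\<in>UNIV. y $ i *\<^sub>R G (a + t *\<^sub>R y) $ i)" for t
  have e: "norm e \<le> 1" "e \<bullet> d = norm d"
    by (cases "d = 0"; simp add: e_def norm_sgn sgn_div_norm dot_square_norm power2_eq_square)+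
  have cG: "continuous_on UNIV (\<lambda>t. G (a + t *\<^sub>R y))"
    by (intro continuous_on_compose2[OF C1_grad_continuous(2)[OF v]] continuous_intros) auto
  have cf: "continuous_on UNIV f"
    unfolding f_def by (intro continuous_intros cG)
  have "((\<lambda>t. e \<bullet> v (a + t *\<^sub>R y)) has_real_derivative f t) (at t)" for t
  proof -
    have 1: "((\<lambda>t. a + t *\<^sub>R y) has_derivative (\<lambda>h. h *\<^sub>R y)) (at t)"
      by (auto intro!: derivative_eq_intros)
    have 2: "(v has_derivative (\<lambda>h. \<Sum>i\<in>UNIV. h $ i *\<^sub>R G (a + t *\<^sub>R y) $ i)) (at (a + t *\<^sub>R y))"
      using v by (simp add: C1_grad_def)
    have "((\<lambda>t. e \<bullet> v (a + t *\<^sub>R y)) has_derivative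
        (\<lambda>h. e \<bullet> (\<Sum>i\<in>UNIV. (h *\<^sub>R y) $ i *\<^sub>R G (a + t *\<^sub>R y) $ i))) (at t)"
      by (intro has_derivative_inner_right has_derivative_compose[OF 1 2])
    moreover have "(\<lambda>h. e \<bullet> (\<Sum>i\<in>UNIV. (h *\<^sub>R y) $ i *\<^sub>R G (a + t *\<^sub>R y) $ i)) = (*) (f t)"
      by (auto simp: f_def fun_eq_iff inner_sum_right sum_distrib_left mult_ac)
    ultimately show ?thesis by (simp add: has_field_derivative_def)
  qed
  then have *: "has_bochner_integral lborel (\<lambda>t. f t * indicator {r..s} t)
      (e \<bullet> v (a + s *\<^sub>R y) - e \<bullet> v (a + r *\<^sub>R y))"
    using cf rs by (intro has_bochner_integral_FTC_Icc_real) (auto simp: continuous_on_eq_continuous_at)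
  then have "norm d = (\<integral>t. f t * indicator {r..s} t \<partial>lborel)"
    using e(2) by (simp add: has_bochner_integral_integral_eq d_def inner_diff_right)
  then have "ennreal (norm d) \<le> ennreal (norm (\<integral>t. f t * indicator {r..s} t \<partial>lborel))"
    by (intro ennreal_leI) auto
  also have "\<dots> \<le> (\<integral>\<^sup>+t. ennreal (norm (f t * indicator {r..s} t)) \<partial>lborel)"
    using * by (intro integral_norm_bound_ennreal) (auto simp: has_bochner_integral_iff)
  also have "\<dots> \<le> (\<integral>\<^sup>+t\<in>{r..s}. ennreal (norm y * norm (G (a + t *\<^sub>R y))) \<partial>lborel)"
  proof (intro nn_integral_mono)
    fix t
    have "\<bar>f t\<bar> \<le> norm e * norm (\<Sum>i\<in>UNIV. y $ i *\<^sub>R G (a + t *\<^sub>R y) $ i)"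
      unfolding f_def by (rule Cauchy_Schwarz_ineq2)
    also have "\<dots> \<le> 1 * (norm y * norm (G (a + t *\<^sub>R y)))"
      by (intro mult_mono e norm_sum_scaleR_le) auto
    finally show "ennreal (norm (f t * indicator {r..s} t)) \<le> ennreal (norm y * norm (G (a + t *\<^sub>R y))) * indicator {r..s} t"
      by (auto simp: indicator_def intro!: ennreal_leI)
  qed
  finally show ?thesis by (simp add: d_def)
qed

section \<open>Approximate differentiability of limits of C1 functions\<close>

text \<open>The difference quotient at a + y is at most the integral over t in [0, 1] of |G(a + t
  y)|. For fixed t the substitution x = a + t y turns the integral over the ball of radius r into
  one over the ball of radius t r; the Jacobian is exactly the ratio of the volumes, so the constant
  \<open>c\<close> survives.\<close>

lemma C1_grad_ball_average:
  fixes z :: "real^'m::finite \<Rightarrow> 'h::{real_inner, second_countable_topology}"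
  assumes z: "C1_grad z G" and r: "0 < r"
    and avg: "\<And>s. 0 < s \<Longrightarrow> s \<le> r \<Longrightarrow>
      (\<integral>\<^sup>+x\<in>cball a s. ennreal (norm (G x)) \<partial>lborel) \<le> c * emeasure lborel (cball a s)"
  shows "(\<integral>\<^sup>+x\<in>cball a r. ennreal (norm (z x - z a) / norm (x - a)) \<partial>lborel) \<le> c * emeasure lborel (cball a r)"
proof -
  have [measurable]: "z \<in> borel_measurable borel" "G \<in> borel_measurable borel"
    using C1_grad_continuous[OF z] by (auto intro: borel_measurable_continuous_onI)
  have "(\<integral>\<^sup>+x\<in>cball a r. ennreal (norm (z x - z a) / norm (x - a)) \<partial>lborel)
      = (\<integral>\<^sup>+y\<in>cball 0 r. ennreal (norm (z (a + y) - z a) / norm y) \<partial>lborel)"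
    by (subst nn_integral_lborel_affine[of _ 1 a]) (auto simp: indicator_def dist_norm intro!: nn_integral_cong)
  also have "\<dots> \<le> (\<integral>\<^sup>+y\<in>cball 0 r. (\<integral>\<^sup>+t\<in>{0..1}. ennreal (norm (G (a + t *\<^sub>R y))) \<partial>lborel) \<partial>lborel)"
  proof (intro nn_integral_mono mult_right_mono)
    fix y :: "real^'m"
    show "ennreal (norm (z (a + y) - z a) / norm y) \<le> (\<integral>\<^sup>+t\<in>{0..1}. ennreal (norm (G (a + t *\<^sub>R y))) \<partial>lborel)"
    proof (cases "y = 0")
      case False
      have "ennreal (norm (z (a + y) - z a)) \<le> (\<integral>\<^sup>+t\<in>{0..1}. ennreal (norm y * norm (G (a + t *\<^sub>R y))) \<partial>lborel)"
        using C1_grad_segment[OF z, of 0 1 a y] by simp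
      also have "\<dots> = ennreal (norm y) * (\<integral>\<^sup>+t\<in>{0..1}. ennreal (norm (G (a + t *\<^sub>R y))) \<partial>lborel)"
        by (subst nn_integral_cmult[symmetric]) (auto simp: ennreal_mult mult_ac)
      finally have "ennreal (1 / norm y) * ennreal (norm (z (a + y) - z a)) \<le>
          ennreal (1 / norm y) * (ennreal (norm y) * (\<integral>\<^sup>+t\<in>{0..1}. ennreal (norm (G (a + t *\<^sub>R y))) \<partial>lborel))"
        by (rule mult_left_mono) simp
      then show ?thesis
        using False by (simp add: mult.assoc[symmetric] ennreal_mult'[symmetric])
    qed simp
  qed simp
  also have "\<dots> = (\<integral>\<^sup>+t. (\<integral>\<^sup>+y. ennreal (norm (G (a + t *\<^sub>R y))) * indicator {0..1} t * indicator (cball 0 r) y \<partial>lborel) \<partial>lborel)"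
  proof -
    have [measurable]: "cball (0 :: real^'m) r \<in> sets borel" by simp
    have "(\<lambda>(y, t). ennreal (norm (G (a + t *\<^sub>R y))) * indicator {0..1} t * indicator (cball 0 r) y)
        \<in> borel_measurable (lborel \<Otimes>\<^sub>M (lborel :: real measure))"
      by measurable
    then show ?thesis
      by (subst lborel_pair.Fubini') (auto intro!: nn_integral_cong simp: nn_integral_multc[symmetric])
  qed
  also have "\<dots> \<le> (\<integral>\<^sup>+t. c * emeasure lborel (cball a r) * indicator {0..1::real} t \<partial>lborel)"
  proof (intro nn_integral_mono_AE)
    \<comment> \<open>Dilation by t = 0 is not invertible and has to be left out.\<close>
    have "AE t in lborel. t \<noteq> (0::real)" by (rule AE_lborel_singleton)
    then show "AE t in lborel. (\<integral>\<^sup>+y. ennreal (norm (G (a + t *\<^sub>R y))) * indicator {0..1} t * indicator (cball 0 r) y \<partial>lborel)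
      \<le> c * emeasure lborel (cball a r) * indicator {0..1} t"
    proof (rule AE_mp, intro AE_I2 impI)
      fix t :: real assume "t \<noteq> 0"
      show "(\<integral>\<^sup>+y. ennreal (norm (G (a + t *\<^sub>R y))) * indicator {0..1} t * indicator (cball 0 r) y \<partial>lborel)
        \<le> c * emeasure lborel (cball a r) * indicator {0..1} t"
      proof (cases "t \<in> {0..1}")
        case True
        then have t: "0 < t" "t \<le> 1" using \<open>t \<noteq> 0\<close> by auto
        define D where "D = ennreal (t ^ DIM(real^'m))"
        have D: "D \<noteq> 0" "D \<noteq> top" using t by (auto simp: D_def)
        have "D * (\<integral>\<^sup>+y. ennreal (norm (G (a + t *\<^sub>R y))) * indicator {0..1} t * indicator (cball 0 r) y \<partial>lborel)
          = (\<integral>\<^sup>+x\<in>cball a (t * r). ennreal (norm (G x)) \<partial>lborel)"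
          using True t by (subst nn_integral_lborel_affine[of _ t a])
            (auto simp: D_def indicator_def dist_norm intro!: nn_integral_cong arg_cong2[where f="(*)"])
        also have "\<dots> \<le> c * emeasure lborel (cball a (t * r))"
          using t r by (intro avg) (auto simp: mult_le_cancel_right1)
        also have "\<dots> = D * (c * emeasure lborel (cball a r))"
          using t r by (subst emeasure_cball_scale[of t r a a]) (simp_all add: D_def mult_ac)
        finally have "D * (\<integral>\<^sup>+y. ennreal (norm (G (a + t *\<^sub>R y))) * indicator {0..1} t * indicator (cball 0 r) y \<partial>lborel)
          \<le> D * (c * emeasure lborel (cball a r))" .
        then show ?thesis
          using D True by (simp add: ennreal_mult_le_mult_iff)
      qed simp
    qed
  qed
  also have "\<dots> = c * emeasure lborel (cball a r)"
    by (subst nn_integral_cmult_indicator) auto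
  finally show ?thesis .
qed

text \<open>If g(a) exceeded \<open>c\<close>, then \<open>g\<close> would exceed the midpoint
  \<open>b\<close> of both numbers on a small ball, contrary to the bound there. In this way bounds
  for averages of gradients become bounds at the centre.\<close>

lemma continuous_le_of_ball_averages:
  fixes g :: "real^'m::finite \<Rightarrow> real"
  assumes g: "continuous_on UNIV g" and r: "0 < r" and c: "0 \<le> c"
    and avg: "\<And>s. 0 < s \<Longrightarrow> s \<le> r \<Longrightarrow>
      (\<integral>\<^sup>+x\<in>cball a s. ennreal (g x) \<partial>lborel) \<le> ennreal c * emeasure lborel (cball a s)"
  shows "g a \<le> c"
proof (rule ccontr)
  assume "\<not> g a \<le> c"
  define b where "b = (g a + c) / 2"
  have b: "c < b" "b < g a" "0 \<le> b" using \<open>\<not> g a \<le> c\<close> c by (auto simp: b_def)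
  have "\<forall>\<^sub>F x in at a. b < g x"
    using g b(2) by (intro order_tendstoD(1)[of g "g a"]) (auto simp: continuous_on_def)
  then obtain d where d: "0 < d" "\<And>x. x \<noteq> a \<Longrightarrow> dist x a < d \<Longrightarrow> b < g x"
    by (auto simp: eventually_at)
  define s where "s = min r (d/2)"
  have s: "0 < s" "s \<le> r" "s < d" using d(1) r by (auto simp: s_def)
  have "ennreal b * emeasure lborel (cball a s) = (\<integral>\<^sup>+x\<in>cball a s. ennreal b \<partial>lborel)"
    by (simp add: nn_integral_cmult_indicator)
  also have "\<dots> \<le> (\<integral>\<^sup>+x\<in>cball a s. ennreal (g x) \<partial>lborel)"
  proof (intro nn_integral_mono)
    fix x show "ennreal b * indicator (cball a s) x \<le> ennreal (g x) * indicator (cball a s) x"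
      using d(2)[of x] b s by (cases "x = a") (auto simp: indicator_def dist_commute intro!: ennreal_leI)
  qed
  also have "\<dots> \<le> ennreal c * emeasure lborel (cball a s)" using s by (intro avg)
  finally have "ennreal b * emeasure lborel (cball a s) \<le> ennreal c * emeasure lborel (cball a s)" .
  then have "ennreal b \<le> ennreal c"
    using emeasure_cball_pos_finite[OF s(1), of a]
    by (simp add: mult.commute[of _ "emeasure lborel (cball a s)"] ennreal_mult_le_mult_iff)
  then show False using b c by (simp add: ennreal_le_iff)
qed

lemma norm_diff_le_sum_diffs:
  fixes G :: "nat \<Rightarrow> 'a::real_normed_vector"
  assumes "k \<le> n"
  shows "norm (G n - G k) \<le> (\<Sum>i=k..<n. norm (G (Suc i) - G i))"
  using norm_sum[of "\<lambda>i. G (Suc i) - G i" "{k..<n}"] assms by (simp add: sum_Suc_diff')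

lemma sum_half_power_le: "(\<Sum>i=k..<n. (1/2::real)^i) \<le> 2 * (1/2)^k"
proof (cases "k \<le> n")
  case True
  then have "(\<Sum>i=k..<n. (1/2::real)^i) = 2 * (1/2)^k - 2 * (1/2)^n"
    by (induction rule: dec_induct) auto
  then show ?thesis by simp
qed simp

lemma cball_in_sets_borel [measurable]: "cball (a :: 'a::metric_space) r \<in> sets borel"
  by simp

text \<open>Bounds for the averages on all small balls serve twice. At the centre they make
  \<open>G n a\<close> a Cauchy sequence; integrated along rays they bound the mean of the
  difference quotients of v n - v k and, by Fatou, of w - v k. Markov's inequality then makes the
  set where w - v k grows too fast small in proportion to the ball, while v k is differentiable at
  \<open>a\<close>.\<close>

lemma C1_limit_approx_differentiable_at:
  fixes v :: "nat \<Rightarrow> real^'m::finite \<Rightarrow> 'h::{real_inner, banach, second_countable_topology}"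
  assumes v: "\<And>n. C1_grad (v n) (G n)" and [measurable]: "w \<in> borel_measurable borel"
    and r1: "0 < r1" "cball a r1 \<subseteq> U"
    and lim: "AE x in lborel. x \<in> U \<longrightarrow> (\<lambda>n. v n x) \<longlonglongrightarrow> w x" "(\<lambda>n. v n a) \<longlonglongrightarrow> w a"
    and avg: "\<And>n r. N \<le> n \<Longrightarrow> 0 < r \<Longrightarrow> r \<le> r1 \<Longrightarrow>
      (\<integral>\<^sup>+x\<in>cball a r. ennreal (norm (G (Suc n) x - G n x)) \<partial>lborel) \<le> ennreal ((1/2)^n) * emeasure lborel (cball a r)"
  shows "\<exists>g. (\<lambda>n. G n a) \<longlonglongrightarrow> g \<and>
    (\<forall>\<epsilon>>0. density_zero_at {x. norm (w x - w a - (\<Sum>i\<in>UNIV. (x - a) $ i *\<^sub>R g $ i)) > \<epsilon> * norm (x - a)} a)"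
proof -
  have cG: "continuous_on UNIV (G n)" and cv: "continuous_on UNIV (v n)" for n
    using C1_grad_continuous[OF v] by auto
  have [measurable]: "G n \<in> borel_measurable borel" "v n \<in> borel_measurable borel" for n
    using cG cv by (auto intro: borel_measurable_continuous_onI)
  have avg2: "(\<integral>\<^sup>+x\<in>cball a r. ennreal (norm (G n x - G k x)) \<partial>lborel) \<le> ennreal (2 * (1/2)^k) * emeasure lborel (cball a r)"
    if "N \<le> k" "k \<le> n" "0 < r" "r \<le> r1" for k n r
  proof -
    have [measurable]: "cball a r \<in> sets borel" by simp
    have "(\<integral>\<^sup>+x\<in>cball a r. ennreal (norm (G n x - G k x)) \<partial>lborel)
      \<le> (\<integral>\<^sup>+x. (\<Sum>i=k..<n. ennreal (norm (G (Suc i) x - G i x)) * indicator (cball a r) x) \<partial>lborel)"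
    proof (intro nn_integral_mono)
      fix x
      have "ennreal (norm (G n x - G k x)) \<le> ennreal (\<Sum>i=k..<n. norm (G (Suc i) x - G i x))"
        using that by (intro ennreal_leI norm_diff_le_sum_diffs) auto
      also have "\<dots> = (\<Sum>i=k..<n. ennreal (norm (G (Suc i) x - G i x)))" by (simp add: sum_ennreal)
      finally show "ennreal (norm (G n x - G k x)) * indicator (cball a r) x \<le>
          (\<Sum>i=k..<n. ennreal (norm (G (Suc i) x - G i x)) * indicator (cball a r) x)"
        by (simp add: sum_distrib_right[symmetric] mult_right_mono)
    qed
    also have "\<dots> = (\<Sum>i=k..<n. \<integral>\<^sup>+x\<in>cball a r. ennreal (norm (G (Suc i) x - G i x)) \<partial>lborel)"
      by (rule nn_integral_sum) auto
    also have "\<dots> \<le> (\<Sum>i=k..<n. ennreal ((1/2)^i) * emeasure lborel (cball a r))"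
      using that by (intro sum_mono avg) auto
    also have "\<dots> = ennreal (\<Sum>i=k..<n. (1/2)^i) * emeasure lborel (cball a r)"
      by (simp add: sum_distrib_right[symmetric] sum_ennreal)
    also have "\<dots> \<le> ennreal (2 * (1/2)^k) * emeasure lborel (cball a r)"
      by (intro mult_right_mono ennreal_leI sum_half_power_le) auto
    finally show ?thesis .
  qed
  have Gkn: "norm (G n a - G k a) \<le> 2 * (1/2)^k" if "N \<le> k" "k \<le> n" for k n
  proof (rule continuous_le_of_ball_averages[OF _ r1(1)])
    show "continuous_on UNIV (\<lambda>x. norm (G n x - G k x))" by (intro continuous_intros cG)
  qed (use avg2[OF that] in auto)
  have half: "\<exists>k\<ge>N. 2 * (1/2)^k < e" if "0 < e" for e :: real
  proof -
    have lim0: "(\<lambda>k. 2 * (1/2::real)^k) \<longlonglongrightarrow> 2 * 0"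
      by (intro tendsto_intros LIMSEQ_realpow_zero) auto
    have "eventually (\<lambda>k. 2 * (1/2::real)^k < e) sequentially"
      using order_tendstoD(2)[OF lim0, of e] that by simp
    then obtain M where "\<And>k. M \<le> k \<Longrightarrow> 2 * (1/2::real)^k < e" by (auto simp: eventually_sequentially)
    then show ?thesis by (intro exI[of _ "max M N"]) auto
  qed
  have "Cauchy (\<lambda>n. G n a)"
  proof (rule CauchyI')
    fix e :: real assume "0 < e"
    then obtain k where k: "N \<le> k" "2 * (1/2)^k < e/2" using half[of "e/2"] by auto
    have "dist (G m a) (G n a) < e" if "k \<le> m" "m < n" for m n
      using Gkn[OF k(1) that(1)] Gkn[OF k(1), of n] that k(2) dist_triangle3[of "G m a" "G n a" "G k a"]
      by (simp add: dist_norm norm_minus_commute)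
    then show "\<exists>M. \<forall>m\<ge>M. \<forall>n>m. dist (G m a) (G n a) < e" by blast
  qed
  then obtain g where g: "(\<lambda>n. G n a) \<longlonglongrightarrow> g"
    using Cauchy_convergent_iff convergent_def by blast
  have gk: "norm (g - G k a) \<le> 2 * (1/2)^k" if "N \<le> k" for k
    using Gkn[OF that] by (intro LIMSEQ_le_const2[OF tendsto_norm[OF tendsto_diff[OF g tendsto_const]]]) auto
  have osc: "(\<integral>\<^sup>+x\<in>cball a r. ennreal (norm ((w x - v k x) - (w a - v k a)) / norm (x - a)) \<partial>lborel)
      \<le> ennreal (2 * (1/2)^k) * emeasure lborel (cball a r)" if k: "N \<le> k" and r: "0 < r" "r \<le> r1" for k r
  proof -
    have "(\<integral>\<^sup>+x\<in>cball a r. ennreal (norm ((w x - v k x) - (w a - v k a)) / norm (x - a)) \<partial>lborel)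
      \<le> (\<integral>\<^sup>+x. liminf (\<lambda>n. ennreal (norm ((v n x - v k x) - (v n a - v k a)) / norm (x - a)) * indicator (cball a r) x) \<partial>lborel)"
    proof (intro nn_integral_mono_AE, rule AE_mp[OF lim(1)], intro AE_I2 impI)
      fix x assume x: "x \<in> U \<longrightarrow> (\<lambda>n. v n x) \<longlonglongrightarrow> w x"
      show "ennreal (norm ((w x - v k x) - (w a - v k a)) / norm (x - a)) * indicator (cball a r) x
        \<le> liminf (\<lambda>n. ennreal (norm ((v n x - v k x) - (v n a - v k a)) / norm (x - a)) * indicator (cball a r) x)"
      proof (cases "x \<in> cball a r")
        case True
        then have "x \<in> cball a r1" using r by auto
        then have "(\<lambda>n. v n x) \<longlonglongrightarrow> w x" using x r1(2) by blast
        then have lm: "(\<lambda>n. ennreal (norm ((v n x - v k x) - (v n a - v k a)) / norm (x - a)))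
            \<longlonglongrightarrow> ennreal (norm ((w x - v k x) - (w a - v k a)) / norm (x - a))"
          by (cases "x = a") (auto intro!: tendsto_intros lim(2))
        show ?thesis using True lim_imp_Liminf[OF trivial_limit_sequentially lm] by simp
      qed simp
    qed
    also have "\<dots> \<le> liminf (\<lambda>n. \<integral>\<^sup>+x\<in>cball a r. ennreal (norm ((v n x - v k x) - (v n a - v k a)) / norm (x - a)) \<partial>lborel)"
      by (intro nn_integral_liminf) auto
    also have "\<dots> \<le> ennreal (2 * (1/2)^k) * emeasure lborel (cball a r)"
    proof (intro Liminf_le eventually_sequentiallyI[of k])
      fix n assume "k \<le> n"
      then show "(\<integral>\<^sup>+x\<in>cball a r. ennreal (norm ((v n x - v k x) - (v n a - v k a)) / norm (x - a)) \<partial>lborel)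
          \<le> ennreal (2 * (1/2)^k) * emeasure lborel (cball a r)"
        using k r by (intro C1_grad_ball_average[OF C1_grad_diff[OF v[of n] v[of k]]] avg2) auto
    qed simp
    finally show ?thesis .
  qed
  have "density_zero_at {x. norm (w x - w a - (\<Sum>i\<in>UNIV. (x - a) $ i *\<^sub>R g $ i)) > \<epsilon> * norm (x - a)} a"
    if \<epsilon>: "0 < \<epsilon>" for \<epsilon>
  proof (rule density_zero_atI)
    fix \<eta> :: real assume \<eta>: "0 < \<eta>"
    define S where "S = {x. norm (w x - w a - (\<Sum>i\<in>UNIV. (x - a) $ i *\<^sub>R g $ i)) > \<epsilon> * norm (x - a)}"
    \<comment> \<open>The first bound limits the cost of replacing the limit \<open>g\<close> by
      \<open>G k a\<close>; the second makes the Markov factor 2 / \<epsilon> times the mean at most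
      \<eta>.\<close>
    obtain k where k: "N \<le> k" "2 * (1/2::real)^k < min (\<epsilon>/4) (\<eta> * (\<epsilon>/2))"
      using half[of "min (\<epsilon>/4) (\<eta> * (\<epsilon>/2))"] \<epsilon> \<eta> by auto
    have "(v k has_derivative (\<lambda>h. \<Sum>i\<in>UNIV. h $ i *\<^sub>R G k a $ i)) (at a)"
      using v[of k] by (simp add: C1_grad_def)
    then have "\<exists>d>0. \<forall>x. norm (x - a) < d \<longrightarrow>
        norm (v k x - v k a - (\<Sum>i\<in>UNIV. (x - a) $ i *\<^sub>R G k a $ i)) \<le> \<epsilon>/4 * norm (x - a)"
      using \<epsilon> unfolding has_derivative_at_alt by (elim conjE allE[of _ "\<epsilon>/4"]) simp
    then obtain d where d: "0 < d" "\<And>x. norm (x - a) < d \<Longrightarrow>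
        norm (v k x - v k a - (\<Sum>i\<in>UNIV. (x - a) $ i *\<^sub>R G k a $ i)) \<le> \<epsilon>/4 * norm (x - a)"
      by blast
    show "\<exists>r0>0. \<forall>r. 0 < r \<longrightarrow> r < r0 \<longrightarrow>
      emeasure lebesgue (S \<inter> cball a r) \<le> ennreal \<eta> * emeasure lborel (cball a r)"
    proof (intro exI[of _ "min d r1"] conjI allI impI)
      fix r assume r: "0 < r" "r < min d r1"
      define q where "q x = norm ((w x - v k x) - (w a - v k a)) / norm (x - a)" for x
      have [measurable]: "q \<in> borel_measurable borel" unfolding q_def by measurable
      have sub: "S \<inter> cball a r \<subseteq> {x\<in>cball a r. 1 \<le> ennreal (2/\<epsilon>) * ennreal (q x)}"
      proof
        fix x assume "x \<in> S \<inter> cball a r"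
        then have x: "norm (w x - w a - (\<Sum>i\<in>UNIV. (x - a) $ i *\<^sub>R g $ i)) > \<epsilon> * norm (x - a)" "x \<in> cball a r"
          by (auto simp: S_def)
        then have xa: "x \<noteq> a" by auto
        have nx: "norm (x - a) < d" using x(2) r by (simp add: dist_norm norm_minus_commute)
        have "norm ((\<Sum>i\<in>UNIV. (x - a) $ i *\<^sub>R G k a $ i) - (\<Sum>i\<in>UNIV. (x - a) $ i *\<^sub>R g $ i))
            = norm (\<Sum>i\<in>UNIV. (x - a) $ i *\<^sub>R (G k a - g) $ i)"
          by (simp add: sum_subtractf[symmetric] scaleR_diff_right[symmetric])
        also have "\<dots> \<le> norm (x - a) * norm (G k a - g)" by (rule norm_sum_scaleR_le)
        also have "\<dots> \<le> norm (x - a) * (\<epsilon>/4)"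
          using gk[OF k(1)] k(2) by (intro mult_left_mono) (auto simp: norm_minus_commute)
        finally have 1: "norm ((\<Sum>i\<in>UNIV. (x - a) $ i *\<^sub>R G k a $ i) - (\<Sum>i\<in>UNIV. (x - a) $ i *\<^sub>R g $ i))
            \<le> \<epsilon>/4 * norm (x - a)" by (simp add: mult.commute)
        \<comment> \<open>Two of the three terms cost \<epsilon>/4 each, so on the bad set the
          quotient \<open>q\<close> is at least \<epsilon>/2.\<close>
        have "w x - w a - (\<Sum>i\<in>UNIV. (x - a) $ i *\<^sub>R g $ i) = ((w x - v k x) - (w a - v k a))
            + (v k x - v k a - (\<Sum>i\<in>UNIV. (x - a) $ i *\<^sub>R G k a $ i))
            + ((\<Sum>i\<in>UNIV. (x - a) $ i *\<^sub>R G k a $ i) - (\<Sum>i\<in>UNIV. (x - a) $ i *\<^sub>R g $ i))"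
          by simp
        also have "norm \<dots> \<le> norm ((w x - v k x) - (w a - v k a)) + \<epsilon>/4 * norm (x - a) + \<epsilon>/4 * norm (x - a)"
          by (intro norm_triangle_le add_mono order_refl 1 d(2) nx)
        finally have "\<epsilon>/2 * norm (x - a) \<le> norm ((w x - v k x) - (w a - v k a))"
          using x(1) by simp
        then have "\<epsilon>/2 \<le> q x" using xa by (simp add: q_def pos_le_divide_eq)
        then have "1 \<le> 2/\<epsilon> * q x" using \<epsilon> by (simp add: field_simps)
        then have "ennreal 1 \<le> ennreal (2/\<epsilon> * q x)" by (rule ennreal_leI)
        also have "\<dots> = ennreal (2/\<epsilon>) * ennreal (q x)" using \<epsilon> by (intro ennreal_mult') auto
        finally show "x \<in> {x\<in>cball a r. 1 \<le> ennreal (2/\<epsilon>) * ennreal (q x)}"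
          using x(2) by simp
      qed
      have m: "{x\<in>cball a r. 1 \<le> ennreal (2/\<epsilon>) * ennreal (q x)} \<in> sets borel"
      proof -
        have "{x\<in>cball a r. 1 \<le> ennreal (2/\<epsilon>) * ennreal (q x)} = cball a r \<inter> {x\<in>space borel. 1 \<le> ennreal (2/\<epsilon>) * ennreal (q x)}"
          by auto
        also have "\<dots> \<in> sets borel" by (intro sets.Int) (auto, measurable)
        finally show ?thesis .
      qed
      have "emeasure lebesgue (S \<inter> cball a r) \<le> emeasure lebesgue {x\<in>cball a r. 1 \<le> ennreal (2/\<epsilon>) * ennreal (q x)}"
        using sub m by (intro emeasure_mono) auto
      also have "\<dots> = emeasure lborel {x\<in>cball a r. 1 \<le> ennreal (2/\<epsilon>) * ennreal (q x)}"
        using m by simp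
      also have "\<dots> \<le> ennreal (2/\<epsilon>) * (\<integral>\<^sup>+x\<in>cball a r. ennreal (q x) \<partial>lborel)"
        by (intro nn_integral_Markov_inequality) auto
      also have "\<dots> \<le> ennreal (2/\<epsilon>) * (ennreal (2 * (1/2)^k) * emeasure lborel (cball a r))"
        unfolding q_def using r k(1) by (intro mult_left_mono osc) auto
      also have "\<dots> = ennreal (2/\<epsilon> * (2 * (1/2)^k)) * emeasure lborel (cball a r)"
        using \<epsilon> by (subst ennreal_mult'[of "2/\<epsilon>"]) (auto simp only: mult.assoc zero_le_divide_iff zero_le_numeral less_imp_le)
      also have "\<dots> \<le> ennreal \<eta> * emeasure lborel (cball a r)"
        using k(2) \<epsilon> by (intro mult_right_mono ennreal_leI) (auto simp: field_simps)
      finally show "emeasure lebesgue (S \<inter> cball a r) \<le> ennreal \<eta> * emeasure lborel (cball a r)" .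
    qed (use d r1 in auto)
  qed
  then show ?thesis using g by blast
qed

text \<open>The maximal inequality for the n-th difference of gradients with threshold (1/2)^n has
  an exceptional set of measure at most 5^m (1/2)^n. By Borel-Cantelli almost every point lies in
  only finitely many of these sets; from then on all averages on small balls are bounded by
  (1/2)^n.\<close>

lemma C1_limit_AE_approx_differentiable:
  fixes v :: "nat \<Rightarrow> real^'m::finite \<Rightarrow> 'h::{real_inner, banach, second_countable_topology}"
  assumes v: "\<And>n. C1_grad (v n) (G n)" and w: "w \<in> borel_measurable borel"
    and U: "open U"
    and lim: "AE x in lborel. x \<in> U \<longrightarrow> (\<lambda>n. v n x) \<longlonglongrightarrow> w x"
    and int: "\<And>n. (\<integral>\<^sup>+x\<in>U. ennreal (norm (G (Suc n) x - G n x)) \<partial>lborel) \<le> ennreal ((1/4)^n)"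
  shows "AE a in lborel. a \<in> U \<longrightarrow> (\<exists>g. (\<lambda>n. G n a) \<longlonglongrightarrow> g \<and>
    (\<forall>\<epsilon>>0. density_zero_at {x. norm (w x - w a - (\<Sum>i\<in>UNIV. (x - a) $ i *\<^sub>R g $ i)) > \<epsilon> * norm (x - a)} a))"
proof -
  have [measurable]: "G n \<in> borel_measurable borel" for n
    using C1_grad_continuous(2)[OF v] by (auto intro: borel_measurable_continuous_onI)
  have [measurable]: "U \<in> sets borel" using U by auto
  \<comment> \<open>The gradients are controlled only in \<open>U\<close>, whereas the maximal
    inequality concerns the whole space.\<close>
  define h where "h n x = ennreal (norm (G (Suc n) x - G n x)) * indicator U x" for n x
  have hm: "h n \<in> borel_measurable borel" for n unfolding h_def by measurable
  define P where "P n W \<longleftrightarrow> W \<in> sets borel \<and> emeasure lborel W \<le> ennreal (5 ^ DIM(real^'m) * (1/2)^n) \<and>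
      (\<forall>a r. 0 < r \<longrightarrow> r \<le> 1 \<longrightarrow> a \<notin> W \<longrightarrow>
      (\<integral>\<^sup>+x\<in>cball a r. h n x \<partial>lborel) \<le> ennreal ((1/2)^n) * emeasure lborel (cball a r))" for n W
  have "\<exists>W. P n W" for n
  proof -
    have pos: "0 < (1/2::real)^n" by simp
    obtain W where W: "W \<in> sets borel"
      "emeasure lborel W \<le> ennreal (5 ^ DIM(real^'m) / (1/2)^n) * (\<integral>\<^sup>+x. h n x \<partial>lborel)"
      "\<And>a r. 0 < r \<Longrightarrow> r \<le> 1 \<Longrightarrow> a \<notin> W \<Longrightarrow>
      (\<integral>\<^sup>+x\<in>cball a r. h n x \<partial>lborel) \<le> ennreal ((1/2)^n) * emeasure lborel (cball a r)"
      by (rule weak_type_maximal_inequality[OF hm pos]) (rule that)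
    have "emeasure lborel W \<le> ennreal (5 ^ DIM(real^'m) / (1/2)^n) * ennreal ((1/4)^n)"
      using int[of n] by (intro order_trans[OF W(2)] mult_left_mono) (auto simp: h_def)
    also have "\<dots> = ennreal (5 ^ DIM(real^'m) * (1/2) ^ n)"
    proof -
      have "(1/4::real)^n = (1/2)^n * (1/2)^n" by (simp add: power_mult_distrib[symmetric])
      then have "5 ^ DIM(real^'m) / (1/2::real)^n * (1/4)^n = 5 ^ DIM(real^'m) * (1/2)^n" by simp
      then show ?thesis by (simp add: ennreal_mult'[symmetric])
    qed
    finally show ?thesis using W(1,3) unfolding P_def by blast
  qed
  then obtain W where "\<And>n. P n (W n)" by metis
  then have W: "\<And>n. W n \<in> sets borel" "\<And>n. emeasure lborel (W n) \<le> ennreal (5 ^ DIM(real^'m) * (1/2)^n)"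
    "\<And>n a r. 0 < r \<Longrightarrow> r \<le> 1 \<Longrightarrow> a \<notin> W n \<Longrightarrow>
      (\<integral>\<^sup>+x\<in>cball a r. h n x \<partial>lborel) \<le> ennreal ((1/2)^n) * emeasure lborel (cball a r)"
    unfolding P_def by blast+
  have "AE a in lborel. eventually (\<lambda>n. a \<notin> W n) sequentially"
    using W(1,2) by (intro AE_eventually_notin[where C="5 ^ DIM(real^'m)"]) auto
  with lim show ?thesis
  proof eventually_elim
    case (elim a)
    show ?case
    proof
      assume a: "a \<in> U"
      obtain N where N: "\<And>n. N \<le> n \<Longrightarrow> a \<notin> W n" using elim(2) by (auto simp: eventually_sequentially)
      obtain e where e: "0 < e" "cball a e \<subseteq> U" using U a open_contains_cball by blast
      define r1 where "r1 = min e 1"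
      have r1: "0 < r1" "cball a r1 \<subseteq> U" "r1 \<le> 1" using e by (auto simp: r1_def)
      show "\<exists>g. (\<lambda>n. G n a) \<longlonglongrightarrow> g \<and>
        (\<forall>\<epsilon>>0. density_zero_at {x. norm (w x - w a - (\<Sum>i\<in>UNIV. (x - a) $ i *\<^sub>R g $ i)) > \<epsilon> * norm (x - a)} a)"
      proof (rule C1_limit_approx_differentiable_at[OF v w r1(1,2) lim])
        show "(\<lambda>n. v n a) \<longlonglongrightarrow> w a" using elim(1) a by blast
        fix n r assume n: "N \<le> n" "0 < r" "r \<le> r1"
        then have "cball a r \<subseteq> U" using r1(2) by auto
        then have "(\<integral>\<^sup>+x\<in>cball a r. ennreal (norm (G (Suc n) x - G n x)) \<partial>lborel) = (\<integral>\<^sup>+x\<in>cball a r. h n x \<partial>lborel)"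
          by (intro nn_integral_cong) (auto simp: h_def indicator_def)
        also have "\<dots> \<le> ennreal ((1/2)^n) * emeasure lborel (cball a r)"
          using n r1(3) N by (intro W(3)) auto
        finally show "(\<integral>\<^sup>+x\<in>cball a r. ennreal (norm (G (Suc n) x - G n x)) \<partial>lborel)
            \<le> ennreal ((1/2)^n) * emeasure lborel (cball a r)" .
      qed
    qed
  qed
qed

section \<open>Uniform convexity\<close>

text \<open>Mean value theorem on the two halves of [a, b]: the derivative is strictly larger on the
  right half. At the endpoints only continuity is used, which covers a = 0.\<close>

lemma powr_midpoint_less:
  fixes a b p :: real
  assumes "0 \<le> a" "a < b" "1 < p"
  shows "((a + b) / 2) powr p < (a powr p + b powr p) / 2"
proof -
  define m where "m = (a + b) / 2"
  have m: "a < m" "m < b" "b - m = m - a" using assms by (auto simp: m_def field_simps)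
  have D: "((\<lambda>t. t powr p) has_real_derivative p * t powr (p - 1)) (at t)" if "0 < t" for t
    using that has_real_derivative_powr by blast
  have cont: "continuous_on {x..y} (\<lambda>t. t powr p)" if "0 \<le> x" for x y
    using that assms by (intro continuous_on_powr' continuous_intros) auto
  have mvt: "\<exists>z. x < z \<and> z < y \<and> y powr p - x powr p = (y - x) * (p * z powr (p - 1))"
    if xy: "0 \<le> x" "x < y" for x y
  proof -
    have diff: "(\<lambda>t. t powr p) differentiable (at t)" if "x < t" for t
      using D[of t] that xy real_differentiable_def by force
    obtain l z where z: "x < z" "z < y" "DERIV (\<lambda>t. t powr p) z :> l" "y powr p - x powr p = (y - x) * l"
      using MVT[OF xy(2) cont[OF xy(1)] diff] by blast
    have "l = p * z powr (p - 1)" using DERIV_unique[OF z(3) D] z(1) xy by simp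
    then show ?thesis using z by blast
  qed
  obtain z where z: "a < z" "z < m" "m powr p - a powr p = (m - a) * (p * z powr (p - 1))"
    using mvt[OF assms(1) m(1)] by blast
  obtain y where y: "m < y" "y < b" "b powr p - m powr p = (b - m) * (p * y powr (p - 1))"
    using mvt[OF _ m(2)] assms(1) m(1) by force
  have "z powr (p - 1) < y powr (p - 1)"
    using z y assms by (intro powr_less_mono2) auto
  then have "(m - a) * (p * z powr (p - 1)) < (m - a) * (p * y powr (p - 1))"
    using m assms by (intro mult_strict_left_mono) auto
  then have "m powr p - a powr p < b powr p - m powr p" using z(3) y(3) m(3) by simp
  then show ?thesis by (simp add: m_def)
qed

lemma powr_midpoint_le:
  fixes a b p :: real
  assumes "0 \<le> a" "0 \<le> b" "1 < p"
  shows "((a + b) / 2) powr p \<le> (a powr p + b powr p) / 2"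
  using powr_midpoint_less[of a b p] powr_midpoint_less[of b a p] assms
  by (cases a b rule: linorder_cases) (auto simp: add.commute)

lemma add_powr_le:
  fixes a b p :: real
  assumes "0 \<le> a" "0 \<le> b" "1 < p"
  shows "(a + b) powr p \<le> 2 powr p * (a powr p + b powr p)"
proof -
  have "(a + b) powr p = (2 * ((a + b) / 2)) powr p"
    by (rule arg_cong[where f="\<lambda>x. x powr p"]) (simp add: field_simps)
  also have "\<dots> = 2 powr p * ((a + b) / 2) powr p"
    using assms by (subst powr_mult) auto
  also have "\<dots> \<le> 2 powr p * (a powr p + b powr p)"
  proof (intro mult_left_mono)
    show "((a + b) / 2) powr p \<le> a powr p + b powr p"
      using powr_midpoint_le[OF assms] by (rule order_trans) (simp add: field_simps)
  qed simp
  finally show ?thesis .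
qed

lemma power2_powr_half:
  fixes s p :: real
  assumes "0 \<le> s"
  shows "(s\<^sup>2) powr (p / 2) = s powr p"
proof -
  have "s\<^sup>2 = s powr 2" using assms by simp
  then show ?thesis by (simp only: powr_powr) simp
qed

lemma norm_midpoint_powr_le:
  fixes x y :: "'h::real_normed_vector" and p :: real
  assumes "1 < p"
  shows "norm ((1/2) *\<^sub>R (x + y)) powr p \<le> (norm x powr p + norm y powr p) / 2"
proof -
  have "norm ((1/2) *\<^sub>R (x + y)) powr p \<le> ((norm x + norm y) / 2) powr p"
    using assms norm_triangle_ineq[of x y] by (intro powr_mono2) auto
  also have "\<dots> \<le> (norm x powr p + norm y powr p) / 2"
    using assms by (intro powr_midpoint_le) auto
  finally show ?thesis .
qed

text \<open>
  All the quantities involved depend on \<open>x\<close> and \<open>y\<close> only through the three numbers \<open>norm x\<close>, \<open>norm y\<close>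
  and \<open>x \<bullet> y\<close>, so compactness in \<open>\<real>\<^sup>3\<close> suffices even if \<open>x\<close> and \<open>y\<close> range over an infinite dimensional space.
\<close>

lemma powr_uniform_convexity_normalised:
  fixes p \<epsilon> :: real
  assumes p: "1 < p" and \<epsilon>: "0 < \<epsilon>"
  shows "\<exists>C\<ge>0. \<forall>x y :: 'h::real_inner. norm x powr p + norm y powr p = 1 \<longrightarrow>
    norm (x - y) powr p \<le> \<epsilon> + C * ((norm x powr p + norm y powr p) / 2 - norm ((1/2) *\<^sub>R (x + y)) powr p)"
proof -
  \<comment> \<open>For a = |x|, b = |y| and c the inner product of x and y, \<open>\<Phi>\<close>
    is the convexity defect of the p-th power at the midpoint and \<open>\<Psi>\<close> is |x -
    y|^p.\<close>
  define \<Phi> :: "real \<times> real \<times> real \<Rightarrow> real" where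
    "\<Phi> = (\<lambda>(a, b, c). (a powr p + b powr p) / 2 - ((a\<^sup>2 + b\<^sup>2 + 2 * c) / 4) powr (p / 2))"
  define \<Psi> :: "real \<times> real \<times> real \<Rightarrow> real" where
    "\<Psi> = (\<lambda>(a, b, c). (a\<^sup>2 + b\<^sup>2 - 2 * c) powr (p / 2))"
  \<comment> \<open>\<open>B\<close> is the region allowed by the Cauchy-Schwarz inequality;
    \<open>T\<close> is its compact part where the norms are normalised and x, y are not
    close.\<close>
  define B :: "(real \<times> real \<times> real) set" where "B = {(a, b, c). 0 \<le> a \<and> 0 \<le> b \<and> \<bar>c\<bar> \<le> a * b}"
  define T where "T = {z \<in> B. fst z powr p + fst (snd z) powr p = 1 \<and> \<epsilon> \<le> \<Psi> z}"
  have sq: "0 \<le> a\<^sup>2 + b\<^sup>2 + 2 * c" "0 \<le> a\<^sup>2 + b\<^sup>2 - 2 * c" if "(a, b, c) \<in> B" for a b c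
    using that sum_squares_bound[of a b] by (auto simp: B_def abs_le_iff)
  have B: "closed B"
    unfolding B_def case_prod_beta
    by (intro closed_Collect_conj closed_Collect_le continuous_intros)
  have c1: "continuous_on B (\<lambda>z. fst z powr p + fst (snd z) powr p)"
    using p by (intro continuous_intros continuous_on_powr') (auto simp: B_def)
  have c2: "continuous_on B \<Psi>"
    unfolding \<Psi>_def case_prod_beta
    using p sq(2) by (intro continuous_intros continuous_on_powr') (auto simp: case_prod_beta)
  have c3: "continuous_on B \<Phi>"
    unfolding \<Phi>_def case_prod_beta
    using p sq(1) by (intro continuous_intros continuous_on_powr') (auto simp: B_def)
  have "closed T"
  proof -
    have "T = (B \<inter> (\<lambda>z. fst z powr p + fst (snd z) powr p) -` {1}) \<inter> (B \<inter> \<Psi> -` {\<epsilon>..})"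
      by (auto simp: T_def)
    then show ?thesis
      using continuous_closed_preimage[OF c1 B] continuous_closed_preimage[OF c2 B] by auto
  qed
  moreover have "bounded T"
  proof (rule boundedI[of _ 3])
    fix z assume "z \<in> T"
    then obtain a b c where z: "z = (a, b, c)" "0 \<le> a" "0 \<le> b" "\<bar>c\<bar> \<le> a * b" "a powr p + b powr p = 1"
      by (cases z) (auto simp: T_def B_def)
    have "a \<le> 1" "b \<le> 1"
    proof -
      have "t \<le> 1" if "0 \<le> t" "t powr p \<le> 1" for t :: real
        proof (rule ccontr)
        assume "\<not> t \<le> 1"
        then have "1 powr p < t powr p" using p by (intro powr_less_mono2) auto
        with that show False by simp
      qed
      moreover have "a powr p \<le> 1" "b powr p \<le> 1"
        using z(5) powr_ge_zero[of a p] powr_ge_zero[of b p] by linarith+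
      ultimately show "a \<le> 1" "b \<le> 1" using z(2,3) by blast+
    qed
    moreover from this have "a * b \<le> 1" using z by (simp add: mult_le_one)
    ultimately have "\<bar>a\<bar> + (\<bar>b\<bar> + \<bar>c\<bar>) \<le> 3" using z by linarith
    moreover have "norm z \<le> \<bar>a\<bar> + (\<bar>b\<bar> + \<bar>c\<bar>)"
      unfolding z(1) using norm_Pair_le[of a "(b, c)"] norm_Pair_le[of b c] by simp
    ultimately show "norm z \<le> 3" by linarith
  qed
  ultimately have T: "compact T" by (simp add: compact_eq_bounded_closed)
  have pos: "0 < \<Phi> z" if "z \<in> T" for z
  proof -
    obtain a b c where z: "z = (a, b, c)" "0 \<le> a" "0 \<le> b" "\<bar>c\<bar> \<le> a * b" "\<epsilon> \<le> \<Psi> z" "z \<in> B"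
      using \<open>z \<in> T\<close> by (cases z) (auto simp: T_def B_def)
    have h: "((a + b) / 2) powr p = (((a + b) / 2)\<^sup>2) powr (p / 2)"
      using z by (subst power2_powr_half) auto
    have le: "(a\<^sup>2 + b\<^sup>2 + 2 * c) / 4 \<le> ((a + b) / 2)\<^sup>2"
      using z by (simp add: power2_eq_square field_simps abs_le_iff)
    show ?thesis
    proof (cases "a = b")
      case True
      \<comment> \<open>For vectors of equal norm the strictness comes from the inner product: c = a
        b would give \<open>\<Psi>\<close> = 0.\<close>
      have "c \<noteq> a * b"
        using z(5) \<epsilon> True p by (auto simp: \<Psi>_def z(1) power2_eq_square)
      then have "(a\<^sup>2 + b\<^sup>2 + 2 * c) / 4 < ((a + b) / 2)\<^sup>2"
        using z by (auto simp: power2_eq_square field_simps abs_le_iff)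
      then have "((a\<^sup>2 + b\<^sup>2 + 2 * c) / 4) powr (p / 2) < ((a + b) / 2) powr p"
        unfolding h using sq(1) z p by (intro powr_less_mono2) auto
      also have "\<dots> \<le> (a powr p + b powr p) / 2" using z p by (intro powr_midpoint_le)
      finally show ?thesis by (simp add: \<Phi>_def z(1))
    next
      case False
      have "((a\<^sup>2 + b\<^sup>2 + 2 * c) / 4) powr (p / 2) \<le> ((a + b) / 2) powr p"
        unfolding h using sq(1) z p le by (intro powr_mono2) auto
      also have "\<dots> < (a powr p + b powr p) / 2"
        using powr_midpoint_less[of a b p] powr_midpoint_less[of b a p] False z p
        by (cases a b rule: linorder_cases) (auto simp: add.commute)
      finally show ?thesis by (simp add: \<Phi>_def z(1))
    qed
  qed
  \<comment> \<open>The minimum of the defect on \<open>T\<close>; if \<open>T\<close> is empty, any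
    positive constant serves.\<close>
  obtain c where c: "0 < c" "\<And>z. z \<in> T \<Longrightarrow> c \<le> \<Phi> z"
  proof (cases "T = {}")
    case False
    have "continuous_on T \<Phi>" by (rule continuous_on_subset[OF c3]) (auto simp: T_def)
    then obtain z where "z \<in> T" "\<And>y. y \<in> T \<Longrightarrow> \<Phi> z \<le> \<Phi> y"
      using continuous_attains_inf[OF T False] by blast
    then show ?thesis using pos that by blast
  qed (use that[of 1] in auto)
  show ?thesis
  \<comment> \<open>On \<open>T\<close> the left side is at most 2^p, hence at most 2^p / c times
    the defect; outside \<open>T\<close> it is below \<epsilon>.\<close>
  proof (intro exI[of _ "2 powr p / c"] conjI allI impI)
    fix x y :: 'h assume 1: "norm x powr p + norm y powr p = 1"
    define z where "z = (norm x, norm y, x \<bullet> y)"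
    have zB: "z \<in> B" by (simp add: B_def z_def Cauchy_Schwarz_ineq2)
    have sqrt_powr: "t powr (p / 2) = s powr p" if "t = s\<^sup>2" "0 \<le> s" for s t :: real
      using that power2_powr_half by simp
    have \<Psi>: "\<Psi> z = norm (x - y) powr p"
      by (simp add: \<Psi>_def z_def, rule sqrt_powr)
        (auto simp: power2_norm_eq_inner inner_simps inner_commute)
    have \<Phi>: "\<Phi> z = (norm x powr p + norm y powr p) / 2 - norm ((1/2) *\<^sub>R (x + y)) powr p"
    proof -
      have "(norm x)\<^sup>2 + (norm y)\<^sup>2 + 2 * (x \<bullet> y) = (norm (x + y))\<^sup>2"
        by (simp add: power2_norm_eq_inner inner_simps inner_commute)
      then have "((norm x)\<^sup>2 + (norm y)\<^sup>2 + 2 * (x \<bullet> y)) / 4 = (norm ((1/2) *\<^sub>R (x + y)))\<^sup>2"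
        by (simp add: power_divide)
      from sqrt_powr[OF this] show ?thesis unfolding \<Phi>_def z_def case_prod_conv by simp
    qed
    have \<Phi>0: "0 \<le> \<Phi> z" unfolding \<Phi> using norm_midpoint_powr_le[OF p, of x y] by simp
    show "norm (x - y) powr p \<le> \<epsilon> + 2 powr p / c * ((norm x powr p + norm y powr p) / 2 - norm ((1/2) *\<^sub>R (x + y)) powr p)"
    proof (cases "\<epsilon> \<le> \<Psi> z")
      case True
      then have "z \<in> T" using zB 1 by (simp add: T_def z_def)
      have "norm (x - y) powr p \<le> (norm x + norm y) powr p"
        using p by (intro powr_mono2 norm_triangle_ineq4) auto
      also have "\<dots> \<le> 2 powr p * 1"
        using add_powr_le[of "norm x" "norm y" p] p 1 by simp
      also have "\<dots> \<le> 2 powr p / c * \<Phi> z"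
        using c(2)[OF \<open>z \<in> T\<close>] c(1) by (simp add: pos_le_divide_eq mult_left_mono)
      finally show ?thesis using \<epsilon> unfolding \<Phi> by simp
    next
      case False
      then show ?thesis using \<Phi>0 c(1) unfolding \<Psi> \<Phi> by (intro add_increasing2) auto
    qed
  qed (use c(1) in auto)
qed

text \<open>Both sides are homogeneous of degree p, so scaling by \<open>t\<close> with t^p = 1 / s
  reduces the claim to the normalised case.\<close>

lemma powr_uniform_convexity:
  fixes p \<epsilon> :: real
  assumes p: "1 < p" and \<epsilon>: "0 < \<epsilon>"
  shows "\<exists>C\<ge>0. \<forall>x y :: 'h::real_inner. norm (x - y) powr p \<le> \<epsilon> * (norm x powr p + norm y powr p)
    + C * ((norm x powr p + norm y powr p) / 2 - norm ((1/2) *\<^sub>R (x + y)) powr p)"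
proof -
  obtain C where C: "0 \<le> C" "\<And>x y :: 'h. norm x powr p + norm y powr p = 1 \<Longrightarrow>
    norm (x - y) powr p \<le> \<epsilon> + C * ((norm x powr p + norm y powr p) / 2 - norm ((1/2) *\<^sub>R (x + y)) powr p)"
    using powr_uniform_convexity_normalised[OF p \<epsilon>] by metis
  show ?thesis
  proof (intro exI[of _ C] conjI allI C(1))
    fix x y :: 'h
    define s where "s = norm x powr p + norm y powr p"
    show "norm (x - y) powr p \<le> \<epsilon> * (norm x powr p + norm y powr p)
      + C * ((norm x powr p + norm y powr p) / 2 - norm ((1/2) *\<^sub>R (x + y)) powr p)"
    proof (cases "s = 0")
      case True
      then have "x = 0" "y = 0" using p by (auto simp: s_def add_nonneg_eq_0_iff)
      then show ?thesis by simp
    next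
      case False
      then have s: "0 < s" by (simp add: s_def add_nonneg_nonneg order.not_eq_order_implies_strict)
      define t where "t = s powr (- 1 / p)"
      have "t powr p = s powr (- 1 / p * p)" unfolding t_def by (rule powr_powr)
      then have t: "0 < t" "t powr p = 1 / s" using s p by (auto simp: t_def powr_minus_divide)
      have sc: "norm (t *\<^sub>R z) powr p = norm z powr p / s" for z :: 'h
        using t by (simp add: powr_mult)
      have "norm (t *\<^sub>R x) powr p + norm (t *\<^sub>R y) powr p = 1"
        unfolding sc using s by (simp add: s_def add_divide_distrib[symmetric])
      from C(2)[OF this]
      have "norm (t *\<^sub>R (x - y)) powr p \<le> \<epsilon> + C * ((norm (t *\<^sub>R x) powr p + norm (t *\<^sub>R y) powr p) / 2
          - norm (t *\<^sub>R ((1/2) *\<^sub>R (x + y))) powr p)"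
        by (simp add: scaleR_diff_right scaleR_add_right mult.commute)
      then have "norm (x - y) powr p / s \<le> \<epsilon> + C * ((norm x powr p / s + norm y powr p / s) / 2
          - norm ((1/2) *\<^sub>R (x + y)) powr p / s)"
        unfolding sc .
      then have "norm (x - y) powr p / s * s \<le> (\<epsilon> + C * ((norm x powr p / s + norm y powr p / s) / 2
          - norm ((1/2) *\<^sub>R (x + y)) powr p / s)) * s"
        using s by (intro mult_right_mono) auto
      also have "\<dots> = \<epsilon> * s + C * ((norm x powr p + norm y powr p) / 2 - norm ((1/2) *\<^sub>R (x + y)) powr p)"
        using s by (simp add: field_simps)
      finally show ?thesis using s by (simp add: s_def)
    qed
  qed
qed

section \<open>Almost minimisers of the energy\<close>

lemma ennreal_le_diff_of_add_le:
  assumes "ennreal a + X \<le> ennreal b" "0 \<le> a"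
  shows "X \<le> ennreal (b - a)"
proof -
  have "X = ennreal a + X - ennreal a" by simp
  also have "\<dots> \<le> ennreal b - ennreal a" by (rule ennreal_minus_mono[OF assms(1) order_refl])
  also have "\<dots> = ennreal (b - a)" using assms(2) by (rule ennreal_minus)
  finally show ?thesis .
qed

text \<open>The pointwise inequality is integrated. The convexity defect \<open>D\<close> has
  integral at most (a + b) / 2 - c because the midpoint has energy at least \<open>c\<close>; this
  is derived additively, since subtraction in \<open>ennreal\<close> is truncated.\<close>

lemma nn_integral_powr_diff_le:
  fixes G H :: "'a \<Rightarrow> 'h::{real_inner, second_countable_topology}"
  assumes p: "1 < p"
    and [measurable]: "G \<in> borel_measurable M" "H \<in> borel_measurable M"
    and C: "0 \<le> C" "\<And>x y :: 'h. norm (x - y) powr p \<le> \<epsilon> * (norm x powr p + norm y powr p)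
      + C * ((norm x powr p + norm y powr p) / 2 - norm ((1/2) *\<^sub>R (x + y)) powr p)"
    and \<epsilon>: "0 \<le> \<epsilon>"
    and G: "(\<integral>\<^sup>+x. ennreal (norm (G x) powr p) \<partial>M) \<le> ennreal a" "0 \<le> a"
    and H: "(\<integral>\<^sup>+x. ennreal (norm (H x) powr p) \<partial>M) \<le> ennreal b" "0 \<le> b"
    and mid: "ennreal c \<le> (\<integral>\<^sup>+x. ennreal (norm ((1/2) *\<^sub>R (G x + H x)) powr p) \<partial>M)" "0 \<le> c"
    and cab: "c \<le> (a + b) / 2"
  shows "(\<integral>\<^sup>+x. ennreal (norm (G x - H x) powr p) \<partial>M) \<le> ennreal (\<epsilon> * (a + b) + C * ((a + b) / 2 - c))"
proof -
  define D where "D x = (norm (G x) powr p + norm (H x) powr p) / 2 - norm ((1/2) *\<^sub>R (G x + H x)) powr p" for x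
  have D0: "0 \<le> D x" for x unfolding D_def using norm_midpoint_powr_le[OF p] by simp
  have [measurable]: "D \<in> borel_measurable M" unfolding D_def by measurable
  have sum: "(\<integral>\<^sup>+x. ennreal (norm (G x) powr p + norm (H x) powr p) \<partial>M) \<le> ennreal (a + b)"
    using G H by (simp add: ennreal_plus nn_integral_add add_mono del: ennreal_plus[symmetric])
  have "ennreal c + (\<integral>\<^sup>+x. ennreal (D x) \<partial>M) \<le>
      (\<integral>\<^sup>+x. ennreal (norm ((1/2) *\<^sub>R (G x + H x)) powr p) \<partial>M) + (\<integral>\<^sup>+x. ennreal (D x) \<partial>M)"
    by (intro add_mono mid order_refl)
  also have "\<dots> = (\<integral>\<^sup>+x. ennreal (norm ((1/2) *\<^sub>R (G x + H x)) powr p) + ennreal (D x) \<partial>M)"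
    by (rule nn_integral_add[symmetric]) auto
  also have "\<dots> = (\<integral>\<^sup>+x. ennreal (1/2) * ennreal (norm (G x) powr p + norm (H x) powr p) \<partial>M)"
  proof (intro nn_integral_cong)
    fix x
    have "ennreal (norm ((1/2) *\<^sub>R (G x + H x)) powr p) + ennreal (D x)
        = ennreal (norm ((1/2) *\<^sub>R (G x + H x)) powr p + D x)"
      using D0 by (intro ennreal_plus[symmetric]) auto
    also have "norm ((1/2) *\<^sub>R (G x + H x)) powr p + D x = 1/2 * (norm (G x) powr p + norm (H x) powr p)"
      by (simp add: D_def)
    also have "ennreal \<dots> = ennreal (1/2) * ennreal (norm (G x) powr p + norm (H x) powr p)"
      by (rule ennreal_mult') simp
    finally show "ennreal (norm ((1/2) *\<^sub>R (G x + H x)) powr p) + ennreal (D x)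
        = ennreal (1/2) * ennreal (norm (G x) powr p + norm (H x) powr p)" .
  qed
  also have "\<dots> = ennreal (1/2) * (\<integral>\<^sup>+x. ennreal (norm (G x) powr p + norm (H x) powr p) \<partial>M)"
    by (rule nn_integral_cmult) measurable
  also have "\<dots> \<le> ennreal (1/2) * ennreal (a + b)" by (intro mult_left_mono sum) auto
  also have "\<dots> = ennreal ((a + b) / 2)" using ennreal_mult'[of "1/2" "a + b"] by simp
  finally have "(\<integral>\<^sup>+x. ennreal (D x) \<partial>M) \<le> ennreal ((a + b) / 2 - c)"
    using mid(2) by (rule ennreal_le_diff_of_add_le)
  note D = this
  have "(\<integral>\<^sup>+x. ennreal (norm (G x - H x) powr p) \<partial>M)
      \<le> (\<integral>\<^sup>+x. ennreal \<epsilon> * ennreal (norm (G x) powr p + norm (H x) powr p) + ennreal C * ennreal (D x) \<partial>M)"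
  proof (intro nn_integral_mono)
    fix x
    have "ennreal (norm (G x - H x) powr p) \<le> ennreal (\<epsilon> * (norm (G x) powr p + norm (H x) powr p) + C * D x)"
      unfolding D_def by (intro ennreal_leI C(2))
    also have "\<dots> = ennreal (\<epsilon> * (norm (G x) powr p + norm (H x) powr p)) + ennreal (C * D x)"
      using \<epsilon> C(1) D0 by (intro ennreal_plus mult_nonneg_nonneg add_nonneg_nonneg) auto
    also have "\<dots> = ennreal \<epsilon> * ennreal (norm (G x) powr p + norm (H x) powr p) + ennreal C * ennreal (D x)"
      using \<epsilon> C(1) by (simp only: ennreal_mult')
    finally show "ennreal (norm (G x - H x) powr p) \<le> \<dots>" .
  qed
  also have "\<dots> = ennreal \<epsilon> * (\<integral>\<^sup>+x. ennreal (norm (G x) powr p + norm (H x) powr p) \<partial>M)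
      + ennreal C * (\<integral>\<^sup>+x. ennreal (D x) \<partial>M)"
  proof -
    have A: "(\<integral>\<^sup>+x. ennreal \<epsilon> * ennreal (norm (G x) powr p + norm (H x) powr p) \<partial>M)
        = ennreal \<epsilon> * (\<integral>\<^sup>+x. ennreal (norm (G x) powr p + norm (H x) powr p) \<partial>M)"
      by (rule nn_integral_cmult) measurable
    have B: "(\<integral>\<^sup>+x. ennreal C * ennreal (D x) \<partial>M) = ennreal C * (\<integral>\<^sup>+x. ennreal (D x) \<partial>M)"
      by (rule nn_integral_cmult) measurable
    show ?thesis unfolding A[symmetric] B[symmetric] by (rule nn_integral_add) measurable
  qed
  also have "\<dots> \<le> ennreal \<epsilon> * ennreal (a + b) + ennreal C * ennreal ((a + b) / 2 - c)"
    by (intro add_mono mult_left_mono sum D) auto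
  also have "\<dots> = ennreal (\<epsilon> * (a + b)) + ennreal (C * ((a + b) / 2 - c))"
    using \<epsilon> C(1) by (simp only: ennreal_mult')
  also have "\<dots> = ennreal (\<epsilon> * (a + b) + C * ((a + b) / 2 - c))"
    using \<epsilon> C(1) cab G(2) H(2) by (intro ennreal_plus[symmetric] mult_nonneg_nonneg) auto
  finally show ?thesis .
qed

text \<open>
  Choose almost minimisers of the \<open>p\<close>-energy in the sets \<open>C n\<close>. The midpoint of two of them lies again
  in one of the sets, hence has almost the same energy, and uniform convexity makes them close.
\<close>

lemma Cauchy_selection_of_midpoint_closed:
  fixes C :: "nat \<Rightarrow> ('a \<Rightarrow> 'h::{real_inner, second_countable_topology}) set"
  assumes p: "1 < p" and K: "0 \<le> K"
    and meas: "\<And>n G. G \<in> C n \<Longrightarrow> G \<in> borel_measurable M"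
    and decseq: "\<And>m n. n \<le> m \<Longrightarrow> C m \<subseteq> C n"
    and midpoint: "\<And>n G H. G \<in> C n \<Longrightarrow> H \<in> C n \<Longrightarrow> (\<lambda>x. (1/2) *\<^sub>R (G x + H x)) \<in> C n"
    and energy: "\<And>n. \<exists>G\<in>C n. (\<integral>\<^sup>+x. ennreal (norm (G x) powr p) \<partial>M) \<le> ennreal K"
  obtains G where "\<And>n. G n \<in> C n"
    "\<And>\<epsilon>. 0 < \<epsilon> \<Longrightarrow> \<exists>N. \<forall>m\<ge>N. \<forall>n\<ge>N. (\<integral>\<^sup>+x. ennreal (norm (G m x - G n x) powr p) \<partial>M) \<le> ennreal \<epsilon>"
proof -
  define J where "J n = inverse (real (Suc n))" for n
  have J: "0 < J n" "J n \<le> 1" for n by (simp_all add: J_def inverse_eq_divide)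
  have J_mono: "J k \<le> J n" if "n \<le> k" for n k using that by (simp add: J_def)
  define E where "E G = (\<integral>\<^sup>+x. ennreal (norm (G x) powr p) \<partial>M)" for G :: "'a \<Rightarrow> 'h"
  \<comment> \<open>The infima increase with n because the sets shrink, and they are bounded by
    \<open>K\<close>; their convergence makes the energies of the almost minimisers asymptotically
    equal.\<close>
  define i where "i n = enn2real (INF G\<in>C n. E G)" for n
  have le: "(INF G\<in>C n. E G) \<le> ennreal K" for n
    using energy[of n] by (auto simp: E_def intro: INF_lower2)
  have i: "ennreal (i n) = (INF G\<in>C n. E G)" for n
    unfolding i_def using le_less_trans[OF le ennreal_less_top] by (intro ennreal_enn2real) auto
  have i0: "0 \<le> i n" for n by (simp add: i_def)
  have iK: "i n \<le> K" for n using le[of n] K unfolding i[symmetric] by (simp add: ennreal_le_iff)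
  have imono: "i n \<le> i m" if "n \<le> m" for m n
  proof -
    have "ennreal (i n) \<le> ennreal (i m)"
      unfolding i using decseq[OF that] by (intro INF_superset_mono) auto
    then show ?thesis using i0 by (simp add: ennreal_le_iff)
  qed
  have "\<exists>G\<in>C n. E G \<le> ennreal (i n + J n)" for n
  proof -
    have "ennreal (i n) < ennreal (i n + J n)"
      using i0 J by (intro ennreal_lessI add_nonneg_pos) auto
    then show ?thesis unfolding i INF_less_iff by (auto intro: less_imp_le)
  qed
  then obtain G where G: "\<And>n. G n \<in> C n" "\<And>n. E (G n) \<le> ennreal (i n + J n)"
    by metis
  have mono_conv: "Cauchy i"
  proof -
    have "convergent i"
      using imono iK i0 by (intro Bseq_monoseq_convergent BseqI'[of _ K]) (auto simp: monoseq_def)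
    then show ?thesis by (simp add: Cauchy_convergent_iff)
  qed
  have main: "\<exists>N. \<forall>m\<ge>N. \<forall>n\<ge>N. (\<integral>\<^sup>+x. ennreal (norm (G m x - G n x) powr p) \<partial>M) \<le> ennreal \<epsilon>"
    if \<epsilon>: "0 < \<epsilon>" for \<epsilon>
  proof -
    \<comment> \<open>Below a + b is at most 2 (K + 1), so the term with \<open>e\<close>
      contributes \<epsilon>/2; likewise \<open>d\<close> is chosen for an excess over the infimum
      of at most 2 d.\<close>
    define e where "e = \<epsilon> / (4 * (K + 1))"
    have e: "0 < e" using \<epsilon> K by (simp add: e_def)
    obtain C' where C': "0 \<le> C'" "\<And>x y :: 'h. norm (x - y) powr p \<le> e * (norm x powr p + norm y powr p)
      + C' * ((norm x powr p + norm y powr p) / 2 - norm ((1/2) *\<^sub>R (x + y)) powr p)"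
      using powr_uniform_convexity[OF p e] by metis
    define d where "d = \<epsilon> / (4 * (C' + 1))"
    have d: "0 < d" using \<epsilon> C'(1) by (simp add: d_def)
    obtain N1 where N1: "\<And>m n. N1 \<le> m \<Longrightarrow> N1 \<le> n \<Longrightarrow> dist (i m) (i n) < d"
      using mono_conv d unfolding Cauchy_def by blast
    obtain N2 where N2: "J N2 < d" using reals_Archimedean[OF d] by (auto simp: J_def)
    have half: "(\<integral>\<^sup>+x. ennreal (norm (G m x - G n x) powr p) \<partial>M) \<le> ennreal \<epsilon>"
      if mn: "max N1 N2 \<le> n" "n \<le> m" for m n
    proof -
      define a b where "a = i m + J m" and "b = i n + J n"
      have ab: "0 \<le> a" "0 \<le> b"
        unfolding a_def b_def by (intro add_nonneg_nonneg i0 less_imp_le[OF J(1)])+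
      have inv: "J k < d" if "n \<le> k" for k
        by (rule le_less_trans[OF J_mono N2]) (use that mn in auto)
      \<comment> \<open>For n \<le> m both maps lie in the larger set \<open>C n\<close>, so the
        energy of their midpoint is at least \<open>i n\<close>.\<close>
      have mid: "(\<lambda>x. (1/2) *\<^sub>R (G m x + G n x)) \<in> C n"
        using G(1) decseq[OF mn(2)] by (intro midpoint) auto
      have "(\<integral>\<^sup>+x. ennreal (norm (G m x - G n x) powr p) \<partial>M) \<le> ennreal (e * (a + b) + C' * ((a + b) / 2 - i n))"
      proof (rule nn_integral_powr_diff_le[OF p meas meas C' less_imp_le[OF e]])
        show "ennreal (i n) \<le> (\<integral>\<^sup>+x. ennreal (norm ((1/2) *\<^sub>R (G m x + G n x)) powr p) \<partial>M)"
          using INF_lower[OF mid, of E] i[of n] E_def[of "\<lambda>x. (1/2) *\<^sub>R (G m x + G n x)"] by simp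
        show "i n \<le> (a + b) / 2" using imono[OF mn(2)] J(1)[of m] J(1)[of n] by (simp add: a_def b_def field_simps)
      qed (use G i0 ab in \<open>auto simp: E_def a_def b_def\<close>)
      also have "\<dots> \<le> ennreal \<epsilon>"
      proof (intro ennreal_leI)
        have "a + b \<le> 2 * (K + 1)" using iK[of m] iK[of n] J(2)[of m] J(2)[of n] by (simp add: a_def b_def)
        then have "e * (a + b) \<le> e * (2 * (K + 1))" using e by (intro mult_left_mono) auto
        also have "\<dots> = \<epsilon> / 2" using K by (simp add: e_def field_simps)
        finally have 1: "e * (a + b) \<le> \<epsilon> / 2" .
        have "i m - i n < d" using N1[of m n] mn by (auto simp: dist_real_def)
        then have "(a + b) / 2 - i n \<le> 2 * d" using inv[of m] inv[of n] mn(2) d by (simp add: a_def b_def field_simps)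
        then have "C' * ((a + b) / 2 - i n) \<le> (C' + 1) * (2 * d)"
          using C'(1) d by (intro order_trans[OF mult_left_mono mult_right_mono]) auto
        also have "\<dots> = \<epsilon> / 2" using C'(1) by (simp add: d_def field_simps)
        finally show "e * (a + b) + C' * ((a + b) / 2 - i n) \<le> \<epsilon>" using 1 by linarith
      qed
      finally show ?thesis .
    qed
    show ?thesis
    proof (intro exI[of _ "max N1 N2"] allI impI)
      fix m n assume "max N1 N2 \<le> m" "max N1 N2 \<le> n"
      then show "(\<integral>\<^sup>+x. ennreal (norm (G m x - G n x) powr p) \<partial>M) \<le> ennreal \<epsilon>"
        using half[of n m] half[of m n] by (cases "n \<le> m") (auto simp: norm_minus_commute)
    qed
  qed
  show ?thesis by (rule that[OF G(1) main])
qed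

section \<open>Limits of C1 functions with bounded energy\<close>

lemma AE_summable_of_nn_integral_le:
  fixes f :: "nat \<Rightarrow> 'a \<Rightarrow> real"
  assumes [measurable]: "\<And>n. f n \<in> borel_measurable M" and f0: "\<And>n x. 0 \<le> f n x"
    and le: "\<And>n. (\<integral>\<^sup>+x. ennreal (f n x) \<partial>M) \<le> ennreal ((1/2)^n)"
  shows "AE x in M. summable (\<lambda>n. f n x)"
proof -
  have "(\<integral>\<^sup>+x. (\<Sum>n. ennreal (f n x)) \<partial>M) = (\<Sum>n. \<integral>\<^sup>+x. ennreal (f n x) \<partial>M)"
    by (rule nn_integral_suminf) auto
  also have "\<dots> \<le> (\<Sum>n. ennreal ((1/2)^n))" by (intro suminf_le le) auto
  also have "\<dots> = ennreal (\<Sum>n. (1/2)^n)" by (intro suminf_ennreal2) auto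
  also have "\<dots> < \<infinity>" by simp
  finally have "(\<integral>\<^sup>+x. (\<Sum>n. ennreal (f n x)) \<partial>M) \<noteq> \<infinity>" by simp
  then have "AE x in M. (\<Sum>n. ennreal (f n x)) \<noteq> \<infinity>"
    by (intro nn_integral_noteq_infinite) auto
  then show ?thesis
    by (rule AE_mp, intro AE_I2 impI summable_suminf_not_top) (use f0 in auto)
qed

text \<open>If t exceeds \<eta>, then t / \<eta> is at most its p-th power. With a suitable \<eta>
  this bounds L1 norms over sets of finite measure by Lp norms and takes the place of Hoelder's
  inequality.\<close>

lemma le_add_powr:
  fixes t \<eta> p :: real
  assumes "0 \<le> t" "0 < \<eta>" "1 < p"
  shows "t \<le> \<eta> + \<eta> powr (1 - p) * t powr p"
proof (cases "t \<le> \<eta>")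
  case False
  then have "1 \<le> t / \<eta>" using assms by simp
  then have "(t / \<eta>) powr 1 \<le> (t / \<eta>) powr p" using assms by (intro powr_mono) auto
  then have "t \<le> \<eta> * (t / \<eta>) powr p" using assms False by (simp add: pos_divide_le_eq mult.commute)
  also have "\<dots> = \<eta> powr (1 - p) * t powr p"
    using assms False by (simp add: powr_divide powr_diff)
  finally show ?thesis using assms by simp
qed (use assms in \<open>simp add: add_increasing2\<close>)

text \<open>\<open>Q n\<close> is a class of admissible functions, shrinking with n and stable under
  midpoints. The selected gradients are Cauchy in Lp; a subsequence is fast enough in L1 for the
  result on approximate differentiability of limits, which identifies the Lp limit of the gradients
  with the approximate gradient of \<open>w\<close>.\<close>

lemma C1_bounded_energy_limit:
  fixes w :: "real^'m::finite \<Rightarrow> 'h::{real_inner, banach, second_countable_topology}"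
  assumes p: "1 < p" and K: "0 \<le> K" and U: "open U" "emeasure lborel U < \<infinity>"
    and w: "w \<in> borel_measurable borel"
    and decseq: "\<And>m n v. n \<le> m \<Longrightarrow> Q m v \<Longrightarrow> Q n v"
    and midpoint: "\<And>n v v'. Q n v \<Longrightarrow> Q n v' \<Longrightarrow> Q n (\<lambda>x. (1/2) *\<^sub>R (v x + v' x))"
    and close: "\<And>n v. Q n v \<Longrightarrow> (\<integral>\<^sup>+x\<in>U. ennreal (norm (v x - w x) powr p) \<partial>lborel) \<le> ennreal ((1/2)^n)"
    and energy: "\<And>n. \<exists>v G. C1_grad v G \<and> Q n v \<and> (\<integral>\<^sup>+x\<in>U. ennreal (norm (G x) powr p) \<partial>lborel) \<le> ennreal K"
  obtains v G g where "\<And>n. C1_grad (v n) (G n)" "\<And>n. Q n (v n)" "g \<in> borel_measurable borel"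
    "\<And>\<epsilon>. 0 < \<epsilon> \<Longrightarrow> \<exists>N. \<forall>n\<ge>N. (\<integral>\<^sup>+x\<in>U. ennreal (norm (G n x - g x) powr p) \<partial>lborel) \<le> ennreal \<epsilon>"
    "AE a in lborel. a \<in> U \<longrightarrow>
      (\<forall>\<epsilon>>0. density_zero_at {x. norm (w x - w a - (\<Sum>i\<in>UNIV. (x - a) $ i *\<^sub>R g a $ i)) > \<epsilon> * norm (x - a)} a)"
proof -
  have [measurable]: "U \<in> sets borel" "w \<in> borel_measurable borel" using U w by auto
  define M where "M = restrict_space lborel U"
  have M: "(\<integral>\<^sup>+x. f x \<partial>M) = (\<integral>\<^sup>+x\<in>U. f x \<partial>lborel)" for f :: "_ \<Rightarrow> ennreal"
    unfolding M_def by (subst nn_integral_restrict_space) auto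
  define C where "C n = {G. \<exists>v. C1_grad v G \<and> Q n v}" for n
  have Cm: "G \<in> borel_measurable borel" if "G \<in> C n" for n G
    using that C1_grad_continuous(2) by (auto simp: C_def intro!: borel_measurable_continuous_onI)
  obtain G0 where G0: "\<And>n. G0 n \<in> C n"
    "\<And>\<epsilon>. 0 < \<epsilon> \<Longrightarrow> \<exists>N. \<forall>m\<ge>N. \<forall>n\<ge>N. (\<integral>\<^sup>+x. ennreal (norm (G0 m x - G0 n x) powr p) \<partial>M) \<le> ennreal \<epsilon>"
  proof (rule Cauchy_selection_of_midpoint_closed[OF p K, of C M])
    show "G \<in> borel_measurable M" if "G \<in> C n" for n G
      unfolding M_def using Cm[OF that] by (intro measurable_restrict_space1) auto
    show "C m \<subseteq> C n" if "n \<le> m" for m n using decseq[OF that] by (auto simp: C_def)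
    show "(\<lambda>x. (1/2) *\<^sub>R (G x + H x)) \<in> C n" if "G \<in> C n" "H \<in> C n" for n G H
      using that C1_grad_midpoint midpoint unfolding C_def by fast
    show "\<exists>G\<in>C n. (\<integral>\<^sup>+x. ennreal (norm (G x) powr p) \<partial>M) \<le> ennreal K" for n
      using energy[of n] unfolding M C_def by blast
  qed (use that in blast)
  define u where "u = measure lborel U"
  have u: "emeasure lborel U = ennreal u" "0 \<le> u"
    using U(2) by (simp_all add: u_def emeasure_eq_ennreal_measure)
  \<comment> \<open>By \<open>le_add_powr\<close> the L1 norm is at most \<eta> u + \<eta> powr (1 -
    p) \<delta>; each summand is made at most half of (1/4)^k.\<close>
  define \<eta> where "\<eta> k = (1/4)^k / (2 * (u + 1))" for k :: nat
  define \<delta> where "\<delta> k = \<eta> k powr (p - 1) * ((1/4)^k / 2)" for k :: nat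
  have \<eta>: "0 < \<eta> k" and \<delta>: "0 < \<delta> k" for k using u by (simp_all add: \<eta>_def \<delta>_def)
  have "\<exists>N. \<forall>k. \<forall>m\<ge>N k. \<forall>n\<ge>N k. (\<integral>\<^sup>+x. ennreal (norm (G0 m x - G0 n x) powr p) \<partial>M) \<le> ennreal (\<delta> k)"
    using G0(2)[OF \<delta>] by metis
  then obtain N where N: "\<And>k m n. N k \<le> m \<Longrightarrow> N k \<le> n \<Longrightarrow>
      (\<integral>\<^sup>+x. ennreal (norm (G0 m x - G0 n x) powr p) \<partial>M) \<le> ennreal (\<delta> k)"
    by blast
  \<comment> \<open>Adding up the thresholds makes \<open>r\<close> nondecreasing and at least as
    large as both k and \<open>N k\<close>, so members of the class with index \<open>r k\<close>
    belong to that with index k.\<close>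
  define r where "r k = k + (\<Sum>i\<le>k. N i)" for k
  have r1: "k \<le> r k" "N k \<le> r k" for k
    using member_le_sum[of k "{..k}" N] by (auto simp: r_def)
  have r2: "r k \<le> r (Suc k)" for k by (simp add: r_def)
  define G where "G k = G0 (r k)" for k
  have "\<exists>v. C1_grad v (G k) \<and> Q k v" for k
    using G0(1)[of "r k"] decseq[OF r1(1)] by (auto simp: C_def G_def)
  then obtain v where v: "\<And>k. C1_grad (v k) (G k)" "\<And>k. Q k (v k)" by metis
  have [measurable]: "G k \<in> borel_measurable borel" for k using Cm[OF G0(1)] by (simp add: G_def)
  have [measurable]: "v k \<in> borel_measurable borel" for k
    using C1_grad_continuous(1)[OF v(1)] by (intro borel_measurable_continuous_onI)
  have L1: "(\<integral>\<^sup>+x\<in>U. ennreal (norm (G (Suc k) x - G k x)) \<partial>lborel) \<le> ennreal ((1/4)^k)" for k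
  proof -
    have "(\<integral>\<^sup>+x\<in>U. ennreal (norm (G (Suc k) x - G k x)) \<partial>lborel)
      \<le> (\<integral>\<^sup>+x. ennreal (\<eta> k) * indicator U x + ennreal (\<eta> k powr (1 - p)) * (ennreal (norm (G (Suc k) x - G k x) powr p) * indicator U x) \<partial>lborel)"
    proof (intro nn_integral_mono)
      fix x
      have "ennreal (norm (G (Suc k) x - G k x)) \<le> ennreal (\<eta> k + \<eta> k powr (1 - p) * norm (G (Suc k) x - G k x) powr p)"
        using \<eta> p by (intro ennreal_leI le_add_powr) auto
      also have "\<dots> = ennreal (\<eta> k) + ennreal (\<eta> k powr (1 - p)) * ennreal (norm (G (Suc k) x - G k x) powr p)"
        using less_imp_le[OF \<eta>[of k]] by (subst ennreal_plus) (auto simp: ennreal_mult)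
      finally show "ennreal (norm (G (Suc k) x - G k x)) * indicator U x \<le> ennreal (\<eta> k) * indicator U x
          + ennreal (\<eta> k powr (1 - p)) * (ennreal (norm (G (Suc k) x - G k x) powr p) * indicator U x)"
        by (auto simp: indicator_def)
    qed
    also have "\<dots> = ennreal (\<eta> k) * ennreal u + ennreal (\<eta> k powr (1 - p)) *
        (\<integral>\<^sup>+x\<in>U. ennreal (norm (G (Suc k) x - G k x) powr p) \<partial>lborel)"
      by (subst nn_integral_add) (simp_all add: nn_integral_cmult u)
    also have "\<dots> \<le> ennreal (\<eta> k) * ennreal u + ennreal (\<eta> k powr (1 - p)) * ennreal (\<delta> k)"
      using N[of k "r (Suc k)" "r k"] r1(2)[of k] r2[of k]
      by (intro add_mono mult_left_mono order_refl) (auto simp: M[symmetric] G_def)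
    also have "\<dots> = ennreal (\<eta> k * u + \<eta> k powr (1 - p) * \<delta> k)"
      using less_imp_le[OF \<eta>[of k]] less_imp_le[OF \<delta>[of k]] u(2) by (simp add: ennreal_mult)
    also have "\<eta> k powr (1 - p) * \<delta> k = (1/4)^k / 2"
      using \<eta>[of k] by (simp add: \<delta>_def powr_add[symmetric])
    also have "\<eta> k * u \<le> (1/4)^k / 2"
    proof -
      have "\<eta> k * u = (1/4)^k / 2 * (u / (u + 1))" by (simp add: \<eta>_def)
      also have "\<dots> \<le> (1/4)^k / 2 * 1" using u(2) by (intro mult_left_mono) auto
      finally show ?thesis by simp
    qed
    finally show ?thesis by (simp add: ennreal_leI)
  qed
  have vw: "AE x in lborel. x \<in> U \<longrightarrow> (\<lambda>n. v n x) \<longlonglongrightarrow> w x"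
  proof -
    have "AE x in lborel. summable (\<lambda>n. norm (v n x - w x) powr p * indicator U x)"
    proof (rule AE_summable_of_nn_integral_le)
      fix n
      have "(\<integral>\<^sup>+x. ennreal (norm (v n x - w x) powr p * indicator U x) \<partial>lborel)
          = (\<integral>\<^sup>+x\<in>U. ennreal (norm (v n x - w x) powr p) \<partial>lborel)"
        by (intro nn_integral_cong) (auto simp: indicator_def)
      also have "\<dots> \<le> ennreal ((1/2)^n)" by (intro close v)
      finally show "(\<integral>\<^sup>+x. ennreal (norm (v n x - w x) powr p * indicator U x) \<partial>lborel) \<le> ennreal ((1/2)^n)" .
    qed auto
    then show ?thesis
    proof (rule AE_mp, intro AE_I2 impI)
      fix x assume s: "summable (\<lambda>n. norm (v n x - w x) powr p * indicator U x)" and x: "x \<in> U"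
      have "(\<lambda>n. norm (v n x - w x) powr p) \<longlonglongrightarrow> 0" using summable_LIMSEQ_zero[OF s] x by simp
      then have "(\<lambda>n. (norm (v n x - w x) powr p) powr (1 / p)) \<longlonglongrightarrow> 0 powr (1 / p)"
        using p by (intro tendsto_powr' tendsto_const) auto
      then have "(\<lambda>n. norm (v n x - w x)) \<longlonglongrightarrow> 0" using p by (simp add: powr_powr)
      then show "(\<lambda>n. v n x) \<longlonglongrightarrow> w x" by (simp add: tendsto_norm_zero_iff LIM_zero_iff)
    qed
  qed
  \<comment> \<open>\<open>lim\<close> yields a Borel map on the whole space, also where the
    sequence diverges.\<close>
  define g where "g a = lim (\<lambda>n. G n a)" for a
  have g[measurable]: "g \<in> borel_measurable borel"
    unfolding g_def by (rule borel_measurable_lim_metric) measurable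
  have D: "AE a in lborel. a \<in> U \<longrightarrow> (\<lambda>n. G n a) \<longlonglongrightarrow> g a \<and>
      (\<forall>\<epsilon>>0. density_zero_at {x. norm (w x - w a - (\<Sum>i\<in>UNIV. (x - a) $ i *\<^sub>R g a $ i)) > \<epsilon> * norm (x - a)} a)"
    using C1_limit_AE_approx_differentiable[OF v(1) w U(1) vw L1]
  proof (rule AE_mp, intro AE_I2 impI)
    fix a assume *: "a \<in> U \<longrightarrow> (\<exists>g. (\<lambda>n. G n a) \<longlonglongrightarrow> g \<and>
      (\<forall>\<epsilon>>0. density_zero_at {x. norm (w x - w a - (\<Sum>i\<in>UNIV. (x - a) $ i *\<^sub>R g $ i)) > \<epsilon> * norm (x - a)} a))"
      and a: "a \<in> U"
    then obtain g' where g': "(\<lambda>n. G n a) \<longlonglongrightarrow> g'"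
      "\<forall>\<epsilon>>0. density_zero_at {x. norm (w x - w a - (\<Sum>i\<in>UNIV. (x - a) $ i *\<^sub>R g' $ i)) > \<epsilon> * norm (x - a)} a"
      by blast
    have "g a = g'" unfolding g_def by (rule limI[OF g'(1)])
    with g' show "(\<lambda>n. G n a) \<longlonglongrightarrow> g a \<and>
      (\<forall>\<epsilon>>0. density_zero_at {x. norm (w x - w a - (\<Sum>i\<in>UNIV. (x - a) $ i *\<^sub>R g a $ i)) > \<epsilon> * norm (x - a)} a)"
      by simp
  qed
  have conv: "\<exists>N. \<forall>n\<ge>N. (\<integral>\<^sup>+x\<in>U. ennreal (norm (G n x - g x) powr p) \<partial>lborel) \<le> ennreal \<epsilon>" if "0 < \<epsilon>" for \<epsilon>
  proof -
    obtain N' where N': "\<And>m n. N' \<le> m \<Longrightarrow> N' \<le> n \<Longrightarrow>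
        (\<integral>\<^sup>+x. ennreal (norm (G0 m x - G0 n x) powr p) \<partial>M) \<le> ennreal \<epsilon>"
      using G0(2)[OF \<open>0 < \<epsilon>\<close>] by blast
    show ?thesis
    proof (intro exI[of _ N'] allI impI)
      fix n assume n: "N' \<le> n"
      have "(\<integral>\<^sup>+x\<in>U. ennreal (norm (G n x - g x) powr p) \<partial>lborel)
        \<le> (\<integral>\<^sup>+x. liminf (\<lambda>m. ennreal (norm (G n x - G m x) powr p) * indicator U x) \<partial>lborel)"
      proof (intro nn_integral_mono_AE, rule AE_mp[OF D], intro AE_I2 impI)
        fix x assume x: "x \<in> U \<longrightarrow> (\<lambda>n. G n x) \<longlonglongrightarrow> g x \<and>
          (\<forall>\<epsilon>>0. density_zero_at {y. norm (w y - w x - (\<Sum>i\<in>UNIV. (y - x) $ i *\<^sub>R g x $ i)) > \<epsilon> * norm (y - x)} x)"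
        show "ennreal (norm (G n x - g x) powr p) * indicator U x
          \<le> liminf (\<lambda>m. ennreal (norm (G n x - G m x) powr p) * indicator U x)"
        proof (cases "x \<in> U")
          case True
          then have "(\<lambda>m. G m x) \<longlonglongrightarrow> g x" using x by blast
          then have lm: "(\<lambda>m. ennreal (norm (G n x - G m x) powr p)) \<longlonglongrightarrow> ennreal (norm (G n x - g x) powr p)"
            using p by (intro tendsto_ennrealI tendsto_powr' tendsto_norm tendsto_diff tendsto_const) auto
          show ?thesis using True lim_imp_Liminf[OF trivial_limit_sequentially lm] by simp
        qed simp
      qed
      also have "\<dots> \<le> liminf (\<lambda>m. \<integral>\<^sup>+x\<in>U. ennreal (norm (G n x - G m x) powr p) \<partial>lborel)"
        by (intro nn_integral_liminf) auto
      also have "\<dots> \<le> ennreal \<epsilon>"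
      proof (intro Liminf_le eventually_sequentiallyI[of N'])
        fix m assume "N' \<le> m"
        then show "(\<integral>\<^sup>+x\<in>U. ennreal (norm (G n x - G m x) powr p) \<partial>lborel) \<le> ennreal \<epsilon>"
          using N'[of "r n" "r m"] n r1(1)[of n] r1(1)[of m] by (simp add: G_def M)
      qed simp
      finally show "(\<integral>\<^sup>+x\<in>U. ennreal (norm (G n x - g x) powr p) \<partial>lborel) \<le> ennreal \<epsilon>" .
    qed
  qed
  show ?thesis
    by (rule that[OF v g conv]) (use D in \<open>auto elim: AE_mp\<close>)
qed

section \<open>Jensen's inequality for powers\<close>

lemma powr_above_tangent:
  fixes s t p :: real
  assumes "0 < s" "0 \<le> t" "1 < p"
  shows "s powr p + p * s powr (p - 1) * (t - s) \<le> t powr p"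
proof (cases "t = 0")
  case True
  have "s powr p = s powr (p - 1) * s" using assms by (simp add: powr_diff)
  then have "s powr p + p * s powr (p - 1) * (t - s) = (1 - p) * s powr p"
    using True by (simp add: algebra_simps)
  then show ?thesis using assms True by (simp add: mult_nonpos_nonneg)
next
  case False
  have "p * s powr (p - 1) * (t - s) \<le> t powr p - s powr p"
  proof (rule convex_on_imp_above_tangent[of "{0<..}" "\<lambda>x. x powr p"])
    show "convex_on {0<..} (\<lambda>x. x powr p)" using assms by (intro powr_convex) auto
    show "((\<lambda>x. x powr p) has_real_derivative p * s powr (p - 1)) (at s within {0<..})"
      using assms(1) by (intro has_real_derivative_powr has_field_derivative_at_within)
  qed (use assms False in \<open>auto simp: interior_open\<close>)
  then show ?thesis by simp
qed

text \<open>The tangent inequality at the mean \<open>s\<close> is integrated; for s = 0 or an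
  infinite right-hand side there is nothing to prove.\<close>

lemma Jensen_powr:
  fixes f :: "'a \<Rightarrow> real"
  assumes "prob_space M" and f: "integrable M f" "\<And>x. 0 \<le> f x" and p: "1 < p"
  shows "ennreal ((\<integral>x. f x \<partial>M) powr p) \<le> (\<integral>\<^sup>+x. ennreal (f x powr p) \<partial>M)"
proof -
  interpret prob_space M by fact
  define s where "s = (\<integral>x. f x \<partial>M)"
  have s: "0 \<le> s" unfolding s_def using f by (intro integral_nonneg_AE) auto
  show ?thesis
  proof (cases "(\<integral>\<^sup>+x. ennreal (f x powr p) \<partial>M) = \<infinity> \<or> s = 0")
    case True
    then show ?thesis using p by (auto simp: s_def[symmetric])
  next
    case False
    then have s0: "0 < s" and fin: "(\<integral>\<^sup>+x. ennreal (f x powr p) \<partial>M) < \<infinity>" using s by (auto simp: less_top)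
    have ip: "integrable M (\<lambda>x. f x powr p)"
      using f(1) fin by (intro integrableI_nonneg) auto
    have "s powr p = (\<integral>x. s powr p + p * s powr (p - 1) * (f x - s) \<partial>M)"
      using f(1) by (simp add: s_def[symmetric] prob_space)
    also have "\<dots> \<le> (\<integral>x. f x powr p \<partial>M)"
      using f s0 p ip by (intro integral_mono powr_above_tangent) auto
    finally have "ennreal (s powr p) \<le> ennreal (\<integral>x. f x powr p \<partial>M)" by (rule ennreal_leI)
    also have "\<dots> = (\<integral>\<^sup>+x. ennreal (f x powr p) \<partial>M)"
      using ip by (intro nn_integral_eq_integral[symmetric]) auto
    finally show ?thesis by (simp add: s_def)
  qed
qed

section \<open>Mollification of Lipschitz maps\<close>

text \<open>A substitute for the norm of the gradient that needs only a metric on the values.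
  Increments 1 / (n + 1) instead of all small ones make it a countable upper limit of continuous
  functions, hence Borel. For Lipschitz maps the sum is finite, so \<open>enn2real\<close> loses
  nothing.\<close>

definition dir_lip :: "(real^'m::finite \<Rightarrow> 'b::metric_space) \<Rightarrow> real^'m \<Rightarrow> real" where
  "dir_lip F x = enn2real (\<Sum>i\<in>UNIV. limsup (\<lambda>n. ennreal (real (Suc n) * dist (F (x + axis i (1 / real (Suc n)))) (F x))))"

context
  fixes F :: "real^'m::finite \<Rightarrow> 'b::metric_space" and L :: real
  assumes F: "L-lipschitz_on UNIV F"
begin

lemma dir_quotient_le: "real (Suc n) * dist (F (x + axis i (1 / real (Suc n)))) (F x) \<le> L"
proof -
  have "dist (F (x + axis i (1 / real (Suc n)))) (F x) \<le> L * dist (x + axis i (1 / real (Suc n))) x"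
    using lipschitz_onD[OF F] by simp
  also have "dist (x + axis i (1 / real (Suc n))) x = 1 / real (Suc n)"
    by (simp add: dist_norm norm_eq_sqrt_inner inner_axis_axis real_sqrt_divide)
  finally show ?thesis by (simp add: field_simps)
qed

lemma limsup_dir_quotient_le:
  "limsup (\<lambda>n. ennreal (real (Suc n) * dist (F (x + axis i (1 / real (Suc n)))) (F x))) \<le> ennreal L"
  using dir_quotient_le by (intro Limsup_bounded always_eventually allI ennreal_leI) auto

lemma ennreal_dir_lip:
  "ennreal (dir_lip F x) = (\<Sum>i\<in>UNIV. limsup (\<lambda>n. ennreal (real (Suc n) * dist (F (x + axis i (1 / real (Suc n)))) (F x))))"
proof -
  have "(\<Sum>i\<in>UNIV. limsup (\<lambda>n. ennreal (real (Suc n) * dist (F (x + axis i (1 / real (Suc n)))) (F x)))) < top"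
    using le_less_trans[OF limsup_dir_quotient_le ennreal_less_top] by simp
  then show ?thesis unfolding dir_lip_def by (intro ennreal_enn2real) auto
qed

lemma dir_lip_nonneg: "0 \<le> dir_lip F x"
  by (simp add: dir_lip_def)

lemma dir_lip_le: "dir_lip F x \<le> real CARD('m) * L"
proof -
  have "ennreal (dir_lip F x) \<le> (\<Sum>i\<in>(UNIV :: 'm set). ennreal L)"
    unfolding ennreal_dir_lip by (intro sum_mono limsup_dir_quotient_le)
  also have "\<dots> = ennreal (real CARD('m) * L)"
    using lipschitz_on_nonneg[OF F] by (simp add: ennreal_mult ennreal_of_nat_eq_real_of_nat)
  finally show ?thesis using lipschitz_on_nonneg[OF F] by (simp add: ennreal_le_iff)
qed

lemma borel_measurable_dir_quotient:
  "(\<lambda>x. ennreal (real (Suc n) * dist (F (x + axis i (1 / real (Suc n)))) (F x))) \<in> borel_measurable borel"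
proof -
  have c: "continuous_on UNIV F" by (rule lipschitz_on_continuous_on[OF F])
  have "continuous_on UNIV (\<lambda>x. real (Suc n) * dist (F (x + axis i (1 / real (Suc n)))) (F x))"
    by (intro continuous_intros c continuous_on_compose2[OF c]) auto
  then have "(\<lambda>x. real (Suc n) * dist (F (x + axis i (1 / real (Suc n)))) (F x)) \<in> borel_measurable borel"
    by (rule borel_measurable_continuous_onI)
  then show ?thesis by (rule measurable_compose) simp
qed

lemma borel_measurable_dir_lip: "dir_lip F \<in> borel_measurable borel"
proof -
  note borel_measurable_dir_quotient[measurable]
  show ?thesis unfolding dir_lip_def[abs_def] by measurable
qed

end

section \<open>Convolution with a bump function\<close>

text \<open>The square makes the truncated paraboloid continuously differentiable; its gradient is
  \<open>dbump\<close>, which is Lipschitz and so gives a second order Taylor bound.\<close>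

definition bump :: "'a::real_inner \<Rightarrow> real" where
  "bump z = (max 0 (1 - z \<bullet> z))\<^sup>2"

definition dbump :: "'a::real_inner \<Rightarrow> 'a" where
  "dbump z = (- 4 * max 0 (1 - z \<bullet> z)) *\<^sub>R z"

lemma bump_eq_0: "1 \<le> norm z \<Longrightarrow> bump z = 0" and dbump_eq_0: "1 \<le> norm z \<Longrightarrow> dbump z = 0"
  by (auto simp: bump_def dbump_def dot_square_norm)

lemma bump_nonneg: "0 \<le> bump z"
  by (simp add: bump_def)

lemma continuous_on_bump: "continuous_on S bump" and continuous_on_dbump: "continuous_on S dbump"
  unfolding bump_def[abs_def] dbump_def[abs_def] by (intro continuous_intros)+

text \<open>The function max(0, 1 - t)^2 has derivative -2 max(0, 1 - t), which is Lipschitz with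
  constant 2; the remainder is therefore at most half of 2 (u - t)^2.\<close>

lemma square_positive_part_taylor:
  fixes t u :: real
  shows "\<bar>(max 0 (1 - u))\<^sup>2 - (max 0 (1 - t))\<^sup>2 + 2 * max 0 (1 - t) * (u - t)\<bar> \<le> (u - t)\<^sup>2"
proof -
  have A: "\<bar>2 * a * d - a\<^sup>2\<bar> \<le> d\<^sup>2" if "0 \<le> a" "a \<le> d" for a d :: real
  proof -
    have "0 \<le> (d - a)\<^sup>2" "a\<^sup>2 \<le> a * d" using that by (auto simp: power2_eq_square mult_left_mono)
    moreover have "(d - a)\<^sup>2 = d\<^sup>2 - 2 * a * d + a\<^sup>2" by (simp add: power2_eq_square algebra_simps)
    moreover have "0 \<le> d\<^sup>2" "0 \<le> a * d" using that by auto
    ultimately show ?thesis by (simp add: abs_le_iff)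
  qed
  consider "t \<le> 1" "u \<le> 1" | "t \<le> 1" "1 < u" | "1 < t" "u \<le> 1" | "1 < t" "1 < u" by linarith
  then show ?thesis
  proof cases
    case 1
    then have "(max 0 (1 - u))\<^sup>2 - (max 0 (1 - t))\<^sup>2 + 2 * max 0 (1 - t) * (u - t) = (u - t)\<^sup>2"
      by (simp add: max_def power2_eq_square algebra_simps)
    then show ?thesis by simp
  next
    case 2
    then show ?thesis using A[of "1 - t" "u - t"] by (simp add: max_def abs_minus_commute)
  next
    case 3
    then have "(1 - u)\<^sup>2 \<le> (t - u)\<^sup>2" by (intro power_mono) auto
    then show ?thesis using 3 by (simp add: max_def power2_commute)
  next
    case 4
    then show ?thesis by (simp add: max_def)
  qed
qed

text \<open>The one-dimensional bound is applied to squared norms. The constant is 27 = 25 + 2,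
  where 25 comes from |u - t| \<le> 5 |k| and 2 from the quadratic part |k|^2 of u - t. For |z| > 2
  both points lie outside the unit ball, where everything vanishes.\<close>

lemma bump_taylor:
  fixes z k :: "'a::real_inner"
  assumes k: "norm k \<le> 1"
  shows "\<bar>bump (z + k) - bump z - dbump z \<bullet> k\<bar> \<le> 27 * (norm k)\<^sup>2 * indicator (cball 0 2) z"
proof (cases "norm z \<le> 2")
  case True
  define t u where "t = z \<bullet> z" and "u = (z + k) \<bullet> (z + k)"
  define a where "a = max 0 (1 - t)"
  have a: "0 \<le> a" "a \<le> 1" by (auto simp: a_def t_def)
  have ut: "u - t = 2 * (z \<bullet> k) + (norm k)\<^sup>2"
    by (simp add: u_def t_def inner_simps inner_commute power2_norm_eq_inner)
  have kk: "(norm k)\<^sup>2 \<le> norm k" using k by (simp add: power2_eq_square mult_left_le)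
  have "\<bar>z \<bullet> k\<bar> \<le> 2 * norm k"
    using Cauchy_Schwarz_ineq2[of z k] True by (meson mult_right_mono norm_ge_zero order_trans)
  moreover have "\<bar>u - t\<bar> \<le> 2 * \<bar>z \<bullet> k\<bar> + (norm k)\<^sup>2"
    unfolding ut by (rule order_trans[OF abs_triangle_ineq]) (simp add: abs_mult)
  ultimately have "\<bar>u - t\<bar> \<le> 5 * norm k" using kk by linarith
  then have 1: "(u - t)\<^sup>2 \<le> 25 * (norm k)\<^sup>2"
    using power_mono[of "\<bar>u - t\<bar>" "5 * norm k" 2] by (simp add: power_mult_distrib)
  have "bump (z + k) - bump z - dbump z \<bullet> k
      = ((max 0 (1 - u))\<^sup>2 - a\<^sup>2 + 2 * a * (u - t)) - 2 * a * (norm k)\<^sup>2"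
    unfolding ut by (simp add: bump_def dbump_def a_def t_def u_def algebra_simps)
  also have "\<bar>\<dots>\<bar> \<le> (u - t)\<^sup>2 + 2 * a * (norm k)\<^sup>2"
    using square_positive_part_taylor[of u t] a(1) unfolding a_def[symmetric]
    by (intro order_trans[OF abs_triangle_ineq4] add_mono) auto
  also have "\<dots> \<le> 25 * (norm k)\<^sup>2 + 2 * 1 * (norm k)\<^sup>2"
    using 1 a by (intro add_mono mult_right_mono mult_left_mono) auto
  finally show ?thesis using True by simp
next
  case False
  then have "1 \<le> norm (z + k)" "1 \<le> norm z"
    using norm_diff_ineq[of z k] k by auto
  then show ?thesis using False by (simp add: bump_eq_0 dbump_eq_0)
qed

lemma has_derivative_of_quadratic_error:
  fixes f :: "'a::real_normed_vector \<Rightarrow> 'b::real_normed_vector"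
  assumes D: "bounded_linear D" and C: "\<And>h. norm h \<le> 1 \<Longrightarrow> norm (f (y + h) - f y - D h) \<le> C * (norm h)\<^sup>2"
  shows "(f has_derivative D) (at y)"
  unfolding has_derivative_at_alt
proof (intro conjI D allI impI)
  fix e :: real assume e: "0 < e"
  show "\<exists>d>0. \<forall>x. norm (x - y) < d \<longrightarrow> norm (f x - f y - D (x - y)) \<le> e * norm (x - y)"
  proof (intro exI[of _ "min 1 (e / (\<bar>C\<bar> + 1))"] conjI allI impI)
    fix x assume x: "norm (x - y) < min 1 (e / (\<bar>C\<bar> + 1))"
    then have "norm (x - y) * (\<bar>C\<bar> + 1) \<le> e" by (simp add: pos_less_divide_eq less_imp_le)
    then have "C * norm (x - y) \<le> e"
      using norm_ge_zero[of "x - y"] by (smt (verit) abs_ge_self mult.commute mult_left_mono)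
    then have "C * norm (x - y) * norm (x - y) \<le> e * norm (x - y)" by (rule mult_right_mono) simp
    then show "norm (f x - f y - D (x - y)) \<le> e * norm (x - y)"
      using C[of "x - y"] x by (simp add: power2_eq_square mult.assoc)
  qed (use e in auto)
qed

lemma integrable_of_compact_support:
  fixes f :: "'a::euclidean_space \<Rightarrow> 'b::{banach, second_countable_topology}"
  assumes "continuous_on UNIV f" "\<And>z. z \<notin> cball c R \<Longrightarrow> f z = 0"
  shows "integrable lborel f"
proof -
  have "integrable lborel (\<lambda>x. indicator (cball c R) x *\<^sub>R f x)"
    using assms(1) by (intro borel_integrable_compact) (auto intro: continuous_on_subset)
  moreover have "(\<lambda>x. indicator (cball c R) x *\<^sub>R f x) = f"
    using assms(2) by (auto simp: indicator_def fun_eq_iff)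
  ultimately show ?thesis by simp
qed

lemma lborel_integral_shift:
  fixes f :: "'a::euclidean_space \<Rightarrow> 'b::{banach, second_countable_topology}"
  assumes "f \<in> borel_measurable borel"
  shows "(\<integral>z. f (y + z) \<partial>lborel) = (\<integral>z. f z \<partial>lborel)"
  using integral_distr[of "(+) y" lborel borel f] assms by (simp add: lborel_distr_plus)

text \<open>After a shift of the integration variable \<open>y\<close> occurs only in the kernel
  bump(z - y), so the derivative falls on the bump, with a minus sign; the Taylor bound for the bump
  makes the error quadratic in h.\<close>

lemma C1_grad_bump_convolution:
  fixes w :: "real^'m::finite \<Rightarrow> 'h::{banach, second_countable_topology}"
  assumes w: "L-lipschitz_on UNIV w"
  shows "C1_grad (\<lambda>y. \<integral>z. bump z *\<^sub>R w (y + z) \<partial>lborel) (\<lambda>y. \<chi> i. \<integral>z. (- (dbump z $ i)) *\<^sub>R w (y + z) \<partial>lborel)"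
    (is "C1_grad ?W ?G")
  unfolding C1_grad_def
proof (intro conjI allI)
  have cw: "continuous_on UNIV w" by (rule lipschitz_on_continuous_on[OF w])
  have cb: "continuous_on UNIV (\<lambda>z. w (y + z))" "continuous_on UNIV (\<lambda>z. bump (z - y))"
    "continuous_on UNIV (\<lambda>z. dbump (z - y))" for y :: "real^'m"
    by (intro continuous_on_compose2[OF cw] continuous_on_compose2[OF continuous_on_bump[of UNIV]]
        continuous_on_compose2[OF continuous_on_dbump[of UNIV]] continuous_intros; simp)+
  have di: "continuous_on UNIV (\<lambda>z. dbump (z :: real^'m) $ i)" for i :: 'm
    by (intro continuous_intros continuous_on_dbump)
  have int1: "integrable lborel (\<lambda>z. (- (dbump z $ i)) *\<^sub>R w (y + z))" for y and i :: 'm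
    by (rule integrable_of_compact_support[of _ 0 1])
      (auto intro!: continuous_intros di cb simp: dbump_eq_0)
  have int2: "integrable lborel (\<lambda>z. dbump (z :: real^'m) $ i)" for i :: 'm
    by (rule integrable_of_compact_support[of _ 0 1]) (auto intro!: di simp: dbump_eq_0)
  have L: "0 \<le> L" by (rule lipschitz_on_nonneg[OF w])
  show "continuous_on UNIV ?G"
  proof (rule continuous_on_vec_lambda)
    fix i :: 'm
    define B where "B = (\<integral>z. norm (dbump (z :: real^'m) $ i) \<partial>lborel)"
    have "(B * L)-lipschitz_on UNIV (\<lambda>y. \<integral>z. (- (dbump z $ i)) *\<^sub>R w (y + z) \<partial>lborel)"
    proof (rule lipschitz_onI)
      fix x y :: "real^'m"
      have "dist (\<integral>z. (- (dbump z $ i)) *\<^sub>R w (x + z) \<partial>lborel) (\<integral>z. (- (dbump z $ i)) *\<^sub>R w (y + z) \<partial>lborel)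
          = norm (\<integral>z. (- (dbump z $ i)) *\<^sub>R (w (x + z) - w (y + z)) \<partial>lborel)"
        using int1[of i x] int1[of i y] by (simp add: dist_norm scaleR_diff_right del: scaleR_minus_left)
      also have "\<dots> \<le> (\<integral>z. norm (dbump (z :: real^'m) $ i) * (L * dist x y) \<partial>lborel)"
      proof (rule Bochner_Integration.integral_norm_bound_integral)
        show "integrable lborel (\<lambda>z. (- (dbump z $ i)) *\<^sub>R (w (x + z) - w (y + z)))"
          using Bochner_Integration.integrable_diff[OF int1[of i x] int1[of i y]]
          by (simp add: scaleR_diff_right del: scaleR_minus_left)
        show "integrable lborel (\<lambda>z. norm (dbump (z :: real^'m) $ i) * (L * dist x y))"
          using int2 by (intro integrable_mult_left integrable_norm) auto
        show "norm ((- (dbump z $ i)) *\<^sub>R (w (x + z) - w (y + z))) \<le> norm (dbump z $ i) * (L * dist x y)" for z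
          using lipschitz_onD[OF w, of "x + z" "y + z"] by (simp add: dist_norm mult_left_mono)
      qed
      also have "\<dots> = B * L * dist x y" by (simp add: B_def)
      finally show "dist (\<integral>z. (- (dbump z $ i)) *\<^sub>R w (x + z) \<partial>lborel) (\<integral>z. (- (dbump z $ i)) *\<^sub>R w (y + z) \<partial>lborel)
          \<le> B * L * dist x y" .
    qed (use L in \<open>auto simp: B_def\<close>)
    then show "continuous_on UNIV (\<lambda>y. \<integral>z. (- (dbump z $ i)) *\<^sub>R w (y + z) \<partial>lborel)"
      by (rule lipschitz_on_continuous_on)
  qed
  fix y :: "real^'m"
  have W: "?W x = (\<integral>z. bump (z - x) *\<^sub>R w z \<partial>lborel)" for x
  proof -
    have "(\<lambda>z. bump (z - x) *\<^sub>R w z) \<in> borel_measurable borel"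
      by (intro borel_measurable_continuous_onI continuous_intros cb(2) cw)
    from lborel_integral_shift[OF this, of x] show ?thesis by simp
  qed
  have G: "?G x $ i = (\<integral>z. (- (dbump (z - x) $ i)) *\<^sub>R w z \<partial>lborel)" for x i
  proof -
    have "(\<lambda>z. (- (dbump (z - x) $ i)) *\<^sub>R w z) \<in> borel_measurable borel"
      by (intro borel_measurable_continuous_onI continuous_intros cb(3) cw)
    from lborel_integral_shift[OF this, of x] show ?thesis by simp
  qed
  have int3: "integrable lborel (\<lambda>z. bump (z - x) *\<^sub>R w z)" for x
    by (rule integrable_of_compact_support[of _ x 1])
      (auto intro!: continuous_intros cb cw simp: bump_eq_0 dist_norm norm_minus_commute)
  have int4: "integrable lborel (\<lambda>z. (- (dbump (z - x) $ i)) *\<^sub>R w z)" for x i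
    by (rule integrable_of_compact_support[of _ x 1])
      (auto intro!: continuous_intros cb cw simp: dbump_eq_0 dist_norm norm_minus_commute)
  \<comment> \<open>The ball of radius 2 contains the supports of all the shifted kernels with |h|
    \<le> 1.\<close>
  define B where "B = (\<integral>z. indicator (cball y 2) z *\<^sub>R norm (w z) \<partial>lborel)"
  have int5: "integrable lborel (\<lambda>z. indicator (cball y 2) z *\<^sub>R norm (w z))"
    using cw by (intro borel_integrable_compact) (auto intro: continuous_on_subset continuous_intros)
  show "(?W has_derivative (\<lambda>h. \<Sum>i\<in>UNIV. h $ i *\<^sub>R ?G y $ i)) (at y)"
  proof (rule has_derivative_of_quadratic_error[where C = "27 * B"])
    show "bounded_linear (\<lambda>h. \<Sum>i\<in>UNIV. h $ i *\<^sub>R ?G y $ i)"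
      by (intro bounded_linear_sum bounded_linear_compose[OF bounded_linear_scaleR_left] bounded_linear_vec_nth)
    fix h :: "real^'m" assume h: "norm h \<le> 1"
    have dh: "dbump z \<bullet> h = (\<Sum>i\<in>UNIV. h $ i * dbump z $ i)" for z :: "real^'m"
      by (simp add: inner_vec_def mult.commute)
    have "?W (y + h) - ?W y - (\<Sum>i\<in>UNIV. h $ i *\<^sub>R ?G y $ i)
      = (\<integral>z. bump (z - (y + h)) *\<^sub>R w z \<partial>lborel) - (\<integral>z. bump (z - y) *\<^sub>R w z \<partial>lborel)
        - (\<Sum>i\<in>UNIV. \<integral>z. h $ i *\<^sub>R ((- (dbump (z - y) $ i)) *\<^sub>R w z) \<partial>lborel)"
      unfolding W G by (simp only: Bochner_Integration.integral_scaleR_right)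
    also have "\<dots> = (\<integral>z. bump (z - (y + h)) *\<^sub>R w z - bump (z - y) *\<^sub>R w z
        - (\<Sum>i\<in>UNIV. h $ i *\<^sub>R ((- (dbump (z - y) $ i)) *\<^sub>R w z)) \<partial>lborel)"
    proof -
      have i: "integrable lborel (\<lambda>z. \<Sum>i\<in>UNIV. h $ i *\<^sub>R ((- (dbump (z - y) $ i)) *\<^sub>R w z))"
        by (intro Bochner_Integration.integrable_sum integrable_scaleR_right int4)
      have s: "(\<Sum>i\<in>UNIV. \<integral>z. h $ i *\<^sub>R ((- (dbump (z - y) $ i)) *\<^sub>R w z) \<partial>lborel)
          = (\<integral>z. (\<Sum>i\<in>UNIV. h $ i *\<^sub>R ((- (dbump (z - y) $ i)) *\<^sub>R w z)) \<partial>lborel)"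
        by (intro Bochner_Integration.integral_sum[symmetric] integrable_scaleR_right int4)
      show ?thesis
        unfolding s
        by (subst Bochner_Integration.integral_diff[OF int3 int3, symmetric],
            subst Bochner_Integration.integral_diff[OF Bochner_Integration.integrable_diff[OF int3 int3] i, symmetric])
           (rule refl)
    qed
    also have "\<dots> = (\<integral>z. (bump (z - y - h) - bump (z - y) - dbump (z - y) \<bullet> (- h)) *\<^sub>R w z \<partial>lborel)"
      by (intro Bochner_Integration.integral_cong refl)
        (simp add: dh scaleR_diff_left scaleR_add_left scaleR_sum_left sum_negf algebra_simps)
    finally have eq: "?W (y + h) - ?W y - (\<Sum>i\<in>UNIV. h $ i *\<^sub>R ?G y $ i)
      = (\<integral>z. (bump (z - y - h) - bump (z - y) - dbump (z - y) \<bullet> (- h)) *\<^sub>R w z \<partial>lborel)" .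
    have "norm (\<integral>z. (bump (z - y - h) - bump (z - y) - dbump (z - y) \<bullet> (- h)) *\<^sub>R w z \<partial>lborel)
      \<le> (\<integral>z. (27 * (norm h)\<^sup>2) *\<^sub>R (indicator (cball y 2) z *\<^sub>R norm (w z)) \<partial>lborel)"
    proof (rule Bochner_Integration.integral_norm_bound_integral)
      show "integrable lborel (\<lambda>z. (27 * (norm h)\<^sup>2) *\<^sub>R (indicator (cball y 2) z *\<^sub>R norm (w z)))"
        by (intro integrable_scaleR_right int5)
      fix z
      have "\<bar>bump (z - y + (- h)) - bump (z - y) - dbump (z - y) \<bullet> (- h)\<bar> \<le> 27 * (norm (- h))\<^sup>2 * indicator (cball 0 2) (z - y)"
        using h by (intro bump_taylor) simp
      also have "\<dots> = 27 * (norm h)\<^sup>2 * indicator (cball y 2) z"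
        by (simp add: indicator_def dist_norm norm_minus_commute)
      finally show "norm ((bump (z - y - h) - bump (z - y) - dbump (z - y) \<bullet> (- h)) *\<^sub>R w z)
          \<le> (27 * (norm h)\<^sup>2) *\<^sub>R (indicator (cball y 2) z *\<^sub>R norm (w z))"
        by (simp add: mult_right_mono mult.assoc[symmetric])
    next
      show "integrable lborel (\<lambda>z. (bump (z - y - h) - bump (z - y) - dbump (z - y) \<bullet> (- h)) *\<^sub>R w z)"
      proof (rule integrable_of_compact_support[of _ y 2])
        have "continuous_on UNIV (\<lambda>z. bump (z - y - h))"
          using cb(2)[of "y + h"] by (simp add: algebra_simps)
        then show "continuous_on UNIV (\<lambda>z. (bump (z - y - h) - bump (z - y) - dbump (z - y) \<bullet> (- h)) *\<^sub>R w z)"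
          by (intro continuous_on_scaleR continuous_on_diff continuous_on_inner continuous_on_const cb cw)
        fix z assume "z \<notin> cball y 2"
        then have "z - y \<notin> cball 0 2" by (simp add: dist_norm norm_minus_commute)
        then show "(bump (z - y - h) - bump (z - y) - dbump (z - y) \<bullet> (- h)) *\<^sub>R w z = 0"
          using bump_taylor[of "- h" "z - y"] h by simp
      qed
    qed
    also have "\<dots> = 27 * B * (norm h)\<^sup>2" by (simp add: B_def)
    finally show "norm (?W (y + h) - ?W y - (\<Sum>i\<in>UNIV. h $ i *\<^sub>R ?G y $ i)) \<le> 27 * B * (norm h)\<^sup>2"
      unfolding eq .
  qed
qed

lemma C1_grad_rescale:
  fixes W :: "real^'m::finite \<Rightarrow> 'h::real_normed_vector"
  assumes "C1_grad W G"
  shows "C1_grad (\<lambda>x. c *\<^sub>R W (b *\<^sub>R x)) (\<lambda>x. (c * b) *\<^sub>R G (b *\<^sub>R x))"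
  unfolding C1_grad_def
proof (intro conjI allI)
  show "continuous_on UNIV (\<lambda>x. (c * b) *\<^sub>R G (b *\<^sub>R x))"
    by (intro continuous_on_scaleR continuous_on_const continuous_on_id
        continuous_on_compose2[OF C1_grad_continuous(2)[OF assms]]) auto
  fix x :: "real^'m"
  have 1: "((\<lambda>x. b *\<^sub>R x) has_derivative (\<lambda>h. b *\<^sub>R h)) (at x)"
    by (auto intro!: derivative_eq_intros)
  have 2: "(W has_derivative (\<lambda>h. \<Sum>i\<in>UNIV. h $ i *\<^sub>R G (b *\<^sub>R x) $ i)) (at (b *\<^sub>R x))"
    using assms by (simp add: C1_grad_def)
  have "((\<lambda>x. c *\<^sub>R W (b *\<^sub>R x)) has_derivative
      (\<lambda>h. c *\<^sub>R (\<Sum>i\<in>UNIV. (b *\<^sub>R h) $ i *\<^sub>R G (b *\<^sub>R x) $ i))) (at x)"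
    by (intro has_derivative_scaleR_right has_derivative_compose[OF 1 2])
  then show "((\<lambda>x. c *\<^sub>R W (b *\<^sub>R x)) has_derivative
      (\<lambda>h. \<Sum>i\<in>UNIV. h $ i *\<^sub>R ((c * b) *\<^sub>R G (b *\<^sub>R x)) $ i)) (at x)"
    by (simp add: scaleR_sum_right mult_ac)
qed

lemma integral_bump_pos: "0 < (\<integral>z. bump (z :: real^'m::finite) \<partial>lborel)"
proof -
  have ib: "integrable lborel (bump :: real^'m \<Rightarrow> real)"
    by (rule integrable_of_compact_support[of _ 0 1]) (auto simp: bump_eq_0 continuous_on_bump)
  have "0 < measure lborel (cball (0 :: real^'m) (1/2))"
    using emeasure_cball_pos_finite[of "1/2" "0 :: real^'m"] by (simp add: measure_def enn2real_positive_iff less_top zero_less_iff_neq_zero)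
  then have "0 < (\<integral>z. (9/16 :: real) * indicator (cball (0 :: real^'m) (1/2)) z \<partial>lborel)"
    by simp
  also have "\<dots> \<le> (\<integral>z. bump (z :: real^'m) \<partial>lborel)"
  proof (rule integral_mono[OF _ ib])
    show "integrable lborel (\<lambda>z. (9/16 :: real) * indicator (cball (0 :: real^'m) (1/2)) z)"
      using emeasure_cball_pos_finite(2)[of "1/2" "0 :: real^'m"]
      by (intro integrable_mult_right integrable_real_indicator) auto
    fix z :: "real^'m"
    show "(9/16 :: real) * indicator (cball 0 (1/2)) z \<le> bump z"
    proof (cases "norm z \<le> 1/2")
      case True
      have "z \<bullet> z \<le> (1/2)\<^sup>2" unfolding power2_norm_eq_inner[symmetric] using True by (intro power_mono) auto
      then have "3/4 \<le> 1 - z \<bullet> z" by (simp add: power2_eq_square)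
      also have "\<dots> \<le> max 0 (1 - z \<bullet> z)" by (rule max.cobounded2)
      finally have "3/4 \<le> max 0 (1 - z \<bullet> z)" .
      then have "(3/4)\<^sup>2 \<le> bump z" unfolding bump_def by (rule power_mono) simp
      then show ?thesis using True by (simp add: power2_eq_square)
    qed (simp add: bump_nonneg)
  qed
  finally show ?thesis .
qed

text \<open>
  The average runs over the points \<open>(1 - s) x + s z\<close>, which stay in the unit ball together with \<open>x\<close>
  and \<open>z\<close>, so that the energy of \<open>w\<close> outside the ball does not enter.
\<close>

lemma mollification:
  fixes w :: "real^'m::finite \<Rightarrow> 'h::{real_inner, banach, second_countable_topology}"
  assumes w: "L-lipschitz_on UNIV w" and s: "0 < s" "s < 1" and p: "1 < p"
  obtains v G where "C1_grad v G" "\<And>x. x \<in> cball 0 1 \<Longrightarrow> norm (v x - w x) \<le> 2 * s * L"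
    "(\<integral>\<^sup>+x\<in>ball 0 1. ennreal (norm (G x) powr p) \<partial>lborel)
      \<le> ennreal (1 / (1 - s) ^ CARD('m)) * (\<integral>\<^sup>+x\<in>ball 0 1. ennreal (dir_lip w x powr p) \<partial>lborel)"
proof -
  define \<kappa> where "\<kappa> = (\<integral>z. bump (z :: real^'m) \<partial>lborel)"
  have \<kappa>: "0 < \<kappa>" unfolding \<kappa>_def by (rule integral_bump_pos)
  have [measurable]: "(bump :: real^'m \<Rightarrow> real) \<in> borel_measurable borel"
    by (intro borel_measurable_continuous_onI continuous_on_bump)
  define N where "N = density lborel (\<lambda>z :: real^'m. ennreal (bump z / \<kappa>))"
  have setsN[measurable_cong]: "sets N = sets borel" by (simp add: N_def)
  have spN: "space N = UNIV" by (simp add: N_def)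
  have L: "0 \<le> L" by (rule lipschitz_on_nonneg[OF w])
  have cw: "continuous_on UNIV w" by (rule lipschitz_on_continuous_on[OF w])
  have [measurable]: "w \<in> borel_measurable borel" by (intro borel_measurable_continuous_onI cw)
  note borel_measurable_dir_lip[OF w, measurable]
  have ib: "integrable lborel (bump :: real^'m \<Rightarrow> real)"
    by (rule integrable_of_compact_support[of _ 0 1]) (auto simp: bump_eq_0 continuous_on_bump)
  have intN: "integrable N f" "(\<integral>z. f z \<partial>N) = (1/\<kappa>) *\<^sub>R (\<integral>z. bump z *\<^sub>R f z \<partial>lborel)"
    if f: "continuous_on UNIV f" for f :: "real^'m \<Rightarrow> 'h"
  proof -
    have [measurable]: "f \<in> borel_measurable borel" by (intro borel_measurable_continuous_onI f)
    have i: "integrable lborel (\<lambda>z. bump z *\<^sub>R f z)"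
      by (rule integrable_of_compact_support[of _ 0 1])
        (auto intro!: continuous_intros f continuous_on_bump simp: bump_eq_0)
    have e: "(\<lambda>z. (bump z / \<kappa>) *\<^sub>R f z) = (\<lambda>z. (1/\<kappa>) *\<^sub>R (bump z *\<^sub>R f z))" by auto
    have i2: "integrable lborel (\<lambda>z. (bump z / \<kappa>) *\<^sub>R f z)"
      unfolding e by (rule integrable_scaleR_right) (rule i)
    have n: "AE z in lborel. 0 \<le> bump z / \<kappa>" using \<kappa> by (intro AE_I2 divide_nonneg_nonneg bump_nonneg) auto
    show "integrable N f"
      unfolding N_def by (subst integrable_density[OF _ _ n]) (use i2 in simp_all)
    have "(\<integral>z. f z \<partial>N) = (\<integral>z. (bump z / \<kappa>) *\<^sub>R f z \<partial>lborel)"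
      unfolding N_def by (subst integral_density[OF _ _ n]) simp_all
    then show "(\<integral>z. f z \<partial>N) = (1/\<kappa>) *\<^sub>R (\<integral>z. bump z *\<^sub>R f z \<partial>lborel)"
      unfolding e by (simp only: Bochner_Integration.integral_scaleR_right)
  qed
  have prob: "prob_space N"
  proof (rule prob_spaceI)
    have "emeasure N (space N) = (\<integral>\<^sup>+z. ennreal (bump (z :: real^'m) / \<kappa>) \<partial>lborel)"
      by (simp add: N_def emeasure_density)
    also have "\<dots> = ennreal (\<integral>z. bump (z :: real^'m) / \<kappa> \<partial>lborel)"
      using \<kappa> ib by (intro nn_integral_eq_integral) (auto simp: bump_nonneg)
    also have "\<dots> = 1" using \<kappa> by (simp add: \<kappa>_def[symmetric])
    finally show "emeasure N (space N) = 1" .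
  qed
  interpret prob_space N by fact
  have "norm z < 1" if "0 < bump z / \<kappa>" for z :: "real^'m"
    using that by (rule contrapos_pp) (simp add: not_less bump_eq_0)
  then have AEN: "AE z in N. norm z < 1"
    unfolding N_def by (subst AE_density) (auto intro!: AE_I2)
  define y where "y x z = (1 - s) *\<^sub>R x + s *\<^sub>R z" for x z :: "real^'m"
  define v where "v x = (\<integral>z. w (y x z) \<partial>N)" for x
  have cy: "continuous_on UNIV (\<lambda>z. w (y x z))" for x
    unfolding y_def by (intro continuous_on_compose2[OF cw] continuous_intros) auto
  have [measurable]: "(\<lambda>z. y x z) \<in> borel_measurable borel" for x unfolding y_def by measurable
  have "(L * s)-lipschitz_on UNIV (\<lambda>z. w (s *\<^sub>R z))"
  proof (rule lipschitz_onI)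
    fix a b
    have "dist (w (s *\<^sub>R a)) (w (s *\<^sub>R b)) \<le> L * dist (s *\<^sub>R a) (s *\<^sub>R b)" using lipschitz_onD[OF w] by simp
    moreover have "norm (s *\<^sub>R a - s *\<^sub>R b) = s * norm (a - b)"
      using s unfolding scaleR_diff_right[symmetric] by simp
    ultimately show "dist (w (s *\<^sub>R a)) (w (s *\<^sub>R b)) \<le> L * s * dist a b"
      by (simp add: dist_norm mult.assoc)
  qed (use L s in auto)
  \<comment> \<open>The average over the points \<open>y x z\<close> is the convolution of z -> w(s
    z) with the bump, evaluated at ((1 - s) / s) x.\<close>
  from C1_grad_rescale[OF C1_grad_bump_convolution[OF this], of "1/\<kappa>" "(1 - s)/s"]
  obtain G where "C1_grad (\<lambda>x. (1/\<kappa>) *\<^sub>R (\<integral>z. bump z *\<^sub>R w (s *\<^sub>R (((1 - s)/s) *\<^sub>R x + z)) \<partial>lborel)) G" by blast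
  also have "(\<lambda>x. (1/\<kappa>) *\<^sub>R (\<integral>z. bump z *\<^sub>R w (s *\<^sub>R (((1 - s)/s) *\<^sub>R x + z)) \<partial>lborel)) = v"
  proof
    fix x
    have "s *\<^sub>R (((1 - s)/s) *\<^sub>R x + z) = y x z" for z using s by (simp add: y_def scaleR_add_right)
    then show "(1/\<kappa>) *\<^sub>R (\<integral>z. bump z *\<^sub>R w (s *\<^sub>R (((1 - s)/s) *\<^sub>R x + z)) \<partial>lborel) = v x"
      unfolding v_def intN(2)[OF cy] by simp
  qed
  finally have vG: "C1_grad v G" .
  have v_diff: "ennreal (norm (v x - c)) \<le> (\<integral>\<^sup>+z. ennreal (norm (w (y x z) - c)) \<partial>N)" for x c
  proof -
    have "v x - c = (\<integral>z. w (y x z) - c \<partial>N)"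
      unfolding v_def by (subst Bochner_Integration.integral_diff[OF intN(1)[OF cy]]) (auto simp: prob_space)
    then show ?thesis
      using integral_norm_bound_ennreal[of N "\<lambda>z. w (y x z) - c"] intN(1)[OF cy]
      by (simp add: Bochner_Integration.integrable_diff)
  qed
  have v_diff2: "ennreal (norm (v x - v x')) \<le> (\<integral>\<^sup>+z. ennreal (norm (w (y x z) - w (y x' z))) \<partial>N)" for x x'
  proof -
    have "v x - v x' = (\<integral>z. w (y x z) - w (y x' z) \<partial>N)"
      unfolding v_def by (rule Bochner_Integration.integral_diff[OF intN(1)[OF cy] intN(1)[OF cy], symmetric])
    then show ?thesis
      using integral_norm_bound_ennreal[OF Bochner_Integration.integrable_diff[OF intN(1)[OF cy[of x]] intN(1)[OF cy[of x']]]]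
      by simp
  qed
  have close: "norm (v x - w x) \<le> 2 * s * L" if x: "x \<in> cball 0 1" for x
  proof -
    have "ennreal (norm (v x - w x)) \<le> (\<integral>\<^sup>+z. ennreal (norm (w (y x z) - w x)) \<partial>N)" by (rule v_diff)
    also have "\<dots> \<le> (\<integral>\<^sup>+z. ennreal (2 * s * L) \<partial>N)"
    proof (intro nn_integral_mono_AE, rule AE_mp[OF AEN], intro AE_I2 impI ennreal_leI)
      fix z :: "real^'m" assume z: "norm z < 1"
      have "norm (w (y x z) - w x) \<le> L * norm (y x z - x)"
        using lipschitz_onD[OF w, of "y x z" x] by (simp add: dist_norm)
      also have "y x z - x = s *\<^sub>R (z - x)" by (simp add: y_def algebra_simps)
      also have "norm \<dots> = s * norm (z - x)" using s by simp
      also have "L * (s * norm (z - x)) \<le> L * (s * 2)"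
        using L s x z norm_triangle_ineq4[of z x] by (intro mult_left_mono) auto
      finally show "norm (w (y x z) - w x) \<le> 2 * s * L" by (simp add: mult_ac)
    qed
    also have "\<dots> = ennreal (2 * s * L)" by (simp add: emeasure_space_1)
    finally show ?thesis using L s by (simp add: ennreal_le_iff)
  qed
  define q where "q i n x = ennreal (real (Suc n) * dist (w (x + axis i (1 / real (Suc n)))) (w x))" for i n x
  have q[measurable]: "q i n \<in> borel_measurable borel" for i n
    unfolding q_def by (rule borel_measurable_dir_quotient[OF w])
  have grad_i: "ennreal (norm (G x $ i)) \<le> (\<integral>\<^sup>+z. limsup (\<lambda>n. q i n (y x z)) \<partial>N)" for x i
  proof (rule ennreal_le_epsilon)
    fix e :: real assume e: "0 < e"
    \<comment> \<open>An increment of x by \<open>\<tau> n\<close> moves each point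
      \<open>y x z\<close> by exactly 1 / (n + 1), the increment that occurs in
      \<open>dir_lip\<close>.\<close>
    define \<tau> where "\<tau> n = 1 / (real (Suc n) * (1 - s))" for n
    have \<tau>: "0 < \<tau> n" for n using s by (simp add: \<tau>_def)
    have "(v has_derivative (\<lambda>h. \<Sum>i\<in>UNIV. h $ i *\<^sub>R G x $ i)) (at x)"
      using vG by (simp add: C1_grad_def)
    then have "\<exists>d>0. \<forall>z. norm (z - x) < d \<longrightarrow>
        norm (v z - v x - (\<Sum>i\<in>UNIV. (z - x) $ i *\<^sub>R G x $ i)) \<le> e * norm (z - x)"
      using e unfolding has_derivative_at_alt by (elim conjE allE[of _ e]) simp
    then obtain d where d: "0 < d" "\<And>z. norm (z - x) < d \<Longrightarrow>
        norm (v z - v x - (\<Sum>i\<in>UNIV. (z - x) $ i *\<^sub>R G x $ i)) \<le> e * norm (z - x)" by blast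
    have "\<tau> \<longlonglongrightarrow> 0"
    proof -
      have "(\<lambda>n. (1 / (1 - s)) * (1 / real (Suc n))) \<longlonglongrightarrow> (1 / (1 - s)) * 0"
        by (intro tendsto_mult tendsto_const LIMSEQ_Suc[OF lim_1_over_n])
      then show ?thesis by (simp add: \<tau>_def[abs_def] mult.commute)
    qed
    then have ev: "eventually (\<lambda>n. \<tau> n < d) sequentially" using d(1) by (rule order_tendstoD(2))
    have "eventually (\<lambda>n. ennreal (norm (G x $ i)) \<le> (\<integral>\<^sup>+z. q i n (y x z) \<partial>N) + ennreal e) sequentially"
      using ev
    proof (rule eventually_mono)
      fix n assume n: "\<tau> n < d"
      have na: "norm (axis i (\<tau> n) :: real^'m) = \<tau> n"
        using \<tau>[of n] by (simp add: norm_eq_sqrt_inner inner_axis_axis)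
      have sm: "(\<Sum>j\<in>UNIV. (axis i (\<tau> n) :: real^'m) $ j *\<^sub>R G x $ j) = \<tau> n *\<^sub>R G x $ i"
      proof -
        have "(\<Sum>j\<in>UNIV. (axis i (\<tau> n) :: real^'m) $ j *\<^sub>R G x $ j) = (\<Sum>j\<in>UNIV. if j = i then \<tau> n *\<^sub>R G x $ j else 0)"
          by (intro sum.cong) (auto simp: axis_def)
        then show ?thesis by simp
      qed
      have "norm (v (x + axis i (\<tau> n)) - v x - \<tau> n *\<^sub>R G x $ i) \<le> e * \<tau> n"
        using d(2)[of "x + axis i (\<tau> n)"] n by (simp add: na sm)
      then have "norm (\<tau> n *\<^sub>R G x $ i) \<le> norm (v (x + axis i (\<tau> n)) - v x) + e * \<tau> n"
        using norm_triangle_ineq2[of "\<tau> n *\<^sub>R G x $ i" "v (x + axis i (\<tau> n)) - v x"]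
        by (simp add: norm_minus_commute)
      then have "norm (G x $ i) \<le> 1 / \<tau> n * norm (v (x + axis i (\<tau> n)) - v x) + e"
        using \<tau>[of n] by (simp add: field_simps)
      then have "ennreal (norm (G x $ i)) \<le> ennreal (1 / \<tau> n * norm (v (x + axis i (\<tau> n)) - v x) + e)"
        by (rule ennreal_leI)
      also have "\<dots> = ennreal (1 / \<tau> n) * ennreal (norm (v (x + axis i (\<tau> n)) - v x)) + ennreal e"
      proof -
        have "0 \<le> 1 / \<tau> n" using \<tau>[of n] by simp
        then show ?thesis
          using e by (subst ennreal_mult[symmetric], simp, simp, subst ennreal_plus[symmetric])
            (simp_all only: mult_nonneg_nonneg norm_ge_zero less_imp_le)
      qed
      also have "\<dots> \<le> ennreal (1 / \<tau> n) * (\<integral>\<^sup>+z. ennreal (norm (w (y (x + axis i (\<tau> n)) z) - w (y x z))) \<partial>N) + ennreal e"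
        by (intro add_mono mult_left_mono v_diff2) auto
      also have "\<dots> = (\<integral>\<^sup>+z. ennreal (1 / \<tau> n) * ennreal (norm (w (y (x + axis i (\<tau> n)) z) - w (y x z))) \<partial>N) + ennreal e"
        by (subst nn_integral_cmult) auto
      also have "\<dots> \<le> (\<integral>\<^sup>+z. q i n (y x z) \<partial>N) + ennreal e"
      proof (intro add_mono nn_integral_mono order_refl)
        fix z
        have "y (x + axis i (\<tau> n)) z = y x z + axis i (1 / real (Suc n))"
          using s by (simp add: y_def scaleR_add_right vec_eq_iff axis_def \<tau>_def)
        moreover have "1 / \<tau> n \<le> real (Suc n)" using s by (simp add: \<tau>_def mult_left_le)
        ultimately have "1 / \<tau> n * norm (w (y (x + axis i (\<tau> n)) z) - w (y x z))
            \<le> real (Suc n) * dist (w (y x z + axis i (1 / real (Suc n)))) (w (y x z))"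
          unfolding dist_norm by (simp only:) (rule mult_right_mono, simp_all only: norm_ge_zero)
        then have "ennreal (1 / \<tau> n * norm (w (y (x + axis i (\<tau> n)) z) - w (y x z))) \<le> q i n (y x z)"
          unfolding q_def by (rule ennreal_leI)
        then show "ennreal (1 / \<tau> n) * ennreal (norm (w (y (x + axis i (\<tau> n)) z) - w (y x z))) \<le> q i n (y x z)"
          using \<tau>[of n] by (subst ennreal_mult[symmetric]) auto
      qed
      finally show "ennreal (norm (G x $ i)) \<le> (\<integral>\<^sup>+z. q i n (y x z) \<partial>N) + ennreal e" .
    qed
    then have "eventually (\<lambda>n. ennreal (norm (G x $ i)) - ennreal e \<le> (\<integral>\<^sup>+z. q i n (y x z) \<partial>N)) sequentially"
      by (rule eventually_mono) (simp add: ennreal_minus_le_iff add.commute)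
    then have "ennreal (norm (G x $ i)) - ennreal e \<le> limsup (\<lambda>n. \<integral>\<^sup>+z. q i n (y x z) \<partial>N)"
      by (intro le_Limsup) auto
    \<comment> \<open>Reverse Fatou; the Lipschitz constant is an integrable majorant on a
      probability space.\<close>
    also have "\<dots> \<le> (\<integral>\<^sup>+z. limsup (\<lambda>n. q i n (y x z)) \<partial>N)"
    proof (rule nn_integral_limsup[where w = "\<lambda>_. ennreal L"])
      show "AE z in N. q i n (y x z) \<le> ennreal L" for n
        unfolding q_def using dir_quotient_le[OF w] by (intro AE_I2 ennreal_leI)
    qed (auto simp: emeasure_space_1)
    finally show "ennreal (norm (G x $ i)) \<le> (\<integral>\<^sup>+z. limsup (\<lambda>n. q i n (y x z)) \<partial>N) + ennreal e"
      by (simp add: ennreal_minus_le_iff add.commute)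
  qed
  have dl: "ennreal (dir_lip w x) = (\<Sum>i\<in>UNIV. limsup (\<lambda>n. q i n x))" for x
    unfolding q_def by (rule ennreal_dir_lip[OF w])
  have dl0: "0 \<le> dir_lip w x" for x by (rule dir_lip_nonneg[OF w])
  have int_dl: "integrable N (\<lambda>z. dir_lip w (y x z))" for x
    using dir_lip_le[OF w] dl0 by (intro integrable_const_bound[where B = "real CARD('m) * L"]) auto
  have grad: "norm (G x) \<le> (\<integral>z. dir_lip w (y x z) \<partial>N)" for x
  proof -
    have "norm (G x) \<le> (\<Sum>i\<in>UNIV. norm (G x $ i))"
      unfolding norm_vec_def by (rule L2_set_le_sum) auto
    then have "ennreal (norm (G x)) \<le> ennreal (\<Sum>i\<in>UNIV. norm (G x $ i))" by (rule ennreal_leI)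
    also have "\<dots> = (\<Sum>i\<in>UNIV. ennreal (norm (G x $ i)))" by (simp add: sum_ennreal)
    also have "\<dots> \<le> (\<Sum>i\<in>UNIV. \<integral>\<^sup>+z. limsup (\<lambda>n. q i n (y x z)) \<partial>N)"
      by (intro sum_mono grad_i)
    also have "\<dots> = (\<integral>\<^sup>+z. ennreal (dir_lip w (y x z)) \<partial>N)"
      unfolding dl by (rule nn_integral_sum[symmetric]) measurable
    also have "\<dots> = ennreal (\<integral>z. dir_lip w (y x z) \<partial>N)"
      using int_dl dl0 by (intro nn_integral_eq_integral) auto
    finally show ?thesis using dl0 by (simp add: ennreal_le_iff integral_nonneg_AE)
  qed
  have Gp: "ennreal (norm (G x) powr p) \<le> (\<integral>\<^sup>+z. ennreal (dir_lip w (y x z) powr p) \<partial>N)" for x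
  proof -
    have "ennreal (norm (G x) powr p) \<le> ennreal ((\<integral>z. dir_lip w (y x z) \<partial>N) powr p)"
      using grad p by (intro ennreal_leI powr_mono2) auto
    also have "\<dots> \<le> (\<integral>\<^sup>+z. ennreal (dir_lip w (y x z) powr p) \<partial>N)"
      using int_dl dl0 p by (intro Jensen_powr prob) auto
    finally show ?thesis .
  qed
  define U where "U = ball (0 :: real^'m) 1"
  have [measurable]: "U \<in> sets borel" by (simp add: U_def)
  define E where "E = (\<integral>\<^sup>+x\<in>U. ennreal (dir_lip w x powr p) \<partial>lborel)"
  have energy: "(\<integral>\<^sup>+x\<in>U. ennreal (norm (G x) powr p) \<partial>lborel) \<le> ennreal (1 / (1 - s) ^ CARD('m)) * E"
  proof -
    have yp: "(\<lambda>(x, z). y x z) \<in> borel_measurable (lborel \<Otimes>\<^sub>M N)"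
      unfolding y_def by measurable
    have "(\<integral>\<^sup>+x\<in>U. ennreal (norm (G x) powr p) \<partial>lborel)
      \<le> (\<integral>\<^sup>+x. (\<integral>\<^sup>+z. ennreal (dir_lip w (y x z) powr p) * indicator U x \<partial>N) \<partial>lborel)"
      using Gp by (intro nn_integral_mono) (auto simp: indicator_def)
    also have "\<dots> = (\<integral>\<^sup>+z. (\<integral>\<^sup>+x. ennreal (dir_lip w (y x z) powr p) * indicator U x \<partial>lborel) \<partial>N)"
    proof -
      interpret pair_sigma_finite lborel N ..
      have [measurable]: "(\<lambda>x. y (fst x) (snd x)) \<in> borel_measurable (lborel \<Otimes>\<^sub>M N)"
        using yp by (simp add: case_prod_beta)
      have "(\<lambda>(x, z). ennreal (dir_lip w (y x z) powr p) * indicator U x) \<in> borel_measurable (lborel \<Otimes>\<^sub>M N)"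
        unfolding case_prod_beta by measurable
      then show ?thesis by (rule Fubini'[symmetric])
    qed
    also have "\<dots> \<le> (\<integral>\<^sup>+z. ennreal (1 / (1 - s) ^ CARD('m)) * E \<partial>N)"
    proof (intro nn_integral_mono_AE, rule AE_mp[OF AEN], intro AE_I2 impI)
      fix z :: "real^'m" assume z: "norm z < 1"
      have U: "y x z \<in> U" if "x \<in> U" for x
      proof -
        have "norm (y x z) \<le> (1 - s) * norm x + s * norm z"
          unfolding y_def using s by (intro order_trans[OF norm_triangle_ineq]) auto
        also have "\<dots> < (1 - s) * 1 + s * 1"
          using that z s by (intro add_strict_mono mult_strict_left_mono) (auto simp: U_def)
        finally show ?thesis by (simp add: U_def)
      qed
      have "(\<integral>\<^sup>+x. ennreal (dir_lip w (y x z) powr p) * indicator U x \<partial>lborel)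
        \<le> (\<integral>\<^sup>+x. ennreal (dir_lip w (s *\<^sub>R z + (1 - s) *\<^sub>R x) powr p) * indicator U (s *\<^sub>R z + (1 - s) *\<^sub>R x) \<partial>lborel)"
        using U by (intro nn_integral_mono) (auto simp: indicator_def y_def add.commute)
      \<comment> \<open>The factor is the inverse Jacobian of x -> s z + (1 - s) x.\<close>
      also have "\<dots> = ennreal (1 / (1 - s) ^ CARD('m)) * (ennreal ((1 - s) ^ CARD('m)) * \<dots>)"
        using s by (simp add: mult.assoc[symmetric] ennreal_mult'[symmetric])
      also have "\<dots> = ennreal (1 / (1 - s) ^ CARD('m)) * E"
        unfolding E_def using s by (subst (2) nn_integral_lborel_affine[of _ "1 - s" "s *\<^sub>R z"]) auto
      finally show "(\<integral>\<^sup>+x. ennreal (dir_lip w (y x z) powr p) * indicator U x \<partial>lborel)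
        \<le> ennreal (1 / (1 - s) ^ CARD('m)) * E" .
    qed
    also have "\<dots> = ennreal (1 / (1 - s) ^ CARD('m)) * E" by (simp add: emeasure_space_1)
    finally show ?thesis .
  qed
  show ?thesis
    by (rule that[OF vG close]) (use energy in \<open>simp_all add: U_def E_def\<close>)
qed

section \<open>The trace inequality\<close>

abbreviation annulus :: "(real^'m::finite) set" where
  "annulus \<equiv> {x. 1/2 < norm x \<and> norm x < 1}"

lemma annulus_in_sets_borel [measurable]: "annulus \<in> sets borel"
  by measurable

lemma borel_measurable_sgn_vec [measurable]: "(sgn :: real^'m::finite \<Rightarrow> real^'m) \<in> borel_measurable borel"
  unfolding sgn_div_norm[abs_def] by measurable

text \<open>Along the ray through \<omega> at least 1 / r disjoint balls of radius r / 8 fit into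
  the truncated cone over the cap, so its volume is at least of order r^(m - 1).\<close>

lemma cone_over_cap_ge:
  fixes \<omega> :: "real^'m::finite"
  assumes \<omega>: "norm \<omega> = 1" and r: "0 < r" "r \<le> 1/2"
  shows "ennreal (unit_ball_vol (real CARD('m)) / 8 ^ CARD('m) * r ^ (CARD('m) - 1))
    \<le> emeasure lborel (annulus \<inter> sgn -` cball \<omega> r)"
proof -
  \<comment> \<open>Consecutive centres are r / 4 apart, twice the radius; k r < 1 keeps them at
    norms between 5/8 and 7/8, so the balls, of radius at most 1/16, stay in the annulus.\<close>
  define c where "c k = (5/8 + real k * r / 4) *\<^sub>R \<omega>" for k :: nat
  define n where "n = nat \<lceil>1 / r\<rceil>"
  have n: "1 / r \<le> real n" "\<And>k. k < n \<Longrightarrow> real k < 1 / r"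
    using r by (auto simp: n_def) linarith+
  have sub: "ball (c k) (r/8) \<subseteq> annulus \<inter> sgn -` cball \<omega> r" if k: "k < n" for k
  proof
    fix x assume x: "x \<in> ball (c k) (r/8)"
    define t where "t = 5/8 + real k * r / 4"
    have "real k * r < 1" using n(2)[OF k] r by (simp add: field_simps)
    then have t: "5/8 \<le> t" "t < 7/8" using r by (auto simp: t_def mult.commute)
    have d: "norm (x - t *\<^sub>R \<omega>) < r/8" using x by (simp add: c_def t_def dist_norm norm_minus_commute)
    have nt: "norm (t *\<^sub>R \<omega>) = t" using \<omega> t by simp
    have dn: "\<bar>norm x - t\<bar> < r/8" using norm_triangle_ineq3[of x "t *\<^sub>R \<omega>"] d nt by linarith
    then have nx: "1/2 < norm x" "norm x < 1" using t r by linarith+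
    have "norm (x - norm x *\<^sub>R \<omega>) \<le> norm (x - t *\<^sub>R \<omega>) + norm ((t - norm x) *\<^sub>R \<omega>)"
      using norm_triangle_ineq[of "x - t *\<^sub>R \<omega>" "(t - norm x) *\<^sub>R \<omega>"] by (simp add: algebra_simps)
    also have "\<dots> \<le> r/4" using d dn \<omega> abs_minus_commute[of t "norm x"] by simp
    finally have "norm (x - norm x *\<^sub>R \<omega>) \<le> r/4" .
    moreover have "norm x \<noteq> 0" using nx by linarith
    then have "x - norm x *\<^sub>R \<omega> = norm x *\<^sub>R (sgn x - \<omega>)"
      by (simp add: sgn_div_norm scaleR_diff_right)
    ultimately have "norm x * norm (sgn x - \<omega>) \<le> r/4" by simp
    moreover have "1/2 * norm (sgn x - \<omega>) \<le> norm x * norm (sgn x - \<omega>)"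
      using nx by (intro mult_right_mono) auto
    ultimately have "norm (sgn x - \<omega>) \<le> r" using r by linarith
    then show "x \<in> annulus \<inter> sgn -` cball \<omega> r"
      using nx by (simp add: dist_norm norm_minus_commute)
  qed
  have disj: "disjoint_family_on (\<lambda>k. ball (c k) (r/8)) {..<n}"
    unfolding disjoint_family_on_def
  proof (intro ballI impI)
    fix j k :: nat assume "j \<noteq> k"
    then have "1 \<le> \<bar>real j - real k\<bar>" by linarith
    then have "r / 4 * 1 \<le> r / 4 * \<bar>real j - real k\<bar>" using r by (intro mult_left_mono) auto
    also have "\<dots> = dist (c j) (c k)"
    proof -
      have "c j - c k = (r / 4 * (real j - real k)) *\<^sub>R \<omega>"
        unfolding c_def scaleR_diff_left[symmetric]
        by (rule arg_cong[where f = "\<lambda>t. t *\<^sub>R \<omega>"]) (simp add: field_simps)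
      then show ?thesis using \<omega> r by (simp add: dist_norm abs_mult)
    qed
    finally have "r / 8 + r / 8 \<le> dist (c j) (c k)" by simp
    then show "ball (c j) (r/8) \<inter> ball (c k) (r/8) = {}"
      using disjoint_ballI by blast
  qed
  define \<beta> where "\<beta> = unit_ball_vol (real CARD('m))"
  have \<beta>: "0 < \<beta>" by (simp add: \<beta>_def)
  have "\<beta> / 8 ^ CARD('m) * r ^ (CARD('m) - 1) = 1 / r * (\<beta> * (r / 8) ^ CARD('m))"
    using r by (subst power_eq_if[of "r / 8"]) (simp add: power_divide power_eq_if[of 8])
  also have "\<dots> \<le> real n * (\<beta> * (r / 8) ^ CARD('m))"
    using n(1) \<beta> r by (intro mult_right_mono) auto
  finally have "ennreal (\<beta> / 8 ^ CARD('m) * r ^ (CARD('m) - 1)) \<le> ennreal (real n * (\<beta> * (r / 8) ^ CARD('m)))"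
    by (rule ennreal_leI)
  also have "\<dots> = (\<Sum>k<n. emeasure lborel (ball (c k) (r/8)))"
    using \<beta> r by (simp add: emeasure_ball ennreal_mult \<beta>_def ennreal_of_nat_eq_real_of_nat)
  also have "\<dots> = emeasure lborel (\<Union>k<n. ball (c k) (r/8))"
    using disj by (intro sum_emeasure) auto
  also have "\<dots> \<le> emeasure lborel (annulus \<inter> sgn -` cball \<omega> r)"
  proof (rule emeasure_mono)
    show "annulus \<inter> sgn -` cball \<omega> r \<in> sets lborel"
      using measurable_sets[OF borel_measurable_sgn_vec, of "cball \<omega> r"] by auto
  qed (use sub in blast)
  finally show ?thesis by (simp add: \<beta>_def)
qed

text \<open>The volume of the truncated cone over a set, which on the sphere is the surface measure
  up to a constant. Bounding the Hausdorff measure by it replaces integration in polar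
  coordinates.\<close>

definition cone_measure :: "(real^'m::finite) measure" where
  "cone_measure = distr (density lborel (indicator annulus)) borel sgn"

lemma sets_cone_measure [simp, measurable_cong]: "sets cone_measure = sets borel"
  and space_cone_measure [simp]: "space cone_measure = UNIV"
  by (simp_all add: cone_measure_def)

lemma emeasure_cone_measure:
  "S \<in> sets borel \<Longrightarrow> emeasure cone_measure S = emeasure lborel (annulus \<inter> sgn -` S)"
  unfolding cone_measure_def
  using measurable_sets[OF borel_measurable_sgn_vec, of S]
  by (subst emeasure_distr) (auto simp: emeasure_density nn_integral_indicator indicator_inter_arith[symmetric])

lemma nn_integral_cone_measure:
  assumes [measurable]: "h \<in> borel_measurable borel"
  shows "(\<integral>\<^sup>+x. h x \<partial>cone_measure) = (\<integral>\<^sup>+x\<in>annulus. h (sgn x) \<partial>lborel)"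
  unfolding cone_measure_def
  by (subst nn_integral_distr) (simp_all add: nn_integral_density mult.commute)

text \<open>
  Cover \<open>S\<close> by balls centred on the sphere that are contained in an open set of almost minimal cone
  measure; disjointness of the balls provided by Vitali's lemma bounds the sum of their gauges.
\<close>

lemma hausdorff_outer_le_cone_measure_open:
  fixes S V :: "(real^'m::finite) set"
  assumes S: "S \<subseteq> sphere 0 1" and V: "open V" "S \<subseteq> V"
  shows "hausdorff_outer (CARD('m) - 1) S
    \<le> ennreal (unit_ball_vol (real (CARD('m) - 1)) * 5 ^ (CARD('m) - 1) * 8 ^ CARD('m) / unit_ball_vol (real CARD('m)))
      * emeasure cone_measure V"
  unfolding hausdorff_outer_def
proof (rule SUP_least)
  fix \<delta> :: real assume "\<delta> \<in> {0<..}"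
  then have \<delta>: "0 < \<delta>" by simp
  define d where "d = CARD('m) - 1"
  define \<alpha> where "\<alpha> = unit_ball_vol (real d)"
  define \<beta> where "\<beta> = unit_ball_vol (real CARD('m))"
  have \<alpha>\<beta>: "0 < \<alpha>" "0 < \<beta>" by (simp_all add: \<alpha>_def \<beta>_def)
  \<comment> \<open>10 r is the diameter of the enlarged ball, which must not exceed \<delta> in an
    admissible covering.\<close>
  define K where "K = {(x, r). x \<in> S \<and> 0 < r \<and> r \<le> 1/2 \<and> 10 * r \<le> \<delta> \<and> cball x r \<subseteq> V}"
  have cov: "S \<subseteq> (\<Union>i\<in>K. cball (fst i) (snd i))"
  proof
    fix x assume x: "x \<in> S"
    then obtain e where e: "0 < e" "cball x e \<subseteq> V" using V open_contains_cball by blast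
    define r where "r = min e (min (1/2) (\<delta>/10))"
    have "(x, r) \<in> K" using x e \<delta> by (auto simp: K_def r_def)
    then show "x \<in> (\<Union>i\<in>K. cball (fst i) (snd i))"
      by (intro UN_I[of "(x, r)"]) (auto simp: K_def)
  qed
  obtain I :: "nat set" and f where f: "\<And>n. n \<in> I \<Longrightarrow> f n \<in> K"
    "disjoint_family_on (\<lambda>n. cball (fst (f n)) (snd (f n))) I"
    "S \<subseteq> (\<Union>n\<in>I. cball (fst (f n)) (5 * snd (f n)))"
    by (rule Vitali_covering_lemma_sequence[OF cov, of 1]) (auto simp: K_def)
  define X where "X n = (if n \<in> I then cball (fst (f n)) (snd (f n)) else {})" for n
  define Y where "Y n = (if n \<in> I then cball (fst (f n)) (5 * snd (f n)) else {})" for n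
  have XY: "hausdorff_gauge d (Y n) \<le> ennreal (\<alpha> * 5 ^ d * 8 ^ CARD('m) / \<beta>) * emeasure cone_measure (X n)" for n
  proof (cases "n \<in> I")
    case True
    define x r where "x = fst (f n)" and "r = snd (f n)"
    have xr: "x \<in> S" "0 < r" "r \<le> 1/2" using f(1)[OF True] by (auto simp: K_def x_def r_def)
    then have nx: "norm x = 1" using S by auto
    have "hausdorff_gauge d (Y n) = ennreal (\<alpha> * (5 * r) ^ d)"
      using True xr by (simp add: hausdorff_gauge_def Y_def x_def r_def \<alpha>_def)
    \<comment> \<open>5^d comes from the Vitali enlargement and 8^m / \<beta> from the lower bound
      for cones over caps.\<close>
    also have "\<dots> = ennreal (\<alpha> * 5 ^ d * 8 ^ CARD('m) / \<beta>) * ennreal (\<beta> / 8 ^ CARD('m) * r ^ d)"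
      using \<alpha>\<beta> xr by (subst ennreal_mult'[symmetric]) (auto simp: power_mult_distrib)
    also have "\<dots> \<le> ennreal (\<alpha> * 5 ^ d * 8 ^ CARD('m) / \<beta>) * emeasure cone_measure (X n)"
      using cone_over_cap_ge[OF nx xr(2,3)] True
      by (intro mult_left_mono) (auto simp: \<beta>_def d_def emeasure_cone_measure X_def x_def r_def)
    finally show ?thesis .
  qed (simp add: X_def Y_def)
  have "Y \<in> hausdorff_covers \<delta> S"
    unfolding hausdorff_covers_def
  proof (intro CollectI conjI allI)
    show "S \<subseteq> (\<Union>i. Y i)" using f(3) by (force simp: Y_def)
    fix i
    have "\<delta> \<ge> 10 * snd (f i)" "0 < snd (f i)" if "i \<in> I" using f(1)[OF that] by (auto simp: K_def)
    then show "bounded (Y i)" "diameter (Y i) \<le> \<delta>" using \<delta> by (auto simp: Y_def)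
  qed
  then have "hausdorff_premeasure d \<delta> S \<le> (\<Sum>n. hausdorff_gauge d (Y n))"
    unfolding hausdorff_premeasure_def by (rule INF_lower)
  also have "\<dots> \<le> (\<Sum>n. ennreal (\<alpha> * 5 ^ d * 8 ^ CARD('m) / \<beta>) * emeasure cone_measure (X n))"
    by (intro suminf_le XY) auto
  also have "\<dots> = ennreal (\<alpha> * 5 ^ d * 8 ^ CARD('m) / \<beta>) * (\<Sum>n. emeasure cone_measure (X n))" by simp
  also have "(\<Sum>n. emeasure cone_measure (X n)) = emeasure cone_measure (\<Union>n. X n)"
    using f(2) by (intro suminf_emeasure) (auto simp: X_def disjoint_family_on_def)
  also have "\<dots> \<le> emeasure cone_measure V"
  proof (rule emeasure_mono)
    have "X n \<subseteq> V" for n using f(1)[of n] by (cases "f n") (simp add: X_def K_def)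
    then show "(\<Union>n. X n) \<subseteq> V" by blast
  qed (use V in simp)
  finally show "hausdorff_premeasure (CARD('m) - 1) \<delta> S
    \<le> ennreal (unit_ball_vol (real (CARD('m) - 1)) * 5 ^ (CARD('m) - 1) * 8 ^ CARD('m) / unit_ball_vol (real CARD('m)))
      * emeasure cone_measure V"
    by (simp add: d_def \<alpha>_def \<beta>_def mult_left_mono)
qed

lemma finite_cone_measure: "emeasure cone_measure (UNIV :: (real^'m::finite) set) < \<infinity>"
proof -
  have "emeasure cone_measure (UNIV :: (real^'m) set) \<le> emeasure lborel (ball (0 :: real^'m) 1)"
    by (subst emeasure_cone_measure) (auto intro!: emeasure_mono)
  also have "\<dots> < \<infinity>" by (rule emeasure_lborel_ball_finite)
  finally show ?thesis .
qed

text \<open>Outer regularity of the finite measure \<open>cone_measure\<close> passes from open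
  neighbourhoods to the set itself.\<close>

lemma emeasure_hausdorff_sphere_le:
  obtains C :: real where "0 < C" "\<And>S :: (real^'m::finite) set. S \<in> sets borel \<Longrightarrow> S \<subseteq> sphere 0 1 \<Longrightarrow>
    emeasure (hausdorff_measure (CARD('m) - 1)) S \<le> ennreal C * emeasure cone_measure S"
proof -
  define C where "C = unit_ball_vol (real (CARD('m) - 1)) * 5 ^ (CARD('m) - 1) * 8 ^ CARD('m) / unit_ball_vol (real CARD('m))"
  have C: "0 < C" by (simp add: C_def)
  show ?thesis
  proof (rule that[OF C])
    fix S :: "(real^'m) set" assume S: "S \<in> sets borel" "S \<subseteq> sphere 0 1"
    have "ennreal (1 / C) * hausdorff_outer (CARD('m) - 1) S \<le> (INF V\<in>{V. S \<subseteq> V \<and> open V}. emeasure cone_measure V)"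
    proof (rule INF_greatest)
      fix V assume "V \<in> {V. S \<subseteq> V \<and> open V}"
      then have "ennreal (1 / C) * hausdorff_outer (CARD('m) - 1) S \<le> ennreal (1 / C) * (ennreal C * emeasure cone_measure V)"
        using S unfolding C_def by (intro mult_left_mono hausdorff_outer_le_cone_measure_open) auto
      also have "\<dots> = emeasure cone_measure V"
        using C by (simp add: mult.assoc[symmetric] ennreal_mult'[symmetric])
      finally show "ennreal (1 / C) * hausdorff_outer (CARD('m) - 1) S \<le> emeasure cone_measure V" .
    qed
    also have "\<dots> = emeasure cone_measure S"
      using finite_cone_measure[where 'm = 'm] S(1) by (intro outer_regular[symmetric]) auto
    finally have "ennreal C * (ennreal (1 / C) * hausdorff_outer (CARD('m) - 1) S) \<le> ennreal C * emeasure cone_measure S"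
      by (rule mult_left_mono) simp
    then show "emeasure (hausdorff_measure (CARD('m) - 1)) S \<le> ennreal C * emeasure cone_measure S"
      using C S(1) by (simp add: mult.assoc[symmetric] ennreal_mult'[symmetric] emeasure_hausdorff_measure)
  qed
qed

text \<open>Both sides are additive, positively homogeneous and continuous along increasing
  sequences in f, so the inequality extends from indicator functions.\<close>

lemma nn_integral_le_of_emeasure_le:
  assumes "sets M = sets N" and le: "\<And>S. S \<in> sets N \<Longrightarrow> emeasure M S \<le> c * emeasure N S"
    and f: "f \<in> borel_measurable N"
  shows "(\<integral>\<^sup>+x. f x \<partial>M) \<le> c * (\<integral>\<^sup>+x. f x \<partial>N)"
  using f
proof induction
  case (cong f g)
  then show ?case
    using sets_eq_imp_space_eq[OF assms(1)] nn_integral_cong[of M f g] nn_integral_cong[of N f g] by simp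
next
  case (set A)
  then show ?case using le assms(1) by simp
next
  case (mult u a)
  have [measurable]: "u \<in> borel_measurable M" using mult(2) assms(1) by (simp cong: measurable_cong_sets)
  show ?case using mult by (simp add: nn_integral_cmult mult.left_commute mult_left_mono)
next
  case (add u v)
  have [measurable]: "u \<in> borel_measurable M" "v \<in> borel_measurable M"
    using add assms(1) by (simp_all cong: measurable_cong_sets)
  show ?case using add by (simp add: nn_integral_add distrib_left add_mono)
next
  case (seq U)
  have [measurable]: "U i \<in> borel_measurable M" for i
    using seq(1) assms(1) by (simp cong: measurable_cong_sets)
  have "(\<integral>\<^sup>+x. (SUP i. U i) x \<partial>M) = (SUP i. \<integral>\<^sup>+x. U i x \<partial>M)"
    using seq by (simp add: nn_integral_monotone_convergence_SUP image_comp)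
  also have "\<dots> \<le> c * (\<integral>\<^sup>+x. (SUP i. U i) x \<partial>N)"
  proof (rule SUP_least)
    fix i
    have "(\<integral>\<^sup>+x. U i x \<partial>M) \<le> c * (\<integral>\<^sup>+x. U i x \<partial>N)" using seq by simp
    also have "\<dots> \<le> c * (\<integral>\<^sup>+x. (SUP i. U i) x \<partial>N)"
      by (intro mult_left_mono nn_integral_mono le_funD[OF SUP_upper]) auto
    finally show "(\<integral>\<^sup>+x. U i x \<partial>M) \<le> c * (\<integral>\<^sup>+x. (SUP i. U i) x \<partial>N)" .
  qed
  finally show ?case .
qed

lemma nn_integral_hausdorff_sphere_le:
  obtains C :: real where "0 < C" "\<And>h :: real^'m::finite \<Rightarrow> ennreal. h \<in> borel_measurable borel \<Longrightarrow>
    (\<integral>\<^sup>+x\<in>sphere 0 1. h x \<partial>hausdorff_measure (CARD('m) - 1)) \<le> ennreal C * (\<integral>\<^sup>+x\<in>annulus. h (sgn x) \<partial>lborel)"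
proof -
  let ?H = "hausdorff_measure (CARD('m) - 1) :: (real^'m) measure"
  obtain C where C: "0 < C" "\<And>S :: (real^'m) set. S \<in> sets borel \<Longrightarrow> S \<subseteq> sphere 0 1 \<Longrightarrow>
    emeasure ?H S \<le> ennreal C * emeasure cone_measure S"
    by (rule emeasure_hausdorff_sphere_le) blast
  show ?thesis
  proof (rule that[OF C(1)])
    fix h :: "real^'m \<Rightarrow> ennreal" assume [measurable]: "h \<in> borel_measurable borel"
    have sp: "sphere (0 :: real^'m) 1 \<in> sets borel" by simp
    have ind: "(indicator (sphere 0 1) :: real^'m \<Rightarrow> ennreal) \<in> borel_measurable ?H"
      using sp by (intro borel_measurable_indicator) simp
    have "(\<integral>\<^sup>+x\<in>sphere 0 1. h x \<partial>?H) = (\<integral>\<^sup>+x. h x \<partial>density ?H (indicator (sphere 0 1)))"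
      by (subst nn_integral_density[OF ind]) (auto simp: mult.commute)
    also have "\<dots> \<le> ennreal C * (\<integral>\<^sup>+x. h x \<partial>cone_measure)"
    proof (rule nn_integral_le_of_emeasure_le)
      fix S :: "(real^'m) set" assume "S \<in> sets cone_measure"
      then have S: "S \<in> sets borel" by simp
      have "emeasure (density ?H (indicator (sphere 0 1))) S = emeasure ?H (sphere 0 1 \<inter> S)"
        using S sp by (subst emeasure_density[OF ind]) (auto simp: indicator_inter_arith[symmetric])
      also have "\<dots> \<le> ennreal C * emeasure cone_measure (sphere 0 1 \<inter> S)"
        using S sp by (intro C(2)) auto
      also have "\<dots> \<le> ennreal C * emeasure cone_measure S"
        using S by (intro mult_left_mono emeasure_mono) auto
      finally show "emeasure (density ?H (indicator (sphere 0 1))) S \<le> ennreal C * emeasure cone_measure S" .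
    qed auto
    finally show "(\<integral>\<^sup>+x\<in>sphere 0 1. h x \<partial>?H) \<le> ennreal C * (\<integral>\<^sup>+x\<in>annulus. h (sgn x) \<partial>lborel)"
      by (simp add: nn_integral_cone_measure)
  qed
qed

section \<open>Integration along rays\<close>

text \<open>
  Along the ray through \<open>x\<close> the substitution \<open>t = l * norm x\<close> turns the inner integral into one over the
  dilates \<open>l *\<^sub>R x\<close>; after exchanging the integrals only the scaling of Lebesgue measure is needed.
\<close>

lemma nn_integral_rays_le:
  fixes h :: "real^'m::finite \<Rightarrow> ennreal"
  assumes [measurable]: "h \<in> borel_measurable borel"
  shows "(\<integral>\<^sup>+x\<in>annulus. (\<integral>\<^sup>+t\<in>{1/2<..<1}. h (t *\<^sub>R sgn x) \<partial>lborel) \<partial>lborel)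
    \<le> ennreal (2 * 2 ^ CARD('m)) * (\<integral>\<^sup>+x\<in>annulus. h x \<partial>lborel)"
proof -
  define k where "k x = h x * indicator annulus x" for x
  have [measurable]: "k \<in> borel_measurable borel" unfolding k_def by measurable
  have "(\<integral>\<^sup>+x\<in>annulus. (\<integral>\<^sup>+t\<in>{1/2<..<1}. h (t *\<^sub>R sgn x) \<partial>lborel) \<partial>lborel)
    \<le> (\<integral>\<^sup>+x. (\<integral>\<^sup>+l\<in>{1/2..2}. k (l *\<^sub>R x) \<partial>lborel) \<partial>lborel)"
  proof (intro nn_integral_mono)
    fix x :: "real^'m"
    show "(\<integral>\<^sup>+t\<in>{1/2<..<1}. h (t *\<^sub>R sgn x) \<partial>lborel) * indicator annulus x \<le> (\<integral>\<^sup>+l\<in>{1/2..2}. k (l *\<^sub>R x) \<partial>lborel)"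
    proof (cases "x \<in> annulus")
      case True
      then have x: "1/2 < norm x" "norm x < 1" by auto
      have "(\<integral>\<^sup>+t\<in>{1/2<..<1}. h (t *\<^sub>R sgn x) \<partial>lborel)
          = ennreal (norm x) * (\<integral>\<^sup>+l. h ((norm x * l) *\<^sub>R sgn x) * indicator {1/2<..<1} (norm x * l) \<partial>lborel)"
        using x by (subst nn_integral_real_affine[where c = "norm x" and t = 0]) auto
      also have "\<dots> \<le> 1 * (\<integral>\<^sup>+l\<in>{1/2..2}. k (l *\<^sub>R x) \<partial>lborel)"
      proof (rule mult_mono, goal_cases)
        case 2
        show ?case
      proof (rule nn_integral_mono)
        fix l :: real
        have e: "(norm x * l) *\<^sub>R sgn x = l *\<^sub>R x"
          using x by (cases "x = 0") (auto simp: sgn_div_norm)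
        show "h ((norm x * l) *\<^sub>R sgn x) * indicator {1/2<..<1} (norm x * l) \<le> k (l *\<^sub>R x) * indicator {1/2..2} l"
        proof (cases "1/2 < norm x * l \<and> norm x * l < 1")
          case True
          have l0: "0 < l" using True x by (meson less_trans half_gt_zero_iff zero_less_mult_pos zero_less_one)
          have "norm x * l \<le> l" using x l0 by (simp add: mult_left_le_one_le)
          moreover have "l / 2 \<le> norm x * l" using x l0 by simp
          \<comment> \<open>Both |x| and |x| l lie between 1/2 and 1, so their quotient lies between
            1/2 and 2.\<close>
          ultimately have "1/2 \<le> l" "l \<le> 2" using True by linarith+
          then show ?thesis using True l0 unfolding e k_def by (simp add: mult.commute)
        qed simp
      qed
      qed (use x in auto)
      finally show ?thesis using True by simp
    qed simp
  qed
  also have "\<dots> = (\<integral>\<^sup>+l. (\<integral>\<^sup>+x. k (l *\<^sub>R x) * indicator {1/2..2::real} l \<partial>lborel) \<partial>lborel)"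
  proof -
    have "(\<lambda>(l, x). k (l *\<^sub>R x) * indicator {1/2..2::real} l) \<in> borel_measurable (lborel \<Otimes>\<^sub>M lborel)"
      by measurable
    from lborel_pair.Fubini'[OF this] show ?thesis by simp
  qed
  also have "\<dots> \<le> (\<integral>\<^sup>+l. ennreal (2 ^ CARD('m)) * (\<integral>\<^sup>+x. k x \<partial>lborel) * indicator {1/2..2::real} l \<partial>lborel)"
  proof (rule nn_integral_mono)
    fix l :: real
    show "(\<integral>\<^sup>+x. k (l *\<^sub>R x) * indicator {1/2..2} l \<partial>lborel) \<le> ennreal (2 ^ CARD('m)) * (\<integral>\<^sup>+x. k x \<partial>lborel) * indicator {1/2..2} l"
    proof (cases "l \<in> {1/2..2}")
      case True
      then have l: "0 < l" "1 \<le> 2 * l" by auto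
      have "1 \<le> ennreal (2 ^ CARD('m)) * ennreal (l ^ CARD('m))"
        using l one_le_power[OF l(2), of "CARD('m)"] by (simp add: ennreal_mult'[symmetric] power_mult_distrib)
      then have "1 * (\<integral>\<^sup>+x. k (l *\<^sub>R x) \<partial>lborel) \<le> (ennreal (2 ^ CARD('m)) * ennreal (l ^ CARD('m))) * (\<integral>\<^sup>+x. k (l *\<^sub>R x) \<partial>lborel)"
        by (rule mult_right_mono) simp
      also have "\<dots> = ennreal (2 ^ CARD('m)) * (\<integral>\<^sup>+x. k x \<partial>lborel)"
        using l nn_integral_lborel_affine[of k l 0] by (simp add: mult.assoc)
      finally show ?thesis using True by simp
    qed simp
  qed
  also have "\<dots> = ennreal (2 ^ CARD('m)) * (\<integral>\<^sup>+x. k x \<partial>lborel) * ennreal (3/2)"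
    by (subst nn_integral_cmult_indicator) auto
  also have "\<dots> \<le> ennreal (2 ^ CARD('m)) * (\<integral>\<^sup>+x. k x \<partial>lborel) * ennreal 2"
    by (intro mult_left_mono ennreal_leI) auto
  also have "\<dots> = ennreal (2 * 2 ^ CARD('m)) * (\<integral>\<^sup>+x. k x \<partial>lborel)"
    by (subst ennreal_mult) (auto simp: mult_ac)
  finally show ?thesis by (simp add: k_def)
qed

text \<open>Let J = (1 - \<delta>, 1) and let \<open>s\<close> be the mean of |G(t \<omega>)| over t
  in J; then |v(\<omega>)| \<le> |v(r \<omega>)| + \<delta> s for every r in J. Integration over r
  in J gives the factor \<delta> on the left, and \<delta> times \<delta>^p s^p is at most
  \<delta>^p times the integral of |G|^p by Jensen.\<close>

lemma C1_trace_pointwise: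
  fixes v :: "real^'m::finite \<Rightarrow> 'h::{real_inner, second_countable_topology}"
  assumes v: "C1_grad v G" and \<omega>: "norm \<omega> = 1" and \<delta>: "0 < \<delta>" "\<delta> \<le> 1/2" and p: "1 < p"
  shows "ennreal \<delta> * ennreal (norm (v \<omega>) powr p) \<le>
    ennreal (2 powr p) * (\<integral>\<^sup>+r\<in>{1/2<..<1}. ennreal (norm (v (r *\<^sub>R \<omega>)) powr p) \<partial>lborel) +
    ennreal (2 powr p * \<delta> powr p) * (\<integral>\<^sup>+t\<in>{1/2<..<1}. ennreal (norm (G (t *\<^sub>R \<omega>)) powr p) \<partial>lborel)"
proof -
  define J where "J = {1 - \<delta><..<1}"
  have J: "J \<in> sets borel" "emeasure lborel J = ennreal \<delta>" "J \<subseteq> {1/2<..<1}"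
    using \<delta> by (auto simp: J_def)
  note J(1)[measurable]
  have c: "continuous_on UNIV (\<lambda>t. norm (G (t *\<^sub>R \<omega>)))" "continuous_on UNIV (\<lambda>t. norm (v (t *\<^sub>R \<omega>)))"
    by (intro continuous_intros continuous_on_compose2[OF C1_grad_continuous(2)[OF v]]
        continuous_on_compose2[OF C1_grad_continuous(1)[OF v]]; simp)+
  note c[THEN borel_measurable_continuous_onI, measurable]
  define f where "f t = norm (G (t *\<^sub>R \<omega>)) * indicator J t" for t
  have f[measurable]: "f \<in> borel_measurable borel" unfolding f_def by measurable
  have "compact ((\<lambda>t. norm (G (t *\<^sub>R \<omega>))) ` {0..1})"
    by (intro compact_continuous_image continuous_on_subset[OF c(1)]) auto
  then have "bounded ((\<lambda>t. norm (G (t *\<^sub>R \<omega>))) ` {0..1})" by (rule compact_imp_bounded)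
  then obtain B where "\<forall>y\<in>(\<lambda>t. norm (G (t *\<^sub>R \<omega>))) ` {0..1}. norm y \<le> B"
    unfolding bounded_iff by blast
  then have B: "norm (G (t *\<^sub>R \<omega>)) \<le> B" if "t \<in> {0..1}" for t using that by auto
  have B0: "0 \<le> B" using order_trans[OF norm_ge_zero B[of 0]] by simp
  have fB: "f t \<le> B" "0 \<le> f t" for t
    using B[of t] B0 \<delta> by (auto simp: f_def J_def indicator_def)
  define M where "M = uniform_measure lborel J"
  have prob: "prob_space M"
    unfolding M_def using \<delta> J by (intro prob_space_uniform_measure) auto
  interpret prob_space M by fact
  have setsM[measurable_cong]: "sets M = sets borel" by (simp add: M_def)
  have int: "integrable M f"
    using fB by (intro integrable_const_bound[where B = B]) auto
  define s where "s = (\<integral>t. f t \<partial>M)"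
  have s0: "0 \<le> s" unfolding s_def using fB by (intro integral_nonneg_AE) auto
  have M: "ennreal \<delta> * (\<integral>\<^sup>+t. ennreal (k t) \<partial>M) = (\<integral>\<^sup>+t\<in>J. ennreal (k t) \<partial>lborel)"
    if [measurable]: "k \<in> borel_measurable borel" for k
    unfolding M_def using \<delta> J
    by (simp add: nn_integral_uniform_measure ennreal_times_divide mult.commute[of "ennreal \<delta>"] mult_divide_eq_ennreal)
  have s1: "(\<integral>\<^sup>+t\<in>J. ennreal (norm (G (t *\<^sub>R \<omega>))) \<partial>lborel) = ennreal (\<delta> * s)"
  proof -
    have "ennreal s = (\<integral>\<^sup>+t. ennreal (f t) \<partial>M)"
      unfolding s_def using int fB by (intro nn_integral_eq_integral[symmetric]) auto
    then have "ennreal (\<delta> * s) = (\<integral>\<^sup>+t\<in>J. ennreal (f t) \<partial>lborel)"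
      using \<delta> by (simp add: ennreal_mult' M[OF f])
    also have "\<dots> = (\<integral>\<^sup>+t\<in>J. ennreal (norm (G (t *\<^sub>R \<omega>))) \<partial>lborel)"
      by (intro nn_integral_cong) (auto simp: f_def indicator_def)
    finally show ?thesis ..
  qed
  have s2: "ennreal \<delta> * ennreal (s powr p) \<le> (\<integral>\<^sup>+t\<in>J. ennreal (norm (G (t *\<^sub>R \<omega>)) powr p) \<partial>lborel)"
  proof -
    have "ennreal \<delta> * ennreal (s powr p) \<le> ennreal \<delta> * (\<integral>\<^sup>+t. ennreal (f t powr p) \<partial>M)"
      unfolding s_def using fB p by (intro mult_left_mono Jensen_powr prob int) auto
    also have "\<dots> = (\<integral>\<^sup>+t\<in>J. ennreal (f t powr p) \<partial>lborel)" by (rule M) measurable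
    also have "\<dots> = (\<integral>\<^sup>+t\<in>J. ennreal (norm (G (t *\<^sub>R \<omega>)) powr p) \<partial>lborel)"
      by (intro nn_integral_cong) (auto simp: f_def indicator_def)
    finally show ?thesis .
  qed
  have vr: "norm (v \<omega>) powr p \<le> 2 powr p * (norm (v (r *\<^sub>R \<omega>)) powr p + \<delta> powr p * s powr p)" if r: "r \<in> J" for r
  proof -
    have "ennreal (norm (v \<omega> - v (r *\<^sub>R \<omega>))) \<le> (\<integral>\<^sup>+t\<in>{r..1}. ennreal (norm (G (t *\<^sub>R \<omega>))) \<partial>lborel)"
      using C1_grad_segment[OF v, of r 1 0 \<omega>] r \<omega> by (simp add: J_def)
    \<comment> \<open>The endpoint 1 belongs to the segment but not to the open interval
      \<open>J\<close>; it is a null set.\<close>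
    also have "\<dots> \<le> (\<integral>\<^sup>+t\<in>J. ennreal (norm (G (t *\<^sub>R \<omega>))) \<partial>lborel)"
      using AE_lborel_singleton[of "1 :: real"] r
      by (intro nn_integral_mono_AE) (auto simp: J_def indicator_def elim!: AE_mp)
    finally have "norm (v \<omega> - v (r *\<^sub>R \<omega>)) \<le> \<delta> * s"
      unfolding s1 using s0 \<delta> by (simp add: ennreal_le_iff)
    then have "norm (v \<omega>) \<le> norm (v (r *\<^sub>R \<omega>)) + \<delta> * s"
      using norm_triangle_ineq2[of "v \<omega>" "v (r *\<^sub>R \<omega>)"] by linarith
    then have "norm (v \<omega>) powr p \<le> (norm (v (r *\<^sub>R \<omega>)) + \<delta> * s) powr p"
      using p by (intro powr_mono2) auto
    also have "\<dots> \<le> 2 powr p * (norm (v (r *\<^sub>R \<omega>)) powr p + (\<delta> * s) powr p)"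
      using p s0 \<delta> by (intro add_powr_le) auto
    finally show ?thesis using s0 \<delta> by (simp add: powr_mult)
  qed
  have "ennreal \<delta> * ennreal (norm (v \<omega>) powr p) = (\<integral>\<^sup>+r\<in>J. ennreal (norm (v \<omega>) powr p) \<partial>lborel)"
    using J by (simp add: nn_integral_cmult_indicator mult.commute[of "ennreal \<delta>"])
  also have "\<dots> \<le> (\<integral>\<^sup>+r. ennreal (2 powr p) * (ennreal (norm (v (r *\<^sub>R \<omega>)) powr p) * indicator J r)
      + ennreal (2 powr p * \<delta> powr p * s powr p) * indicator J r \<partial>lborel)"
  proof (intro nn_integral_mono)
    fix r
    show "ennreal (norm (v \<omega>) powr p) * indicator J r \<le> ennreal (2 powr p) * (ennreal (norm (v (r *\<^sub>R \<omega>)) powr p) * indicator J r)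
      + ennreal (2 powr p * \<delta> powr p * s powr p) * indicator J r"
      using ennreal_leI[OF vr[of r]] by (auto simp: indicator_def ennreal_mult[symmetric] distrib_left mult.assoc simp flip: ennreal_plus)
  qed
  also have "\<dots> = ennreal (2 powr p) * (\<integral>\<^sup>+r\<in>J. ennreal (norm (v (r *\<^sub>R \<omega>)) powr p) \<partial>lborel)
      + ennreal (2 powr p * \<delta> powr p * s powr p) * ennreal \<delta>"
    using J(2) by (subst nn_integral_add) (simp_all add: nn_integral_cmult)
  also have "ennreal (2 powr p * \<delta> powr p * s powr p) * ennreal \<delta>
      = ennreal (2 powr p * \<delta> powr p) * (ennreal \<delta> * ennreal (s powr p))"
    by (simp add: ennreal_mult mult_ac)
  also have "ennreal (2 powr p) * (\<integral>\<^sup>+r\<in>J. ennreal (norm (v (r *\<^sub>R \<omega>)) powr p) \<partial>lborel)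
      + ennreal (2 powr p * \<delta> powr p) * (ennreal \<delta> * ennreal (s powr p))
    \<le> ennreal (2 powr p) * (\<integral>\<^sup>+r\<in>{1/2<..<1}. ennreal (norm (v (r *\<^sub>R \<omega>)) powr p) \<partial>lborel)
      + ennreal (2 powr p * \<delta> powr p) * (\<integral>\<^sup>+t\<in>{1/2<..<1}. ennreal (norm (G (t *\<^sub>R \<omega>)) powr p) \<partial>lborel)"
    using J(3) by (intro add_mono mult_left_mono order_trans[OF s2] nn_integral_mono) (auto simp: indicator_def)
  finally show ?thesis .
qed

text \<open>The inequality on rays is integrated over the directions: \<open>C0\<close> compares the
  Hausdorff measure with volumes of cones, and \<open>D\<close> comes from the dilations along the
  rays.\<close>

lemma C1_trace_inequality:
  fixes p :: real
  assumes p: "1 < p"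
  obtains C :: real where "0 < C" "\<And>v :: real^'m::finite \<Rightarrow> 'h::{real_inner, second_countable_topology}. \<And>G \<delta>.
    C1_grad v G \<Longrightarrow> 0 < \<delta> \<Longrightarrow> \<delta> \<le> 1/2 \<Longrightarrow>
    ennreal \<delta> * (\<integral>\<^sup>+x\<in>sphere 0 1. ennreal (norm (v x) powr p) \<partial>hausdorff_measure (CARD('m) - 1)) \<le>
    ennreal C * ((\<integral>\<^sup>+x\<in>ball 0 1. ennreal (norm (v x) powr p) \<partial>lborel)
      + ennreal (\<delta> powr p) * (\<integral>\<^sup>+x\<in>ball 0 1. ennreal (norm (G x) powr p) \<partial>lborel))"
proof -
  let ?H = "hausdorff_measure (CARD('m) - 1) :: (real^'m) measure"
  obtain C0 where C0: "0 < C0" "\<And>h :: real^'m \<Rightarrow> ennreal. h \<in> borel_measurable borel \<Longrightarrow>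
    (\<integral>\<^sup>+x\<in>sphere 0 1. h x \<partial>?H) \<le> ennreal C0 * (\<integral>\<^sup>+x\<in>annulus. h (sgn x) \<partial>lborel)"
    by (rule nn_integral_hausdorff_sphere_le) blast
  define D :: real where "D = 2 * 2 ^ CARD('m)"
  have D: "0 < D" by (simp add: D_def)
  show ?thesis
  proof (rule that[of "C0 * (2 powr p * D)"])
    show "0 < C0 * (2 powr p * D)" using C0(1) D by simp
    fix v :: "real^'m \<Rightarrow> 'h" and G and \<delta> :: real assume v: "C1_grad v G" and \<delta>: "0 < \<delta>" "\<delta> \<le> 1/2"
    note C1_grad_continuous[OF v, THEN borel_measurable_continuous_onI, measurable]
    define a where "a x = ennreal (norm (v x) powr p)" for x
    define b where "b x = ennreal (norm (G x) powr p)" for x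
    have ab[measurable]: "a \<in> borel_measurable borel" "b \<in> borel_measurable borel"
      unfolding a_def b_def by measurable
    have ray: "(\<integral>\<^sup>+x\<in>annulus. (\<integral>\<^sup>+t\<in>{1/2<..<1}. h (t *\<^sub>R sgn x) \<partial>lborel) \<partial>lborel) \<le> ennreal D * (\<integral>\<^sup>+x\<in>ball 0 1. h x \<partial>lborel)"
      if [measurable]: "h \<in> borel_measurable borel" for h :: "real^'m \<Rightarrow> ennreal"
    proof -
      have "(\<integral>\<^sup>+x\<in>annulus. h x \<partial>lborel) \<le> (\<integral>\<^sup>+x\<in>ball 0 1. h x \<partial>lborel)"
        by (intro nn_integral_mono) (auto simp: indicator_def)
      then show ?thesis
        unfolding D_def by (intro order_trans[OF nn_integral_rays_le] mult_left_mono) auto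
    qed
    have m: "(\<lambda>x. (\<integral>\<^sup>+t\<in>{1/2<..<1}. h (t *\<^sub>R sgn x) \<partial>lborel)) \<in> borel_measurable lborel"
      if [measurable]: "h \<in> borel_measurable borel" for h :: "real^'m \<Rightarrow> ennreal"
      by measurable
    have "ennreal \<delta> * (\<integral>\<^sup>+x\<in>sphere 0 1. a x \<partial>?H) \<le> ennreal \<delta> * (ennreal C0 * (\<integral>\<^sup>+x\<in>annulus. a (sgn x) \<partial>lborel))"
      by (intro mult_left_mono C0(2)) auto
    also have "\<dots> = ennreal C0 * (\<integral>\<^sup>+x\<in>annulus. ennreal \<delta> * a (sgn x) \<partial>lborel)"
      by (simp add: nn_integral_cmult[symmetric] mult.assoc mult.left_commute[of "ennreal \<delta>"])
    also have "\<dots> \<le> ennreal C0 * (\<integral>\<^sup>+x. ennreal (2 powr p) * ((\<integral>\<^sup>+t\<in>{1/2<..<1}. a (t *\<^sub>R sgn x) \<partial>lborel) * indicator annulus x)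
        + ennreal (2 powr p * \<delta> powr p) * ((\<integral>\<^sup>+t\<in>{1/2<..<1}. b (t *\<^sub>R sgn x) \<partial>lborel) * indicator annulus x) \<partial>lborel)"
    proof (intro mult_left_mono nn_integral_mono)
      fix x :: "real^'m"
      show "ennreal \<delta> * a (sgn x) * indicator annulus x \<le> ennreal (2 powr p) * ((\<integral>\<^sup>+t\<in>{1/2<..<1}. a (t *\<^sub>R sgn x) \<partial>lborel) * indicator annulus x)
        + ennreal (2 powr p * \<delta> powr p) * ((\<integral>\<^sup>+t\<in>{1/2<..<1}. b (t *\<^sub>R sgn x) \<partial>lborel) * indicator annulus x)"
      proof (cases "x \<in> annulus")
        case True
        then have "norm (sgn x) = 1" by (auto simp: norm_sgn)
        from C1_trace_pointwise[OF v this \<delta> p] show ?thesis using True by (simp add: a_def b_def)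
      qed simp
    qed simp
    also have "\<dots> = ennreal C0 * (ennreal (2 powr p) * (\<integral>\<^sup>+x\<in>annulus. (\<integral>\<^sup>+t\<in>{1/2<..<1}. a (t *\<^sub>R sgn x) \<partial>lborel) \<partial>lborel)
        + ennreal (2 powr p * \<delta> powr p) * (\<integral>\<^sup>+x\<in>annulus. (\<integral>\<^sup>+t\<in>{1/2<..<1}. b (t *\<^sub>R sgn x) \<partial>lborel) \<partial>lborel))"
    proof -
      note m[OF ab(1), measurable] m[OF ab(2), measurable]
      show ?thesis by (subst nn_integral_add) (simp_all add: nn_integral_cmult)
    qed
    also have "\<dots> \<le> ennreal C0 * (ennreal (2 powr p) * (ennreal D * (\<integral>\<^sup>+x\<in>ball 0 1. a x \<partial>lborel))
        + ennreal (2 powr p * \<delta> powr p) * (ennreal D * (\<integral>\<^sup>+x\<in>ball 0 1. b x \<partial>lborel)))"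
      by (intro mult_left_mono add_mono ray ab) auto
    also have "\<dots> = ennreal (C0 * (2 powr p * D)) * ((\<integral>\<^sup>+x\<in>ball 0 1. a x \<partial>lborel) + ennreal (\<delta> powr p) * (\<integral>\<^sup>+x\<in>ball 0 1. b x \<partial>lborel))"
      using C0(1) D by (simp add: ennreal_mult distrib_left mult_ac)
    finally show "ennreal \<delta> * (\<integral>\<^sup>+x\<in>sphere 0 1. ennreal (norm (v x) powr p) \<partial>?H) \<le>
      ennreal (C0 * (2 powr p * D)) * ((\<integral>\<^sup>+x\<in>ball 0 1. ennreal (norm (v x) powr p) \<partial>lborel)
      + ennreal (\<delta> powr p) * (\<integral>\<^sup>+x\<in>ball 0 1. ennreal (norm (G x) powr p) \<partial>lborel))"
      by (simp add: a_def b_def)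
  qed
qed

lemma emeasure_hausdorff_sphere_finite:
  "emeasure (hausdorff_measure (CARD('m) - 1)) (sphere (0 :: real^'m::finite) 1) < \<infinity>"
proof -
  obtain C :: real where "0 < C" "\<And>S :: (real^'m) set. S \<in> sets borel \<Longrightarrow> S \<subseteq> sphere 0 1 \<Longrightarrow>
    emeasure (hausdorff_measure (CARD('m) - 1)) S \<le> ennreal C * emeasure cone_measure S"
    by (rule emeasure_hausdorff_sphere_le) blast
  then have "emeasure (hausdorff_measure (CARD('m) - 1)) (sphere (0 :: real^'m) 1) \<le> ennreal C * emeasure cone_measure (sphere (0 :: real^'m) 1)"
    by auto
  also have "\<dots> \<le> ennreal C * emeasure cone_measure (UNIV :: (real^'m) set)"
    by (intro mult_left_mono emeasure_mono) auto
  also have "\<dots> < \<infinity>" using finite_cone_measure[where 'm = 'm] by (simp add: ennreal_mult_less_top)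
  finally show ?thesis .
qed

section \<open>From C1 functions to Lipschitz functions\<close>

lemma mollification_uniform:
  fixes w :: "real^'m::finite \<Rightarrow> 'h::{real_inner, banach, second_countable_topology}"
  assumes w: "L-lipschitz_on UNIV w" and \<eta>: "0 < \<eta>" and p: "1 < p"
  obtains v G where "C1_grad v G" "\<And>x. x \<in> cball 0 1 \<Longrightarrow> norm (v x - w x) \<le> \<eta>"
    "(\<integral>\<^sup>+x\<in>ball 0 1. ennreal (norm (G x) powr p) \<partial>lborel)
      \<le> ennreal (2 ^ CARD('m)) * (\<integral>\<^sup>+x\<in>ball 0 1. ennreal (dir_lip w x powr p) \<partial>lborel)"
proof -
  have L: "0 \<le> L" by (rule lipschitz_on_nonneg[OF w])
  \<comment> \<open>s \<le> 1/2 bounds the Jacobian factor by 2^m, and the other term makes the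
    error 2 s L at most \<eta>; L + 1 in place of L covers L = 0.\<close>
  define s where "s = min (1/2) (\<eta> / (2 * (L + 1)))"
  have s: "0 < s" "s < 1" "s \<le> 1/2" "2 * s * L \<le> \<eta>"
  proof -
    show "0 < s" using \<eta> L by (auto simp: s_def)
    show "s \<le> 1/2" unfolding s_def by (rule min.cobounded1)
    then show "s < 1" by simp
    have "2 * s * L \<le> 2 * (\<eta> / (2 * (L + 1))) * L" using L by (intro mult_right_mono mult_left_mono) (auto simp: s_def)
    also have "\<dots> = \<eta> * (L / (L + 1))"
      using mult_divide_mult_cancel_left[of 2 \<eta> "L + 1"] by (simp only: times_divide_eq_right times_divide_eq_left)
    also have "\<dots> \<le> \<eta> * 1" using \<eta> L by (intro mult_left_mono) auto
    finally show "2 * s * L \<le> \<eta>" by simp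
  qed
  obtain v :: "real^'m \<Rightarrow> 'h" and G where v: "C1_grad v G" "\<And>x. x \<in> cball 0 1 \<Longrightarrow> norm (v x - w x) \<le> 2 * s * L"
    "(\<integral>\<^sup>+x\<in>ball 0 1. ennreal (norm (G x) powr p) \<partial>lborel)
      \<le> ennreal (1 / (1 - s) ^ CARD('m)) * (\<integral>\<^sup>+x\<in>ball 0 1. ennreal (dir_lip w x powr p) \<partial>lborel)"
    by (rule mollification[OF w s(1,2) p]) (rule that; assumption)
  have "1 / (1 - s) ^ CARD('m) = (1 / (1 - s)) ^ CARD('m)" by (simp add: power_one_over)
  also have "\<dots> \<le> 2 ^ CARD('m)" using s by (intro power_mono) (auto simp: field_simps)
  finally have "(\<integral>\<^sup>+x\<in>ball 0 1. ennreal (norm (G x) powr p) \<partial>lborel)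
      \<le> ennreal (2 ^ CARD('m)) * (\<integral>\<^sup>+x\<in>ball 0 1. ennreal (dir_lip w x powr p) \<partial>lborel)"
    by (intro order_trans[OF v(3)] mult_right_mono ennreal_leI) auto
  then show ?thesis using order_trans[OF v(2) s(4)] by (rule that[OF v(1), rotated])
qed

text \<open>Serves to choose mollification errors and the width \<delta>. Dividing by c + 1 in place
  of c covers c = 0.\<close>

lemma small_root_exists:
  fixes b c q :: real
  assumes "0 < b" "0 \<le> c" "0 < q"
  obtains \<delta> where "0 < \<delta>" "\<delta> \<le> 1/2" "c * \<delta> powr q \<le> b"
proof (rule that[of "min (1/2) ((b / (c + 1)) powr (1 / q))"])
  let ?\<delta> = "min (1/2) ((b / (c + 1)) powr (1 / q))"
  show "0 < ?\<delta>" using assms by simp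
  have "?\<delta> powr q \<le> ((b / (c + 1)) powr (1 / q)) powr q" using assms by (intro powr_mono2) auto
  also have "\<dots> = b / (c + 1)" using assms by (simp add: powr_powr)
  finally have "c * ?\<delta> powr q \<le> c * (b / (c + 1))" using assms by (intro mult_left_mono)
  also have "\<dots> = b * (c / (c + 1))" by simp
  also have "\<dots> \<le> b * 1" using assms by (intro mult_left_mono) auto
  finally show "c * ?\<delta> powr q \<le> b" by simp
qed simp

lemma nn_integral_powr_triangle:
  fixes f g h :: "'a \<Rightarrow> real"
  assumes p: "1 < p" and le: "\<And>x. x \<in> A \<Longrightarrow> f x \<le> g x + h x"
    and nn: "\<And>x. 0 \<le> f x" "\<And>x. 0 \<le> g x" "\<And>x. 0 \<le> h x"
    and [measurable]: "g \<in> borel_measurable M" "h \<in> borel_measurable M" "A \<in> sets M"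
  shows "(\<integral>\<^sup>+x\<in>A. ennreal (f x powr p) \<partial>M) \<le>
    ennreal (2 powr p) * ((\<integral>\<^sup>+x\<in>A. ennreal (g x powr p) \<partial>M) + (\<integral>\<^sup>+x\<in>A. ennreal (h x powr p) \<partial>M))"
proof -
  have "(\<integral>\<^sup>+x\<in>A. ennreal (f x powr p) \<partial>M)
    \<le> (\<integral>\<^sup>+x. ennreal (2 powr p) * (ennreal (g x powr p) * indicator A x + ennreal (h x powr p) * indicator A x) \<partial>M)"
  proof (intro nn_integral_mono)
    fix x
    show "ennreal (f x powr p) * indicator A x
      \<le> ennreal (2 powr p) * (ennreal (g x powr p) * indicator A x + ennreal (h x powr p) * indicator A x)"
    proof (cases "x \<in> A")
      case True
      have "f x powr p \<le> (g x + h x) powr p" using le[OF True] nn p by (intro powr_mono2) auto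
      also have "\<dots> \<le> 2 powr p * (g x powr p + h x powr p)" by (rule add_powr_le[OF nn(2,3) p])
      finally have "ennreal (f x powr p) \<le> ennreal (2 powr p * (g x powr p + h x powr p))" by (rule ennreal_leI)
      then show ?thesis using True by (simp add: ennreal_mult)
    qed simp
  qed
  also have "\<dots> = ennreal (2 powr p) * ((\<integral>\<^sup>+x\<in>A. ennreal (g x powr p) \<partial>M) + (\<integral>\<^sup>+x\<in>A. ennreal (h x powr p) \<partial>M))"
    by (subst nn_integral_cmult) (simp_all add: nn_integral_add)
  finally show ?thesis .
qed

lemma nn_integral_powr_add_le:
  fixes f g :: "'a \<Rightarrow> real"
  assumes le: "\<And>x. x \<in> A \<Longrightarrow> f x \<le> g x + c" and f0: "\<And>x. 0 \<le> f x" and g0: "\<And>x. 0 \<le> g x" and c: "0 \<le> c" and p: "1 < p"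
    and g[measurable]: "g \<in> borel_measurable M" and A[measurable]: "A \<in> sets M"
  shows "(\<integral>\<^sup>+x\<in>A. ennreal (f x powr p) \<partial>M) \<le>
    ennreal (2 powr p) * ((\<integral>\<^sup>+x\<in>A. ennreal (g x powr p) \<partial>M) + ennreal (c powr p) * emeasure M A)"
  using nn_integral_powr_triangle[where f = f and g = g and h = "\<lambda>_. c" and A = A and M = M, OF p le f0 g0] c
  by (simp add: nn_integral_cmult_indicator)

text \<open>Mollification within \<eta> costs a multiple of \<eta>^p, which can be made smaller than
  any \<open>e\<close>; the energy of the mollified function is at most 2^m times the
  \<open>dir_lip\<close> energy of \<phi>.\<close>

lemma Lipschitz_trace_inequality:
  fixes p :: real
  assumes p: "1 < p"
  obtains C :: real where "0 < C" "\<And>(\<phi> :: real^'m::finite \<Rightarrow> real) L \<delta>.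
    L-lipschitz_on UNIV \<phi> \<Longrightarrow> 0 < \<delta> \<Longrightarrow> \<delta> \<le> 1/2 \<Longrightarrow>
    ennreal \<delta> * (\<integral>\<^sup>+x\<in>sphere 0 1. ennreal (\<bar>\<phi> x\<bar> powr p) \<partial>hausdorff_measure (CARD('m) - 1)) \<le>
    ennreal C * ((\<integral>\<^sup>+x\<in>ball 0 1. ennreal (\<bar>\<phi> x\<bar> powr p) \<partial>lborel)
      + ennreal (\<delta> powr p) * (\<integral>\<^sup>+x\<in>ball 0 1. ennreal (dir_lip \<phi> x powr p) \<partial>lborel))"
proof -
  let ?H = "hausdorff_measure (CARD('m) - 1) :: (real^'m) measure"
  let ?U = "ball (0 :: real^'m) 1" and ?S = "sphere (0 :: real^'m) 1"
  obtain C0 where C0: "0 < C0" "\<And>v :: real^'m \<Rightarrow> real. \<And>G \<delta>.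
    C1_grad v G \<Longrightarrow> 0 < \<delta> \<Longrightarrow> \<delta> \<le> 1/2 \<Longrightarrow>
    ennreal \<delta> * (\<integral>\<^sup>+x\<in>?S. ennreal (norm (v x) powr p) \<partial>?H) \<le>
    ennreal C0 * ((\<integral>\<^sup>+x\<in>?U. ennreal (norm (v x) powr p) \<partial>lborel)
      + ennreal (\<delta> powr p) * (\<integral>\<^sup>+x\<in>?U. ennreal (norm (G x) powr p) \<partial>lborel))"
    by (rule C1_trace_inequality[OF p]) blast
  define P :: real where "P = 2 powr p"
  have P: "1 \<le> P" using p by (simp add: P_def ge_one_powr_ge_zero)
  define h where "h = measure ?H ?S"
  have h: "emeasure ?H ?S = ennreal h" "0 \<le> h"
    using emeasure_hausdorff_sphere_finite[where 'm = 'm] by (simp_all add: h_def emeasure_eq_ennreal_measure)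
  define u where "u = measure lborel ?U"
  have u: "emeasure lborel ?U = ennreal u" "0 \<le> u"
    using emeasure_lborel_ball_finite[of "0 :: real^'m" 1] by (simp_all add: u_def emeasure_eq_ennreal_measure)
  define C where "C = P * C0 * (P + 2 ^ CARD('m))"
  show ?thesis
  proof (rule that[of C])
    show "0 < C" using C0(1) P by (simp add: C_def add_pos_pos)
    fix \<phi> :: "real^'m \<Rightarrow> real" and L \<delta> :: real
    assume \<phi>: "L-lipschitz_on UNIV \<phi>" and \<delta>: "0 < \<delta>" "\<delta> \<le> 1/2"
    have L: "0 \<le> L" by (rule lipschitz_on_nonneg[OF \<phi>])
    note lipschitz_on_continuous_on[OF \<phi>, THEN borel_measurable_continuous_onI, measurable]
    define X where "X = (\<integral>\<^sup>+x\<in>?U. ennreal (\<bar>\<phi> x\<bar> powr p) \<partial>lborel)"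
    define E where "E = (\<integral>\<^sup>+x\<in>?U. ennreal (dir_lip \<phi> x powr p) \<partial>lborel)"
    define D where "D = ennreal (\<delta> powr p)"
    define Y where "Y = (\<integral>\<^sup>+x\<in>?S. ennreal (\<bar>\<phi> x\<bar> powr p) \<partial>?H)"
    have "ennreal \<delta> * Y \<le> ennreal C * (X + D * E)"
    proof (rule ennreal_le_epsilon)
      fix e :: real assume e: "0 < e"
      \<comment> \<open>The total coefficient of \<eta>^p: \<open>P * h\<close> from the sphere, the
        other summand from the ball.\<close>
      define c where "c = P * h + P * C0 * P * u"
      have c: "0 \<le> c" using P h(2) u(2) C0(1) by (simp add: c_def)
      obtain \<eta> where \<eta>: "0 < \<eta>" "c * \<eta> powr p \<le> e"
        by (rule small_root_exists[of e c p]) (use e c p in auto)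
      obtain v :: "real^'m \<Rightarrow> real" and G where v: "C1_grad v G" "\<And>x. x \<in> cball 0 1 \<Longrightarrow> norm (v x - \<phi> x) \<le> \<eta>"
        "(\<integral>\<^sup>+x\<in>?U. ennreal (norm (G x) powr p) \<partial>lborel)
          \<le> ennreal (2 ^ CARD('m)) * (\<integral>\<^sup>+x\<in>?U. ennreal (dir_lip \<phi> x powr p) \<partial>lborel)"
        by (rule mollification_uniform[OF \<phi> \<eta>(1) p]) (rule that; assumption)
      note C1_grad_continuous[OF v(1), THEN borel_measurable_continuous_onI, measurable]
      have vX: "(\<integral>\<^sup>+x\<in>?U. ennreal (norm (v x) powr p) \<partial>lborel) \<le> ennreal P * (X + ennreal (\<eta> powr p) * ennreal u)"
        unfolding X_def u(1)[symmetric] P_def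
      proof (rule nn_integral_powr_add_le)
        show "norm (v x) \<le> \<bar>\<phi> x\<bar> + \<eta>" if "x \<in> ?U" for x using v(2)[of x] that by auto
      qed (use \<eta>(1) p in auto)
      have "Y \<le> ennreal P * ((\<integral>\<^sup>+x\<in>?S. ennreal (norm (v x) powr p) \<partial>?H) + ennreal (\<eta> powr p) * ennreal h)"
        unfolding Y_def h(1)[symmetric] P_def
      proof (rule nn_integral_powr_add_le)
        show "\<bar>\<phi> x\<bar> \<le> norm (v x) + \<eta>" if "x \<in> ?S" for x using v(2)[of x] that by auto
      qed (use \<eta>(1) p in auto)
      then have "ennreal \<delta> * Y \<le> ennreal \<delta> * (ennreal P * ((\<integral>\<^sup>+x\<in>?S. ennreal (norm (v x) powr p) \<partial>?H) + ennreal (\<eta> powr p) * ennreal h))"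
        by (rule mult_left_mono) simp
      also have "\<dots> = ennreal P * (ennreal \<delta> * (\<integral>\<^sup>+x\<in>?S. ennreal (norm (v x) powr p) \<partial>?H)) + ennreal \<delta> * (ennreal P * (ennreal (\<eta> powr p) * ennreal h))"
        by (simp add: distrib_left mult_ac)
      also have "\<dots> \<le> ennreal P * (ennreal C0 * (ennreal P * (X + ennreal (\<eta> powr p) * ennreal u) + D * (ennreal (2 ^ CARD('m)) * E)))
          + 1 * (ennreal P * (ennreal (\<eta> powr p) * ennreal h))"
      proof (rule add_mono)
        show "ennreal P * (ennreal \<delta> * (\<integral>\<^sup>+x\<in>?S. ennreal (norm (v x) powr p) \<partial>?H)) \<le>
          ennreal P * (ennreal C0 * (ennreal P * (X + ennreal (\<eta> powr p) * ennreal u) + D * (ennreal (2 ^ CARD('m)) * E)))"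
          unfolding D_def
          by (intro mult_left_mono order_trans[OF C0(2)[OF v(1) \<delta>]] add_mono vX v(3)[folded E_def]) auto
        show "ennreal \<delta> * (ennreal P * (ennreal (\<eta> powr p) * ennreal h)) \<le> 1 * (ennreal P * (ennreal (\<eta> powr p) * ennreal h))"
          using \<delta> by (intro mult_right_mono) auto
      qed
      also have "\<dots> = ennreal (P * C0 * P) * X + ennreal (P * C0 * 2 ^ CARD('m)) * (D * E) + ennreal (c * \<eta> powr p)"
      proof -
        have "ennreal (c * \<eta> powr p) = ennreal P * (ennreal (\<eta> powr p) * ennreal h)
            + ennreal P * (ennreal C0 * (ennreal P * (ennreal (\<eta> powr p) * ennreal u)))"
          using P C0(1) h(2) u(2) by (simp add: c_def distrib_left ennreal_mult mult_ac)
        moreover have "ennreal (P * C0 * P) = ennreal P * (ennreal C0 * ennreal P)"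
          "ennreal (P * C0 * 2 ^ CARD('m)) = ennreal P * (ennreal C0 * ennreal (2 ^ CARD('m)))"
          using P C0(1) by (simp_all add: ennreal_mult mult_ac)
        ultimately show ?thesis by (simp add: distrib_left mult_ac add_ac)
      qed
      also have "\<dots> \<le> ennreal C * X + ennreal C * (D * E) + ennreal e"
        using P C0(1) \<eta>(2) unfolding C_def
        by (intro add_mono mult_right_mono ennreal_leI mult_left_mono) auto
      finally show "ennreal \<delta> * Y \<le> ennreal C * (X + D * E) + ennreal e" by (simp add: distrib_left)
    qed
    then show "ennreal \<delta> * (\<integral>\<^sup>+x\<in>?S. ennreal (\<bar>\<phi> x\<bar> powr p) \<partial>?H) \<le>
      ennreal C * ((\<integral>\<^sup>+x\<in>?U. ennreal (\<bar>\<phi> x\<bar> powr p) \<partial>lborel)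
      + ennreal (\<delta> powr p) * (\<integral>\<^sup>+x\<in>?U. ennreal (dir_lip \<phi> x powr p) \<partial>lborel))"
      by (simp add: X_def Y_def D_def E_def)
  qed
qed

section \<open>Charts on the space of unordered tuples\<close>

text \<open>Representatives are chosen recursively so that consecutive ones are optimally matched;
  each component then moves by at most the distance of the tuples and is a Cauchy sequence.\<close>

lemma unordered_tuple_convergent:
  fixes y :: "nat \<Rightarrow> ('a::complete_space, 'q::finite) unordered_tuple"
  assumes y: "summable (\<lambda>n. dist (y n) (y (Suc n)))"
  shows "convergent y"
proof -
  have "\<exists>z. \<forall>n. y n = unordered (z n) \<and> (\<forall>i. dist (z n i) (z (Suc n) i) \<le> dist (y n) (y (Suc n)))"
  proof (rule dependent_nat_choice)
    show "\<exists>z. y 0 = unordered z" by (rule unordered_cases) blast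
    fix z n assume z: "y n = unordered z"
    obtain z' where z': "y (Suc n) = unordered z'" by (rule unordered_cases)
    obtain \<sigma> where \<sigma>: "bij \<sigma>" "dist (unordered z) (unordered z') = L2_set (\<lambda>i. dist (z i) (z' (\<sigma> i))) UNIV"
      by (rule dist_unordered_attained)
    have "y (Suc n) = unordered (z' \<circ> \<sigma>)" by (simp add: z' unordered_comp_bij[OF \<sigma>(1)])
    moreover have "dist (z i) ((z' \<circ> \<sigma>) i) \<le> dist (y n) (y (Suc n))" for i
      unfolding z z' \<sigma>(2) using member_le_L2_set[of UNIV i "\<lambda>i. dist (z i) (z' (\<sigma> i))"] by simp
    ultimately show "\<exists>z''. y (Suc n) = unordered z'' \<and> (\<forall>i. dist (z i) (z'' i) \<le> dist (y n) (y (Suc n)))" by blast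
  qed
  then obtain z where z: "\<And>n. y n = unordered (z n)"
    "\<And>n i. dist (z n i) (z (Suc n) i) \<le> dist (y n) (y (Suc n))" by blast
  define s where "s n = (\<Sum>k<n. dist (y k) (y (Suc k)))" for n
  have d: "dist (z m i) (z n i) \<le> s n - s m" if "m \<le> n" for m n i
    using that
  proof (induction n rule: dec_induct)
    case (step n)
    then show ?case
      using dist_triangle[of "z m i" "z (Suc n) i" "z n i"] z(2)[of n i] by (simp add: s_def)
  qed simp
  have "Cauchy s" using y unfolding s_def summable_iff_convergent by (rule convergent_Cauchy)
  have "Cauchy (\<lambda>n. z n i)" for i
  proof (rule CauchyI')
    fix e :: real assume "0 < e"
    then obtain M where M: "\<And>m n. M \<le> m \<Longrightarrow> M \<le> n \<Longrightarrow> dist (s m) (s n) < e"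
      using \<open>Cauchy s\<close> unfolding Cauchy_def by blast
    show "\<exists>M. \<forall>m\<ge>M. \<forall>n>m. dist (z m i) (z n i) < e"
    proof (intro exI[of _ M] allI impI)
      fix m n assume "M \<le> m" "m < n"
      then show "dist (z m i) (z n i) < e"
        using d[of m n i] M[of m n] by (auto simp: dist_real_def)
    qed
  qed
  then have conv: "convergent (\<lambda>n. z n i)" for i by (simp add: Cauchy_convergent_iff)
  define l where "l i = lim (\<lambda>n. z n i)" for i
  have l: "(\<lambda>n. z n i) \<longlonglongrightarrow> l i" for i
    using conv[of i] by (simp add: l_def convergent_LIMSEQ_iff)
  have "(\<lambda>n. \<Sum>i\<in>UNIV. dist (z n i) (l i)) \<longlonglongrightarrow> (\<Sum>i\<in>(UNIV :: 'q set). 0)"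
    by (intro tendsto_sum tendsto_dist_iff[THEN iffD1] l)
  then have lim: "(\<lambda>n. \<Sum>i\<in>UNIV. dist (z n i) (l i)) \<longlonglongrightarrow> 0" by simp
  have "dist (y n) (unordered l) \<le> (\<Sum>i\<in>UNIV. dist (z n i) (l i))" for n
    unfolding z(1) by (rule order_trans[OF dist_unordered_le L2_set_le_sum]) simp
  then have "(\<lambda>n. dist (y n) (unordered l)) \<longlonglongrightarrow> 0"
    by (intro tendsto_sandwich[OF _ _ tendsto_const lim] always_eventually allI zero_le_dist)
  then have "y \<longlonglongrightarrow> unordered l" by (rule tendsto_dist_iff[THEN iffD2])
  then show ?thesis by (auto simp: convergent_def)
qed

section \<open>The number of distinct values of a tuple\<close>

lift_definition num_values :: "('a, 'q::finite) unordered_tuple \<Rightarrow> nat" is "\<lambda>y. card (range y)"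
proof -
  fix y z :: "'q \<Rightarrow> 'a" assume "same_up_to_perm y z"
  then obtain \<sigma> where "bij \<sigma>" "z = y \<circ> \<sigma>" by (auto simp: same_up_to_perm_def)
  then have "range z = range y" by (metis bij_is_surj fun.set_map)
  then show "card (range y) = card (range z)" by simp
qed

lemma num_values_unordered: "num_values (unordered y) = card (range y)"
  by transfer simp

text \<open>The value \<open>z i\<close> determines \<open>y i\<close>: two indices with the same
  value of z have y-values less than 2 r apart, hence equal ones.\<close>

lemma values_matched:
  fixes y z :: "'q::finite \<Rightarrow> 'a::metric_space"
  assumes sep: "\<And>i j. y i \<noteq> y j \<Longrightarrow> 2 * r \<le> dist (y i) (y j)" and z: "\<And>i. dist (y i) (z i) < r"
  obtains h where "\<And>i. h (z i) = y i"
proof -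
  define h where "h u = y (SOME i. z i = u)" for u
  have "h (z i) = y i" for i
  proof -
    have e: "z (SOME j. z j = z i) = z i" by (rule someI[of "\<lambda>j. z j = z i"]) simp
    have "dist (y i) (y (SOME j. z j = z i)) < 2 * r"
      using dist_triangle2[of "y i" "y (SOME j. z j = z i)" "z i"] z[of i] z[of "SOME j. z j = z i"] e by simp
    then show ?thesis unfolding h_def using sep[of i "SOME j. z j = z i"] by force
  qed
  then show ?thesis by (rule that)
qed

lemma separation:
  fixes y :: "'q::finite \<Rightarrow> 'a::metric_space"
  obtains r where "0 < r" "\<And>i j. y i \<noteq> y j \<Longrightarrow> r \<le> dist (y i) (y j)"
proof -
  \<comment> \<open>The element 1 keeps the set nonempty for a constant tuple.\<close>
  define S where "S = insert 1 {dist (y i) (y j) |i j. y i \<noteq> y j}"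
  have fin: "finite S"
  proof -
    have "S \<subseteq> insert 1 ((\<lambda>(i, j). dist (y i) (y j)) ` UNIV)" by (auto simp: S_def)
    then show ?thesis by (rule finite_subset) simp
  qed
  have "Min S \<in> S" using fin by (intro Min_in) (auto simp: S_def)
  then have "0 < Min S" by (auto simp: S_def)
  moreover have "Min S \<le> dist (y i) (y j)" if "y i \<noteq> y j" for i j
    using fin that by (intro Min_le) (auto simp: S_def)
  ultimately show ?thesis by (rule that)
qed

lemma unordered_near:
  fixes y :: "('a::metric_space, 'q::finite) unordered_tuple"
  assumes "dist (unordered y0) y < r"
  obtains z where "y = unordered z" "\<And>i. dist (y0 i) (z i) < r"
proof -
  obtain z' where z': "y = unordered z'" by (rule unordered_cases)
  obtain \<sigma> where \<sigma>: "bij \<sigma>" "dist (unordered y0) (unordered z') = L2_set (\<lambda>i. dist (y0 i) (z' (\<sigma> i))) UNIV"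
    by (rule dist_unordered_attained)
  have "y = unordered (z' \<circ> \<sigma>)" by (simp add: z' unordered_comp_bij[OF \<sigma>(1)])
  moreover have "dist (y0 i) ((z' \<circ> \<sigma>) i) < r" for i
    using member_le_L2_set[of UNIV i "\<lambda>i. dist (y0 i) (z' (\<sigma> i))"] \<sigma>(2) assms z' by simp
  ultimately show ?thesis by (rule that)
qed

text \<open>The number of distinct values is lower semicontinuous, because the values of a nearby
  tuple map onto those of \<open>y\<close>. Its level sets are differences of open sets.\<close>

lemma borel_measurable_num_values: "{y :: ('a::metric_space, 'q::finite) unordered_tuple. num_values y = c} \<in> sets borel"
proof -
  have op: "open {y :: ('a, 'q) unordered_tuple. c \<le> num_values y}" for c
    unfolding open_dist
  proof
    fix y :: "('a, 'q) unordered_tuple" assume "y \<in> {y. c \<le> num_values y}"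
    then have c: "c \<le> num_values y" by simp
    obtain y0 where y0: "y = unordered y0" by (rule unordered_cases)
    obtain r where r: "0 < r" "\<And>i j. y0 i \<noteq> y0 j \<Longrightarrow> r \<le> dist (y0 i) (y0 j)"
      by (rule separation[of y0]) blast
    show "\<exists>e>0. \<forall>z. dist z y < e \<longrightarrow> z \<in> {y. c \<le> num_values y}"
    proof (intro exI[of _ "r/2"] conjI allI impI)
      fix z assume "dist z y < r/2"
      then have "dist (unordered y0) z < r/2" using y0 by (simp add: dist_commute)
      then obtain z0 where z0: "z = unordered z0" "\<And>i. dist (y0 i) (z0 i) < r/2"
        by (rule unordered_near) blast
      obtain h where h: "\<And>i. h (z0 i) = y0 i"
        by (rule values_matched[of y0 "r/2" z0]) (use r z0 in auto)
      have "range y0 = h ` range z0" by (simp add: image_image h)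
      then have "card (range y0) \<le> card (range z0)" using card_image_le[of "range z0" h] by simp
      then show "z \<in> {y. c \<le> num_values y}" using c y0 z0 by (simp add: num_values_unordered)
    qed (use r in auto)
  qed
  have "{y :: ('a, 'q) unordered_tuple. num_values y = c} = {y. c \<le> num_values y} - {y. Suc c \<le> num_values y}"
    by auto
  then show ?thesis using op by auto
qed

section \<open>Cluster sums as charts\<close>

definition bump_map :: "real \<Rightarrow> 'h::real_normed_vector \<Rightarrow> 'h \<Rightarrow> 'h" where
  "bump_map r b u = max 0 (min 1 (2 - norm (u - b) / (2 * r))) *\<^sub>R (u - b)"

lemma bump_map_near: "0 < r \<Longrightarrow> norm (u - b) \<le> 2 * r \<Longrightarrow> bump_map r b u = u - b"
  and bump_map_far: "0 < r \<Longrightarrow> 4 * r \<le> norm (u - b) \<Longrightarrow> bump_map r b u = 0"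
  by (auto simp: bump_map_def field_simps)

text \<open>The constant is 1 + 2: the cut-off factor is at most 1 and has Lipschitz constant 1 / (2
  r), and one of the points may be assumed within 4 r of \<open>b\<close>, since otherwise both
  values vanish.\<close>

lemma bump_map_Lipschitz:
  assumes r: "0 < r"
  shows "norm (bump_map r b u - bump_map r b v) \<le> 3 * norm (u - v)"
proof -
  define k where "k u = max 0 (min 1 (2 - norm (u - b) / (2 * r)))" for u
  have k: "0 \<le> k u" "k u \<le> 1" for u by (auto simp: k_def)
  have kd: "\<bar>k u - k v\<bar> \<le> norm (u - v) / (2 * r)" for u v
  proof -
    have clip: "\<bar>max 0 (min 1 (2 - s)) - max 0 (min 1 (2 - t))\<bar> \<le> \<bar>s - t\<bar>" for s t :: real
      by linarith
    have "\<bar>k u - k v\<bar> \<le> \<bar>norm (u - b) / (2 * r) - norm (v - b) / (2 * r)\<bar>"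
      unfolding k_def by (rule clip)
    also have "\<dots> = \<bar>norm (u - b) - norm (v - b)\<bar> / (2 * r)"
      using r by (simp add: diff_divide_distrib[symmetric])
    also have "\<dots> \<le> norm (u - v) / (2 * r)"
      using r norm_triangle_ineq3[of "u - b" "v - b"] by (intro divide_right_mono) auto
    finally show ?thesis .
  qed
  have near: "norm (k u *\<^sub>R (u - b) - k v *\<^sub>R (v - b)) \<le> 3 * norm (u - v)" if "norm (v - b) \<le> 4 * r" for u v
  proof -
    have "k u *\<^sub>R (u - b) - k v *\<^sub>R (v - b) = k u *\<^sub>R (u - v) + (k u - k v) *\<^sub>R (v - b)"
      by (simp add: algebra_simps)
    also have "norm \<dots> \<le> k u * norm (u - v) + \<bar>k u - k v\<bar> * norm (v - b)"
      using k(1)[of u] by (intro order_trans[OF norm_triangle_ineq]) simp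
    also have "\<dots> \<le> 1 * norm (u - v) + norm (u - v) / (2 * r) * (4 * r)"
      using k kd that r by (intro add_mono mult_mono) auto
    also have "\<dots> = 3 * norm (u - v)" using r by (simp add: field_simps)
    finally show ?thesis .
  qed
  consider "norm (v - b) \<le> 4 * r" | "norm (u - b) \<le> 4 * r" | "4 * r \<le> norm (u - b)" "4 * r \<le> norm (v - b)" by linarith
  then show ?thesis
  proof cases
    case 1
    then show ?thesis using near[of v u] by (simp add: bump_map_def k_def)
  next
    case 2
    then show ?thesis using near[of u v] by (simp add: bump_map_def k_def norm_minus_commute)
  next
    case 3
    then show ?thesis using r by (simp add: bump_map_far)
  qed
qed

text \<open>
  Near \<open>unordered z\<close> the \<open>i\<close>-th component is the sum of \<open>y j - z i\<close> over the \<open>y j\<close> in the cluster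
  around \<open>z i\<close>. It is defined on all tuples, depends on them in a Lipschitz way, and inverts on the set of
  tuples with the same number of distinct values as \<open>z\<close>, where each cluster consists of a single value.
\<close>

lift_definition cluster_sums ::
    "real \<Rightarrow> ('q::finite \<Rightarrow> 'h::real_inner) \<Rightarrow> ('h, 'q) unordered_tuple \<Rightarrow> 'h hilbert_copy ^ 'q"
  is "\<lambda>r z y. \<chi> i. copy (\<Sum>j\<in>UNIV. bump_map r (z i) (y j))"
proof -
  fix r and z y y' :: "'q \<Rightarrow> 'h" assume "same_up_to_perm y y'"
  then obtain \<sigma> where \<sigma>: "bij \<sigma>" "y' = y \<circ> \<sigma>" by (auto simp: same_up_to_perm_def)
  then have "(\<Sum>j\<in>UNIV. bump_map r (z i) (y' j)) = (\<Sum>j\<in>UNIV. bump_map r (z i) (y j))" for i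
    using sum.reindex_bij_betw[of \<sigma> UNIV UNIV "\<lambda>j. bump_map r (z i) (y j)"] by simp
  then show "(\<chi> i. copy (\<Sum>j\<in>UNIV. bump_map r (z i) (y j))) = (\<chi> i. copy (\<Sum>j\<in>UNIV. bump_map r (z i) (y' j)))"
    by simp
qed

lemma cluster_sums_unordered:
  "cluster_sums r z (unordered y) $ i = copy (\<Sum>j\<in>UNIV. bump_map r (z i) (y j))"
  by (simp add: unordered.abs_eq cluster_sums.abs_eq)

text \<open>For optimally matched representatives each of the Q components is a sum of Q terms that
  are 3-Lipschitz in the entries.\<close>

lemma cluster_sums_Lipschitz:
  fixes z :: "'q::finite \<Rightarrow> 'h::real_inner"
  assumes r: "0 < r"
  shows "(3 * (real CARD('q))\<^sup>2)-lipschitz_on UNIV (cluster_sums r z)"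
proof (rule lipschitz_onI)
  fix y y' :: "('h, 'q) unordered_tuple"
  obtain u where u: "y = unordered u" by (rule unordered_cases)
  obtain u' where u': "y' = unordered u'" by (rule unordered_cases)
  obtain \<sigma> where \<sigma>: "bij \<sigma>" "dist (unordered u) (unordered u') = L2_set (\<lambda>i. dist (u i) (u' (\<sigma> i))) UNIV"
    by (rule dist_unordered_attained)
  have y': "y' = unordered (u' \<circ> \<sigma>)" by (simp add: u' unordered_comp_bij[OF \<sigma>(1)])
  have d: "dist (u j) (u' (\<sigma> j)) \<le> dist y y'" for j
    using member_le_L2_set[of UNIV j "\<lambda>i. dist (u i) (u' (\<sigma> i))"] \<sigma>(2) u u' by simp
  have "dist (cluster_sums r z y $ i) (cluster_sums r z y' $ i) \<le> real CARD('q) * (3 * dist y y')" for i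
  proof -
    have "dist (cluster_sums r z y $ i) (cluster_sums r z y' $ i)
        = norm (\<Sum>j\<in>UNIV. bump_map r (z i) (u j) - bump_map r (z i) (u' (\<sigma> j)))"
      unfolding u y' cluster_sums_unordered dist_copy by (simp add: dist_norm sum_subtractf)
    also have "\<dots> \<le> (\<Sum>j\<in>(UNIV :: 'q set). 3 * dist y y')"
    proof (rule sum_norm_le)
      fix j
      have "norm (bump_map r (z i) (u j) - bump_map r (z i) (u' (\<sigma> j))) \<le> 3 * dist (u j) (u' (\<sigma> j))"
        unfolding dist_norm by (rule bump_map_Lipschitz[OF r])
      also have "\<dots> \<le> 3 * dist y y'" using d by simp
      finally show "norm (bump_map r (z i) (u j) - bump_map r (z i) (u' (\<sigma> j))) \<le> 3 * dist y y'" .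
    qed
    finally show ?thesis by simp
  qed
  note comp = this
  have "dist (cluster_sums r z y) (cluster_sums r z y')
      \<le> (\<Sum>i\<in>UNIV. dist (cluster_sums r z y $ i) (cluster_sums r z y' $ i))"
    unfolding dist_vec_def by (rule L2_set_le_sum) simp
  also have "\<dots> \<le> (\<Sum>i\<in>(UNIV :: 'q set). real CARD('q) * (3 * dist y y'))" by (intro sum_mono comp)
  finally show "dist (cluster_sums r z y) (cluster_sums r z y') \<le> 3 * (real CARD('q))\<^sup>2 * dist y y'"
    by (simp add: power2_eq_square mult_ac)
qed simp

text \<open>Division by the multiplicity of \<open>z i\<close> undoes the summation when all entries
  in the cluster agree.\<close>

definition from_cluster_sums :: "('q::finite \<Rightarrow> 'h::real_inner) \<Rightarrow> 'h hilbert_copy ^ 'q \<Rightarrow> 'q \<Rightarrow> 'h" where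
  "from_cluster_sums z x i = z i + (1 / real (card {j. z j = z i})) *\<^sub>R uncopy (x $ i)"

text \<open>The map from the values of \<open>y\<close> to those of \<open>z\<close> is onto, hence
  injective when the numbers of values agree, so each cluster is a single value. Separation by 8 r
  puts the entries of the other clusters at distance at least 4 r, where \<open>bump_map\<close>
  vanishes.\<close>

lemma from_cluster_sums:
  fixes z :: "'q::finite \<Rightarrow> 'h::real_inner"
  assumes r: "0 < r" and sep: "\<And>i j. z i \<noteq> z j \<Longrightarrow> 8 * r \<le> dist (z i) (z j)"
    and y: "num_values y = card (range z)" "dist y (unordered z) < r"
  shows "unordered (from_cluster_sums z (cluster_sums r z y)) = y"
proof -
  have "dist (unordered z) y < r" using y(2) by (simp add: dist_commute)
  then obtain u where u: "y = unordered u" "\<And>i. dist (z i) (u i) < r" by (rule unordered_near) blast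
  have sep2: "2 * r \<le> dist (z i) (z j)" if "z i \<noteq> z j" for i j using sep[OF that] r by linarith
  obtain h where h: "\<And>i. h (u i) = z i" using values_matched[of z r u] sep2 u(2) by blast
  have "h ` range u = range z" by (simp add: image_image h)
  moreover have "card (range u) = card (range z)" using y(1) u(1) by (simp add: num_values_unordered)
  ultimately have inj: "inj_on h (range u)" by (intro eq_card_imp_inj_on) auto
  have const: "u j = u i" if "z j = z i" for i j
    using inj_onD[OF inj, of "u j" "u i"] h that by simp
  have "from_cluster_sums z (cluster_sums r z y) i = u i" for i
  proof -
    define S where "S = {j. z j = z i}"
    have S: "finite S" "S \<noteq> {}" by (auto simp: S_def)
    have "(\<Sum>j\<in>UNIV. bump_map r (z i) (u j)) = (\<Sum>j\<in>UNIV. if j \<in> S then u i - z i else 0)"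
    proof (rule sum.cong)
      fix j
      show "bump_map r (z i) (u j) = (if j \<in> S then u i - z i else 0)"
      proof (cases "j \<in> S")
        case True
        then have "z j = z i" by (simp add: S_def)
        moreover from this have "u j = u i" by (rule const)
        moreover have "norm (u i - z i) \<le> 2 * r" using u(2)[of i] r by (simp add: dist_norm norm_minus_commute)
        ultimately show ?thesis using r True by (simp add: bump_map_near)
      next
        case False
        then have "8 * r \<le> dist (z i) (z j)" by (intro sep) (auto simp: S_def)
        then have "4 * r \<le> norm (u j - z i)"
          using u(2)[of j] r dist_triangle[of "z i" "z j" "u j"] by (simp add: dist_norm norm_minus_commute)
        then show ?thesis using r False by (simp add: bump_map_far)
      qed
    qed simp
    also have "\<dots> = (\<Sum>j\<in>S. u i - z i)" by (simp add: sum.If_cases)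
    also have "\<dots> = real (card S) *\<^sub>R (u i - z i)" by (rule sum_constant_scaleR)
    finally have "cluster_sums r z y $ i = copy (real (card S) *\<^sub>R (u i - z i))"
      unfolding u(1) cluster_sums_unordered by simp
    then show ?thesis
      using S by (simp add: from_cluster_sums_def copy_inverse S_def[symmetric])
  qed
  then have "from_cluster_sums z (cluster_sums r z y) = u" by (rule ext)
  then show ?thesis using u(1) by simp
qed

text \<open>A tuple is approximated by one with entries in a countable dense set. Replacing each
  value, and not each entry, by an approximation keeps the number of distinct values.\<close>

lemma countable_chart_cover:
  obtains z :: "nat \<Rightarrow> 'q::finite \<Rightarrow> 'h::{real_inner, second_countable_topology}" and r :: "nat \<Rightarrow> real"
  where "\<And>n. 0 < r n" "\<And>n i j. z n i \<noteq> z n j \<Longrightarrow> 8 * r n \<le> dist (z n i) (z n j)"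
    "\<And>y. \<exists>n. num_values y = card (range (z n)) \<and> dist y (unordered (z n)) < r n"
proof -
  obtain D :: "'h set" where D: "countable D" "\<And>x e. 0 < e \<Longrightarrow> \<exists>d\<in>D. dist d x < e"
    by (rule countable_dense_metric) auto
  define T :: "(('q \<Rightarrow> 'h) \<times> nat) set" where "T = {(z, n). range z \<subseteq> D \<and> (\<forall>i j. z i \<noteq> z j \<longrightarrow> 8 / real (Suc n) \<le> dist (z i) (z j))}"
  have "T \<subseteq> {z :: 'q \<Rightarrow> 'h. range z \<subseteq> D} \<times> UNIV" by (auto simp: T_def)
  then have cT: "countable T"
    by (rule countable_subset) (intro countable_SIGMA countable_dense_tuples D(1), simp)
  have cover: "\<exists>(z, n)\<in>T. num_values y = card (range z) \<and> dist y (unordered z) < 1 / real (Suc n)"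
    for y :: "('h, 'q) unordered_tuple"
  proof -
    obtain y0 where y0: "y = unordered y0" by (rule unordered_cases)
    obtain s where s: "0 < s" "\<And>i j. y0 i \<noteq> y0 j \<Longrightarrow> s \<le> dist (y0 i) (y0 j)"
      by (rule separation[of y0]) blast
    obtain n where n: "inverse (real (Suc n)) < s / 16" using reals_Archimedean[of "s / 16"] s(1) by auto
    \<comment> \<open>Each value moves by less than r, so values at distance s > 16 r stay at least
      14 r apart, more than the 8 r demanded of a chart.\<close>
    define r where "r = 1 / real (Suc n)"
    have r: "0 < r" "16 * r < s" using n by (auto simp: r_def inverse_eq_divide)
    define q where "q = real CARD('q)"
    have q: "1 \<le> q" by (simp add: q_def Suc_leI)
    have rq: "0 < r / (q + 1)" "r / (q + 1) \<le> r" using r q by (auto simp: field_simps)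
    have "\<forall>u. \<exists>d. d \<in> D \<and> dist d u < r / (q + 1)" using D(2)[OF rq(1)] by blast
    then obtain g where g: "\<And>u. g u \<in> D" "\<And>u. dist (g u) u < r / (q + 1)" by metis
    define z where "z i = g (y0 i)" for i
    have sep: "14 * r \<le> dist (z i) (z j)" if "y0 i \<noteq> y0 j" for i j
    proof -
      have "dist (y0 i) (y0 j) \<le> dist (z i) (y0 i) + dist (z i) (z j) + dist (z j) (y0 j)"
        using dist_triangle[of "y0 i" "y0 j" "z i"] dist_triangle[of "z i" "y0 j" "z j"]
        by (simp add: dist_commute)
      then show ?thesis using s(2)[OF that] r rq g(2)[of "y0 i"] g(2)[of "y0 j"] unfolding z_def by linarith
    qed
    have "(z, n) \<in> T"
    proof -
      have "8 / real (Suc n) \<le> dist (z i) (z j)" if "z i \<noteq> z j" for i j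
      proof -
        have "y0 i \<noteq> y0 j" using that by (auto simp: z_def)
        from sep[OF this] r(1) have "8 * r \<le> dist (z i) (z j)" by linarith
        then show ?thesis by (simp add: r_def)
      qed
      then show ?thesis using g(1) by (auto simp: T_def z_def)
    qed
    moreover have "num_values y = card (range z)"
    proof -
      have "inj_on g (range y0)"
      proof (rule inj_onI)
        fix a b assume "a \<in> range y0" "b \<in> range y0" "g a = g b"
        then obtain i j where ij: "a = y0 i" "b = y0 j" "z i = z j" by (auto simp: z_def)
        then show "a = b" using sep[of i j] r(1) by auto
      qed
      moreover have "range z = g ` range y0" by (auto simp: z_def)
      ultimately show ?thesis unfolding y0 num_values_unordered by (simp add: card_image)
    qed
    moreover have "dist y (unordered z) < r"
    proof -
      have "dist y (unordered z) \<le> (\<Sum>i\<in>UNIV. dist (y0 i) (z i))"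
        unfolding y0 by (rule order_trans[OF dist_unordered_le L2_set_le_sum]) simp
      also have "\<dots> \<le> (\<Sum>i\<in>(UNIV :: 'q set). r / (q + 1))"
        using g(2) by (intro sum_mono less_imp_le) (simp add: z_def dist_commute)
      also have "\<dots> = q * (r / (q + 1))" by (simp add: q_def)
      also have "\<dots> < r" using r q by (simp add: field_simps)
      finally show ?thesis .
    qed
    ultimately show ?thesis unfolding r_def by blast
  qed
  have "T \<noteq> {}" using cover[of undefined] by auto
  define Z where "Z k = from_nat_into T k" for k
  have Z: "Z k \<in> T" for k unfolding Z_def using \<open>T \<noteq> {}\<close> by (rule from_nat_into)
  show ?thesis
  proof (rule that[of "\<lambda>k. 1 / real (Suc (snd (Z k)))" "\<lambda>k. fst (Z k)"])
    show "8 * (1 / real (Suc (snd (Z k)))) \<le> dist (fst (Z k) i) (fst (Z k) j)" if "fst (Z k) i \<noteq> fst (Z k) j" for k i j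
      using Z[of k] that by (auto simp: T_def)
    fix y :: "('h, 'q) unordered_tuple"
    obtain z n where zn: "(z, n) \<in> T" "num_values y = card (range z)" "dist y (unordered z) < 1 / real (Suc n)"
      using cover[of y] by blast
    obtain k where "Z k = (z, n)" unfolding Z_def using from_nat_into_surj[OF cT zn(1)] by blast
    then show "\<exists>k. num_values y = card (range (fst (Z k))) \<and> dist y (unordered (fst (Z k))) < 1 / real (Suc (snd (Z k)))"
      using zn by (intro exI[of _ k]) simp
  qed simp
qed

section \<open>Uniqueness of the approximate derivative\<close>

text \<open>The ball of radius \<eta> t about a + t v occupies the fixed proportion \<open>k\<close>
  of the ball of radius t (|v| + \<eta>) about \<open>a\<close>, so a set of density zero cannot
  contain it for small t.\<close>

lemma density_zero_at_avoided:
  fixes a v :: "real^'m::finite"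
  assumes S: "density_zero_at S a" "S \<in> sets lebesgue" and \<eta>: "0 < \<eta>"
  shows "\<exists>t0>0. \<forall>t. 0 < t \<longrightarrow> t < t0 \<longrightarrow> (\<exists>x. x \<notin> S \<and> norm (x - (a + t *\<^sub>R v)) \<le> \<eta> * t)"
proof -
  define R where "R = norm v + \<eta>"
  have R: "0 < R" using \<eta> by (simp add: R_def add_nonneg_pos)
  define k where "k = (\<eta> / R) ^ CARD('m)"
  have k: "0 < k" using \<eta> R by (simp add: k_def)
  obtain r0 where r0: "0 < r0" "\<And>r. 0 < r \<Longrightarrow> r < r0 \<Longrightarrow>
    emeasure lebesgue (S \<inter> cball a r) \<le> ennreal (k / 2) * emeasure lborel (cball a r)"
    using density_zero_atD[OF S(1) _ S(2), of "k / 2"] k by auto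
  show ?thesis
  proof (intro exI[of _ "r0 / R"] conjI allI impI)
    fix t assume t: "0 < t" "t < r0 / R"
    have tR: "0 < t * R" "t * R < r0" using t R by (auto simp: pos_less_divide_eq)
    show "\<exists>x. x \<notin> S \<and> norm (x - (a + t *\<^sub>R v)) \<le> \<eta> * t"
    proof (rule ccontr)
      assume "\<not> ?thesis"
      then have sub: "cball (a + t *\<^sub>R v) (\<eta> * t) \<subseteq> S"
        by (auto simp: dist_norm norm_minus_commute)
      have "cball (a + t *\<^sub>R v) (\<eta> * t) \<subseteq> cball a (t * R)"
      proof
        fix x assume "x \<in> cball (a + t *\<^sub>R v) (\<eta> * t)"
        then have "norm (x - (a + t *\<^sub>R v)) \<le> \<eta> * t" by (simp add: dist_norm norm_minus_commute)
        moreover have "norm (x - a) \<le> norm (x - (a + t *\<^sub>R v)) + norm (t *\<^sub>R v)"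
          using norm_triangle_ineq[of "x - (a + t *\<^sub>R v)" "t *\<^sub>R v"] by simp
        ultimately show "x \<in> cball a (t * R)"
          using t by (simp add: R_def dist_norm norm_minus_commute algebra_simps)
      qed
      with sub have "cball (a + t *\<^sub>R v) (\<eta> * t) \<subseteq> S \<inter> cball a (t * R)" by blast
      then have "emeasure lebesgue (cball (a + t *\<^sub>R v) (\<eta> * t)) \<le> emeasure lebesgue (S \<inter> cball a (t * R))"
        using S(2) by (intro emeasure_mono) auto
      also have "\<dots> \<le> ennreal (k / 2) * emeasure lborel (cball a (t * R))" using tR by (intro r0(2))
      also have "emeasure lebesgue (cball (a + t *\<^sub>R v) (\<eta> * t)) = emeasure lborel (cball (a + t *\<^sub>R v) (\<eta> / R * (t * R)))"
        using R by simp
      also have "\<dots> = ennreal k * emeasure lborel (cball a (t * R))"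
        using \<eta> R tR by (subst emeasure_cball_scale[of _ _ _ a]) (auto simp: k_def)
      finally have "ennreal k \<le> ennreal (k / 2)"
        using emeasure_cball_pos_finite[OF tR(1), of a]
        by (simp add: mult.commute[of _ "emeasure lborel (cball a (t * R))"] ennreal_mult_le_mult_iff)
      then show False using k by (simp add: ennreal_le_iff)
    qed
  qed (use r0 R in auto)
qed

text \<open>Such a sequence realises the direction \<open>v\<close> while avoiding bad sets whose
  tolerance 1 / (n + 1) tends to zero; along it, limits can be taken as for ordinary
  differentiability.\<close>

lemma blow_up_sequence:
  fixes a v :: "real^'m::finite"
  assumes S: "\<And>\<epsilon>. 0 < \<epsilon> \<Longrightarrow> density_zero_at (S \<epsilon>) a" "\<And>\<epsilon>. S \<epsilon> \<in> sets lebesgue"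
  obtains t x where "\<And>n. 0 < t n" "\<And>n. x n \<notin> S (1 / real (Suc n))" "t \<longlonglongrightarrow> 0"
    "(\<lambda>n. (1 / t n) *\<^sub>R (x n - a)) \<longlonglongrightarrow> v"
proof -
  have "\<exists>t x. 0 < t \<and> t < 1 / real (Suc n) \<and> x \<notin> S (1 / real (Suc n)) \<and>
      norm (x - (a + t *\<^sub>R v)) \<le> 1 / real (Suc n) * t" for n
  proof -
    obtain t0 where t0: "0 < t0" "\<And>t. 0 < t \<Longrightarrow> t < t0 \<Longrightarrow>
        \<exists>x. x \<notin> S (1 / real (Suc n)) \<and> norm (x - (a + t *\<^sub>R v)) \<le> 1 / real (Suc n) * t"
      using density_zero_at_avoided[OF S(1,2), of "1 / real (Suc n)" "1 / real (Suc n)" v] by auto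
    define u where "u = min t0 (1 / real (Suc n))"
    have u: "0 < u" "u \<le> t0" "u \<le> 1 / real (Suc n)" using t0(1) by (simp_all add: u_def)
    define t where "t = u / 2"
    have t: "0 < t" "t < t0" "t < 1 / real (Suc n)" using u unfolding t_def by linarith+
    then show ?thesis using t0(2)[of t] by blast
  qed
  then obtain t x where tx: "\<And>n. 0 < t n" "\<And>n. t n < 1 / real (Suc n)" "\<And>n. x n \<notin> S (1 / real (Suc n))"
    "\<And>n. norm (x n - (a + t n *\<^sub>R v)) \<le> 1 / real (Suc n) * t n"
    by metis
  have lim0: "(\<lambda>n. 1 / real (Suc n)) \<longlonglongrightarrow> 0" by (rule LIMSEQ_Suc[OF lim_1_over_n])
  have "t \<longlonglongrightarrow> 0"
    using tx(1,2) by (intro tendsto_sandwich[OF _ _ tendsto_const lim0] always_eventually) (auto intro: less_imp_le)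
  moreover have "(\<lambda>n. (1 / t n) *\<^sub>R (x n - a)) \<longlonglongrightarrow> v"
  proof (rule LIM_zero_cancel, rule Lim_null_comparison[OF always_eventually lim0], rule allI)
    fix n
    have "(1 / t n) *\<^sub>R (x n - a) - v = (1 / t n) *\<^sub>R (x n - (a + t n *\<^sub>R v))"
      using tx(1)[of n] by (simp add: scaleR_diff_right scaleR_add_right)
    also have "norm \<dots> = norm (x n - (a + t n *\<^sub>R v)) / t n" using tx(1)[of n] by simp
    also have "\<dots> \<le> 1 / real (Suc n)" using tx(1,4)[of n] by (simp add: pos_divide_le_eq)
    finally show "norm ((1 / t n) *\<^sub>R (x n - a) - v) \<le> 1 / real (Suc n)" .
  qed
  ultimately show ?thesis using tx by (intro that[of t x]) auto
qed

text \<open>The density at \<open>a\<close> depends only on a neighbourhood and the bad sets are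
  Borel, so an open domain may be replaced by the whole space.\<close>

lemma approx_affine_open:
  fixes f :: "real^'m::finite \<Rightarrow> ('h::{real_inner, second_countable_topology}, 'q::finite) unordered_tuple"
  assumes U: "open U" "a \<in> U" and f: "f \<in> borel_measurable borel"
  shows "approx_affine U f a A \<longleftrightarrow> approx_affine UNIV f a A"
    and "affine_map (A i) \<Longrightarrow> continuous_on UNIV (A i)"
    and "(\<And>i. affine_map (A i)) \<Longrightarrow>
      {x. \<epsilon> * norm (x - a) < dist (f x) (unordered (\<lambda>i. A i x))} \<in> sets borel"
proof -
  have cont: "continuous_on UNIV (A i)" if "affine_map (A i)" for A :: "'q \<Rightarrow> real^'m \<Rightarrow> 'h" and i
  proof -
    have "bounded_linear (\<lambda>x. A i x - A i 0)"
      using that by (simp add: affine_map_def linear_conv_bounded_linear)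
    then have "continuous_on UNIV (\<lambda>x. (A i x - A i 0) + A i 0)"
      by (intro continuous_on_add continuous_on_const linear_continuous_on)
    then show ?thesis by simp
  qed
  have meas: "{x. \<epsilon> * norm (x - a) < dist (f x) (unordered (\<lambda>i. A i x))} \<in> sets borel"
    if A: "\<And>i. affine_map (A i)" for A \<epsilon>
  proof -
    have "continuous_on UNIV (\<lambda>x. unordered (\<lambda>i. A i x))"
      unfolding continuous_on_def
    proof
      fix x
      have "isCont (A i) x" for i using cont[of A i, OF A] by (simp add: continuous_on_eq_continuous_at)
      then have "((\<lambda>y. \<Sum>i\<in>UNIV. dist (A i y) (A i x)) \<longlongrightarrow> (\<Sum>i\<in>(UNIV :: 'q set). 0)) (at x)"
        by (intro tendsto_sum tendsto_dist_iff[THEN iffD1]) (simp add: isCont_def)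
      then have lim: "((\<lambda>y. \<Sum>i\<in>UNIV. dist (A i y) (A i x)) \<longlongrightarrow> 0) (at x)" by simp
      have "dist (unordered (\<lambda>i. A i y)) (unordered (\<lambda>i. A i x)) \<le> (\<Sum>i\<in>UNIV. dist (A i y) (A i x))" for y
        by (rule order_trans[OF dist_unordered_le L2_set_le_sum]) simp
      then have "((\<lambda>y. dist (unordered (\<lambda>i. A i y)) (unordered (\<lambda>i. A i x))) \<longlongrightarrow> 0) (at x)"
        by (intro tendsto_sandwich[OF _ _ tendsto_const lim] always_eventually allI zero_le_dist)
      then have "((\<lambda>y. unordered (\<lambda>i. A i y)) \<longlongrightarrow> unordered (\<lambda>i. A i x)) (at x)"
        by (rule tendsto_dist_iff[THEN iffD2])
      then show "((\<lambda>y. unordered (\<lambda>i. A i y)) \<longlongrightarrow> unordered (\<lambda>i. A i x)) (at x within UNIV)" by simp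
    qed
    note this[THEN borel_measurable_continuous_onI, measurable] f[measurable]
    have "{x \<in> space borel. \<epsilon> * norm (x - a) < dist (f x) (unordered (\<lambda>i. A i x))} \<in> sets borel"
      by measurable
    then show ?thesis by simp
  qed
  show "affine_map (A i) \<Longrightarrow> continuous_on UNIV (A i)" by (rule cont)
  show "(\<And>i. affine_map (A i)) \<Longrightarrow>
      {x. \<epsilon> * norm (x - a) < dist (f x) (unordered (\<lambda>i. A i x))} \<in> sets borel" by (rule meas)
  obtain r where r: "0 < r" "cball a r \<subseteq> U" using U open_contains_cball by blast
  have "density_zero_at {x\<in>U. dist (f x) (unordered (\<lambda>i. A i x)) > \<epsilon> * norm (x - a)} a
      \<longleftrightarrow> density_zero_at {x\<in>UNIV. dist (f x) (unordered (\<lambda>i. A i x)) > \<epsilon> * norm (x - a)} a"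
    if A: "\<And>i. affine_map (A i)" for \<epsilon>
  proof -
    have m1: "{x. \<epsilon> * norm (x - a) < dist (f x) (unordered (\<lambda>i. A i x))} \<in> sets lebesgue"
      using meas[OF A] by (intro sets_completionI_sets) simp
    have "{x\<in>U. \<epsilon> * norm (x - a) < dist (f x) (unordered (\<lambda>i. A i x))}
        = U \<inter> {x. \<epsilon> * norm (x - a) < dist (f x) (unordered (\<lambda>i. A i x))}" by auto
    also have "\<dots> \<in> sets lebesgue" using m1 U by (intro sets.Int) auto
    finally have m2: "{x\<in>U. \<epsilon> * norm (x - a) < dist (f x) (unordered (\<lambda>i. A i x))} \<in> sets lebesgue" .
    show ?thesis
    proof
      assume "density_zero_at {x\<in>U. dist (f x) (unordered (\<lambda>i. A i x)) > \<epsilon> * norm (x - a)} a"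
      then show "density_zero_at {x\<in>UNIV. dist (f x) (unordered (\<lambda>i. A i x)) > \<epsilon> * norm (x - a)} a"
        by (rule density_zero_at_mono[OF _ m2 r(1)]) (use r(2) in auto)
    next
      assume "density_zero_at {x\<in>UNIV. dist (f x) (unordered (\<lambda>i. A i x)) > \<epsilon> * norm (x - a)} a"
      then show "density_zero_at {x\<in>U. dist (f x) (unordered (\<lambda>i. A i x)) > \<epsilon> * norm (x - a)} a"
        by (rule density_zero_at_mono[OF _ _ r(1)]) (use m1 in auto)
    qed
  qed
  then show "approx_affine U f a A \<longleftrightarrow> approx_affine UNIV f a A"
    unfolding approx_affine_def by blast
qed

lemma affine_map_diff:
  assumes "affine_map A"
  shows "A x - A y = A (x - y) - A 0"
proof -
  have "linear (\<lambda>x. A x - A 0)" using assms by (simp add: affine_map_def)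
  from linear_diff[OF this, of x y] show ?thesis by simp
qed

lemma affine_map_bounded_linear:
  fixes A :: "real^'m::finite \<Rightarrow> 'h::real_normed_vector"
  shows "affine_map A \<Longrightarrow> bounded_linear (\<lambda>x. A x - A 0)"
  by (simp add: affine_map_def linear_conv_bounded_linear)

lemma infinite_constant_subsequence:
  fixes \<sigma> :: "nat \<Rightarrow> 'a::finite"
  obtains s r where "strict_mono (r :: nat \<Rightarrow> nat)" "\<And>n. \<sigma> (r n) = s"
proof -
  obtain s where s: "infinite (\<sigma> -` {s})"
    using inf_img_fin_dom[of \<sigma> UNIV] by auto
  show ?thesis
  proof (rule that[of "enumerate (\<sigma> -` {s})" s])
    show "strict_mono (enumerate (\<sigma> -` {s}))" using s by (rule strict_mono_enumerate)
    show "\<sigma> (enumerate (\<sigma> -` {s}) n) = s" for n using enumerate_in_set[OF s, of n] by simp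
  qed
qed

text \<open>
  For matched affine maps the permutation realising the distance may be assumed constant along the
  blow-up sequence.
\<close>

lemma blow_up_matching:
  fixes A B :: "'q::finite \<Rightarrow> real^'m::finite \<Rightarrow> 'h::real_normed_vector"
  assumes A: "\<And>i. affine_map (A i)" and B: "\<And>i. affine_map (B i)"
    and t: "\<And>n. 0 < t n" "t \<longlonglongrightarrow> 0" and x: "(\<lambda>n. (1 / t n) *\<^sub>R (x n - a)) \<longlonglongrightarrow> v"
    and le: "\<And>n. dist (unordered (\<lambda>i. A i (x n))) (unordered (\<lambda>i. B i (x n))) \<le> e n * norm (x n - a)"
    and e: "e \<longlonglongrightarrow> L"
  obtains \<sigma> where "bij \<sigma>" "\<And>i. A i a = B (\<sigma> i) a"
    "\<And>i. norm ((A i v - A i 0) - (B (\<sigma> i) v - B (\<sigma> i) 0)) \<le> L * norm v"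
proof -
  have "\<exists>\<sigma>. bij \<sigma> \<and> dist (unordered (\<lambda>i. A i (x n))) (unordered (\<lambda>i. B i (x n)))
      = L2_set (\<lambda>i. dist (A i (x n)) (B (\<sigma> i) (x n))) UNIV" for n
    using dist_unordered_attained[of "\<lambda>i. A i (x n)" "\<lambda>i. B i (x n)"] by metis
  then obtain \<sigma>' where \<sigma>': "\<And>n. bij (\<sigma>' n)"
    "\<And>n. dist (unordered (\<lambda>i. A i (x n))) (unordered (\<lambda>i. B i (x n)))
      = L2_set (\<lambda>i. dist (A i (x n)) (B (\<sigma>' n i) (x n))) UNIV" by metis
  obtain \<sigma> r where r: "strict_mono (r :: nat \<Rightarrow> nat)" "\<And>n. \<sigma>' (r n) = \<sigma>"
    by (rule infinite_constant_subsequence[of \<sigma>']) (rule that; assumption)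
  have \<sigma>: "bij \<sigma>" using \<sigma>'(1)[of "r 0"] r(2) by simp
  define y where "y n = (1 / t n) *\<^sub>R (x n - a)" for n
  have yr: "(\<lambda>n. y (r n)) \<longlonglongrightarrow> v" and tr: "(\<lambda>n. t (r n)) \<longlonglongrightarrow> 0" and er: "(\<lambda>n. e (r n)) \<longlonglongrightarrow> L"
    using LIMSEQ_subseq_LIMSEQ[OF x r(1)] LIMSEQ_subseq_LIMSEQ[OF t(2) r(1)] LIMSEQ_subseq_LIMSEQ[OF e r(1)]
    by (simp_all add: y_def comp_def)
  have xy: "x n - a = t n *\<^sub>R y n" for n using t(1)[of n] by (simp add: y_def)
  have main: "A i a = B (\<sigma> i) a \<and> norm ((A i v - A i 0) - (B (\<sigma> i) v - B (\<sigma> i) 0)) \<le> L * norm v" for i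
  proof -
    define D where "D h = (A i h - A i 0) - (B (\<sigma> i) h - B (\<sigma> i) 0)" for h
    have D: "bounded_linear D"
      unfolding D_def by (intro bounded_linear_sub affine_map_bounded_linear A B)
    have lim: "(\<lambda>n. D (y (r n))) \<longlonglongrightarrow> D v" by (rule bounded_linear.tendsto[OF D yr])
    define d where "d = A i a - B (\<sigma> i) a"
    have le2: "norm (d + t (r n) *\<^sub>R D (y (r n))) \<le> e (r n) * (t (r n) * norm (y (r n)))" for n
    proof -
      let ?x = "x (r n)"
      have "A i ?x - B (\<sigma> i) ?x = d + ((A i ?x - A i a) - (B (\<sigma> i) ?x - B (\<sigma> i) a))" by (simp add: d_def)
      also have "(A i ?x - A i a) - (B (\<sigma> i) ?x - B (\<sigma> i) a) = D (?x - a)"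
        using affine_map_diff[OF A, of i ?x a] affine_map_diff[OF B, of "\<sigma> i" ?x a] by (simp add: D_def)
      also have "\<dots> = t (r n) *\<^sub>R D (y (r n))"
        unfolding xy by (rule linear_simps(5)[OF D])
      finally have "norm (d + t (r n) *\<^sub>R D (y (r n))) = dist (A i ?x) (B (\<sigma> i) ?x)" by (simp add: dist_norm)
      also have "\<dots> \<le> dist (unordered (\<lambda>i. A i ?x)) (unordered (\<lambda>i. B i ?x))"
        unfolding \<sigma>'(2) r(2) using member_le_L2_set[of UNIV i "\<lambda>i. dist (A i ?x) (B (\<sigma> i) ?x)"] by simp
      also have "\<dots> \<le> e (r n) * norm (?x - a)" by (rule le)
      also have "norm (?x - a) = t (r n) * norm (y (r n))" unfolding xy using t(1)[of "r n"] by simp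
      finally show ?thesis .
    qed
    \<comment> \<open>As t tends to zero the linear parts disappear, so the values at
      \<open>a\<close> agree; after that the inequality can be divided by t.\<close>
    have "(\<lambda>n. norm (d + t (r n) *\<^sub>R D (y (r n)))) \<longlonglongrightarrow> norm (d + 0 *\<^sub>R D v)"
      by (intro tendsto_intros tr lim)
    moreover have "(\<lambda>n. e (r n) * (t (r n) * norm (y (r n)))) \<longlonglongrightarrow> L * (0 * norm v)"
      by (intro tendsto_intros tr yr er)
    ultimately have "norm (d + 0 *\<^sub>R D v) \<le> L * (0 * norm v)"
      using le2 by (intro LIMSEQ_le) auto
    then have d: "d = 0" by simp
    have "norm (D (y (r n))) \<le> e (r n) * norm (y (r n))" for n
    proof -
      have "t (r n) * norm (D (y (r n))) \<le> t (r n) * (e (r n) * norm (y (r n)))"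
        using le2[of n] d t(1)[of "r n"] by (simp add: mult_ac)
      then show ?thesis using t(1)[of "r n"] by simp
    qed
    moreover have "(\<lambda>n. e (r n) * norm (y (r n))) \<longlonglongrightarrow> L * norm v" by (intro tendsto_intros er yr)
    ultimately have "norm (D v) \<le> L * norm v"
      using lim by (intro LIMSEQ_le[OF tendsto_norm]) auto
    then show ?thesis using d by (simp add: d_def D_def)
  qed
  show ?thesis by (rule that[OF \<sigma>]) (use main in auto)
qed

text \<open>For each direction \<open>v\<close> a blow-up yields a permutation that matches the
  linear parts at \<open>v\<close> and may depend on \<open>v\<close>. The space is thus a finite
  union of subspaces \<open>N \<sigma>\<close>; proper subspaces are null sets, so one of them is
  everything and a single permutation serves all directions.\<close>

lemma approx_affine_unique:
  fixes f :: "real^'m::finite \<Rightarrow> ('h::{real_inner, second_countable_topology}, 'q::finite) unordered_tuple"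
  assumes f: "f \<in> borel_measurable borel" and A: "approx_affine UNIV f a A" and B: "approx_affine UNIV f a B"
  shows "unordered (\<lambda>i x. A i x - A i 0) = unordered (\<lambda>i x. B i x - B i 0)"
    and "unordered (\<lambda>i. A i a) = unordered (\<lambda>i. B i a)"
proof -
  define S where "S \<epsilon> = {x. \<epsilon> * norm (x - a) < dist (f x) (unordered (\<lambda>i. A i x))}
      \<union> {x. \<epsilon> * norm (x - a) < dist (f x) (unordered (\<lambda>i. B i x))}" for \<epsilon>
  have aff: "\<And>i. affine_map (A i)" "\<And>i. affine_map (B i)" using A B by (auto simp: approx_affine_def)
  have m: "{x. \<epsilon> * norm (x - a) < dist (f x) (unordered (\<lambda>i. A i x))} \<in> sets lebesgue"
    "{x. \<epsilon> * norm (x - a) < dist (f x) (unordered (\<lambda>i. B i x))} \<in> sets lebesgue" for \<epsilon>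
    using approx_affine_open(3)[OF open_UNIV UNIV_I f] aff by (auto intro!: sets_completionI_sets)
  have S: "density_zero_at (S \<epsilon>) a" if "0 < \<epsilon>" for \<epsilon>
    unfolding S_def using A B that m
    by (intro density_zero_at_Un) (auto simp: approx_affine_def)
  have Sm: "S \<epsilon> \<in> sets lebesgue" for \<epsilon> unfolding S_def using m by auto
  have "\<exists>\<sigma>. bij \<sigma> \<and> (\<forall>i. A i a = B (\<sigma> i) a) \<and> (\<forall>i. A i v - A i 0 = B (\<sigma> i) v - B (\<sigma> i) 0)" for v
  proof -
    obtain t x where tx: "\<And>n. 0 < t n" "\<And>n. x n \<notin> S (1 / real (Suc n))" "t \<longlonglongrightarrow> 0"
      "(\<lambda>n. (1 / t n) *\<^sub>R (x n - a)) \<longlonglongrightarrow> v"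
      using blow_up_sequence[of S a, OF S Sm] by blast
    have le: "dist (unordered (\<lambda>i. A i (x n))) (unordered (\<lambda>i. B i (x n))) \<le> (2 * (1 / real (Suc n))) * norm (x n - a)" for n
      using tx(2)[of n] dist_triangle3[of "unordered (\<lambda>i. A i (x n))" "unordered (\<lambda>i. B i (x n))" "f (x n)"]
      by (auto simp: S_def not_less)
    have e: "(\<lambda>n. 2 * (1 / real (Suc n))) \<longlonglongrightarrow> 2 * 0" by (intro tendsto_intros LIMSEQ_Suc[OF lim_1_over_n])
    obtain \<sigma> where "bij \<sigma>" "\<And>i. A i a = B (\<sigma> i) a"
      "\<And>i. norm ((A i v - A i 0) - (B (\<sigma> i) v - B (\<sigma> i) 0)) \<le> 2 * 0 * norm v"
      by (rule blow_up_matching[OF aff tx(1,3,4) le e]) (rule that; assumption)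
    then show ?thesis by (intro exI[of _ \<sigma>]) auto
  qed
  note ex = this
  define N where "N \<sigma> = {v. \<forall>i. A i v - A i 0 = B (\<sigma> i) v - B (\<sigma> i) 0}" for \<sigma>
  define P where "P = {\<sigma>. bij \<sigma> \<and> (\<forall>i. A i a = B (\<sigma> i) a)}"
  have cov: "UNIV = (\<Union>\<sigma>\<in>P. N \<sigma>)" using ex by (auto simp: N_def P_def)
  have sub: "subspace (N \<sigma>)" for \<sigma>
  proof -
    define D where "D i v = (A i v - A i 0) - (B (\<sigma> i) v - B (\<sigma> i) 0)" for i v
    have lin: "linear (D i)" for i
      unfolding D_def using aff(1)[of i] aff(2)[of "\<sigma> i"]
      by (simp only: affine_map_def linear_compose_sub)
    have "N \<sigma> = {v. \<forall>i. D i v = 0}" by (auto simp: N_def D_def)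
    then show ?thesis
      by (simp add: subspace_def linear_add[OF lin] linear_scale[OF lin] linear_0[OF lin])
  qed
  have "\<exists>\<sigma>\<in>P. N \<sigma> = UNIV"
  proof (rule ccontr)
    assume *: "\<not> ?thesis"
    have "negligible (N \<sigma>)" if "\<sigma> \<in> P" for \<sigma>
    proof (rule negligible_lowdim)
      have "dim (N \<sigma>) \<noteq> DIM(real^'m)"
        using * that sub[of \<sigma>] by (metis dim_eq_full span_eq_iff)
      then show "dim (N \<sigma>) < DIM(real^'m)" using dim_subset_UNIV[of "N \<sigma>"] by simp
    qed
    then have "negligible (\<Union>\<sigma>\<in>P. N \<sigma>)" by (intro negligible_Union) auto
    then show False using cov non_negligible_UNIV by metis
  qed
  then obtain \<sigma> where \<sigma>: "bij \<sigma>" "\<And>i. A i a = B (\<sigma> i) a" "N \<sigma> = UNIV" by (auto simp: P_def)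
  have "(\<lambda>i x. A i x - A i 0) = (\<lambda>i x. B i x - B i 0) \<circ> \<sigma>"
    using \<sigma>(3) by (auto simp: N_def fun_eq_iff set_eq_iff)
  then show "unordered (\<lambda>i x. A i x - A i 0) = unordered (\<lambda>i x. B i x - B i 0)"
    by (simp add: unordered_comp_bij[OF \<sigma>(1)])
  have "(\<lambda>i. A i a) = (\<lambda>i. B i a) \<circ> \<sigma>" using \<sigma>(2) by auto
  then show "unordered (\<lambda>i. A i a) = unordered (\<lambda>i. B i a)"
    by (simp add: unordered_comp_bij[OF \<sigma>(1)])
qed

section \<open>The norm of the derivative and difference quotients of Lipschitz maps\<close>

lemma abs_deriv_eq:
  fixes f :: "real^'m::finite \<Rightarrow> ('h::{real_inner, second_countable_topology}, 'q::finite) unordered_tuple"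
  assumes f: "f \<in> borel_measurable borel" and U: "open U" "a \<in> U" and A: "approx_affine UNIV f a A"
  shows "abs_deriv U f a = sqrt (\<Sum>i\<in>UNIV. \<Sum>j\<in>UNIV. (norm (A i (axis j 1) - A i 0))\<^sup>2)"
proof -
  note eq = approx_affine_open(1)[OF U f]
  have "approx_deriv U f a = unordered (\<lambda>i x. A i x - A i 0)"
    unfolding approx_deriv_def eq
  proof (rule the_equality)
    show "\<exists>B. approx_affine UNIV f a B \<and> unordered (\<lambda>i x. A i x - A i 0) = unordered (\<lambda>i x. B i x - B i 0)"
      using A by blast
    show "D = unordered (\<lambda>i x. A i x - A i 0)"
      if "\<exists>B. approx_affine UNIV f a B \<and> D = unordered (\<lambda>i x. B i x - B i 0)" for D
      using that approx_affine_unique(1)[OF f _ A] by blast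
  qed
  moreover have "approx_differentiable U f a" using A eq by (auto simp: approx_differentiable_def)
  moreover have "deriv_norm (unordered (\<lambda>i x. A i x - A i 0)) = sqrt (\<Sum>i\<in>UNIV. \<Sum>j\<in>UNIV. (norm (A i (axis j 1) - A i 0))\<^sup>2)"
    by (simp add: unordered.abs_eq deriv_norm.abs_eq)
  ultimately show ?thesis by (simp add: abs_deriv_def)
qed

lemma L2_set_column_le_abs_deriv:
  fixes f :: "real^'m::finite \<Rightarrow> ('h::{real_inner, second_countable_topology}, 'q::finite) unordered_tuple"
  assumes "f \<in> borel_measurable borel" "open U" "a \<in> U" "approx_affine UNIV f a A"
  shows "L2_set (\<lambda>i. norm (A i (axis j 1) - A i 0)) UNIV \<le> abs_deriv U f a"
  unfolding abs_deriv_eq[OF assms] L2_set_def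
  by (intro real_sqrt_le_mono sum_mono member_le_sum[of j UNIV "\<lambda>j. (norm (A _ (axis j 1) - A _ 0))\<^sup>2"]) auto

text \<open>Upper limits are subadditive: the quotients are eventually below their upper limits plus
  \<open>c\<close>, and \<open>c\<close> is chosen so that the resulting error C (2 c) is at most
  \<open>e\<close>. The lemma transfers energies to compositions and to distances.\<close>

lemma dir_lip_dominated:
  fixes F :: "real^'m::finite \<Rightarrow> 'b::metric_space" and G :: "real^'m \<Rightarrow> 'c::metric_space" and H :: "real^'m \<Rightarrow> 'd::metric_space"
  assumes F: "L-lipschitz_on UNIV F" and G: "M-lipschitz_on UNIV G" and C: "0 \<le> C"
    and le: "\<And>x y. dist (H y) (H x) \<le> C * (dist (F y) (F x) + dist (G y) (G x))"
  shows "dir_lip H x \<le> C * (dir_lip F x + dir_lip G x)"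
proof -
  define q where "q K i n = ennreal (real (Suc n) * K i n)" for K :: "'m \<Rightarrow> nat \<Rightarrow> real" and i n
  define f where "f i n = dist (F (x + axis i (1 / real (Suc n)))) (F x)" for i n
  define g where "g i n = dist (G (x + axis i (1 / real (Suc n)))) (G x)" for i n
  define h where "h i n = dist (H (x + axis i (1 / real (Suc n)))) (H x)" for i n
  have fin: "limsup (q f i) < top" "limsup (q g i) < top" for i
    unfolding q_def[abs_def] f_def g_def
    using le_less_trans[OF limsup_dir_quotient_le[OF F] ennreal_less_top]
      le_less_trans[OF limsup_dir_quotient_le[OF G] ennreal_less_top] by simp_all
  have main: "limsup (q h i) \<le> ennreal C * (limsup (q f i) + limsup (q g i))" for i
  proof (rule ennreal_le_epsilon)
    fix e :: real assume e: "0 < e"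
    define c where "c = e / (2 * (C + 1))"
    have c: "0 < c" "C * (2 * c) \<le> e"
    proof -
      show "0 < c" using e C by (simp add: c_def)
      have "C * (2 * c) = e * (C / (C + 1))" using C by (simp add: c_def field_simps)
      also have "\<dots> \<le> e * 1" using e C by (intro mult_left_mono) auto
      finally show "C * (2 * c) \<le> e" by simp
    qed
    have lt: "l < l + ennreal c" if "l < top" for l
      using ennreal_add_left_cancel_less[of l 0 "ennreal c"] that c(1) by (simp add: top.not_eq_extremum)
    have "eventually (\<lambda>n. q f i n < limsup (q f i) + ennreal c) sequentially"
      "eventually (\<lambda>n. q g i n < limsup (q g i) + ennreal c) sequentially"
      using lt[OF fin(1)] lt[OF fin(2)] by (intro Limsup_lessD; simp)+
    then have "eventually (\<lambda>n. q h i n \<le> ennreal C * (limsup (q f i) + limsup (q g i)) + ennreal e) sequentially"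
    proof eventually_elim
      case (elim n)
      have "real (Suc n) * h i n \<le> real (Suc n) * (C * (f i n + g i n))"
        unfolding h_def f_def g_def by (intro mult_left_mono le) auto
      also have "\<dots> = C * (real (Suc n) * f i n + real (Suc n) * g i n)"
        by (simp only: distrib_left mult.left_commute)
      finally have "q h i n \<le> ennreal (C * (real (Suc n) * f i n + real (Suc n) * g i n))"
        unfolding q_def by (rule ennreal_leI)
      also have "\<dots> = ennreal C * (q f i n + q g i n)"
        unfolding q_def f_def g_def using C
        by (subst ennreal_mult') (simp_all only: ennreal_plus mult_nonneg_nonneg of_nat_0_le_iff zero_le_dist)
      also have "\<dots> \<le> ennreal C * ((limsup (q f i) + ennreal c) + (limsup (q g i) + ennreal c))"
        using elim[THEN less_imp_le] by (intro mult_left_mono add_mono zero_le)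
      also have "\<dots> = ennreal C * (limsup (q f i) + limsup (q g i)) + ennreal C * (ennreal c + ennreal c)"
        by (simp add: distrib_left add_ac)
      also have "ennreal C * (ennreal c + ennreal c) = ennreal (C * (2 * c))"
        using C c(1) by (simp add: ennreal_mult[symmetric] flip: ennreal_plus)
      also have "ennreal C * (limsup (q f i) + limsup (q g i)) + ennreal (C * (2 * c))
          \<le> ennreal C * (limsup (q f i) + limsup (q g i)) + ennreal e"
        using c(2) by (intro add_mono ennreal_leI) auto
      finally show ?case .
    qed
    then show "limsup (q h i) \<le> ennreal C * (limsup (q f i) + limsup (q g i)) + ennreal e"
      by (rule Limsup_bounded)
  qed
  have "(\<Sum>i\<in>UNIV. limsup (q h i)) \<le> (\<Sum>i\<in>UNIV. ennreal C * (limsup (q f i) + limsup (q g i)))"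
    by (intro sum_mono main)
  also have "\<dots> = ennreal C * (ennreal (dir_lip F x) + ennreal (dir_lip G x))"
    unfolding ennreal_dir_lip[OF F] ennreal_dir_lip[OF G] q_def[abs_def] f_def g_def
    by (simp add: sum_distrib_left[symmetric] sum.distrib)
  also have "\<dots> = ennreal (C * (dir_lip F x + dir_lip G x))"
    using C dir_lip_nonneg[OF F] dir_lip_nonneg[OF G] by (simp add: ennreal_mult)
  finally have "(\<Sum>i\<in>UNIV. limsup (q h i)) \<le> ennreal (C * (dir_lip F x + dir_lip G x))" .
  then show ?thesis
    unfolding dir_lip_def[of H] q_def[abs_def] h_def
    using C dir_lip_nonneg[OF F] dir_lip_nonneg[OF G] by (intro enn2real_leI) auto
qed

context
  fixes f :: "real^'m::finite \<Rightarrow> ('h::{real_inner, second_countable_topology}, 'q::finite) unordered_tuple"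
    and a :: "real^'m" and A
  assumes f: "f \<in> borel_measurable borel" and A: "approx_affine UNIV f a A"
begin

lemma approx_affine_components: "affine_map (A i)"
  using A by (simp add: approx_affine_def)

lemma approx_affine_bad_set:
  "{x. \<epsilon> * norm (x - a) < dist (f x) (unordered (\<lambda>i. A i x))} \<in> sets lebesgue"
  "0 < \<epsilon> \<Longrightarrow> density_zero_at {x. \<epsilon> * norm (x - a) < dist (f x) (unordered (\<lambda>i. A i x))} a"
  using approx_affine_open(3)[OF open_UNIV UNIV_I f approx_affine_components] A
  by (auto simp: approx_affine_def intro!: sets_completionI_sets)

lemma dist_affine_tuple_le:
  "dist (unordered (\<lambda>i. A i x)) (unordered (\<lambda>i. A i y)) \<le> L2_set (\<lambda>i. norm (A i (x - y) - A i 0)) UNIV"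
proof -
  have "dist (A i x) (A i y) = norm (A i (x - y) - A i 0)" for i
    unfolding dist_norm using affine_map_diff[OF approx_affine_components] by simp
  then show ?thesis using dist_unordered_le[of "\<lambda>i. A i x" "\<lambda>i. A i y"] by simp
qed

lemma affine_tuple_Lipschitz:
  obtains K where "0 \<le> K" "\<And>h. L2_set (\<lambda>i. norm (A i h - A i 0)) UNIV \<le> K * norm h"
proof -
  define K where "K = (\<Sum>i\<in>UNIV. onorm (\<lambda>h. A i h - A i 0))"
  have bl: "bounded_linear (\<lambda>h. A i h - A i 0)" for i
    by (rule affine_map_bounded_linear[OF approx_affine_components])
  have "L2_set (\<lambda>i. norm (A i h - A i 0)) UNIV \<le> K * norm h" for h
  proof -
    have "L2_set (\<lambda>i. norm (A i h - A i 0)) UNIV \<le> (\<Sum>i\<in>UNIV. norm (A i h - A i 0))"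
      by (rule L2_set_le_sum) simp
    also have "\<dots> \<le> (\<Sum>i\<in>UNIV. onorm (\<lambda>h. A i h - A i 0) * norm h)" by (intro sum_mono onorm bl)
    finally show ?thesis by (simp add: K_def sum_distrib_right)
  qed
  moreover have "0 \<le> K" unfolding K_def by (intro sum_nonneg onorm_pos_le bl)
  ultimately show ?thesis using that by blast
qed

text \<open>The density condition says nothing about the point \<open>a\<close> itself; the equality
  is carried to \<open>a\<close> by the continuity of both sides along points outside the bad
  sets.\<close>

lemma approx_affine_at_base:
  assumes L: "L-lipschitz_on UNIV f"
  shows "f a = unordered (\<lambda>i. A i a)"
proof -
  obtain K where K: "0 \<le> K" "\<And>h. L2_set (\<lambda>i. norm (A i h - A i 0)) UNIV \<le> K * norm h"
    by (rule affine_tuple_Lipschitz) (rule that; assumption)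
  define S where "S \<epsilon> = {x. \<epsilon> * norm (x - a) < dist (f x) (unordered (\<lambda>i. A i x))}" for \<epsilon>
  obtain t x where tx: "\<And>n. 0 < t n" "\<And>n. x n \<notin> S (1 / real (Suc n))" "t \<longlonglongrightarrow> 0"
    "(\<lambda>n. (1 / t n) *\<^sub>R (x n - a)) \<longlonglongrightarrow> 0"
    using blow_up_sequence[of S a 0] approx_affine_bad_set unfolding S_def by blast
  have "(\<lambda>n. t n *\<^sub>R ((1 / t n) *\<^sub>R (x n - a))) \<longlonglongrightarrow> 0 *\<^sub>R 0" by (intro tendsto_scaleR tx)
  moreover have "t n *\<^sub>R ((1 / t n) *\<^sub>R (x n - a)) = x n - a" for n using tx(1)[of n] by simp
  ultimately have "(\<lambda>n. (L + 1 + K) * norm (x n - a)) \<longlonglongrightarrow> (L + 1 + K) * norm (0 :: real^'m)"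
    by (intro tendsto_mult tendsto_const tendsto_norm) simp
  moreover have "dist (f a) (unordered (\<lambda>i. A i a)) \<le> (L + 1 + K) * norm (x n - a)" for n
  proof -
    have "dist (f (x n)) (unordered (\<lambda>i. A i (x n))) \<le> 1 / real (Suc n) * norm (x n - a)"
      using tx(2)[of n] by (simp add: S_def not_less)
    also have "\<dots> \<le> 1 * norm (x n - a)" by (intro mult_right_mono) auto
    finally have 1: "dist (f (x n)) (unordered (\<lambda>i. A i (x n))) \<le> norm (x n - a)" by simp
    have 2: "dist (f a) (f (x n)) \<le> L * norm (x n - a)"
      using lipschitz_onD[OF L, of a "x n"] by (simp add: dist_norm norm_minus_commute)
    have 3: "dist (unordered (\<lambda>i. A i (x n))) (unordered (\<lambda>i. A i a)) \<le> K * norm (x n - a)"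
      by (rule order_trans[OF dist_affine_tuple_le K(2)])
    show ?thesis
      using 1 2 3 dist_triangle[of "f a" "unordered (\<lambda>i. A i a)" "f (x n)"]
        dist_triangle[of "f (x n)" "unordered (\<lambda>i. A i a)" "unordered (\<lambda>i. A i (x n))"]
      by (simp add: algebra_simps)
  qed
  ultimately have "dist (f a) (unordered (\<lambda>i. A i a)) \<le> (L + 1 + K) * norm (0 :: real^'m)"
    by (intro LIMSEQ_le_const) auto
  then show ?thesis by simp
qed

text \<open>The affine maps are matched with the constant tuple f(a). The permutation does not
  affect the conclusion, because the linear parts of constants are zero.\<close>

lemma column_le_of_Lipschitz:
  assumes L: "L-lipschitz_on UNIV f"
  shows "norm (A i v - A i 0) \<le> L * norm v"
proof -
  define S where "S \<epsilon> = {x. \<epsilon> * norm (x - a) < dist (f x) (unordered (\<lambda>i. A i x))}" for \<epsilon>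
  obtain t x where tx: "\<And>n. 0 < t n" "\<And>n. x n \<notin> S (1 / real (Suc n))" "t \<longlonglongrightarrow> 0"
    "(\<lambda>n. (1 / t n) *\<^sub>R (x n - a)) \<longlonglongrightarrow> v"
    using blow_up_sequence[of S a v] approx_affine_bad_set unfolding S_def by blast
  have e: "(\<lambda>n. 1 / real (Suc n) + L) \<longlonglongrightarrow> 0 + L" by (intro tendsto_intros LIMSEQ_Suc[OF lim_1_over_n])
  have le: "dist (unordered (\<lambda>i. A i (x n))) (unordered (\<lambda>i. A i a)) \<le> (1 / real (Suc n) + L) * norm (x n - a)" for n
  proof -
    have "dist (f (x n)) (unordered (\<lambda>i. A i (x n))) \<le> 1 / real (Suc n) * norm (x n - a)"
      using tx(2)[of n] by (simp add: S_def not_less)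
    moreover have "dist (f (x n)) (f a) \<le> L * norm (x n - a)"
      using lipschitz_onD[OF L, of "x n" a] by (simp add: dist_norm)
    ultimately show ?thesis
      using dist_triangle3[of "unordered (\<lambda>i. A i (x n))" "unordered (\<lambda>i. A i a)" "f (x n)"]
      unfolding approx_affine_at_base[OF L] by (simp add: distrib_right)
  qed
  have const: "affine_map (\<lambda>x. A i a)" for i by (auto simp: affine_map_def intro!: linearI)
  obtain \<sigma> where "bij \<sigma>" "\<And>i. A i a = A (\<sigma> i) a"
    "\<And>i. norm ((A i v - A i 0) - (A (\<sigma> i) a - A (\<sigma> i) a)) \<le> (0 + L) * norm v"
    by (rule blow_up_matching[OF approx_affine_components const tx(1,3,4) le e]) (rule that; assumption)
  then show ?thesis by simp
qed

text \<open>The points a + t v may all be bad, but within \<eta> t of them there are good points,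
  and the Lipschitz bounds of \<open>f\<close> and of the affine tuple transfer the
  estimate.\<close>

lemma limsup_dir_quotient_le_column:
  assumes L: "L-lipschitz_on UNIV f"
  shows "limsup (\<lambda>n. ennreal (real (Suc n) * dist (f (a + axis j (1 / real (Suc n)))) (f a)))
    \<le> ennreal (L2_set (\<lambda>i. norm (A i (axis j 1) - A i 0)) UNIV)"
proof (rule ennreal_le_epsilon)
  fix e :: real assume e: "0 < e"
  have L0: "0 \<le> L" by (rule lipschitz_on_nonneg[OF L])
  obtain K where K: "0 \<le> K" "\<And>h. L2_set (\<lambda>i. norm (A i h - A i 0)) UNIV \<le> K * norm h"
    by (rule affine_tuple_Lipschitz) (rule that; assumption)
  define c where "c = L2_set (\<lambda>i. norm (A i (axis j 1) - A i 0)) UNIV"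
  define v :: "real^'m" where "v = axis j 1"
  have v: "norm v = 1" by (simp add: v_def norm_eq_sqrt_inner inner_axis_axis)
  \<comment> \<open>L + K + 2 collects three errors: L from \<open>f\<close>, K from the affine
    tuple, and 2 because |x - a| \<le> 2 t at the good point x.\<close>
  define \<eta> where "\<eta> = min 1 (e / (L + K + 2))"
  have \<eta>: "0 < \<eta>" "\<eta> \<le> 1" "\<eta> * (L + K + 2) \<le> e"
    using e L0 K(1) by (auto simp: \<eta>_def min_def pos_le_divide_eq)
  obtain t0 where t0: "0 < t0" "\<And>t. 0 < t \<Longrightarrow> t < t0 \<Longrightarrow>
    \<exists>x. x \<notin> {x. \<eta> * norm (x - a) < dist (f x) (unordered (\<lambda>i. A i x))} \<and> norm (x - (a + t *\<^sub>R v)) \<le> \<eta> * t"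
    using density_zero_at_avoided[OF approx_affine_bad_set(2)[OF \<eta>(1)] approx_affine_bad_set(1) \<eta>(1), of v] by blast
  have main: "dist (f (a + t *\<^sub>R v)) (f a) \<le> t * (c + e)" if t: "0 < t" "t < t0" for t
  proof -
    obtain x where x: "dist (f x) (unordered (\<lambda>i. A i x)) \<le> \<eta> * norm (x - a)" "norm (x - (a + t *\<^sub>R v)) \<le> \<eta> * t"
      using t0(2)[OF t] by (auto simp: not_less)
    have "norm (x - a) \<le> norm (x - (a + t *\<^sub>R v)) + norm (t *\<^sub>R v)"
      using norm_triangle_ineq[of "x - (a + t *\<^sub>R v)" "t *\<^sub>R v"] by simp
    also have "\<dots> \<le> t + t" using x(2) \<eta>(1,2) t v by (intro add_mono) (auto intro: order_trans simp: mult_left_le_one_le)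
    finally have "\<eta> * norm (x - a) \<le> \<eta> * (2 * t)" using \<eta>(1) by simp
    with x(1) have 1: "dist (f x) (unordered (\<lambda>i. A i x)) \<le> \<eta> * 2 * t" by simp
    have "dist (f (a + t *\<^sub>R v)) (f x) \<le> L * norm (x - (a + t *\<^sub>R v))"
      using lipschitz_onD[OF L, of "a + t *\<^sub>R v" x] by (simp add: dist_norm norm_minus_commute)
    also have "\<dots> \<le> L * (\<eta> * t)" using x(2) L0 by (intro mult_left_mono)
    finally have 2: "dist (f (a + t *\<^sub>R v)) (f x) \<le> \<eta> * L * t" by (simp add: mult_ac)
    have 3: "dist (unordered (\<lambda>i. A i x)) (unordered (\<lambda>i. A i (a + t *\<^sub>R v))) \<le> \<eta> * K * t"
    proof -
      have "dist (unordered (\<lambda>i. A i x)) (unordered (\<lambda>i. A i (a + t *\<^sub>R v))) \<le> K * norm (x - (a + t *\<^sub>R v))"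
        by (rule order_trans[OF dist_affine_tuple_le K(2)])
      also have "\<dots> \<le> K * (\<eta> * t)" using x(2) K(1) by (intro mult_left_mono)
      finally show ?thesis by (simp add: mult_ac)
    qed
    have 4: "dist (unordered (\<lambda>i. A i (a + t *\<^sub>R v))) (f a) \<le> t * c"
    proof -
      have "A i (t *\<^sub>R v) - A i 0 = t *\<^sub>R (A i v - A i 0)" for i
        by (rule linear_simps(5)[OF affine_map_bounded_linear[OF approx_affine_components]])
      then have "L2_set (\<lambda>i. norm (A i (t *\<^sub>R v) - A i 0)) UNIV = t * c"
        using t by (simp add: c_def v_def L2_set_right_distrib)
      then show ?thesis
        unfolding approx_affine_at_base[OF L] using dist_affine_tuple_le[of "a + t *\<^sub>R v" a] by simp
    qed
    have "dist (f (a + t *\<^sub>R v)) (f a) \<le> \<eta> * L * t + \<eta> * 2 * t + \<eta> * K * t + t * c"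
      using 1 2 3 4 dist_triangle[of "f (a + t *\<^sub>R v)" "f a" "f x"]
        dist_triangle[of "f x" "f a" "unordered (\<lambda>i. A i x)"]
        dist_triangle[of "unordered (\<lambda>i. A i x)" "f a" "unordered (\<lambda>i. A i (a + t *\<^sub>R v))"]
      by linarith
    also have "\<dots> = t * (\<eta> * (L + K + 2)) + t * c" by (simp add: algebra_simps)
    also have "\<dots> \<le> t * e + t * c" using \<eta>(3) t by simp
    finally show ?thesis by (simp add: algebra_simps)
  qed
  have "eventually (\<lambda>n. 1 / real (Suc n) < t0) sequentially"
    using t0(1) LIMSEQ_Suc[OF lim_1_over_n] by (intro order_tendstoD(2)) auto
  then have "eventually (\<lambda>n. ennreal (real (Suc n) * dist (f (a + axis j (1 / real (Suc n)))) (f a)) \<le> ennreal c + ennreal e) sequentially"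
  proof eventually_elim
    case (elim n)
    have "axis j (1 / real (Suc n)) = (1 / real (Suc n)) *\<^sub>R v"
      by (simp add: v_def vec_eq_iff axis_def)
    then have "dist (f (a + axis j (1 / real (Suc n)))) (f a) \<le> 1 / real (Suc n) * (c + e)"
      using main[OF _ elim] by simp
    then have "real (Suc n) * dist (f (a + axis j (1 / real (Suc n)))) (f a) \<le> real (Suc n) * (1 / real (Suc n) * (c + e))"
      by (rule mult_left_mono) simp
    also have "\<dots> = c + e" by simp
    finally have "ennreal (real (Suc n) * dist (f (a + axis j (1 / real (Suc n)))) (f a)) \<le> ennreal (c + e)"
      by (rule ennreal_leI)
    then show ?case using e by (simp add: c_def L2_set_nonneg)
  qed
  then show "limsup (\<lambda>n. ennreal (real (Suc n) * dist (f (a + axis j (1 / real (Suc n)))) (f a)))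
    \<le> ennreal (L2_set (\<lambda>i. norm (A i (axis j 1) - A i 0)) UNIV) + ennreal e"
    unfolding c_def by (rule Limsup_bounded)
qed

lemma dir_lip_le_abs_deriv:
  assumes L: "L-lipschitz_on UNIV f"
  shows "dir_lip f a \<le> real CARD('m) * abs_deriv UNIV f a"
proof -
  have nn: "0 \<le> abs_deriv UNIV f a"
    using order_trans[OF L2_set_nonneg L2_set_column_le_abs_deriv[OF f open_UNIV UNIV_I A]] .
  have "ennreal (dir_lip f a) \<le> (\<Sum>j\<in>(UNIV :: 'm set). ennreal (abs_deriv UNIV f a))"
    unfolding ennreal_dir_lip[OF L]
    by (intro sum_mono order_trans[OF limsup_dir_quotient_le_column[OF L]] ennreal_leI
        L2_set_column_le_abs_deriv f open_UNIV UNIV_I A)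
  also have "\<dots> = ennreal (real CARD('m) * abs_deriv UNIV f a)"
    using nn by (simp add: ennreal_mult ennreal_of_nat_eq_real_of_nat)
  finally show ?thesis using nn by (simp add: ennreal_le_iff)
qed

lemma abs_deriv_le_of_Lipschitz:
  assumes L: "L-lipschitz_on UNIV f"
  shows "abs_deriv UNIV f a \<le> real CARD('q) * real CARD('m) * L"
proof -
  have L0: "0 \<le> L" by (rule lipschitz_on_nonneg[OF L])
  define c where "c i j = norm (A i (axis j 1) - A i 0)" for i j
  have c: "0 \<le> c i j" "c i j \<le> L" for i j
    using column_le_of_Lipschitz[OF L, of i "axis j 1"] by (simp_all add: c_def norm_eq_sqrt_inner[of "axis j 1"] inner_axis_axis)
  have "abs_deriv UNIV f a = L2_set (\<lambda>(i, j). c i j) (UNIV \<times> UNIV)"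
    unfolding abs_deriv_eq[OF f open_UNIV UNIV_I A] L2_set_def c_def
    by (simp add: sum.cartesian_product case_prod_beta)
  also have "\<dots> \<le> (\<Sum>(i, j)\<in>UNIV \<times> UNIV. c i j)" using c(1) by (intro L2_set_le_sum) auto
  also have "\<dots> \<le> (\<Sum>(i, j)\<in>(UNIV :: 'q set) \<times> (UNIV :: 'm set). L)" using c(2) by (intro sum_mono) auto
  also have "\<dots> = real CARD('q) * real CARD('m) * L" by (simp add: case_prod_beta card_cartesian_product del: UNIV_Times_UNIV)
  finally show ?thesis .
qed

end

text \<open>A blow-up in the direction of the j-th basis vector: by the triangle inequality the
  increment of the distance is at most the sum of the increments of f1 and f2, whose quotients tend
  to norms of columns. Summation over the components of \<open>g\<close> gives the factor m.\<close>

lemma gradient_of_dist_le: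
  fixes f1 f2 :: "real^'m::finite \<Rightarrow> ('h::{real_inner, second_countable_topology}, 'q::finite) unordered_tuple"
  assumes f1: "f1 \<in> borel_measurable borel" "approx_affine UNIV f1 a A" "unordered (\<lambda>i. A i a) = f1 a"
    and f2: "f2 \<in> borel_measurable borel" "approx_affine UNIV f2 a B" "unordered (\<lambda>i. B i a) = f2 a"
    and U: "open U" "a \<in> U" and \<phi>: "\<phi> \<in> borel_measurable borel" "\<And>x. x \<in> U \<Longrightarrow> \<phi> x = dist (f1 x) (f2 x)"
    and g: "\<And>\<epsilon>. 0 < \<epsilon> \<Longrightarrow> density_zero_at {x. norm (\<phi> x - \<phi> a - (\<Sum>i\<in>UNIV. (x - a) $ i *\<^sub>R g $ i)) > \<epsilon> * norm (x - a)} a"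
  shows "norm (g :: real^'m) \<le> real CARD('m) * (abs_deriv U f1 a + abs_deriv U f2 a)"
proof -
  define ad where "ad = abs_deriv U f1 a + abs_deriv U f2 a"
  have comp: "\<bar>g $ j\<bar> \<le> ad" for j
  proof -
    define v :: "real^'m" where "v = axis j 1"
    \<comment> \<open>The complement of \<open>U\<close> is added because \<phi> is known to be the
      distance only in \<open>U\<close>.\<close>
    define S where "S \<epsilon> = {x. \<epsilon> * norm (x - a) < dist (f1 x) (unordered (\<lambda>i. A i x))}
      \<union> ({x. \<epsilon> * norm (x - a) < dist (f2 x) (unordered (\<lambda>i. B i x))}
      \<union> ({x. norm (\<phi> x - \<phi> a - (\<Sum>i\<in>UNIV. (x - a) $ i *\<^sub>R g $ i)) > \<epsilon> * norm (x - a)} \<union> - U))" for \<epsilon>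
    have m3: "{x. norm (\<phi> x - \<phi> a - (\<Sum>i\<in>UNIV. (x - a) $ i *\<^sub>R g $ i)) > \<epsilon> * norm (x - a)} \<in> sets lebesgue" for \<epsilon>
    proof -
      have "continuous_on UNIV (\<lambda>x. \<Sum>i\<in>UNIV. (x - a) $ i *\<^sub>R g $ i)" by (intro continuous_intros)
      note \<phi>(1)[measurable] this[THEN borel_measurable_continuous_onI, measurable]
      have "{x \<in> space borel. norm (\<phi> x - \<phi> a - (\<Sum>i\<in>UNIV. (x - a) $ i *\<^sub>R g $ i)) > \<epsilon> * norm (x - a)} \<in> sets borel"
        by measurable
      then show ?thesis by (intro sets_completionI_sets) simp
    qed
    have m4: "- U \<in> sets lebesgue" using U(1) by auto
    have d4: "density_zero_at (- U) a"
    proof -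
      obtain r where r: "0 < r" "cball a r \<subseteq> U" using U open_contains_cball by blast
      have "density_zero_at {} a" by (rule density_zero_atI) (auto intro: exI[of _ 1])
      then show ?thesis by (rule density_zero_at_mono[OF _ _ r(1)]) (use r(2) in auto)
    qed
    have Sm: "S \<epsilon> \<in> sets lebesgue" for \<epsilon>
      unfolding S_def by (intro sets.Un approx_affine_bad_set(1)[OF f1(1,2)] approx_affine_bad_set(1)[OF f2(1,2)] m3 m4)
    have S: "density_zero_at (S \<epsilon>) a" if "0 < \<epsilon>" for \<epsilon>
      unfolding S_def
      by (intro density_zero_at_Un sets.Un approx_affine_bad_set[OF f1(1,2)] approx_affine_bad_set[OF f2(1,2)] m3 m4 d4 g that)
    obtain t x where tx: "\<And>n. 0 < t n" "\<And>n. x n \<notin> S (1 / real (Suc n))" "t \<longlonglongrightarrow> 0"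
      "(\<lambda>n. (1 / t n) *\<^sub>R (x n - a)) \<longlonglongrightarrow> v"
      using blow_up_sequence[of S a, OF S Sm] by blast
    define y where "y n = (1 / t n) *\<^sub>R (x n - a)" for n
    have y: "y \<longlonglongrightarrow> v" using tx(4) by (simp add: y_def[abs_def])
    have xy: "x n - a = t n *\<^sub>R y n" for n using tx(1)[of n] by (simp add: y_def)
    define D where "D h = L2_set (\<lambda>i. norm (A i h - A i 0)) UNIV + L2_set (\<lambda>i. norm (B i h - B i 0)) UNIV" for h
    have blA: "bounded_linear (\<lambda>h. A i h - A i 0)" and blB: "bounded_linear (\<lambda>h. B i h - B i 0)" for i
      by (intro affine_map_bounded_linear approx_affine_components[OF f1(1,2)] approx_affine_components[OF f2(1,2)])+
    have Dscale: "D (s *\<^sub>R h) = s * D h" if "0 \<le> s" for s h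
    proof -
      have "A i (s *\<^sub>R h) - A i 0 = s *\<^sub>R (A i h - A i 0)" "B i (s *\<^sub>R h) - B i 0 = s *\<^sub>R (B i h - B i 0)" for i
        using linear_simps(5)[OF blA] linear_simps(5)[OF blB] by auto
      then show ?thesis using that by (simp add: D_def L2_set_right_distrib distrib_left)
    qed
    have Dlim: "(\<lambda>n. D (y n)) \<longlonglongrightarrow> D v"
      unfolding D_def L2_set_def
      by (intro tendsto_intros bounded_linear.tendsto[OF blA y] bounded_linear.tendsto[OF blB y])
    have le: "\<bar>\<Sum>i\<in>UNIV. y n $ i * g $ i\<bar> \<le> 3 * (1 / real (Suc n)) * norm (y n) + D (y n)" for n
    proof -
      define e where "e = 1 / real (Suc n)"
      have xS: "dist (f1 (x n)) (unordered (\<lambda>i. A i (x n))) \<le> e * norm (x n - a)"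
        "dist (f2 (x n)) (unordered (\<lambda>i. B i (x n))) \<le> e * norm (x n - a)"
        "norm (\<phi> (x n) - \<phi> a - (\<Sum>i\<in>UNIV. (x n - a) $ i *\<^sub>R g $ i)) \<le> e * norm (x n - a)" "x n \<in> U"
        using tx(2)[of n] by (auto simp: S_def not_less e_def)
      have 1: "dist (f1 (x n)) (f1 a) \<le> e * norm (x n - a) + L2_set (\<lambda>i. norm (A i (x n - a) - A i 0)) UNIV"
        using xS(1) dist_affine_tuple_le[OF f1(1,2), of "x n" a] dist_triangle[of "f1 (x n)" "f1 a" "unordered (\<lambda>i. A i (x n))"]
        unfolding f1(3) by linarith
      have 2: "dist (f2 (x n)) (f2 a) \<le> e * norm (x n - a) + L2_set (\<lambda>i. norm (B i (x n - a) - B i 0)) UNIV"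
        using xS(2) dist_affine_tuple_le[OF f2(1,2), of "x n" a] dist_triangle[of "f2 (x n)" "f2 a" "unordered (\<lambda>i. B i (x n))"]
        unfolding f2(3) by linarith
      have 3: "\<bar>\<phi> (x n) - \<phi> a\<bar> \<le> dist (f1 (x n)) (f1 a) + dist (f2 (x n)) (f2 a)"
      proof -
        have "dist (f1 (x n)) (f2 (x n)) \<le> dist (f1 (x n)) (f1 a) + dist (f1 a) (f2 a) + dist (f2 (x n)) (f2 a)"
          "dist (f1 a) (f2 a) \<le> dist (f1 (x n)) (f1 a) + dist (f1 (x n)) (f2 (x n)) + dist (f2 (x n)) (f2 a)"
          by metric+
        then show ?thesis using \<phi>(2)[OF xS(4)] \<phi>(2)[OF U(2)] by (simp add: abs_le_iff)
      qed
      have "\<bar>\<Sum>i\<in>UNIV. (x n - a) $ i * g $ i\<bar> \<le> 3 * e * norm (x n - a) + D (x n - a)"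
        using xS(3) 1 2 3 by (simp add: D_def abs_le_iff)
      moreover have "(\<Sum>i\<in>UNIV. (x n - a) $ i * g $ i) = t n * (\<Sum>i\<in>UNIV. y n $ i * g $ i)"
        unfolding xy by (simp add: sum_distrib_left mult_ac)
      moreover have "norm (x n - a) = t n * norm (y n)" "D (x n - a) = t n * D (y n)"
        unfolding xy using tx(1)[of n] Dscale by simp_all
      ultimately have "t n * \<bar>\<Sum>i\<in>UNIV. y n $ i * g $ i\<bar> \<le> t n * (3 * e * norm (y n) + D (y n))"
        using tx(1)[of n] by (simp add: abs_mult algebra_simps)
      then show ?thesis using tx(1)[of n] by (simp add: e_def)
    qed
    have "\<bar>\<Sum>i\<in>UNIV. v $ i * g $ i\<bar> \<le> 3 * 0 * norm v + D v"
    proof (rule LIMSEQ_le)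
      show "(\<lambda>n. \<bar>\<Sum>i\<in>UNIV. y n $ i * g $ i\<bar>) \<longlonglongrightarrow> \<bar>\<Sum>i\<in>UNIV. v $ i * g $ i\<bar>"
        by (intro tendsto_intros tendsto_vec_nth y)
      show "(\<lambda>n. 3 * (1 / real (Suc n)) * norm (y n) + D (y n)) \<longlonglongrightarrow> 3 * 0 * norm v + D v"
        by (intro tendsto_intros LIMSEQ_Suc[OF lim_1_over_n] y Dlim)
    qed (use le in auto)
    moreover have "(\<Sum>i\<in>UNIV. v $ i * g $ i) = g $ j"
    proof -
      have "(\<Sum>i\<in>UNIV. v $ i * g $ i) = (\<Sum>i\<in>UNIV. if i = j then g $ i else 0)"
        by (intro sum.cong) (auto simp: v_def axis_def)
      then show ?thesis by simp
    qed
    ultimately have "\<bar>g $ j\<bar> \<le> D v" by simp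
    also have "\<dots> \<le> ad"
      unfolding D_def v_def ad_def
      by (intro add_mono L2_set_column_le_abs_deriv f1 f2 U)
    finally show ?thesis .
  qed
  have "norm g \<le> (\<Sum>j\<in>UNIV. \<bar>g $ j\<bar>)" by (rule norm_le_l1_cart)
  also have "\<dots> \<le> (\<Sum>j\<in>(UNIV :: 'm set). ad)" by (intro sum_mono comp)
  finally show ?thesis by (simp add: ad_def)
qed

section \<open>Maps with bounded energy\<close>

text \<open>By convexity of the p-th power of the norm, closeness to a fixed function is stable
  under midpoints.\<close>

lemma nn_integral_midpoint_powr_le:
  fixes v v' w :: "'a \<Rightarrow> 'h::{real_normed_vector, second_countable_topology}"
  assumes p: "1 < p" and c: "0 \<le> c"
    and [measurable]: "v \<in> borel_measurable M" "v' \<in> borel_measurable M" "w \<in> borel_measurable M" "A \<in> sets M"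
    and le: "(\<integral>\<^sup>+x\<in>A. ennreal (norm (v x - w x) powr p) \<partial>M) \<le> ennreal c"
      "(\<integral>\<^sup>+x\<in>A. ennreal (norm (v' x - w x) powr p) \<partial>M) \<le> ennreal c"
  shows "(\<integral>\<^sup>+x\<in>A. ennreal (norm ((1/2) *\<^sub>R (v x + v' x) - w x) powr p) \<partial>M) \<le> ennreal c"
proof -
  have half: "ennreal (1/2 * t) = ennreal (1/2) * ennreal t" for t by (rule ennreal_mult') simp
  have "(\<integral>\<^sup>+x\<in>A. ennreal (norm ((1/2) *\<^sub>R (v x + v' x) - w x) powr p) \<partial>M)
    \<le> (\<integral>\<^sup>+x. ennreal (1/2) * (ennreal (norm (v x - w x) powr p) * indicator A x)
        + ennreal (1/2) * (ennreal (norm (v' x - w x) powr p) * indicator A x) \<partial>M)"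
  proof (intro nn_integral_mono)
    fix x
    have "(1/2) *\<^sub>R (v x + v' x) - w x = (1/2) *\<^sub>R ((v x - w x) + (v' x - w x))"
      by (simp add: algebra_simps flip: scaleR_add_left)
    then have "norm ((1/2) *\<^sub>R (v x + v' x) - w x) powr p \<le> 1/2 * norm (v x - w x) powr p + 1/2 * norm (v' x - w x) powr p"
      using norm_midpoint_powr_le[OF p, of "v x - w x" "v' x - w x"] by simp
    then have "ennreal (norm ((1/2) *\<^sub>R (v x + v' x) - w x) powr p)
        \<le> ennreal (1/2 * norm (v x - w x) powr p + 1/2 * norm (v' x - w x) powr p)"
      by (rule ennreal_leI)
    also have "\<dots> = ennreal (1/2) * ennreal (norm (v x - w x) powr p) + ennreal (1/2) * ennreal (norm (v' x - w x) powr p)"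
      unfolding half[symmetric] by (rule ennreal_plus) auto
    finally show "ennreal (norm ((1/2) *\<^sub>R (v x + v' x) - w x) powr p) * indicator A x
      \<le> ennreal (1/2) * (ennreal (norm (v x - w x) powr p) * indicator A x)
        + ennreal (1/2) * (ennreal (norm (v' x - w x) powr p) * indicator A x)"
      by (cases "x \<in> A") auto
  qed
  also have "\<dots> = ennreal (1/2) * (\<integral>\<^sup>+x\<in>A. ennreal (norm (v x - w x) powr p) \<partial>M)
      + ennreal (1/2) * (\<integral>\<^sup>+x\<in>A. ennreal (norm (v' x - w x) powr p) \<partial>M)"
    by (subst nn_integral_add) (simp_all add: nn_integral_cmult)
  also have "\<dots> \<le> ennreal (1/2) * ennreal c + ennreal (1/2) * ennreal c"
    by (intro add_mono mult_left_mono le) auto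
  also have "\<dots> = ennreal c"
    unfolding half[symmetric] using c by (subst ennreal_plus[symmetric]) auto
  finally show ?thesis .
qed

text \<open>Sobolev membership in a form that makes sense for arbitrary metric targets, with an
  explicit bound \<open>K\<close> for the \<open>dir_lip\<close> energies. It applies alike to
  tuples, to real distances and to maps read in a chart.\<close>

definition energy_approx :: "real \<Rightarrow> (nat \<Rightarrow> real^'m::finite \<Rightarrow> 'b::metric_space) \<Rightarrow> (real^'m \<Rightarrow> 'b) \<Rightarrow> real \<Rightarrow> bool" where
  "energy_approx p F f K \<longleftrightarrow> (\<forall>j. \<exists>L. L-lipschitz_on UNIV (F j)) \<and> 0 \<le> K \<and>
    (\<forall>j. (\<integral>\<^sup>+x\<in>ball 0 1. ennreal (dir_lip (F j) x powr p) \<partial>lborel) \<le> ennreal K) \<and>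
    (\<lambda>j. \<integral>\<^sup>+x\<in>ball 0 1. ennreal (dist (F j x) (f x) powr p) \<partial>lborel) \<longlonglongrightarrow> 0"

lemma energy_approx_measurable:
  "energy_approx p F f K \<Longrightarrow> F j \<in> borel_measurable borel"
  unfolding energy_approx_def by (blast intro: borel_measurable_continuous_onI lipschitz_on_continuous_on)

lemma energy_approx_const:
  fixes F :: "real^'m::finite \<Rightarrow> 'b::metric_space"
  assumes p: "1 < p" and F: "L-lipschitz_on UNIV F" and eq: "\<And>x. x \<in> ball 0 1 \<Longrightarrow> f x = F x"
  shows "\<exists>K. energy_approx p (\<lambda>_. F) f K"
proof -
  let ?U = "ball (0 :: real^'m) 1"
  define u where "u = measure lborel ?U"
  have u: "emeasure lborel ?U = ennreal u" "0 \<le> u"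
    using emeasure_lborel_ball_finite[of "0 :: real^'m" 1] by (simp_all add: u_def emeasure_eq_ennreal_measure)
  define c where "c = (real CARD('m) * L) powr p"
  have "(\<integral>\<^sup>+x\<in>?U. ennreal (dir_lip F x powr p) \<partial>lborel) \<le> (\<integral>\<^sup>+x\<in>?U. ennreal c \<partial>lborel)"
    unfolding c_def using dir_lip_le[OF F] dir_lip_nonneg[OF F] p
    by (intro nn_integral_mono mult_right_mono ennreal_leI powr_mono2) auto
  also have "\<dots> = ennreal (c * u)" using u by (simp add: nn_integral_cmult_indicator ennreal_mult c_def)
  finally have "(\<integral>\<^sup>+x\<in>?U. ennreal (dir_lip F x powr p) \<partial>lborel) \<le> ennreal (c * u)" .
  moreover have "(\<integral>\<^sup>+x\<in>?U. ennreal (dist (F x) (f x) powr p) \<partial>lborel) = (\<integral>\<^sup>+x. 0 \<partial>(lborel :: (real^'m) measure))"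
    using eq by (intro nn_integral_cong) (auto simp: indicator_def)
  moreover have "0 \<le> c * u" using u by (simp add: c_def)
  ultimately show ?thesis using F unfolding energy_approx_def by (intro exI[of _ "c * u"]) auto
qed

lemma energy_approx_compose:
  fixes f :: "real^'m::finite \<Rightarrow> 'b::{metric_space, second_countable_topology}" and X :: "'b \<Rightarrow> 'c::metric_space"
  assumes p: "1 < p" and F: "energy_approx p F f K" and X: "\<Lambda>-lipschitz_on UNIV X" and f[measurable]: "f \<in> borel_measurable borel"
  shows "energy_approx p (\<lambda>j x. X (F j x)) (\<lambda>x. X (f x)) ((2 * \<Lambda>) powr p * K)"
  unfolding energy_approx_def
proof (intro conjI allI)
  have \<Lambda>: "0 \<le> \<Lambda>" by (rule lipschitz_on_nonneg[OF X])
  have [measurable]: "ball (0 :: real^'m) 1 \<in> sets borel" by simp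
  note energy_approx_measurable[OF F, measurable]
  have F0: "(\<lambda>j. \<integral>\<^sup>+x\<in>ball 0 1. ennreal (dist (F j x) (f x) powr p) \<partial>lborel) \<longlonglongrightarrow> 0"
    using F by (simp add: energy_approx_def)
  have le: "ennreal (b powr p) * indicator U x \<le> ennreal (c powr p) * (ennreal (a powr p) * indicator U x)"
    if "0 \<le> b" "0 \<le> c" "b \<le> c * a" for a b c :: real and U and x :: "real^'m"
  proof -
    have "b powr p \<le> c powr p * a powr p" using that p powr_mono2[of p b "c * a"] by (simp add: powr_mult)
    then have "ennreal (b powr p) \<le> ennreal (c powr p) * ennreal (a powr p)"
      by (simp add: ennreal_mult[symmetric] ennreal_leI)
    then show ?thesis by (cases "x \<in> U") auto
  qed
  show "(\<lambda>j. \<integral>\<^sup>+x\<in>ball 0 1. ennreal (dist (X (F j x)) (X (f x)) powr p) \<partial>lborel) \<longlonglongrightarrow> 0"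
  proof (rule tendsto_sandwich[OF _ _ tendsto_const])
    show "\<forall>\<^sub>F j in sequentially. (\<integral>\<^sup>+x\<in>ball 0 1. ennreal (dist (X (F j x)) (X (f x)) powr p) \<partial>lborel)
      \<le> ennreal (\<Lambda> powr p) * (\<integral>\<^sup>+x\<in>ball 0 1. ennreal (dist (F j x) (f x) powr p) \<partial>lborel)"
      using lipschitz_onD[OF X] \<Lambda>
      by (intro always_eventually allI, subst nn_integral_cmult[symmetric], measurable) (auto intro!: nn_integral_mono le)
    show "(\<lambda>j. ennreal (\<Lambda> powr p) * (\<integral>\<^sup>+x\<in>ball 0 1. ennreal (dist (F j x) (f x) powr p) \<partial>lborel)) \<longlonglongrightarrow> 0"
      using ennreal_tendsto_cmult[OF _ F0, of "ennreal (\<Lambda> powr p)"] by simp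
  qed simp
  fix j
  obtain L where L: "L-lipschitz_on UNIV (F j)" using F unfolding energy_approx_def by blast
  note borel_measurable_dir_lip[OF L, measurable]
  have XL: "(\<Lambda> * L)-lipschitz_on UNIV (\<lambda>x. X (F j x))"
    using lipschitz_on_compose2[OF L, of \<Lambda> X] X by (auto intro: lipschitz_on_subset)
  then show "\<exists>L. L-lipschitz_on UNIV (\<lambda>x. X (F j x))" ..
  \<comment> \<open>\<open>dir_lip_dominated\<close> takes two maps; using \<open>F j\<close> for
    both costs the factor 2.\<close>
  have "dir_lip (\<lambda>x. X (F j x)) x \<le> \<Lambda> * (dir_lip (F j) x + dir_lip (F j) x)" for x
  proof (rule dir_lip_dominated[OF L L \<Lambda>])
    fix x y
    have "dist (X (F j y)) (X (F j x)) \<le> \<Lambda> * dist (F j y) (F j x)" using lipschitz_onD[OF X] by simp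
    also have "\<dots> \<le> \<Lambda> * (dist (F j y) (F j x) + dist (F j y) (F j x))" using \<Lambda> by (intro mult_left_mono) auto
    finally show "dist (X (F j y)) (X (F j x)) \<le> \<Lambda> * (dist (F j y) (F j x) + dist (F j y) (F j x))" .
  qed
  then have "(\<integral>\<^sup>+x\<in>ball 0 1. ennreal (dir_lip (\<lambda>x. X (F j x)) x powr p) \<partial>lborel)
    \<le> (\<integral>\<^sup>+x. ennreal ((2 * \<Lambda>) powr p) * (ennreal (dir_lip (F j) x powr p) * indicator (ball 0 1) x) \<partial>lborel)"
    using \<Lambda> dir_lip_nonneg[OF XL] by (intro nn_integral_mono le) (auto simp: mult_ac)
  also have "\<dots> = ennreal ((2 * \<Lambda>) powr p) * (\<integral>\<^sup>+x\<in>ball 0 1. ennreal (dir_lip (F j) x powr p) \<partial>lborel)"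
    by (rule nn_integral_cmult) measurable
  also have "\<dots> \<le> ennreal ((2 * \<Lambda>) powr p) * ennreal K"
    using F by (intro mult_left_mono) (auto simp: energy_approx_def)
  also have "\<dots> = ennreal ((2 * \<Lambda>) powr p * K)" by (rule ennreal_mult'[symmetric]) simp
  finally show "(\<integral>\<^sup>+x\<in>ball 0 1. ennreal (dir_lip (\<lambda>x. X (F j x)) x powr p) \<partial>lborel) \<le> ennreal ((2 * \<Lambda>) powr p * K)" .
qed (use F in \<open>auto simp: energy_approx_def\<close>)

text \<open>Closeness to \<open>w\<close> in the ball and to \<tau> on \<open>S\<close> are imposed
  together, so one sequence of almost minimisers has both limits. \<open>N\<close> and
  \<open>S\<close> are arbitrary so that the result also serves maps read in a chart, where no trace
  is at hand.\<close>

lemma energy_approx_C1_limit: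
  fixes w \<tau> :: "real^'m::finite \<Rightarrow> 'h::{real_inner, banach, second_countable_topology}"
  assumes p: "1 < p" and F: "energy_approx p F w K" and w[measurable]: "w \<in> borel_measurable borel"
    and N[measurable_cong]: "sets N = sets borel" and S[measurable]: "S \<in> sets N" and S_sub: "S \<subseteq> cball 0 1"
    and fin: "emeasure N S < \<infinity>" and \<tau>[measurable]: "\<tau> \<in> borel_measurable borel"
    and trace: "(\<lambda>j. \<integral>\<^sup>+x\<in>S. ennreal (dist (F j x) (\<tau> x) powr p) \<partial>N) \<longlonglongrightarrow> 0"
  obtains v G g where "\<And>n. C1_grad (v n) (G n)" "g \<in> borel_measurable borel"
    "\<And>n. (\<integral>\<^sup>+x\<in>ball 0 1. ennreal (norm (v n x - w x) powr p) \<partial>lborel) \<le> ennreal ((1/2)^n)"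
    "\<And>n. (\<integral>\<^sup>+x\<in>S. ennreal (norm (v n x - \<tau> x) powr p) \<partial>N) \<le> ennreal ((1/2)^n)"
    "(\<lambda>n. \<integral>\<^sup>+x\<in>ball 0 1. ennreal (norm (G n x - g x) powr p) \<partial>lborel) \<longlonglongrightarrow> 0"
    "AE a in lborel. a \<in> ball 0 1 \<longrightarrow>
      (\<forall>\<epsilon>>0. density_zero_at {x. norm (w x - w a - (\<Sum>i\<in>UNIV. (x - a) $ i *\<^sub>R g a $ i)) > \<epsilon> * norm (x - a)} a)"
proof -
  let ?U = "ball (0 :: real^'m) 1"
  note energy_approx_measurable[OF F, measurable]
  define h where "h = measure N S"
  have h: "emeasure N S = ennreal h" "0 \<le> h"
    using fin by (simp_all add: h_def emeasure_eq_ennreal_measure)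
  define u where "u = measure lborel ?U"
  have u: "emeasure lborel ?U = ennreal u" "0 \<le> u"
    using emeasure_lborel_ball_finite[of "0 :: real^'m" 1] by (simp_all add: u_def emeasure_eq_ennreal_measure)
  have K: "0 \<le> K" using F by (simp add: energy_approx_def)
  define Q where "Q n v \<longleftrightarrow> v \<in> borel_measurable borel \<and>
    (\<integral>\<^sup>+x\<in>?U. ennreal (norm (v x - w x) powr p) \<partial>lborel) \<le> ennreal ((1/2)^n) \<and>
    (\<integral>\<^sup>+x\<in>S. ennreal (norm (v x - \<tau> x) powr p) \<partial>N) \<le> ennreal ((1/2)^n)" for n :: nat and v
  have energy: "\<exists>v G. C1_grad v G \<and> Q n v \<and>
    (\<integral>\<^sup>+x\<in>?U. ennreal (norm (G x) powr p) \<partial>lborel) \<le> ennreal (2 ^ CARD('m) * K)" for n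
  proof -
    define P :: real where "P = 2 powr p"
    have P: "0 < P" by (simp add: P_def)
    \<comment> \<open>The triangle inequality costs the factor P; half of (1/2)^n / P is left for
      the distance of \<open>F j\<close> and half for the mollification error.\<close>
    define b where "b = (1/2 :: real) ^ n / (2 * P)"
    have b: "0 < b" using P by (simp add: b_def)
    have c: "0 \<le> u + h" using u h by simp
    obtain \<eta> where \<eta>: "0 < \<eta>" "(u + h) * \<eta> powr p \<le> b"
      by (rule small_root_exists[of b "u + h" p]) (use b c p in auto)
    have "\<forall>\<^sub>F j in sequentially. (\<integral>\<^sup>+x\<in>?U. ennreal (dist (F j x) (w x) powr p) \<partial>lborel) < ennreal b \<and>
      (\<integral>\<^sup>+x\<in>S. ennreal (dist (F j x) (\<tau> x) powr p) \<partial>N) < ennreal b"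
      using F b trace by (intro eventually_conj order_tendstoD(2)[where y = 0]) (auto simp: energy_approx_def)
    then obtain j where j: "(\<integral>\<^sup>+x\<in>?U. ennreal (dist (F j x) (w x) powr p) \<partial>lborel) < ennreal b"
      "(\<integral>\<^sup>+x\<in>S. ennreal (dist (F j x) (\<tau> x) powr p) \<partial>N) < ennreal b"
      using eventually_happens'[OF sequentially_bot] by blast
    obtain L where L: "L-lipschitz_on UNIV (F j)" using F unfolding energy_approx_def by blast
    obtain v G where v: "C1_grad v G" "\<And>x. x \<in> cball 0 1 \<Longrightarrow> norm (v x - F j x) \<le> \<eta>"
      "(\<integral>\<^sup>+x\<in>?U. ennreal (norm (G x) powr p) \<partial>lborel)
        \<le> ennreal (2 ^ CARD('m)) * (\<integral>\<^sup>+x\<in>?U. ennreal (dir_lip (F j) x powr p) \<partial>lborel)"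
      by (rule mollification_uniform[OF L \<eta>(1) p]) (rule that; assumption)
    have vm[measurable]: "v \<in> borel_measurable borel"
      by (rule C1_grad_continuous(1)[OF v(1), THEN borel_measurable_continuous_onI])
    have close: "(\<integral>\<^sup>+x\<in>A. ennreal (norm (v x - w x) powr p) \<partial>M) \<le> ennreal ((1/2)^n)"
      if [measurable_cong]: "sets M = sets borel" and [measurable]: "A \<in> sets M" "w \<in> borel_measurable M"
        and A: "A \<subseteq> cball 0 1" "emeasure M A = ennreal c" "0 \<le> c" "c \<le> u + h"
        and F: "(\<integral>\<^sup>+x\<in>A. ennreal (dist (F j x) (w x) powr p) \<partial>M) < ennreal b" for M A c and w :: "real^'m \<Rightarrow> 'h"
    proof -
      have "(\<integral>\<^sup>+x\<in>A. ennreal (norm (v x - w x) powr p) \<partial>M)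
        \<le> ennreal (2 powr p) * ((\<integral>\<^sup>+x\<in>A. ennreal (dist (F j x) (w x) powr p) \<partial>M) + (\<integral>\<^sup>+x\<in>A. ennreal (\<eta> powr p) \<partial>M))"
      proof (rule nn_integral_powr_triangle[OF p])
        show "norm (v x - w x) \<le> dist (F j x) (w x) + \<eta>" if "x \<in> A" for x
          using v(2)[of x] that A(1) norm_triangle_ineq[of "v x - F j x" "F j x - w x"] by (auto simp: dist_norm)
      qed (use \<eta>(1) in auto)
      also have "\<dots> \<le> ennreal P * (ennreal b + ennreal (\<eta> powr p * c))"
        unfolding P_def using A \<eta>(1) less_imp_le[OF F]
        by (intro mult_left_mono add_mono) (simp_all add: nn_integral_cmult_indicator ennreal_mult)
      also have "\<dots> = ennreal (P * (b + \<eta> powr p * c))" using P b A by (simp add: ennreal_mult)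
      also have "\<dots> \<le> ennreal ((1/2)^n)"
      proof (rule ennreal_leI)
        have "\<eta> powr p * c \<le> (u + h) * \<eta> powr p" unfolding mult.commute[of "\<eta> powr p"] using A by (intro mult_right_mono) auto
        then have "P * (b + \<eta> powr p * c) \<le> P * (b + b)" using \<eta>(2) P by (intro mult_left_mono) auto
        also have "\<dots> = (1/2)^n" using P by (simp add: b_def)
        finally show "P * (b + \<eta> powr p * c) \<le> (1/2)^n" .
      qed
      finally show ?thesis .
    qed
    have "Q n v" unfolding Q_def
      using close[of lborel ?U w u] close[of N S \<tau> h] j u h vm N S S_sub by auto
    moreover have "(\<integral>\<^sup>+x\<in>?U. ennreal (norm (G x) powr p) \<partial>lborel) \<le> ennreal (2 ^ CARD('m) * K)"
    proof -
      have "(\<integral>\<^sup>+x\<in>?U. ennreal (norm (G x) powr p) \<partial>lborel) \<le> ennreal (2 ^ CARD('m)) * ennreal K"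
        using F by (intro order_trans[OF v(3)] mult_left_mono) (auto simp: energy_approx_def)
      then show ?thesis using K by (simp add: ennreal_mult)
    qed
    ultimately show ?thesis using v(1) by blast
  qed
  obtain v G g where g: "\<And>n. C1_grad (v n) (G n)" "\<And>n. Q n (v n)" "g \<in> borel_measurable borel"
    "\<And>\<epsilon>. 0 < \<epsilon> \<Longrightarrow> \<exists>N. \<forall>n\<ge>N. (\<integral>\<^sup>+x\<in>?U. ennreal (norm (G n x - g x) powr p) \<partial>lborel) \<le> ennreal \<epsilon>"
    "AE a in lborel. a \<in> ?U \<longrightarrow>
      (\<forall>\<epsilon>>0. density_zero_at {x. norm (w x - w a - (\<Sum>i\<in>UNIV. (x - a) $ i *\<^sub>R g a $ i)) > \<epsilon> * norm (x - a)} a)"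
  proof (rule C1_bounded_energy_limit[where p = p and K = "2 ^ CARD('m) * K" and U = ?U and w = w and Q = Q])
    show "0 \<le> 2 ^ CARD('m) * K" using K by simp
    show "emeasure lborel ?U < \<infinity>" by (simp add: u)
    show "Q n v" if "n \<le> m" "Q m v" for m n v
    proof -
      have "(1/2 :: real) ^ m \<le> (1/2) ^ n" using that(1) by (intro power_decreasing) auto
      then show ?thesis using that(2) unfolding Q_def by (meson ennreal_leI order_trans)
    qed
    show "Q n (\<lambda>x. (1/2) *\<^sub>R (v x + v' x))" if "Q n v" "Q n v'" for n v v'
      using that unfolding Q_def
      by (intro conjI nn_integral_midpoint_powr_le[OF p]) auto
  qed (use p w energy that in \<open>auto simp: Q_def\<close>)
  have "(\<lambda>n. \<integral>\<^sup>+x\<in>?U. ennreal (norm (G n x - g x) powr p) \<partial>lborel) \<longlonglongrightarrow> 0"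
  proof (rule tendsto_zero_ennreal)
    fix e :: real assume e: "0 < e"
    obtain N where "\<And>n. N \<le> n \<Longrightarrow> (\<integral>\<^sup>+x\<in>?U. ennreal (norm (G n x - g x) powr p) \<partial>lborel) \<le> ennreal (e / 2)"
      using g(4)[of "e / 2"] e by auto
    moreover have "ennreal (e / 2) < ennreal e" using e by (simp add: ennreal_less_iff)
    ultimately show "\<forall>\<^sub>F n in sequentially. (\<integral>\<^sup>+x\<in>?U. ennreal (norm (G n x - g x) powr p) \<partial>lborel) < ennreal e"
      by (intro eventually_sequentiallyI[of N]) (blast intro: le_less_trans)
  qed
  then show ?thesis using g(2) unfolding Q_def by (intro that[OF g(1,3) _ _ _ g(5)]) auto
qed

section \<open>Approximate differentiability almost everywhere\<close>

lemma from_cluster_sums_diff: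
  "norm (from_cluster_sums z x i - from_cluster_sums z y i) \<le> norm ((x - y) $ i)"
proof -
  define k where "k = 1 / real (card {j. z j = z i})"
  have "1 \<le> card {j. z j = z i}" by (simp add: Suc_le_eq card_gt_0_iff) blast
  then have "1 \<le> real (card {j. z j = z i})" by linarith
  then have k: "0 \<le> k" "k \<le> 1" by (simp_all add: k_def)
  have "from_cluster_sums z x i - from_cluster_sums z y i = k *\<^sub>R (uncopy (x $ i) - uncopy (y $ i))"
    by (simp add: from_cluster_sums_def k_def scaleR_diff_right)
  also have "uncopy (x $ i) - uncopy (y $ i) = uncopy ((x - y) $ i)"
    by (simp add: linear_diff[OF uncopy_linear])
  finally show ?thesis using k by (simp add: mult_left_le_one_le)
qed

lemma from_cluster_sums_affine:
  fixes g :: "'h::real_inner hilbert_copy ^ 'q::finite ^ 'm::finite" and a :: "real^'m"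
  shows "from_cluster_sums z (y + (\<Sum>j\<in>UNIV. (x - a) $ j *\<^sub>R g $ j)) i
      - from_cluster_sums z (y + (\<Sum>j\<in>UNIV. (0 - a) $ j *\<^sub>R g $ j)) i
    = (1 / real (card {j. z j = z i})) *\<^sub>R uncopy (\<Sum>j\<in>UNIV. x $ j *\<^sub>R g $ j $ i)"
proof -
  define D where "D x = (\<Sum>j\<in>UNIV. x $ j *\<^sub>R g $ j $ i)" for x :: "real^'m"
  have D: "linear D"
    by (rule linearI) (simp_all add: D_def scaleR_add_left sum.distrib scaleR_sum_right)
  have eq: "from_cluster_sums z (y + (\<Sum>j\<in>UNIV. (x - a) $ j *\<^sub>R g $ j)) i
      = z i + (1 / real (card {j. z j = z i})) *\<^sub>R uncopy (y $ i + D (x - a))" for x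
    by (simp add: from_cluster_sums_def D_def sum_component)
  have "uncopy (y $ i + D (x - a)) - uncopy (y $ i + D (0 - a)) = uncopy (D x)"
    unfolding linear_diff[OF uncopy_linear, symmetric] linear_diff[OF D] linear_0[OF D] by simp
  then show ?thesis unfolding eq[of x] eq[of 0] D_def[symmetric] by (simp only: add_diff_cancel_left flip: scaleR_diff_right)
qed

lemma affine_map_from_cluster_sums:
  fixes g :: "'h::real_inner hilbert_copy ^ 'q::finite ^ 'm::finite" and a :: "real^'m"
  shows "affine_map (\<lambda>x. from_cluster_sums z (y + (\<Sum>j\<in>UNIV. (x - a) $ j *\<^sub>R g $ j)) i)"
proof -
  have "linear (\<lambda>x. (1 / real (card {j. z j = z i})) *\<^sub>R uncopy (\<Sum>j\<in>UNIV. x $ j *\<^sub>R g $ j $ i))"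
    by (intro linear_compose_scale_right linear_compose[OF _ uncopy_linear, unfolded comp_def] linearI)
      (simp_all add: scaleR_add_left sum.distrib scaleR_sum_right)
  then show ?thesis unfolding affine_map_def from_cluster_sums_affine .
qed

text \<open>Read in the chart, the map becomes the Hilbert space valued \<open>w\<close>, which has
  an approximate gradient almost everywhere. At density points of the chart domain \<open>E\<close>
  the inverse chart, which is affine and 1-Lipschitz in each component, turns the affine
  approximation of \<open>w\<close> into affine components for \<open>f\<close>; the points outside
  \<open>E\<close> have density zero.\<close>

lemma AE_approx_affine_in_chart:
  fixes f :: "real^'m::finite \<Rightarrow> ('h::{real_inner, polish_space}, 'q::finite) unordered_tuple"
  assumes p: "1 < p" and F: "energy_approx p F f K" and f: "f \<in> borel_measurable borel"
    and r: "0 < r" "\<And>i j. z i \<noteq> z j \<Longrightarrow> 8 * r \<le> dist (z i) (z j)"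
  shows "\<exists>D \<in> borel_measurable borel. AE a in lborel. a \<in> ball 0 1 \<longrightarrow>
    num_values (f a) = card (range z) \<longrightarrow> dist (f a) (unordered z) < r \<longrightarrow>
    (\<exists>A. approx_affine UNIV f a A \<and> unordered (\<lambda>i. A i a) = f a) \<and> abs_deriv (ball 0 1) f a = D a"
proof -
  define U where "U = ball (0 :: real^'m) 1"
  have [measurable]: "U \<in> sets borel" by (simp add: U_def)
  define \<Lambda> where "\<Lambda> = 3 * (real CARD('q))\<^sup>2"
  define X :: "('h, 'q) unordered_tuple \<Rightarrow> 'h hilbert_copy ^ 'q" where "X = cluster_sums r z"
  have X: "\<Lambda>-lipschitz_on UNIV X" unfolding X_def \<Lambda>_def by (rule cluster_sums_Lipschitz[OF r(1)])
  note lipschitz_on_continuous_on[OF X, THEN borel_measurable_continuous_onI, measurable] f[measurable]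
  define w where "w x = X (f x)" for x
  have w[measurable]: "w \<in> borel_measurable borel" unfolding w_def by measurable
  have W: "energy_approx p (\<lambda>j x. X (F j x)) w ((2 * \<Lambda>) powr p * K)"
    unfolding w_def by (rule energy_approx_compose[OF p F X f])
  obtain v :: "nat \<Rightarrow> real^'m \<Rightarrow> 'h hilbert_copy ^ 'q" and G g where g: "\<And>n. C1_grad (v n) (G n)" "g \<in> borel_measurable borel"
    "AE a in lborel. a \<in> U \<longrightarrow>
      (\<forall>\<epsilon>>0. density_zero_at {x. norm (w x - w a - (\<Sum>i\<in>UNIV. (x - a) $ i *\<^sub>R g a $ i)) > \<epsilon> * norm (x - a)} a)"
  \<comment> \<open>No trace is involved here: the second condition is the convergence in
    \<open>U\<close> once more.\<close>
  proof (rule energy_approx_C1_limit[where N = lborel and S = U and \<tau> = w, OF p W w])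
    show "emeasure lborel U < \<infinity>" using emeasure_lborel_ball_finite[of "0 :: real^'m" 1] by (simp add: U_def)
    show "(\<lambda>j. \<integral>\<^sup>+x\<in>U. ennreal (dist (X (F j x)) (w x) powr p) \<partial>lborel) \<longlonglongrightarrow> 0"
      using W by (simp add: energy_approx_def U_def)
  qed (use w that in \<open>auto simp: U_def\<close>)
  define E where "E = {a. num_values (f a) = card (range z) \<and> dist (f a) (unordered z) < r}"
  have E: "E \<in> sets borel"
  proof -
    have "{y. num_values y = card (range z)} \<inter> ball (unordered z) r \<in> sets borel"
      by (intro sets.Int borel_measurable_num_values) auto
    from measurable_sets[OF f this] have "f -` ({y. num_values y = card (range z)} \<inter> ball (unordered z) r) \<in> sets borel" by simp
    also have "f -` ({y. num_values y = card (range z)} \<inter> ball (unordered z) r) = E" by (auto simp: E_def dist_commute)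
    finally show ?thesis .
  qed
  have fE: "f x = unordered (from_cluster_sums z (w x))" if "x \<in> E" for x
    using that from_cluster_sums[OF r, where y = "f x"] by (simp add: E_def w_def X_def)
  \<comment> \<open>The explicit formula for |Df| in the chart is visibly Borel, unlike
    \<open>abs_deriv\<close>; 1 / card is the factor by which the inverse chart scales a
    component.\<close>
  define D where "D a = sqrt (\<Sum>i\<in>UNIV. \<Sum>j\<in>UNIV. (1 / real (card {j. z j = z i}) * norm (g a $ j $ i))\<^sup>2)" for a
  show ?thesis
  proof (rule bexI[of _ D])
    have "continuous_on UNIV (\<lambda>y :: 'h hilbert_copy ^ 'q ^ 'm. sqrt (\<Sum>i\<in>UNIV. \<Sum>j\<in>UNIV. (1 / real (card {j. z j = z i}) * norm (y $ j $ i))\<^sup>2))"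
      by (intro continuous_intros)
    from measurable_compose[OF g(2) borel_measurable_continuous_onI[OF this]]
    show "D \<in> borel_measurable borel" unfolding D_def .
    show "AE a in lborel. a \<in> ball 0 1 \<longrightarrow> num_values (f a) = card (range z) \<longrightarrow> dist (f a) (unordered z) < r \<longrightarrow>
      (\<exists>A. approx_affine UNIV f a A \<and> unordered (\<lambda>i. A i a) = f a) \<and> abs_deriv (ball 0 1) f a = D a"
      using g(3) lebesgue_density[OF E]
    proof eventually_elim
      case (elim a)
      show ?case
      proof (intro impI)
        assume aU: "a \<in> ball 0 1" and "num_values (f a) = card (range z)" "dist (f a) (unordered z) < r"
        then have a: "a \<in> U" "a \<in> E" by (auto simp: U_def E_def)
        define A where "A i x = from_cluster_sums z (w a + (\<Sum>j\<in>UNIV. (x - a) $ j *\<^sub>R g a $ j)) i" for i x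
        define B where "B \<epsilon> = {x. norm (w x - w a - (\<Sum>i\<in>UNIV. (x - a) $ i *\<^sub>R g a $ i)) > \<epsilon> * norm (x - a)}" for \<epsilon>
        have Bm: "B \<epsilon> \<in> sets lebesgue" for \<epsilon>
        proof -
          have "continuous_on UNIV (\<lambda>x. \<Sum>i\<in>UNIV. (x - a) $ i *\<^sub>R g a $ i)" by (intro continuous_intros)
          note this[THEN borel_measurable_continuous_onI, measurable]
          have "{x \<in> space borel. norm (w x - w a - (\<Sum>i\<in>UNIV. (x - a) $ i *\<^sub>R g a $ i)) > \<epsilon> * norm (x - a)} \<in> sets borel"
            by measurable
          then show ?thesis unfolding B_def by (intro sets_completionI_sets) simp
        qed
        have Em: "- E \<in> sets lebesgue" using E by auto
        have AA: "approx_affine UNIV f a A"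
          unfolding approx_affine_def
        proof (intro conjI allI impI)
          show "affine_map (A i)" for i
            unfolding A_def by (rule affine_map_from_cluster_sums)
          fix \<epsilon> :: real assume \<epsilon>: "0 < \<epsilon>"
          have "density_zero_at (- E \<union> B \<epsilon>) a"
            using elim a \<epsilon> by (intro density_zero_at_Un Em Bm) (auto simp: B_def)
          then show "density_zero_at {x \<in> UNIV. \<epsilon> * norm (x - a) < dist (f x) (unordered (\<lambda>i. A i x))} a"
          proof (rule density_zero_at_mono)
            show "- E \<union> B \<epsilon> \<in> sets lebesgue" using Em Bm by (rule sets.Un)
            show "{x \<in> UNIV. \<epsilon> * norm (x - a) < dist (f x) (unordered (\<lambda>i. A i x))} \<inter> cball a 1 \<subseteq> - E \<union> B \<epsilon>"
            proof
              fix x assume x: "x \<in> {x \<in> UNIV. \<epsilon> * norm (x - a) < dist (f x) (unordered (\<lambda>i. A i x))} \<inter> cball a 1"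
              show "x \<in> - E \<union> B \<epsilon>"
              proof (cases "x \<in> E")
                case True
                define d where "d = w x - (w a + (\<Sum>j\<in>UNIV. (x - a) $ j *\<^sub>R g a $ j))"
                have "dist (f x) (unordered (\<lambda>i. A i x)) \<le> L2_set (\<lambda>i. dist (from_cluster_sums z (w x) i) (A i x)) UNIV"
                  unfolding fE[OF True] by (rule dist_unordered_le)
                also have "\<dots> \<le> L2_set (\<lambda>i. norm (d $ i)) UNIV"
                  unfolding dist_norm A_def d_def by (intro L2_set_mono from_cluster_sums_diff) auto
                also have "\<dots> = norm d" by (simp add: norm_vec_def)
                finally have "\<epsilon> * norm (x - a) < norm d" using x by simp
                then show ?thesis by (simp add: B_def d_def algebra_simps)
              qed simp
            qed
          qed simp
        qed
        moreover have "unordered (\<lambda>i. A i a) = f a"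
          using fE[OF a(2)] by (simp add: A_def)
        moreover have "norm (A i (axis j 1) - A i 0) = 1 / real (card {j. z j = z i}) * norm (g a $ j $ i)" for i j
        proof -
          have "(\<Sum>k\<in>UNIV. (axis j 1 :: real^'m) $ k *\<^sub>R g a $ k $ i) = (\<Sum>k\<in>UNIV. if k = j then g a $ k $ i else 0)"
            by (intro sum.cong) (auto simp: axis_def)
          then show ?thesis unfolding A_def from_cluster_sums_affine by simp
        qed
        ultimately show "(\<exists>A. approx_affine UNIV f a A \<and> unordered (\<lambda>i. A i a) = f a) \<and> abs_deriv (ball 0 1) f a = D a"
          using abs_deriv_eq[OF f open_ball aU AA] unfolding D_def by auto
      qed
    qed
  qed
qed

text \<open>Countably many charts cover the space of tuples. The least index of a chart around f(a)
  selects among the local formulas and gives a Borel representative of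
  \<open>abs_deriv\<close>.\<close>

lemma AE_approx_affine:
  fixes f :: "real^'m::finite \<Rightarrow> ('h::{real_inner, polish_space}, 'q::finite) unordered_tuple"
  assumes p: "1 < p" and F: "energy_approx p F f K" and f: "f \<in> borel_measurable borel"
  obtains D where "D \<in> borel_measurable borel"
    "AE a in lborel. a \<in> ball 0 1 \<longrightarrow>
      (\<exists>A. approx_affine UNIV f a A \<and> unordered (\<lambda>i. A i a) = f a) \<and> abs_deriv (ball 0 1) f a = D a"
proof -
  obtain z :: "nat \<Rightarrow> 'q \<Rightarrow> 'h" and r where zr: "\<And>n. 0 < r n"
    "\<And>n i j. z n i \<noteq> z n j \<Longrightarrow> 8 * r n \<le> dist (z n i) (z n j)"
    "\<And>y. \<exists>n. num_values y = card (range (z n)) \<and> dist y (unordered (z n)) < r n"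
    by (rule countable_chart_cover) (rule that; assumption)
  define P where "P n a \<longleftrightarrow> num_values (f a) = card (range (z n)) \<and> dist (f a) (unordered (z n)) < r n" for n a
  have P[measurable]: "Measurable.pred borel (P n)" for n
  proof -
    note f[measurable]
    have "Measurable.pred borel (\<lambda>y :: ('h, 'q) unordered_tuple. num_values y = card (range (z n)))"
      using borel_measurable_num_values[of "card (range (z n))", where 'a = 'h and 'q = 'q] by (simp add: pred_def)
    note measurable_compose[OF f this, measurable]
    show ?thesis unfolding P_def by measurable
  qed
  have Pex: "\<exists>n. P n a" for a using zr(3)[of "f a"] by (simp add: P_def)
  have "\<forall>n. \<exists>D. D \<in> borel_measurable borel \<and> (AE a in lborel. a \<in> ball 0 1 \<longrightarrow> P n a \<longrightarrow>
    (\<exists>A. approx_affine UNIV f a A \<and> unordered (\<lambda>i. A i a) = f a) \<and> abs_deriv (ball 0 1) f a = D a)"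
  proof
    fix n
    from AE_approx_affine_in_chart[OF p F f zr(1,2)[of n]]
    show "\<exists>D. D \<in> borel_measurable borel \<and> (AE a in lborel. a \<in> ball 0 1 \<longrightarrow> P n a \<longrightarrow>
      (\<exists>A. approx_affine UNIV f a A \<and> unordered (\<lambda>i. A i a) = f a) \<and> abs_deriv (ball 0 1) f a = D a)"
      unfolding P_def Bex_def imp_conjL by simp
  qed
  from choice[OF this] obtain D where D: "\<And>n. D n \<in> borel_measurable borel"
    "\<And>n. AE a in lborel. a \<in> ball 0 1 \<longrightarrow> P n a \<longrightarrow>
      (\<exists>A. approx_affine UNIV f a A \<and> unordered (\<lambda>i. A i a) = f a) \<and> abs_deriv (ball 0 1) f a = D n a"
    by blast
  note D(1)[measurable]
  show ?thesis
  proof (rule that)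
    show "(\<lambda>a. D (LEAST n. P n a) a) \<in> borel_measurable borel" by measurable
    have "AE a in lborel. \<forall>n. a \<in> ball 0 1 \<longrightarrow> P n a \<longrightarrow>
      (\<exists>A. approx_affine UNIV f a A \<and> unordered (\<lambda>i. A i a) = f a) \<and> abs_deriv (ball 0 1) f a = D n a"
      unfolding AE_all_countable by (intro allI D)
    then show "AE a in lborel. a \<in> ball 0 1 \<longrightarrow>
      (\<exists>A. approx_affine UNIV f a A \<and> unordered (\<lambda>i. A i a) = f a) \<and> abs_deriv (ball 0 1) f a = D (LEAST n. P n a) a"
    proof (rule AE_mp, intro AE_I2 impI)
      fix a assume *: "\<forall>n. a \<in> ball 0 1 \<longrightarrow> P n a \<longrightarrow>
        (\<exists>A. approx_affine UNIV f a A \<and> unordered (\<lambda>i. A i a) = f a) \<and> abs_deriv (ball 0 1) f a = D n a"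
        and a: "a \<in> ball 0 1"
      from LeastI_ex[OF Pex[of a]] *[rule_format, OF a]
      show "(\<exists>A. approx_affine UNIV f a A \<and> unordered (\<lambda>i. A i a) = f a) \<and> abs_deriv (ball 0 1) f a = D (LEAST n. P n a) a"
        by blast
    qed
  qed
qed

text \<open>Rademacher's theorem for maps into tuples, obtained from the constant approximating
  sequence.\<close>

lemma AE_approx_affine_of_Lipschitz:
  fixes f :: "real^'m::finite \<Rightarrow> ('h::{real_inner, polish_space}, 'q::finite) unordered_tuple"
  assumes f: "L-lipschitz_on UNIV f"
  shows "AE a in lborel. a \<in> ball 0 1 \<longrightarrow> (\<exists>A. approx_affine UNIV f a A \<and> unordered (\<lambda>i. A i a) = f a)"
proof -
  obtain K where K: "energy_approx 2 (\<lambda>_. f) f K" using energy_approx_const[OF _ f, of 2 f] by auto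
  obtain D where "AE a in lborel. a \<in> ball 0 1 \<longrightarrow>
      (\<exists>A. approx_affine UNIV f a A \<and> unordered (\<lambda>i. A i a) = f a) \<and> abs_deriv (ball 0 1) f a = D a"
    by (rule AE_approx_affine[OF _ K energy_approx_measurable[OF K]]) simp
  then show ?thesis by (rule AE_mp) (intro AE_I2, blast)
qed

text \<open>\<open>dir_lip\<close> is at most m |Df| wherever the approximate derivative exists. The
  constant is divided out on the side of \<open>dir_lip\<close>, whose measurability is
  known.\<close>

lemma dir_lip_energy_le:
  fixes f :: "real^'m::finite \<Rightarrow> ('h::{real_inner, polish_space}, 'q::finite) unordered_tuple"
  assumes f: "L-lipschitz_on UNIV f" and p: "1 < p"
  shows "(\<integral>\<^sup>+x\<in>ball 0 1. ennreal (dir_lip f x powr p) \<partial>lborel)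
    \<le> ennreal (real CARD('m) powr p) * (\<integral>\<^sup>+x\<in>ball 0 1. ennreal (abs_deriv UNIV f x powr p) \<partial>lebesgue)"
proof -
  define m where "m = real CARD('m)"
  have m: "0 < m" by (simp add: m_def)
  have fm: "f \<in> borel_measurable borel"
    by (intro borel_measurable_continuous_onI lipschitz_on_continuous_on[OF f])
  have [measurable]: "ball (0 :: real^'m) 1 \<in> sets borel" by simp
  note borel_measurable_dir_lip[OF f, measurable]
  have "ennreal (1 / m powr p) * (\<integral>\<^sup>+x\<in>ball 0 1. ennreal (dir_lip f x powr p) \<partial>lborel)
      = (\<integral>\<^sup>+x. ennreal (1 / m powr p) * (ennreal (dir_lip f x powr p) * indicator (ball 0 1) x) \<partial>lborel)"
    by (rule nn_integral_cmult[symmetric]) measurable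
  also have "\<dots> = (\<integral>\<^sup>+x. ennreal (1 / m powr p) * (ennreal (dir_lip f x powr p) * indicator (ball 0 1) x) \<partial>lebesgue)"
    by (rule nn_integral_completion[symmetric])
  also have "\<dots> \<le> (\<integral>\<^sup>+x\<in>ball 0 1. ennreal (abs_deriv UNIV f x powr p) \<partial>lebesgue)"
  proof (intro nn_integral_mono_AE, rule AE_mp[OF AE_completion[OF AE_approx_affine_of_Lipschitz[OF f]]], intro AE_I2 impI)
    fix x assume *: "x \<in> ball 0 1 \<longrightarrow> (\<exists>A. approx_affine UNIV f x A \<and> unordered (\<lambda>i. A i x) = f x)"
    show "ennreal (1 / m powr p) * (ennreal (dir_lip f x powr p) * indicator (ball 0 1) x)
        \<le> ennreal (abs_deriv UNIV f x powr p) * indicator (ball 0 1) x"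
    proof (cases "x \<in> ball 0 1")
      case True
      then obtain A where A: "approx_affine UNIV f x A" using * by blast
      have "dir_lip f x \<le> m * abs_deriv UNIV f x" unfolding m_def by (rule dir_lip_le_abs_deriv[OF fm A f])
      then have "dir_lip f x / m \<le> abs_deriv UNIV f x" using m by (simp add: pos_divide_le_eq mult.commute)
      then have "(dir_lip f x / m) powr p \<le> abs_deriv UNIV f x powr p"
        using p m dir_lip_nonneg[OF f, of x] by (intro powr_mono2) auto
      then have "1 / m powr p * dir_lip f x powr p \<le> abs_deriv UNIV f x powr p"
        using m dir_lip_nonneg[OF f, of x] by (simp add: powr_divide)
      then have "ennreal (1 / m powr p * dir_lip f x powr p) \<le> ennreal (abs_deriv UNIV f x powr p)" by (rule ennreal_leI)
      then show ?thesis using True by (subst (asm) ennreal_mult') auto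
    qed simp
  qed
  finally have "ennreal (m powr p) * (ennreal (1 / m powr p) * (\<integral>\<^sup>+x\<in>ball 0 1. ennreal (dir_lip f x powr p) \<partial>lborel))
    \<le> ennreal (m powr p) * (\<integral>\<^sup>+x\<in>ball 0 1. ennreal (abs_deriv UNIV f x powr p) \<partial>lebesgue)"
    by (rule mult_left_mono) simp
  then show ?thesis using m by (simp add: mult.assoc[symmetric] ennreal_mult'[symmetric] m_def)
qed

section \<open>Traces\<close>

lemma nn_integral_dist_dist_tendsto:
  fixes F G :: "nat \<Rightarrow> 'a \<Rightarrow> 'b::{metric_space, second_countable_topology}"
  assumes p: "1 < p"
    and [measurable]: "\<And>j. F j \<in> borel_measurable M" "\<And>j. G j \<in> borel_measurable M"
      "f \<in> borel_measurable M" "g \<in> borel_measurable M" "A \<in> sets M"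
    and F: "(\<lambda>j. \<integral>\<^sup>+x\<in>A. ennreal (dist (F j x) (f x) powr p) \<partial>M) \<longlonglongrightarrow> 0"
    and G: "(\<lambda>j. \<integral>\<^sup>+x\<in>A. ennreal (dist (G j x) (g x) powr p) \<partial>M) \<longlonglongrightarrow> 0"
  shows "(\<lambda>j. \<integral>\<^sup>+x\<in>A. ennreal (dist (dist (F j x) (G j x)) (dist (f x) (g x)) powr p) \<partial>M) \<longlonglongrightarrow> 0"
proof (rule tendsto_sandwich[OF _ _ tendsto_const])
  show "\<forall>\<^sub>F j in sequentially. (\<integral>\<^sup>+x\<in>A. ennreal (dist (dist (F j x) (G j x)) (dist (f x) (g x)) powr p) \<partial>M)
    \<le> ennreal (2 powr p) * ((\<integral>\<^sup>+x\<in>A. ennreal (dist (F j x) (f x) powr p) \<partial>M) + (\<integral>\<^sup>+x\<in>A. ennreal (dist (G j x) (g x) powr p) \<partial>M))"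
  proof (rule always_eventually, rule allI, rule nn_integral_powr_triangle[OF p])
    fix j x
    show "dist (dist (F j x) (G j x)) (dist (f x) (g x)) \<le> dist (F j x) (f x) + dist (G j x) (g x)"
      unfolding dist_real_def abs_le_iff
      by (smt (verit) dist_commute dist_triangle)
  qed auto
  show "(\<lambda>j. ennreal (2 powr p) * ((\<integral>\<^sup>+x\<in>A. ennreal (dist (F j x) (f x) powr p) \<partial>M)
    + (\<integral>\<^sup>+x\<in>A. ennreal (dist (G j x) (g x) powr p) \<partial>M))) \<longlonglongrightarrow> 0"
    using ennreal_tendsto_cmult[OF _ tendsto_add[OF F G], of "ennreal (2 powr p)"] by simp
qed simp

lemma Lipschitz_dist:
  assumes F: "L-lipschitz_on X F" and G: "M-lipschitz_on X G"
  shows "(L + M)-lipschitz_on X (\<lambda>x. dist (F x) (G x))"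
proof (rule lipschitz_onI)
  fix x y assume *: "x \<in> X" "y \<in> X"
  have "dist (dist (F x) (G x)) (dist (F y) (G y)) \<le> dist (F x) (F y) + dist (G x) (G y)"
    unfolding dist_real_def abs_le_iff by (smt (verit) dist_commute dist_triangle)
  then show "dist (dist (F x) (G x)) (dist (F y) (G y)) \<le> (L + M) * dist x y"
    using lipschitz_onD[OF F *] lipschitz_onD[OF G *] by (simp add: distrib_right)
qed (use lipschitz_on_nonneg[OF F] lipschitz_on_nonneg[OF G] in simp)

lemma dir_lip_dist_energy_le:
  fixes F G :: "real^'m::finite \<Rightarrow> 'b::{metric_space, second_countable_topology}"
  assumes p: "1 < p" and F: "L-lipschitz_on UNIV F" and G: "M-lipschitz_on UNIV G" and nn: "0 \<le> K" "0 \<le> K'"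
    and K: "(\<integral>\<^sup>+x\<in>ball 0 1. ennreal (dir_lip F x powr p) \<partial>lborel) \<le> ennreal K"
      "(\<integral>\<^sup>+x\<in>ball 0 1. ennreal (dir_lip G x powr p) \<partial>lborel) \<le> ennreal K'"
  shows "(\<integral>\<^sup>+x\<in>ball 0 1. ennreal (dir_lip (\<lambda>x. dist (F x) (G x)) x powr p) \<partial>lborel) \<le> ennreal (2 powr p * (K + K'))"
proof -
  note borel_measurable_dir_lip[OF F, measurable] borel_measurable_dir_lip[OF G, measurable]
  have "(\<integral>\<^sup>+x\<in>ball 0 1. ennreal (dir_lip (\<lambda>x. dist (F x) (G x)) x powr p) \<partial>lborel)
    \<le> ennreal (2 powr p) * ((\<integral>\<^sup>+x\<in>ball 0 1. ennreal (dir_lip F x powr p) \<partial>lborel)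
      + (\<integral>\<^sup>+x\<in>ball 0 1. ennreal (dir_lip G x powr p) \<partial>lborel))"
  proof (rule nn_integral_powr_triangle[OF p])
    fix x
    have "dir_lip (\<lambda>x. dist (F x) (G x)) x \<le> 1 * (dir_lip F x + dir_lip G x)"
    proof (rule dir_lip_dominated[OF F G])
      show "dist (dist (F y) (G y)) (dist (F x) (G x)) \<le> 1 * (dist (F y) (F x) + dist (G y) (G x))" for x y
        unfolding dist_real_def abs_le_iff by (smt (verit) dist_commute dist_triangle)
    qed simp
    then show "dir_lip (\<lambda>x. dist (F x) (G x)) x \<le> dir_lip F x + dir_lip G x" by simp
  qed (use dir_lip_nonneg[OF F] dir_lip_nonneg[OF G] dir_lip_nonneg[OF Lipschitz_dist[OF F G]] in auto)
  also have "\<dots> \<le> ennreal (2 powr p) * (ennreal K + ennreal K')"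
    by (intro mult_left_mono add_mono K) simp
  also have "\<dots> = ennreal (2 powr p * (K + K'))" using nn by (simp add: ennreal_mult)
  finally show ?thesis .
qed

lemma energy_approx_dist:
  fixes f g :: "real^'m::finite \<Rightarrow> 'b::{metric_space, second_countable_topology}"
  assumes p: "1 < p" and F: "energy_approx p F f K" and G: "energy_approx p G g K'"
    and [measurable]: "f \<in> borel_measurable borel" "g \<in> borel_measurable borel"
  shows "energy_approx p (\<lambda>j x. dist (F j x) (G j x)) (\<lambda>x. dist (f x) (g x)) (2 powr p * (K + K'))"
  unfolding energy_approx_def
proof (intro conjI allI)
  note energy_approx_measurable[OF F, measurable] energy_approx_measurable[OF G, measurable]
  show "(\<lambda>j. \<integral>\<^sup>+x\<in>ball 0 1. ennreal (dist (dist (F j x) (G j x)) (dist (f x) (g x)) powr p) \<partial>lborel) \<longlonglongrightarrow> 0"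
    using F G by (intro nn_integral_dist_dist_tendsto[OF p]) (auto simp: energy_approx_def)
  fix j
  obtain L M where LM: "L-lipschitz_on UNIV (F j)" "M-lipschitz_on UNIV (G j)"
    using F G unfolding energy_approx_def by blast
  show "\<exists>L. L-lipschitz_on UNIV (\<lambda>x. dist (F j x) (G j x))"
    using Lipschitz_dist[OF LM] ..
  show "(\<integral>\<^sup>+x\<in>ball 0 1. ennreal (dir_lip (\<lambda>x. dist (F j x) (G j x)) x powr p) \<partial>lborel) \<le> ennreal (2 powr p * (K + K'))"
    using F G unfolding energy_approx_def by (intro dir_lip_dist_energy_le[OF p LM]) auto
qed (use F G in \<open>auto simp: energy_approx_def\<close>)

lemma borel_measurable_extensional:
  assumes "f \<in> extensional X" "f \<in> borel_measurable (restrict_space borel X)" "X \<in> sets borel"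
  shows "f \<in> borel_measurable borel"
proof -
  have "(\<lambda>x. if x \<in> X then f x else undefined) \<in> borel_measurable borel"
    using assms(2,3) by (subst (asm) measurable_restrict_space_iff[of _ _ undefined]) auto
  also have "(\<lambda>x. if x \<in> X then f x else undefined) = f"
    using assms(1) by (auto simp: extensional_def)
  finally show ?thesis .
qed

text \<open>The passage from |Df| to \<open>dir_lip\<close> multiplies the energy bound by m^p;
  convergence of the p-th roots in \<open>Lp_dist\<close> gives that of the integrals.\<close>

lemma sobolev_energy_approx:
  fixes f :: "real^'m::finite \<Rightarrow> ('h::{real_inner, polish_space}, 'q::finite) unordered_tuple"
  assumes p: "1 < p" and f: "f \<in> sobolev p (ball 0 1)"
  obtains F K where "f \<in> borel_measurable borel" "energy_approx p F f K"
proof -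
  let ?U = "ball (0 :: real^'m) 1"
  have fm: "f \<in> borel_measurable borel"
    using f by (intro borel_measurable_extensional[of _ ?U]) (auto simp: sobolev_def Lp_maps_def)
  obtain F :: "nat \<Rightarrow> real^'m \<Rightarrow> ('h, 'q) unordered_tuple" where F: "\<And>j. \<exists>L. L-lipschitz_on UNIV (F j)"
    "(SUP j. \<integral>\<^sup>+x\<in>?U. ennreal (abs_deriv UNIV (F j) x powr p) \<partial>lebesgue) < \<infinity>"
    "(\<lambda>j. Lp_dist p ?U f (F j)) \<longlonglongrightarrow> 0"
    using f unfolding sobolev_def by blast
  define S where "S = (SUP j. \<integral>\<^sup>+x\<in>?U. ennreal (abs_deriv UNIV (F j) x powr p) \<partial>lebesgue)"
  define K where "K = enn2real (ennreal (real CARD('m) powr p) * S)"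
  have K: "ennreal K = ennreal (real CARD('m) powr p) * S"
    using F(2) unfolding K_def S_def by (intro ennreal_enn2real) (simp add: ennreal_mult_less_top)
  define I where "I j = (\<integral>\<^sup>+x\<in>?U. ennreal (dist (F j x) (f x) powr p) \<partial>lborel)" for j
  have I: "(\<integral>\<^sup>+x\<in>?U. ennreal (dist (f x) (F j x) powr p) \<partial>lebesgue) = I j" for j
    unfolding I_def by (simp add: nn_integral_completion dist_commute)
  have "energy_approx p F f K"
    unfolding energy_approx_def
  proof (intro conjI allI)
    fix j
    show "\<exists>L. L-lipschitz_on UNIV (F j)" by (rule F(1))
    then obtain L where "L-lipschitz_on UNIV (F j)" ..
    from dir_lip_energy_le[OF this p]
    have "(\<integral>\<^sup>+x\<in>?U. ennreal (dir_lip (F j) x powr p) \<partial>lborel)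
      \<le> ennreal (real CARD('m) powr p) * (\<integral>\<^sup>+x\<in>?U. ennreal (abs_deriv UNIV (F j) x powr p) \<partial>lebesgue)" .
    also have "\<dots> \<le> ennreal (real CARD('m) powr p) * S"
      unfolding S_def by (intro mult_left_mono SUP_upper) auto
    finally show "(\<integral>\<^sup>+x\<in>?U. ennreal (dir_lip (F j) x powr p) \<partial>lborel) \<le> ennreal K" by (simp only: K)
  next
    show "0 \<le> K" by (simp add: K_def)
    have "I \<longlonglongrightarrow> 0"
    proof (rule tendsto_zero_ennreal)
      fix e :: real assume e: "0 < e"
      have "\<forall>\<^sub>F j in sequentially. Lp_dist p ?U f (F j) < ennreal (e powr (1/p))"
        using e F(3) by (intro order_tendstoD) auto
      then show "\<forall>\<^sub>F j in sequentially. I j < ennreal e"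
      proof eventually_elim
        case (elim j)
        then have fin: "I j \<noteq> \<infinity>" and "enn2real (I j) powr (1/p) < e powr (1/p)"
          by (auto simp: Lp_dist_def I Let_def ennreal_less_iff split: if_splits)
        then have "enn2real (I j) < e"
          using e p by (meson enn2real_nonneg less_imp_le not_less powr_mono2 zero_le_divide_1_iff order_less_trans zero_less_one)
        then show ?case using fin e by (metis enn2real_nonneg ennreal_enn2real ennreal_less_iff infinity_ennreal_def less_top)
      qed
    qed
    then show "(\<lambda>j. \<integral>\<^sup>+x\<in>?U. ennreal (dist (F j x) (f x) powr p) \<partial>lborel) \<longlonglongrightarrow> 0" unfolding I_def .
  qed
  then show ?thesis by (rule that[OF fm])
qed

section \<open>Existence of traces\<close>

text \<open>The trace inequality is applied to the real function dist(F i, F j). Its energy is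
  bounded by \<open>E\<close> independently of i and j, so \<delta> can be fixed before the
  distances in the ball are made small.\<close>

lemma energy_approx_Cauchy_on_sphere:
  fixes f :: "real^'m::finite \<Rightarrow> 'b::{metric_space, second_countable_topology}"
  assumes p: "1 < p" and F: "energy_approx p F f K" and [measurable]: "f \<in> borel_measurable borel" and e: "0 < e"
  obtains N where "\<And>i j. N \<le> i \<Longrightarrow> N \<le> j \<Longrightarrow>
    (\<integral>\<^sup>+x\<in>sphere 0 1. ennreal (dist (F i x) (F j x) powr p) \<partial>hausdorff_measure (CARD('m) - 1)) \<le> ennreal e"
proof -
  let ?H = "hausdorff_measure (CARD('m) - 1) :: (real^'m) measure"
  let ?U = "ball (0 :: real^'m) 1" and ?S = "sphere (0 :: real^'m) 1"
  note energy_approx_measurable[OF F, measurable]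
  obtain C where C: "0 < C" "\<And>(\<phi> :: real^'m \<Rightarrow> real) L \<delta>.
    L-lipschitz_on UNIV \<phi> \<Longrightarrow> 0 < \<delta> \<Longrightarrow> \<delta> \<le> 1/2 \<Longrightarrow>
    ennreal \<delta> * (\<integral>\<^sup>+x\<in>?S. ennreal (\<bar>\<phi> x\<bar> powr p) \<partial>?H) \<le>
    ennreal C * ((\<integral>\<^sup>+x\<in>?U. ennreal (\<bar>\<phi> x\<bar> powr p) \<partial>lborel)
      + ennreal (\<delta> powr p) * (\<integral>\<^sup>+x\<in>?U. ennreal (dir_lip \<phi> x powr p) \<partial>lborel))"
    by (rule Lipschitz_trace_inequality[OF p, where 'm = 'm]) (rule that; assumption)
  define P :: real where "P = 2 powr p"
  have P: "0 < P" by (simp add: P_def)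
  have K: "0 \<le> K" using F by (simp add: energy_approx_def)
  define E where "E = P * (K + K)"
  have E: "0 \<le> E" using P K by (simp add: E_def)
  \<comment> \<open>p > 1 leaves a positive power of \<delta> after division by \<delta>.\<close>
  obtain \<delta> where \<delta>: "0 < \<delta>" "\<delta> \<le> 1/2" "C * E * \<delta> powr (p - 1) \<le> e / 2"
    by (rule small_root_exists[of "e / 2" "C * E" "p - 1"]) (use e C(1) E p in auto)
  \<comment> \<open>The distance in the ball contributes at most 2 P b, so its term in the trace
    inequality is \<delta> e / 2.\<close>
  define b where "b = \<delta> * e / (4 * C * P)"
  have b: "0 < b" using \<delta>(1) e C(1) P by (simp add: b_def)
  have "\<forall>\<^sub>F j in sequentially. (\<integral>\<^sup>+x\<in>?U. ennreal (dist (F j x) (f x) powr p) \<partial>lborel) < ennreal b"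
    using F b by (intro order_tendstoD(2)[where y = 0]) (auto simp: energy_approx_def)
  then obtain N where N: "\<And>j. N \<le> j \<Longrightarrow> (\<integral>\<^sup>+x\<in>?U. ennreal (dist (F j x) (f x) powr p) \<partial>lborel) < ennreal b"
    unfolding eventually_sequentially by blast
  show ?thesis
  proof (rule that[of N])
    fix i j assume ij: "N \<le> i" "N \<le> j"
    obtain L M where LM: "L-lipschitz_on UNIV (F i)" "M-lipschitz_on UNIV (F j)"
      using F unfolding energy_approx_def by blast
    define Y where "Y = (\<integral>\<^sup>+x\<in>?S. ennreal (dist (F i x) (F j x) powr p) \<partial>?H)"
    have "(\<integral>\<^sup>+x\<in>?U. ennreal (dist (F i x) (F j x) powr p) \<partial>lborel)
      \<le> ennreal (2 powr p) * ((\<integral>\<^sup>+x\<in>?U. ennreal (dist (F i x) (f x) powr p) \<partial>lborel)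
        + (\<integral>\<^sup>+x\<in>?U. ennreal (dist (F j x) (f x) powr p) \<partial>lborel))"
      by (rule nn_integral_powr_triangle[OF p]) (auto simp: dist_triangle2)
    also have "\<dots> \<le> ennreal P * (ennreal b + ennreal b)"
      unfolding P_def by (intro mult_left_mono add_mono less_imp_le[OF N] ij) simp
    also have "\<dots> = ennreal (P * (b + b))" using P b by (simp only: ennreal_mult ennreal_plus less_imp_le add_nonneg_nonneg)
    finally have X: "(\<integral>\<^sup>+x\<in>?U. ennreal (dist (F i x) (F j x) powr p) \<partial>lborel) \<le> ennreal (P * (b + b))" .
    have DE: "(\<integral>\<^sup>+x\<in>?U. ennreal (dir_lip (\<lambda>x. dist (F i x) (F j x)) x powr p) \<partial>lborel) \<le> ennreal E"
      unfolding E_def P_def using F by (intro dir_lip_dist_energy_le[OF p LM]) (auto simp: energy_approx_def)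
    have "ennreal \<delta> * Y \<le> ennreal C * ((\<integral>\<^sup>+x\<in>?U. ennreal (dist (F i x) (F j x) powr p) \<partial>lborel)
      + ennreal (\<delta> powr p) * (\<integral>\<^sup>+x\<in>?U. ennreal (dir_lip (\<lambda>x. dist (F i x) (F j x)) x powr p) \<partial>lborel))"
      using C(2)[OF Lipschitz_dist[OF LM] \<delta>(1,2)] by (simp add: Y_def)
    also have "\<dots> \<le> ennreal C * (ennreal (P * (b + b)) + ennreal (\<delta> powr p) * ennreal E)"
      by (intro mult_left_mono add_mono X DE) auto
    also have "\<dots> = ennreal (C * (P * (b + b) + \<delta> powr p * E))"
      using C(1) P b E by (simp add: ennreal_mult)
    also have "\<dots> \<le> ennreal (\<delta> * e)"
    proof (rule ennreal_leI)
      have "\<delta> powr p = \<delta> powr (p - 1) * \<delta>" using \<delta>(1) by (simp add: powr_diff)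
      then have "C * (\<delta> powr p * E) = (C * E * \<delta> powr (p - 1)) * \<delta>" by simp
      also have "\<dots> \<le> e / 2 * \<delta>" using \<delta> by (intro mult_right_mono) auto
      finally have "C * (\<delta> powr p * E) \<le> e / 2 * \<delta>" .
      moreover have "C * (P * (b + b)) = e / 2 * \<delta>" using C(1) P by (simp add: b_def)
      ultimately have "C * (P * (b + b)) + C * (\<delta> powr p * E) \<le> e / 2 * \<delta> + e / 2 * \<delta>" by linarith
      then show "C * (P * (b + b) + \<delta> powr p * E) \<le> \<delta> * e" by (simp add: distrib_left mult.commute)
    qed
    also have "ennreal (\<delta> * e) = ennreal \<delta> * ennreal e" using \<delta>(1) e by (simp add: ennreal_mult)
    finally have "Y \<le> ennreal e" using \<delta>(1) by (subst (asm) ennreal_mult_le_mult_iff) auto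
    then show "(\<integral>\<^sup>+x\<in>?S. ennreal (dist (F i x) (F j x) powr p) \<partial>?H) \<le> ennreal e" by (simp add: Y_def)
  qed
qed

lemma Lp_Cauchy_subsequence:
  assumes Cauchy: "\<And>e. 0 < e \<Longrightarrow> \<exists>N. \<forall>i j. N \<le> i \<longrightarrow> N \<le> j \<longrightarrow> d i j \<le> ennreal e"
    and e: "\<And>n. 0 < e n"
  obtains r :: "nat \<Rightarrow> nat" where "filterlim r at_top sequentially" "\<And>n k. n \<le> k \<Longrightarrow> d (r n) (r k) \<le> ennreal (e n)"
proof -
  have "\<forall>n. \<exists>N. \<forall>i j. N \<le> i \<longrightarrow> N \<le> j \<longrightarrow> d i j \<le> ennreal (e n)" using Cauchy e by blast
  from choice[OF this] obtain N where N: "\<And>n i j. N n \<le> i \<Longrightarrow> N n \<le> j \<Longrightarrow> d i j \<le> ennreal (e n)" by blast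
  define r where "r n = n + (\<Sum>k\<le>n. N k)" for n
  have r: "N n \<le> r k" if "n \<le> k" for n k
    using member_le_sum[of n "{..k}" N] that by (simp add: r_def)
  show ?thesis
  proof (rule that[of r])
    show "filterlim r at_top sequentially"
      by (rule filterlim_at_top_mono[OF filterlim_ident]) (simp add: r_def)
    show "d (r n) (r k) \<le> ennreal (e n)" if "n \<le> k" for n k
      using that by (intro N r) auto
  qed
qed

text \<open>Riesz-Fischer for tuples: consecutive distances are summable almost everywhere on
  \<open>A\<close>, which makes the tuples converge there, and Fatou gives the convergence in
  Lp.\<close>

lemma Lp_Cauchy_limit:
  fixes F :: "nat \<Rightarrow> 'a \<Rightarrow> ('h::polish_space, 'q::finite) unordered_tuple"
  assumes p: "1 < p" and [measurable]: "\<And>j. F j \<in> borel_measurable M" "A \<in> sets M"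
    and F: "\<And>n k. n \<le> k \<Longrightarrow> (\<integral>\<^sup>+x\<in>A. ennreal (dist (F n x) (F k x) powr p) \<partial>M) \<le> ennreal (((1/2)^n) powr p)"
  obtains \<tau> where "\<tau> \<in> borel_measurable M"
    "(\<lambda>n. \<integral>\<^sup>+x\<in>A. ennreal (dist (F n x) (\<tau> x) powr p) \<partial>M) \<longlonglongrightarrow> 0"
proof -
  define Z where "Z = {x \<in> space M. (\<Sum>n. ennreal (dist (F n x) (F (Suc n) x))) < \<infinity>}"
  have Z[measurable]: "Z \<in> sets M" unfolding Z_def by measurable
  \<comment> \<open>The constant value outside the Borel set \<open>Z\<close> makes the sequence
    \<open>G\<close> converge everywhere, so its limit is Borel.\<close>
  define y0 :: "('h, 'q) unordered_tuple" where "y0 = unordered (\<lambda>_. undefined)"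
  define G where "G n x = (if x \<in> Z then F n x else y0)" for n x
  define \<tau> where "\<tau> x = lim (\<lambda>n. G n x)" for x
  have G[measurable]: "G n \<in> borel_measurable M" for n unfolding G_def by measurable
  have conv: "convergent (\<lambda>n. F n x)" if "x \<in> Z" for x
  proof (rule unordered_tuple_convergent)
    show "summable (\<lambda>n. dist (F n x) (F (Suc n) x))"
      using that by (intro summable_suminf_not_top) (auto simp: Z_def)
  qed
  have lim: "(\<lambda>n. G n x) \<longlonglongrightarrow> \<tau> x" for x
    unfolding \<tau>_def convergent_LIMSEQ_iff[symmetric]
    using conv[of x] by (cases "x \<in> Z") (simp_all add: G_def convergent_const)
  have \<tau>[measurable]: "\<tau> \<in> borel_measurable M" by (rule borel_measurable_LIMSEQ_metric[OF G lim])
  define t where "t n x = dist (F n x) (F (Suc n) x) * indicator A x" for n x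
  have t0: "0 \<le> t n x" for n x by (simp add: t_def)
  \<comment> \<open>The weight is that of \<open>le_add_powr\<close> with \<eta> = (1/2)^n; times
    the bound ((1/2)^n) powr p it is (1/2)^n.\<close>
  have "AE x in M. summable (\<lambda>n. ((1/2)^n) powr (1 - p) * t n x powr p)"
  proof (rule AE_summable_of_nn_integral_le)
    show "(\<lambda>x. ((1/2)^n) powr (1 - p) * t n x powr p) \<in> borel_measurable M" for n unfolding t_def by measurable
    fix n
    have "(\<integral>\<^sup>+x. ennreal (((1/2)^n) powr (1 - p) * t n x powr p) \<partial>M)
      = (\<integral>\<^sup>+x. ennreal (((1/2)^n) powr (1 - p)) * (ennreal (dist (F n x) (F (Suc n) x) powr p) * indicator A x) \<partial>M)"
      using p by (intro nn_integral_cong) (auto simp: t_def indicator_def ennreal_mult)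
    also have "\<dots> = ennreal (((1/2)^n) powr (1 - p)) * (\<integral>\<^sup>+x\<in>A. ennreal (dist (F n x) (F (Suc n) x) powr p) \<partial>M)"
      by (rule nn_integral_cmult) measurable
    also have "\<dots> \<le> ennreal (((1/2)^n) powr (1 - p)) * ennreal (((1/2)^n) powr p)"
      by (intro mult_left_mono F) auto
    also have "\<dots> = ennreal (((1/2)^n) powr (1 - p) * ((1/2)^n) powr p)" by (simp add: ennreal_mult)
    also have "((1/2)^n) powr (1 - p) * ((1/2)^n) powr p = (1/2 :: real)^n" by (simp flip: powr_add)
    finally show "(\<integral>\<^sup>+x. ennreal (((1/2)^n) powr (1 - p) * t n x powr p) \<partial>M) \<le> ennreal ((1/2)^n)" .
  qed simp
  then have AE: "AE x in M. x \<in> A \<longrightarrow> x \<in> Z"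
  proof (rule AE_mp, intro AE_I2 impI)
    fix x assume x: "x \<in> space M" "summable (\<lambda>n. ((1/2)^n) powr (1 - p) * t n x powr p)" "x \<in> A"
    have "summable (\<lambda>n. (1/2 :: real)^n + ((1/2)^n) powr (1 - p) * t n x powr p)"
      by (intro summable_add x summable_geometric) simp
    then have "summable (\<lambda>n. t n x)"
    proof (rule summable_comparison_test'[where N = 0])
      show "norm (t n x) \<le> (1/2)^n + ((1/2)^n) powr (1 - p) * t n x powr p" for n
        using le_add_powr[OF t0[of n x] _ p, of "(1/2)^n"] t0[of n x] by simp
    qed
    then have "(\<Sum>n. ennreal (t n x)) = ennreal (\<Sum>n. t n x)" using t0 by (intro suminf_ennreal2)
    then have "(\<Sum>n. ennreal (t n x)) < \<infinity>" by simp
    then show "x \<in> Z" using x by (simp add: Z_def t_def)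
  qed
  have le: "(\<integral>\<^sup>+x\<in>A. ennreal (dist (F n x) (\<tau> x) powr p) \<partial>M) \<le> ennreal (((1/2)^n) powr p)" for n
  proof -
    have "(\<integral>\<^sup>+x\<in>A. ennreal (dist (F n x) (\<tau> x) powr p) \<partial>M)
      \<le> (\<integral>\<^sup>+x. liminf (\<lambda>k. ennreal (dist (F n x) (F k x) powr p) * indicator A x) \<partial>M)"
      using AE
    proof (intro nn_integral_mono_AE, eventually_elim)
      case (elim x)
      show ?case
      proof (cases "x \<in> A")
        case True
        then have "x \<in> Z" using elim by blast
        then have "(\<lambda>k. F k x) \<longlonglongrightarrow> \<tau> x" using lim[of x] by (simp add: G_def)
        then have "(\<lambda>k. ennreal (dist (F n x) (F k x) powr p)) \<longlonglongrightarrow> ennreal (dist (F n x) (\<tau> x) powr p)"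
          using p by (intro tendsto_ennrealI tendsto_powr' tendsto_dist tendsto_const) auto
        from lim_imp_Liminf[OF sequentially_bot this] show ?thesis using True by simp
      qed simp
    qed
    also have "\<dots> \<le> liminf (\<lambda>k. \<integral>\<^sup>+x\<in>A. ennreal (dist (F n x) (F k x) powr p) \<partial>M)"
      by (rule nn_integral_liminf) measurable
    also have "\<dots> \<le> liminf (\<lambda>k. ennreal (((1/2)^n) powr p))"
      by (intro Liminf_mono eventually_sequentiallyI[of n] F)
    also have "\<dots> = ennreal (((1/2)^n) powr p)" by (simp add: Liminf_const)
    finally show ?thesis .
  qed
  show ?thesis
  proof (rule that[OF \<tau>], rule tendsto_sandwich[OF _ _ tendsto_const])
    have "(\<lambda>n. ((1/2)^n) powr p) \<longlonglongrightarrow> (0 :: real)"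
      using p tendsto_powr'[OF LIMSEQ_power_zero tendsto_const, of "1/2 :: real" p] by simp
    then show "(\<lambda>n. ennreal (((1/2)^n) powr p)) \<longlonglongrightarrow> 0" using tendsto_ennrealI by fastforce
  qed (use le in simp_all)
qed

text \<open>A relation, not a function: the limit on the sphere of some approximating sequence with
  bounded energy. The inequality behind (B) holds for any two maps related in this way, so the
  choice of the sequence does not matter for it.\<close>

definition is_trace :: "real \<Rightarrow> (real^'m::finite \<Rightarrow> 'b::metric_space) \<Rightarrow> (real^'m \<Rightarrow> 'b) \<Rightarrow> bool" where
  "is_trace p f \<tau> \<longleftrightarrow> \<tau> \<in> borel_measurable borel \<and> (\<exists>F K. energy_approx p F f K \<and>
    (\<lambda>j. \<integral>\<^sup>+x\<in>sphere 0 1. ennreal (dist (F j x) (\<tau> x) powr p) \<partial>hausdorff_measure (CARD('m) - 1)) \<longlonglongrightarrow> 0)"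

lemma is_trace_exists:
  fixes f :: "real^'m::finite \<Rightarrow> ('h::polish_space, 'q::finite) unordered_tuple"
  assumes p: "1 < p" and F: "energy_approx p F f K" and f: "f \<in> borel_measurable borel"
  shows "\<exists>\<tau>. is_trace p f \<tau>"
proof -
  let ?H = "hausdorff_measure (CARD('m) - 1) :: (real^'m) measure"
  define d where "d i j = (\<integral>\<^sup>+x\<in>sphere 0 1. ennreal (dist (F i x) (F j x) powr p) \<partial>?H)" for i j
  have "\<exists>N. \<forall>i j. N \<le> i \<longrightarrow> N \<le> j \<longrightarrow> d i j \<le> ennreal e" if e: "0 < e" for e
    by (rule energy_approx_Cauchy_on_sphere[OF p F f e]) (unfold d_def, blast)
  from Lp_Cauchy_subsequence[where d = d and e = "\<lambda>n. ((1/2)^n) powr p", OF this]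
  obtain r where r: "filterlim r at_top sequentially" "\<And>n k. n \<le> k \<Longrightarrow> d (r n) (r k) \<le> ennreal (((1/2)^n) powr p)"
    by (metis powr_gt_zero power_eq_0_iff half_gt_zero_iff zero_less_one less_irrefl)
  have m: "F (r n) \<in> borel_measurable ?H" for n
    using energy_approx_measurable[OF F, of "r n"] by simp
  have "sphere 0 1 \<in> sets ?H" by simp
  then obtain \<tau> where \<tau>: "\<tau> \<in> borel_measurable ?H"
    "(\<lambda>n. \<integral>\<^sup>+x\<in>sphere 0 1. ennreal (dist (F (r n) x) (\<tau> x) powr p) \<partial>?H) \<longlonglongrightarrow> 0"
    by (rule Lp_Cauchy_limit[where F = "\<lambda>n. F (r n)", OF p m _ r(2)[unfolded d_def]])
  have "energy_approx p (\<lambda>n. F (r n)) f K"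
    using F filterlim_compose[OF _ r(1)] unfolding energy_approx_def by fastforce
  with \<tau> have "\<tau> \<in> borel_measurable borel \<and> (\<exists>F K. energy_approx p F f K \<and>
    (\<lambda>j. \<integral>\<^sup>+x\<in>sphere 0 1. ennreal (dist (F j x) (\<tau> x) powr p) \<partial>?H) \<longlonglongrightarrow> 0)"
    by (intro conjI exI[of _ "\<lambda>n. F (r n)"] exI[of _ K]) simp_all
  then show ?thesis unfolding is_trace_def by (intro exI[of _ \<tau>])
qed

section \<open>The inequality for two traces\<close>

lemma abs_deriv_nonneg:
  fixes f :: "real^'m::finite \<Rightarrow> ('h::real_normed_vector, 'q::finite) unordered_tuple"
  shows "0 \<le> abs_deriv U f a"
proof -
  have "0 \<le> deriv_norm D" for D :: "(real^'m \<Rightarrow> 'h, 'q) unordered_tuple"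
    by transfer (simp add: sum_nonneg)
  then show ?thesis by (simp add: abs_deriv_def)
qed

text \<open>The Borel representatives \<open>D1\<close> and \<open>D2\<close> of |Df1| and |Df2|
  make the inequality for the p-th power of a sum applicable; their absolute values are nonnegative
  also where the representatives are wrong.\<close>

lemma gradient_energy_le:
  fixes f1 f2 :: "real^'m::finite \<Rightarrow> ('h::{real_inner, polish_space}, 'q::finite) unordered_tuple"
  assumes p: "1 < p" and F: "energy_approx p F1 f1 K1" "energy_approx p F2 f2 K2"
    and f: "f1 \<in> borel_measurable borel" "f2 \<in> borel_measurable borel"
    and [measurable]: "g \<in> borel_measurable borel"
    and g: "AE a in lborel. a \<in> ball 0 1 \<longrightarrow>
      (\<forall>\<epsilon>>0. density_zero_at {x. norm (dist (f1 x) (f2 x) - dist (f1 a) (f2 a) - (\<Sum>i\<in>UNIV. (x - a) $ i *\<^sub>R g a $ i)) > \<epsilon> * norm (x - a)} a)"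
  shows "(\<integral>\<^sup>+x\<in>ball 0 1. ennreal (norm (g x) powr p) \<partial>lborel)
    \<le> ennreal ((2 * real CARD('m)) powr p) * ((\<integral>\<^sup>+x\<in>ball 0 1. ennreal (abs_deriv (ball 0 1) f1 x powr p) \<partial>lebesgue)
      + (\<integral>\<^sup>+x\<in>ball 0 1. ennreal (abs_deriv (ball 0 1) f2 x powr p) \<partial>lebesgue))"
proof -
  let ?U = "ball (0 :: real^'m) 1"
  have [measurable]: "?U \<in> sets borel" by simp
  define m where "m = real CARD('m)"
  have m: "0 \<le> m" by (simp add: m_def)
  have \<phi>: "(\<lambda>x. dist (f1 x) (f2 x)) \<in> borel_measurable borel" using f by measurable
  obtain D1 where D1: "D1 \<in> borel_measurable borel"
    "AE a in lborel. a \<in> ?U \<longrightarrow> (\<exists>A. approx_affine UNIV f1 a A \<and> unordered (\<lambda>i. A i a) = f1 a) \<and> abs_deriv ?U f1 a = D1 a"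
    by (rule AE_approx_affine[OF p F(1) f(1)])
  obtain D2 where D2: "D2 \<in> borel_measurable borel"
    "AE a in lborel. a \<in> ?U \<longrightarrow> (\<exists>A. approx_affine UNIV f2 a A \<and> unordered (\<lambda>i. A i a) = f2 a) \<and> abs_deriv ?U f2 a = D2 a"
    by (rule AE_approx_affine[OF p F(2) f(2)])
  note D1(1)[measurable] D2(1)[measurable]
  have abs_deriv: "(\<integral>\<^sup>+x\<in>?U. ennreal ((m * \<bar>D x\<bar>) powr p) \<partial>lborel)
      = ennreal (m powr p) * (\<integral>\<^sup>+x\<in>?U. ennreal (abs_deriv ?U f x powr p) \<partial>lebesgue)"
    if [measurable]: "D \<in> borel_measurable borel" and D: "AE a in lborel. a \<in> ?U \<longrightarrow>
      (\<exists>A. approx_affine UNIV f a A \<and> unordered (\<lambda>i. A i a) = f a) \<and> abs_deriv ?U f a = D a"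
    for D and f :: "real^'m \<Rightarrow> ('h, 'q) unordered_tuple"
  proof -
    have "(\<integral>\<^sup>+x\<in>?U. ennreal ((m * \<bar>D x\<bar>) powr p) \<partial>lborel) = (\<integral>\<^sup>+x. ennreal (m powr p) * (ennreal (\<bar>D x\<bar> powr p) * indicator ?U x) \<partial>lborel)"
      using m by (intro nn_integral_cong) (simp add: powr_mult ennreal_mult mult.assoc)
    also have "\<dots> = ennreal (m powr p) * (\<integral>\<^sup>+x\<in>?U. ennreal (\<bar>D x\<bar> powr p) \<partial>lborel)"
      by (rule nn_integral_cmult) measurable
    also have "(\<integral>\<^sup>+x\<in>?U. ennreal (\<bar>D x\<bar> powr p) \<partial>lborel) = (\<integral>\<^sup>+x\<in>?U. ennreal (\<bar>D x\<bar> powr p) \<partial>lebesgue)"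
      by (rule nn_integral_completion[symmetric])
    also have "\<dots> = (\<integral>\<^sup>+x\<in>?U. ennreal (abs_deriv ?U f x powr p) \<partial>lebesgue)"
    proof (intro nn_integral_cong_AE, rule AE_mp[OF AE_completion[OF D]], intro AE_I2 impI)
      fix x assume "x \<in> ?U \<longrightarrow> (\<exists>A. approx_affine UNIV f x A \<and> unordered (\<lambda>i. A i x) = f x) \<and> abs_deriv ?U f x = D x"
      then show "ennreal (\<bar>D x\<bar> powr p) * indicator ?U x = ennreal (abs_deriv ?U f x powr p) * indicator ?U x"
        using abs_deriv_nonneg[of ?U f x] by (cases "x \<in> ?U") auto
    qed
    finally show ?thesis .
  qed
  have "AE a in lborel. a \<in> ?U \<longrightarrow> norm (g a) \<le> m * \<bar>D1 a\<bar> + m * \<bar>D2 a\<bar>"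
    using D1(2) D2(2) g
  proof eventually_elim
    case (elim a)
    show ?case
    proof
      assume a: "a \<in> ?U"
      obtain A where A: "approx_affine UNIV f1 a A" "unordered (\<lambda>i. A i a) = f1 a" using elim(1) a by blast
      obtain B where B: "approx_affine UNIV f2 a B" "unordered (\<lambda>i. B i a) = f2 a" using elim(2) a by blast
      have "norm (g a) \<le> m * (abs_deriv ?U f1 a + abs_deriv ?U f2 a)"
        unfolding m_def
      proof (rule gradient_of_dist_le[OF f(1) A f(2) B open_ball a \<phi>])
        show "density_zero_at {x. \<epsilon> * norm (x - a) < norm (dist (f1 x) (f2 x) - dist (f1 a) (f2 a) - (\<Sum>i\<in>UNIV. (x - a) $ i *\<^sub>R g a $ i))} a"
          if "0 < \<epsilon>" for \<epsilon> using elim(3) a that by blast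
      qed simp
      also have "\<dots> = m * (D1 a + D2 a)" using elim(1,2) a by simp
      also have "\<dots> \<le> m * (\<bar>D1 a\<bar> + \<bar>D2 a\<bar>)" using m by (intro mult_left_mono add_mono) auto
      finally show "norm (g a) \<le> m * \<bar>D1 a\<bar> + m * \<bar>D2 a\<bar>" by (simp add: distrib_left)
    qed
  qed
  then have "(\<integral>\<^sup>+x\<in>?U. ennreal (norm (g x) powr p) \<partial>lborel) \<le> (\<integral>\<^sup>+x\<in>?U. ennreal ((m * \<bar>D1 x\<bar> + m * \<bar>D2 x\<bar>) powr p) \<partial>lborel)"
  proof (intro nn_integral_mono_AE, eventually_elim)
    case (elim a)
    then show ?case using p by (cases "a \<in> ?U") (auto intro!: ennreal_leI powr_mono2)
  qed
  also have "\<dots> \<le> ennreal (2 powr p) * ((\<integral>\<^sup>+x\<in>?U. ennreal ((m * \<bar>D1 x\<bar>) powr p) \<partial>lborel) + (\<integral>\<^sup>+x\<in>?U. ennreal ((m * \<bar>D2 x\<bar>) powr p) \<partial>lborel))"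
    using m by (intro nn_integral_powr_triangle[OF p]) auto
  also have "\<dots> = ennreal ((2 * m) powr p) * ((\<integral>\<^sup>+x\<in>?U. ennreal (abs_deriv ?U f1 x powr p) \<partial>lebesgue)
      + (\<integral>\<^sup>+x\<in>?U. ennreal (abs_deriv ?U f2 x powr p) \<partial>lebesgue))"
    unfolding abs_deriv[OF D1] abs_deriv[OF D2] using m by (simp add: powr_mult ennreal_mult distrib_left mult.assoc)
  finally show ?thesis by (simp add: m_def)
qed

text \<open>\<open>C1_trace_inequality\<close> passes to the limit because the gradients converge in
  norm: the right-hand side then contains the energy of \<open>g\<close> in place of a bound for the
  approximating energies.\<close>

lemma trace_inequality:
  fixes p :: real
  assumes p: "1 < p"
  obtains C where "0 < C" "\<And>(f1 :: real^'m::finite \<Rightarrow> ('h::{real_inner, polish_space}, 'q::finite) unordered_tuple) f2 \<tau>1 \<tau>2 \<delta>.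
    f1 \<in> borel_measurable borel \<Longrightarrow> f2 \<in> borel_measurable borel \<Longrightarrow> is_trace p f1 \<tau>1 \<Longrightarrow> is_trace p f2 \<tau>2 \<Longrightarrow>
    0 < \<delta> \<Longrightarrow> \<delta> \<le> 1/2 \<Longrightarrow>
    ennreal \<delta> * (\<integral>\<^sup>+x\<in>sphere 0 1. ennreal (dist (\<tau>1 x) (\<tau>2 x) powr p) \<partial>hausdorff_measure (CARD('m) - 1)) \<le>
    ennreal C * ((\<integral>\<^sup>+x\<in>ball 0 1. ennreal (dist (f1 x) (f2 x) powr p) \<partial>lebesgue)
      + ennreal (\<delta> powr p) * ((\<integral>\<^sup>+x\<in>ball 0 1. ennreal (abs_deriv (ball 0 1) f1 x powr p) \<partial>lebesgue)
        + (\<integral>\<^sup>+x\<in>ball 0 1. ennreal (abs_deriv (ball 0 1) f2 x powr p) \<partial>lebesgue)))"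
proof -
  let ?H = "hausdorff_measure (CARD('m) - 1) :: (real^'m) measure"
  let ?U = "ball (0 :: real^'m) 1" and ?S = "sphere (0 :: real^'m) 1"
  have [measurable]: "?U \<in> sets borel" "?S \<in> sets borel" by simp_all
  obtain C0 where C0: "0 < C0" "\<And>v :: real^'m \<Rightarrow> real. \<And>G \<delta>.
    C1_grad v G \<Longrightarrow> 0 < \<delta> \<Longrightarrow> \<delta> \<le> 1/2 \<Longrightarrow>
    ennreal \<delta> * (\<integral>\<^sup>+x\<in>?S. ennreal (norm (v x) powr p) \<partial>?H) \<le>
    ennreal C0 * ((\<integral>\<^sup>+x\<in>?U. ennreal (norm (v x) powr p) \<partial>lborel)
      + ennreal (\<delta> powr p) * (\<integral>\<^sup>+x\<in>?U. ennreal (norm (G x) powr p) \<partial>lborel))"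
    by (rule C1_trace_inequality[OF p]) blast
  define P where "P = ennreal (2 powr p)"
  define M where "M = (2 * real CARD('m)) powr p"
  have P: "P < top" "P = ennreal (2 powr p)" by (simp_all add: P_def)
  \<comment> \<open>2^p is lost once on the sphere and once in the ball; 1 + M dominates both the
    coefficient 1 of the distance and the coefficient M of the energies.\<close>
  define C where "C = 2 powr p * C0 * 2 powr p * (1 + M)"
  show ?thesis
  proof (rule that[of C])
    show "0 < C" using C0(1) by (simp add: C_def M_def add_pos_nonneg)
    fix f1 f2 \<tau>1 \<tau>2 :: "real^'m \<Rightarrow> ('h, 'q) unordered_tuple" and \<delta> :: real
    assume f[measurable]: "f1 \<in> borel_measurable borel" "f2 \<in> borel_measurable borel"
      and tr: "is_trace p f1 \<tau>1" "is_trace p f2 \<tau>2" and \<delta>: "0 < \<delta>" "\<delta> \<le> 1/2"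
    from tr obtain F1 K1 F2 K2 where F: "energy_approx p F1 f1 K1" "energy_approx p F2 f2 K2"
      and \<tau>[measurable]: "\<tau>1 \<in> borel_measurable borel" "\<tau>2 \<in> borel_measurable borel"
      and lim: "(\<lambda>j. \<integral>\<^sup>+x\<in>?S. ennreal (dist (F1 j x) (\<tau>1 x) powr p) \<partial>?H) \<longlonglongrightarrow> 0"
        "(\<lambda>j. \<integral>\<^sup>+x\<in>?S. ennreal (dist (F2 j x) (\<tau>2 x) powr p) \<partial>?H) \<longlonglongrightarrow> 0"
      unfolding is_trace_def by blast
    define \<phi> where "\<phi> x = dist (f1 x) (f2 x)" for x
    define \<tau> where "\<tau> x = dist (\<tau>1 x) (\<tau>2 x)" for x
    have \<phi>\<tau>[measurable]: "\<phi> \<in> borel_measurable borel" "\<tau> \<in> borel_measurable borel"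
      unfolding \<phi>_def \<tau>_def by measurable
    note energy_approx_measurable[OF F(1), measurable] energy_approx_measurable[OF F(2), measurable]
    have F12: "energy_approx p (\<lambda>j x. dist (F1 j x) (F2 j x)) \<phi> (2 powr p * (K1 + K2))"
      unfolding \<phi>_def by (rule energy_approx_dist[OF p F f])
    have lim12: "(\<lambda>j. \<integral>\<^sup>+x\<in>?S. ennreal (dist (dist (F1 j x) (F2 j x)) (\<tau> x) powr p) \<partial>?H) \<longlonglongrightarrow> 0"
      unfolding \<tau>_def by (intro nn_integral_dist_dist_tendsto[OF p] lim) measurable
    obtain v G g where v: "\<And>n. C1_grad (v n) (G n)" "g \<in> borel_measurable borel"
      "\<And>n. (\<integral>\<^sup>+x\<in>?U. ennreal (norm (v n x - \<phi> x) powr p) \<partial>lborel) \<le> ennreal ((1/2)^n)"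
      "\<And>n. (\<integral>\<^sup>+x\<in>?S. ennreal (norm (v n x - \<tau> x) powr p) \<partial>?H) \<le> ennreal ((1/2)^n)"
      "(\<lambda>n. \<integral>\<^sup>+x\<in>?U. ennreal (norm (G n x - g x) powr p) \<partial>lborel) \<longlonglongrightarrow> 0"
      "AE a in lborel. a \<in> ?U \<longrightarrow>
        (\<forall>\<epsilon>>0. density_zero_at {x. norm (\<phi> x - \<phi> a - (\<Sum>i\<in>UNIV. (x - a) $ i *\<^sub>R g a $ i)) > \<epsilon> * norm (x - a)} a)"
    proof (rule energy_approx_C1_limit[OF p F12 \<phi>\<tau>(1) _ _ _ _ \<phi>\<tau>(2) lim12])
      show "emeasure ?H ?S < \<infinity>" by (rule emeasure_hausdorff_sphere_finite)
    qed (use that in auto)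
    have [measurable]: "v n \<in> borel_measurable borel" "G n \<in> borel_measurable borel" for n
      using C1_grad_continuous[OF v(1)[of n]] by (simp_all add: borel_measurable_continuous_onI)
    note v(2)[measurable]
    define X where "X = (\<integral>\<^sup>+x\<in>?U. ennreal (\<phi> x powr p) \<partial>lborel)"
    define Y where "Y = (\<integral>\<^sup>+x\<in>?S. ennreal (\<tau> x powr p) \<partial>?H)"
    define E where "E = (\<integral>\<^sup>+x\<in>?U. ennreal (norm (g x) powr p) \<partial>lborel)"
    define t where "t n = (\<integral>\<^sup>+x\<in>?U. ennreal (norm (G n x - g x) powr p) \<partial>lborel)" for n
    define s where "s n = ennreal ((1/2)^n)" for n :: nat
    define D where "D = ennreal (\<delta> powr p)"
    have le: "ennreal \<delta> * Y \<le> P * (ennreal C0 * (P * (X + s n) + D * (P * (E + t n))) + ennreal \<delta> * s n)" for n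
    proof -
      have VU: "(\<integral>\<^sup>+x\<in>?U. ennreal (norm (v n x) powr p) \<partial>lborel) \<le> P * (X + s n)"
      proof -
        have "(\<integral>\<^sup>+x\<in>?U. ennreal (norm (v n x) powr p) \<partial>lborel) \<le> P * (X + (\<integral>\<^sup>+x\<in>?U. ennreal (norm (v n x - \<phi> x) powr p) \<partial>lborel))"
          unfolding P_def X_def
        proof (rule nn_integral_powr_triangle[OF p])
          show "norm (v n x) \<le> \<phi> x + norm (v n x - \<phi> x)" for x
            using zero_le_dist[of "f1 x" "f2 x"] unfolding \<phi>_def real_norm_def by arith
        qed (auto simp: \<phi>_def)
        also have "\<dots> \<le> P * (X + s n)" unfolding s_def by (intro mult_left_mono add_left_mono v) simp
        finally show ?thesis .
      qed
      have GU: "(\<integral>\<^sup>+x\<in>?U. ennreal (norm (G n x) powr p) \<partial>lborel) \<le> P * (E + t n)"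
        unfolding P_def E_def t_def
      proof (rule nn_integral_powr_triangle[OF p])
        show "norm (G n x) \<le> norm (g x) + norm (G n x - g x)" for x
          using norm_triangle_ineq[of "g x" "G n x - g x"] by simp
      qed auto
      have "Y \<le> P * ((\<integral>\<^sup>+x\<in>?S. ennreal (norm (v n x) powr p) \<partial>?H) + (\<integral>\<^sup>+x\<in>?S. ennreal (norm (v n x - \<tau> x) powr p) \<partial>?H))"
        unfolding P_def Y_def by (rule nn_integral_powr_triangle[OF p]) (auto simp: \<tau>_def)
      also have "\<dots> \<le> P * ((\<integral>\<^sup>+x\<in>?S. ennreal (norm (v n x) powr p) \<partial>?H) + s n)"
        unfolding s_def by (intro mult_left_mono add_left_mono v) simp
      finally have "ennreal \<delta> * Y \<le> ennreal \<delta> * \<dots>" by (rule mult_left_mono) simp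
      also have "\<dots> = P * (ennreal \<delta> * (\<integral>\<^sup>+x\<in>?S. ennreal (norm (v n x) powr p) \<partial>?H) + ennreal \<delta> * s n)"
        by (simp add: distrib_left mult_ac)
      also have "\<dots> \<le> P * (ennreal C0 * (P * (X + s n) + D * (P * (E + t n))) + ennreal \<delta> * s n)"
        unfolding D_def
        by (intro mult_left_mono add_right_mono order_trans[OF C0(2)[OF v(1) \<delta>]] add_mono VU GU) auto
      finally show ?thesis .
    qed
    have s: "s \<longlonglongrightarrow> 0"
      unfolding s_def using tendsto_ennrealI[OF LIMSEQ_power_zero[of "1/2 :: real"]] by simp
    have t: "t \<longlonglongrightarrow> 0" unfolding t_def by (rule v(5))
    \<comment> \<open>On \<open>ennreal\<close> multiplication by an infinite constant is not
      continuous at 0, hence the care about the finiteness of the factors.\<close>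
    have R: "(\<lambda>n. P * (ennreal C0 * (P * (X + s n) + D * (P * (E + t n))) + ennreal \<delta> * s n))
      \<longlonglongrightarrow> P * (ennreal C0 * (P * (X + 0) + D * (P * (E + 0))) + ennreal \<delta> * 0)"
      by (intro ennreal_tendsto_cmult tendsto_add tendsto_const s t P) (simp_all add: D_def)
    have "ennreal \<delta> * Y \<le> P * (ennreal C0 * (P * (X + 0) + D * (P * (E + 0))) + ennreal \<delta> * 0)"
      by (rule LIMSEQ_le_const[OF R]) (use le in blast)
    also have "\<dots> = P * ennreal C0 * P * (X + D * E)" by (simp add: distrib_left mult_ac)
    also have "\<dots> \<le> P * ennreal C0 * P * (ennreal (1 + M) * X + D * (ennreal (1 + M) * (E1 + E2)))"
      if E12: "E \<le> ennreal M * (E1 + E2)" for E1 E2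
    proof (intro mult_left_mono add_mono)
      have "1 * X \<le> ennreal (1 + M) * X" by (intro mult_right_mono) (simp_all add: M_def)
      then show "X \<le> ennreal (1 + M) * X" by simp
      show "E \<le> ennreal (1 + M) * (E1 + E2)"
        by (rule order_trans[OF E12]) (intro mult_right_mono ennreal_leI, auto)
    qed auto
    finally have "ennreal \<delta> * Y \<le> P * ennreal C0 * P * (ennreal (1 + M) * X + D * (ennreal (1 + M) * (E1 + E2)))"
      if "E \<le> ennreal M * (E1 + E2)" for E1 E2 using that by blast
    moreover have "P * ennreal C0 * P * (ennreal (1 + M) * X + D * (ennreal (1 + M) * Z)) = ennreal C * (X + D * Z)" for Z
    proof -
      have "ennreal C = P * ennreal C0 * P * ennreal (1 + M)"
        unfolding C_def P(2) using C0(1) by (simp add: ennreal_mult' del: ennreal_plus)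
      then show ?thesis by (simp add: distrib_left mult_ac del: ennreal_plus)
    qed
    ultimately have *: "ennreal \<delta> * Y \<le> ennreal C * (X + D * (E1 + E2))" if "E \<le> ennreal M * (E1 + E2)" for E1 E2
      using that by metis
    have XL: "X = (\<integral>\<^sup>+x\<in>?U. ennreal (dist (f1 x) (f2 x) powr p) \<partial>lebesgue)"
      unfolding X_def \<phi>_def by (rule nn_integral_completion[symmetric])
    show "ennreal \<delta> * (\<integral>\<^sup>+x\<in>?S. ennreal (dist (\<tau>1 x) (\<tau>2 x) powr p) \<partial>?H) \<le>
      ennreal C * ((\<integral>\<^sup>+x\<in>?U. ennreal (dist (f1 x) (f2 x) powr p) \<partial>lebesgue)
      + ennreal (\<delta> powr p) * ((\<integral>\<^sup>+x\<in>?U. ennreal (abs_deriv ?U f1 x powr p) \<partial>lebesgue)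
        + (\<integral>\<^sup>+x\<in>?U. ennreal (abs_deriv ?U f2 x powr p) \<partial>lebesgue)))"
      using *[OF gradient_energy_le[OF p F f v(2) v(6)[unfolded \<phi>_def], folded E_def M_def]]
      unfolding Y_def \<tau>_def XL D_def .
  qed
qed

section \<open>Lipschitz maps and their traces\<close>

text \<open>Composition with the nearest point projection onto the ball, which is 1-Lipschitz, keeps
  the constant \<open>L\<close>.\<close>

lemma Lipschitz_retract_ball:
  fixes f :: "real^'m::finite \<Rightarrow> 'b::metric_space"
  assumes f: "L-lipschitz_on (cball 0 1) f"
  obtains F where "L-lipschitz_on UNIV F" "\<And>x. x \<in> cball 0 1 \<Longrightarrow> F x = f x"
proof (rule that[of "\<lambda>x. f (closest_point (cball 0 1) x)"])
  have cp: "closest_point (cball 0 1) x \<in> cball 0 1" for x :: "real^'m"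
    by (intro closest_point_in_set) auto
  show "L-lipschitz_on UNIV (\<lambda>x. f (closest_point (cball 0 1) x))"
  proof (rule lipschitz_onI)
    fix x y :: "real^'m"
    have "dist (f (closest_point (cball 0 1) x)) (f (closest_point (cball 0 1) y))
      \<le> L * dist (closest_point (cball 0 1) x) (closest_point (cball 0 1) y)"
      by (intro lipschitz_onD[OF f] cp)
    also have "\<dots> \<le> L * dist x y"
      by (intro mult_left_mono closest_point_lipschitz lipschitz_on_nonneg[OF f]) auto
    finally show "dist (f (closest_point (cball 0 1) x)) (f (closest_point (cball 0 1) y)) \<le> L * dist x y" .
  qed (rule lipschitz_on_nonneg[OF f])
qed (simp add: closest_point_self)

lemma is_trace_restrict:
  fixes \<tau> :: "real^'m::finite \<Rightarrow> 'b::metric_space"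
  assumes "is_trace p f \<tau>"
  shows "is_trace p f (restrict \<tau> (sphere 0 1))"
proof -
  let ?H = "hausdorff_measure (CARD('m) - 1) :: (real^'m) measure"
  obtain F K where F: "\<tau> \<in> borel_measurable borel" "energy_approx p F f K"
    "(\<lambda>j. \<integral>\<^sup>+x\<in>sphere 0 1. ennreal (dist (F j x) (\<tau> x) powr p) \<partial>?H) \<longlonglongrightarrow> 0"
    using assms unfolding is_trace_def by blast
  have [measurable]: "sphere (0 :: real^'m) 1 \<in> sets borel" by simp
  note F(1)[measurable]
  have "restrict \<tau> (sphere 0 1) \<in> borel_measurable borel" unfolding restrict_def by measurable
  moreover have "(\<integral>\<^sup>+x\<in>sphere 0 1. ennreal (dist (F j x) (restrict \<tau> (sphere 0 1) x) powr p) \<partial>?H)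
    = (\<integral>\<^sup>+x\<in>sphere 0 1. ennreal (dist (F j x) (\<tau> x) powr p) \<partial>?H)" for j
    by (intro nn_integral_cong) (auto simp: indicator_def)
  ultimately show ?thesis unfolding is_trace_def using F(2,3) by auto
qed

lemma is_trace_Lipschitz:
  fixes f :: "real^'m::finite \<Rightarrow> 'b::metric_space"
  assumes p: "1 < p" and f: "L-lipschitz_on (cball 0 1) f" and g: "\<And>x. x \<in> ball 0 1 \<Longrightarrow> g x = f x"
  obtains \<tau> where "is_trace p g \<tau>" "\<And>x. x \<in> sphere 0 1 \<Longrightarrow> \<tau> x = f x"
proof -
  let ?H = "hausdorff_measure (CARD('m) - 1) :: (real^'m) measure"
  obtain F where F: "L-lipschitz_on UNIV F" "\<And>x. x \<in> cball 0 1 \<Longrightarrow> F x = f x"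
    by (rule Lipschitz_retract_ball[OF f]) blast
  obtain K where K: "energy_approx p (\<lambda>_. F) g K"
    using energy_approx_const[OF p F(1), of g] F(2) g by fastforce
  have "(\<integral>\<^sup>+x\<in>sphere 0 1. ennreal (dist (F x) (F x) powr p) \<partial>?H) = 0" by simp
  then have "is_trace p g F"
    unfolding is_trace_def using energy_approx_measurable[OF K] K by (intro conjI exI[of _ "\<lambda>_. F"] exI[of _ K]) auto
  then show ?thesis by (rule that) (auto intro: F(2))
qed

lemma tuple_abs_bounded:
  fixes F :: "real^'m::finite \<Rightarrow> ('h::real_normed_vector, 'q::finite) unordered_tuple"
  assumes "L-lipschitz_on UNIV F"
  obtains c where "0 \<le> c" "\<And>x. x \<in> cball 0 1 \<Longrightarrow> tuple_abs (F x) \<le> c"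
proof (rule that[of "tuple_abs (F 0) + L"])
  show "tuple_abs (F x) \<le> tuple_abs (F 0) + L" if "x \<in> cball 0 1" for x
  proof -
    have "dist (F x) (F 0) \<le> L * dist x 0" by (rule lipschitz_onD[OF assms]) auto
    also have "\<dots> \<le> L * 1" using that lipschitz_on_nonneg[OF assms] by (intro mult_left_mono) auto
    finally show ?thesis unfolding tuple_abs_def using dist_triangle[of "F x" "unordered (\<lambda>_. 0)" "F 0"] by linarith
  qed
  show "0 \<le> tuple_abs (F 0) + L" using lipschitz_on_nonneg[OF assms] by (simp add: tuple_abs_def)
qed

text \<open>The approximating sequence is constant. Its energy is finite because |Df| of an
  L-Lipschitz map is bounded, with value 0 where no derivative exists.\<close>

lemma Lipschitz_in_sobolev:
  fixes f :: "real^'m::finite \<Rightarrow> ('h::{real_inner, polish_space}, 'q::finite) unordered_tuple"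
  assumes p: "1 < p" and f: "L-lipschitz_on (cball 0 1) f"
  shows "restrict f (ball 0 1) \<in> sobolev p (ball 0 1)"
proof -
  let ?U = "ball (0 :: real^'m) 1"
  obtain F where F: "L-lipschitz_on UNIV F" "\<And>x. x \<in> cball 0 1 \<Longrightarrow> F x = f x"
    by (rule Lipschitz_retract_ball[OF f]) blast
  have eq: "restrict f ?U x = F x" if "x \<in> ?U" for x using that F(2)[of x] by simp
  have Fm: "F \<in> borel_measurable borel"
    by (intro borel_measurable_continuous_onI lipschitz_on_continuous_on[OF F(1)])
  have fin: "emeasure lebesgue ?U < \<infinity>" using emeasure_lborel_ball_finite[of "0 :: real^'m" 1] by simp
  obtain c where c: "0 \<le> c" "\<And>x. x \<in> cball 0 1 \<Longrightarrow> tuple_abs (F x) \<le> c" by (rule tuple_abs_bounded[OF F(1)]) (rule that; assumption)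
  have bounded: "(\<integral>\<^sup>+x\<in>?U. ennreal (h x powr p) \<partial>lebesgue) < \<infinity>"
    if h: "\<And>x. x \<in> ?U \<Longrightarrow> 0 \<le> h x \<and> h x \<le> b" for h b
  proof -
    have "(\<integral>\<^sup>+x\<in>?U. ennreal (h x powr p) \<partial>lebesgue) \<le> (\<integral>\<^sup>+x. ennreal (b powr p) * indicator ?U x \<partial>lebesgue)"
      using h p by (intro nn_integral_mono) (auto simp: indicator_def intro!: ennreal_leI powr_mono2)
    also have "\<dots> < \<infinity>" using fin by (simp add: nn_integral_cmult_indicator ennreal_mult_less_top)
    finally show ?thesis .
  qed
  have "restrict f ?U \<in> borel_measurable (restrict_space borel ?U)"
    by (rule measurable_cong[THEN iffD2, OF _ measurable_restrict_space1[OF Fm]]) (simp add: space_restrict_space F(2))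
  moreover have "(\<integral>\<^sup>+x\<in>?U. ennreal (tuple_abs (restrict f ?U x) powr p) \<partial>lebesgue) < \<infinity>"
  proof (rule bounded[of _ c])
    fix x assume x: "x \<in> ?U"
    show "0 \<le> tuple_abs (restrict f ?U x) \<and> tuple_abs (restrict f ?U x) \<le> c"
      unfolding eq[OF x] using c(2)[of x] x by (simp add: tuple_abs_def)
  qed
  moreover have "(\<integral>\<^sup>+x\<in>?U. ennreal (abs_deriv UNIV F x powr p) \<partial>lebesgue) < \<infinity>"
  proof (rule bounded[of _ "real CARD('q) * real CARD('m) * L"], intro conjI abs_deriv_nonneg)
    fix x
    show "abs_deriv UNIV F x \<le> real CARD('q) * real CARD('m) * L"
    proof (cases "approx_differentiable UNIV F x")
      case True
      then show ?thesis unfolding approx_differentiable_def using abs_deriv_le_of_Lipschitz[OF Fm _ F(1)] by blast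
    next
      case False
      then show ?thesis using lipschitz_on_nonneg[OF F(1)] by (simp add: abs_deriv_def)
    qed
  qed
  moreover have "Lp_dist p ?U (restrict f ?U) F = 0"
  proof -
    have "(\<integral>\<^sup>+x\<in>?U. ennreal (dist (restrict f ?U x) (F x) powr p) \<partial>lebesgue) = (\<integral>\<^sup>+x. 0 \<partial>(lebesgue :: (real^'m) measure))"
      using eq by (intro nn_integral_cong) (auto simp: indicator_def)
    then show ?thesis by (simp add: Lp_dist_def)
  qed
  ultimately show ?thesis unfolding sobolev_def Lp_maps_def
    using F(1) by (intro CollectI conjI exI[of _ "\<lambda>_. F"]) auto
qed

text \<open>The trace is at finite Lp distance from a Lipschitz map, which is bounded on the sphere,
  and the sphere has finite measure.\<close>

lemma is_trace_Lp:
  fixes f :: "real^'m::finite \<Rightarrow> ('h::{real_inner, polish_space}, 'q::finite) unordered_tuple"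
  assumes p: "1 < p" and \<tau>: "is_trace p f \<tau>"
  shows "(\<integral>\<^sup>+x\<in>sphere 0 1. ennreal (tuple_abs (\<tau> x) powr p) \<partial>hausdorff_measure (CARD('m) - 1)) < \<infinity>"
proof -
  let ?H = "hausdorff_measure (CARD('m) - 1) :: (real^'m) measure"
  let ?S = "sphere (0 :: real^'m) 1"
  obtain F K where F: "energy_approx p F f K" and \<tau>m[measurable]: "\<tau> \<in> borel_measurable borel"
    and lim: "(\<lambda>j. \<integral>\<^sup>+x\<in>?S. ennreal (dist (F j x) (\<tau> x) powr p) \<partial>?H) \<longlonglongrightarrow> 0"
    using \<tau> unfolding is_trace_def by blast
  note energy_approx_measurable[OF F, measurable]
  have "\<forall>\<^sub>F j in sequentially. (\<integral>\<^sup>+x\<in>?S. ennreal (dist (F j x) (\<tau> x) powr p) \<partial>?H) < ennreal 1"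
    using lim by (intro order_tendstoD) auto
  then obtain j where j: "(\<integral>\<^sup>+x\<in>?S. ennreal (dist (F j x) (\<tau> x) powr p) \<partial>?H) < ennreal 1"
    using eventually_happens'[OF sequentially_bot] by blast
  obtain L where L: "L-lipschitz_on UNIV (F j)" using F unfolding energy_approx_def by blast
  obtain c where c: "0 \<le> c" "\<And>x. x \<in> cball 0 1 \<Longrightarrow> tuple_abs (F j x) \<le> c"
    by (rule tuple_abs_bounded[OF L]) (rule that; assumption)
  have "(\<integral>\<^sup>+x\<in>?S. ennreal (tuple_abs (\<tau> x) powr p) \<partial>?H)
    \<le> ennreal (2 powr p) * ((\<integral>\<^sup>+x\<in>?S. ennreal (dist (F j x) (\<tau> x) powr p) \<partial>?H) + (\<integral>\<^sup>+x\<in>?S. ennreal (c powr p) \<partial>?H))"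
  proof (rule nn_integral_powr_triangle[OF p])
    show "tuple_abs (\<tau> x) \<le> dist (F j x) (\<tau> x) + c" if "x \<in> ?S" for x
      using c(2)[of x] that dist_triangle3[of "\<tau> x" "unordered (\<lambda>_. 0)" "F j x"] by (auto simp: tuple_abs_def)
  qed (use c(1) in \<open>auto simp: tuple_abs_def\<close>)
  also have "\<dots> < \<infinity>"
    using j emeasure_hausdorff_sphere_finite[where 'm = 'm] less_trans[OF j ennreal_less_top]
    by (simp add: nn_integral_cmult_indicator ennreal_mult_less_top)
  finally show ?thesis .
qed

lemma abs_deriv_zero:
  fixes U :: "(real^'m::finite) set"
  assumes U: "open U" "a \<in> U"
  shows "abs_deriv U (restrict (\<lambda>_. unordered (\<lambda>_. 0)) U
    :: real^'m \<Rightarrow> ('h::{real_inner, second_countable_topology}, 'q::finite) unordered_tuple) a = 0" (is "abs_deriv U ?f a = 0")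
proof -
  have [measurable]: "U \<in> sets borel" using U(1) by simp
  have f: "?f \<in> borel_measurable borel" unfolding restrict_def by measurable
  have "approx_affine U ?f a (\<lambda>_ _. 0)"
    unfolding approx_affine_def
  proof (intro conjI allI impI)
    show "affine_map (\<lambda>_ :: real^'m. 0 :: 'h)" by (simp add: affine_map_def module_hom_zero)
    fix \<epsilon> :: real assume "0 < \<epsilon>"
    then have "{x \<in> U. \<epsilon> * norm (x - a) < dist (?f x) (unordered (\<lambda>_. 0))} = {}"
      by (auto simp: not_less)
    then show "density_zero_at {x \<in> U. \<epsilon> * norm (x - a) < dist (?f x) (unordered (\<lambda>_. 0))} a"
      by (simp add: density_zero_at_def)
  qed
  then have "approx_affine UNIV ?f a (\<lambda>_ _. 0)" using approx_affine_open(1)[OF U f] by blast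
  from abs_deriv_eq[OF f U this] show ?thesis by simp
qed

theorem theorem4p7p3:
  fixes p :: real and U :: "(real^'m::finite) set"
  assumes infinite_dim: "\<nexists>B :: 'h::{real_inner, polish_space} set. finite B \<and> span B = UNIV"
    and p: "1 < p"
    and U: "U = ball 0 1"
  shows "\<exists>\<T> :: (real^'m \<Rightarrow> ('h, 'q::finite) unordered_tuple) \<Rightarrow> (real^'m \<Rightarrow> ('h, 'q) unordered_tuple).
    \<T> \<in> sobolev p U \<rightarrow> Lp_maps p (frontier U) (hausdorff_measure (CARD('m) - 1)) \<and>
    (\<forall>f. (\<exists>L. L-lipschitz_on (closure U) f) \<longrightarrow>
      restrict f U \<in> sobolev p U \<and> (\<forall>x\<in>frontier U. \<T> (restrict f U) x = f x)) \<and>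
    (\<forall>\<epsilon>>0. \<exists>\<theta>>0. \<forall>f\<^sub>1\<in>sobolev p U. \<forall>f\<^sub>2\<in>sobolev p U.
      (\<integral>\<^sup>+x\<in>frontier U. ennreal (dist (\<T> f\<^sub>1 x) (\<T> f\<^sub>2 x) powr p) \<partial>hausdorff_measure (CARD('m) - 1))
      \<le> ennreal \<theta> * (\<integral>\<^sup>+x\<in>U. ennreal (dist (f\<^sub>1 x) (f\<^sub>2 x) powr p) \<partial>lebesgue)
        + ennreal \<epsilon> * ((\<integral>\<^sup>+x\<in>U. ennreal (abs_deriv U f\<^sub>1 x powr p) \<partial>lebesgue)
            + (\<integral>\<^sup>+x\<in>U. ennreal (abs_deriv U f\<^sub>2 x powr p) \<partial>lebesgue))) \<and>
    (\<exists>C>0. \<forall>f\<in>sobolev p U.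
      (\<integral>\<^sup>+x\<in>frontier U. ennreal (tuple_abs (\<T> f x) powr p) \<partial>hausdorff_measure (CARD('m) - 1))
      \<le> ennreal C * ((\<integral>\<^sup>+x\<in>U. ennreal (tuple_abs (f x) powr p) \<partial>lebesgue)
        + (\<integral>\<^sup>+x\<in>U. ennreal (abs_deriv U f x powr p) \<partial>lebesgue)))"
proof -
  let ?H = "hausdorff_measure (CARD('m) - 1) :: (real^'m) measure"
  define S where "S = sphere (0 :: real^'m) 1"
  have frontier: "frontier U = S" and closure: "closure U = cball 0 1" by (simp_all add: U S_def)
  have open_U: "open U" and S_sub: "S \<subseteq> closure U" by (auto simp: U S_def)
  \<comment> \<open>(A) is a pointwise statement, whereas the trace as a limit in Lp is free on null
    sets; \<open>good\<close> therefore prescribes the values on \<open>S\<close> whenever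
    \<open>f\<close> has a Lipschitz extension.\<close>
  define good where "good f \<tau> \<longleftrightarrow> is_trace p f \<tau> \<and>
    (\<forall>g L. L-lipschitz_on (closure U) g \<longrightarrow> restrict g U = f \<longrightarrow> (\<forall>x\<in>S. \<tau> x = g x))"
    for f \<tau> :: "real^'m \<Rightarrow> ('h, 'q) unordered_tuple"
  define \<T> :: "(real^'m \<Rightarrow> ('h, 'q) unordered_tuple) \<Rightarrow> real^'m \<Rightarrow> ('h, 'q) unordered_tuple"
    where "\<T> f = restrict (SOME \<tau>. good f \<tau>) S" for f
  have good: "good f (\<T> f)" if f: "f \<in> sobolev p U" for f
  proof -
    have "\<exists>\<tau>. good f \<tau>"
    proof (cases "\<exists>g L. L-lipschitz_on (closure U) g \<and> restrict g U = f")
      case True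
      then obtain g L where g: "L-lipschitz_on (closure U) g" "restrict g U = f" by blast
      have fg: "f x = g x" if "x \<in> ball 0 1" for x using g(2) that by (auto simp: U)
      obtain \<tau> where \<tau>: "is_trace p f \<tau>" "\<And>x. x \<in> S \<Longrightarrow> \<tau> x = g x"
        unfolding S_def by (rule is_trace_Lipschitz[OF p g(1)[unfolded closure] fg]) blast+
      \<comment> \<open>Two Lipschitz extensions agree in \<open>U\<close> and by continuity on its
        closure, so the prescribed values do not depend on the extension.\<close>
      have "\<tau> x = g' x" if g': "L'-lipschitz_on (closure U) g'" "restrict g' U = f" and x: "x \<in> S" for g' L' x
      proof -
        have "dist (g x) (g' x) = 0"
        proof (rule continuous_constant_on_closure[OF lipschitz_on_continuous_on[OF Lipschitz_dist[OF g(1) g'(1)]]])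
          show "dist (g y) (g' y) = 0" if "y \<in> U" for y
            using fun_cong[OF g(2), of y] fun_cong[OF g'(2), of y] that by simp
          show "x \<in> closure U" using x S_sub by blast
        qed
        then show ?thesis using \<tau>(2)[OF x] by simp
      qed
      then show ?thesis using \<tau>(1) unfolding good_def by blast
    next
      case False
      obtain F K where "f \<in> borel_measurable borel" "energy_approx p F f K"
        by (rule sobolev_energy_approx[OF p f[unfolded U]])
      then obtain \<tau> where "is_trace p f \<tau>" using is_trace_exists[OF p] by blast
      then show ?thesis using False unfolding good_def by blast
    qed
    then have "good f (SOME \<tau>. good f \<tau>)" by (rule someI_ex)
    then show ?thesis
      using is_trace_restrict[of p f "SOME \<tau>. good f \<tau>"] unfolding good_def \<T>_def S_def by auto
  qed
  have trace: "is_trace p f (\<T> f)" if "f \<in> sobolev p U" for f using good[OF that] by (simp add: good_def)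
  have borel: "f \<in> borel_measurable borel" if "f \<in> sobolev p U" for f :: "real^'m \<Rightarrow> ('h, 'q) unordered_tuple"
    by (rule sobolev_energy_approx[OF p that[unfolded U]])
  have maps: "\<T> \<in> sobolev p U \<rightarrow> Lp_maps p S ?H"
  proof
    fix f :: "real^'m \<Rightarrow> ('h, 'q) unordered_tuple" assume f: "f \<in> sobolev p U"
    have "\<T> f \<in> borel_measurable borel" using trace[OF f] by (simp add: is_trace_def)
    then show "\<T> f \<in> Lp_maps p S ?H"
      using is_trace_Lp[OF p trace[OF f]]
      by (simp add: Lp_maps_def measurable_restrict_space1 \<T>_def S_def)
  qed
  have Lipschitz: "restrict f U \<in> sobolev p U" "x \<in> S \<Longrightarrow> \<T> (restrict f U) x = f x"
    if f: "L-lipschitz_on (closure U) f" for f :: "real^'m \<Rightarrow> ('h, 'q) unordered_tuple" and L x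
  proof -
    show *: "restrict f U \<in> sobolev p U" using Lipschitz_in_sobolev[OF p f[unfolded closure]] by (simp only: U)
    show "\<T> (restrict f U) x = f x" if "x \<in> S" using good[OF *] f that unfolding good_def by blast
  qed
  obtain C0 where C0: "0 < C0" "\<And>(f1 :: real^'m \<Rightarrow> ('h, 'q) unordered_tuple) f2 \<tau>1 \<tau>2 \<delta>.
    f1 \<in> borel_measurable borel \<Longrightarrow> f2 \<in> borel_measurable borel \<Longrightarrow> is_trace p f1 \<tau>1 \<Longrightarrow> is_trace p f2 \<tau>2 \<Longrightarrow>
    0 < \<delta> \<Longrightarrow> \<delta> \<le> 1/2 \<Longrightarrow>
    ennreal \<delta> * (\<integral>\<^sup>+x\<in>S. ennreal (dist (\<tau>1 x) (\<tau>2 x) powr p) \<partial>?H) \<le>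
    ennreal C0 * ((\<integral>\<^sup>+x\<in>U. ennreal (dist (f1 x) (f2 x) powr p) \<partial>lebesgue)
      + ennreal (\<delta> powr p) * ((\<integral>\<^sup>+x\<in>U. ennreal (abs_deriv U f1 x powr p) \<partial>lebesgue)
        + (\<integral>\<^sup>+x\<in>U. ennreal (abs_deriv U f2 x powr p) \<partial>lebesgue)))"
    by (rule trace_inequality[OF p, where 'm = 'm and 'h = 'h and 'q = 'q, folded U S_def]) (rule that; assumption)
  have B: "\<exists>\<theta>>0. \<forall>f1\<in>sobolev p U. \<forall>f2\<in>sobolev p U.
      (\<integral>\<^sup>+x\<in>S. ennreal (dist (\<T> f1 x) (\<T> f2 x) powr p) \<partial>?H)
      \<le> ennreal \<theta> * (\<integral>\<^sup>+x\<in>U. ennreal (dist (f1 x) (f2 x) powr p) \<partial>lebesgue)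
        + ennreal \<epsilon> * ((\<integral>\<^sup>+x\<in>U. ennreal (abs_deriv U f1 x powr p) \<partial>lebesgue)
            + (\<integral>\<^sup>+x\<in>U. ennreal (abs_deriv U f2 x powr p) \<partial>lebesgue))" if \<epsilon>: "0 < \<epsilon>" for \<epsilon>
  proof -
    \<comment> \<open>After division by \<delta> the energies carry the factor C0 \<delta> powr (p -
      1), which is small since p > 1; \<theta> becomes C0 / \<delta>.\<close>
    obtain \<delta> where \<delta>: "0 < \<delta>" "\<delta> \<le> 1/2" "C0 * \<delta> powr (p - 1) \<le> \<epsilon>"
      by (rule small_root_exists[of \<epsilon> C0 "p - 1"]) (use \<epsilon> C0(1) p in auto)
    have \<delta>p: "C0 * \<delta> powr p \<le> \<delta> * \<epsilon>"
    proof -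
      have "C0 * \<delta> powr p = C0 * \<delta> powr (p - 1) * \<delta>" using \<delta>(1) by (simp add: powr_diff)
      also have "\<dots> \<le> \<epsilon> * \<delta>" using \<delta> by (intro mult_right_mono) auto
      finally show ?thesis by (simp add: mult.commute)
    qed
    have cancel: "Y \<le> ennreal (C0 / \<delta>) * X + ennreal \<epsilon> * Z"
      if Y: "ennreal \<delta> * Y \<le> ennreal C0 * (X + ennreal (\<delta> powr p) * Z)" for X Y Z
    proof -
      note Y
      also have "ennreal C0 * (X + ennreal (\<delta> powr p) * Z) = ennreal C0 * X + ennreal (C0 * \<delta> powr p) * Z"
        using C0(1) by (simp add: distrib_left ennreal_mult mult_ac)
      also have "\<dots> \<le> ennreal C0 * X + ennreal (\<delta> * \<epsilon>) * Z"
        by (intro add_left_mono mult_right_mono ennreal_leI \<delta>p) simp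
      also have "ennreal C0 = ennreal \<delta> * ennreal (C0 / \<delta>)" using \<delta>(1) C0(1) by (simp add: ennreal_mult[symmetric])
      also have "ennreal (\<delta> * \<epsilon>) = ennreal \<delta> * ennreal \<epsilon>" using \<delta>(1) \<epsilon> by (simp add: ennreal_mult)
      finally have "ennreal \<delta> * Y \<le> ennreal \<delta> * (ennreal (C0 / \<delta>) * X + ennreal \<epsilon> * Z)"
        by (simp only: distrib_left mult.assoc)
      then show ?thesis using \<delta>(1) by (subst (asm) ennreal_mult_le_mult_iff) auto
    qed
    show ?thesis
      by (intro exI[of _ "C0 / \<delta>"] conjI ballI cancel C0(2) borel trace \<delta>) (use C0(1) \<delta>(1) in auto)
  qed
  have "\<exists>C>0. \<forall>f\<in>sobolev p U.
      (\<integral>\<^sup>+x\<in>S. ennreal (tuple_abs (\<T> f x) powr p) \<partial>?H)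
      \<le> ennreal C * ((\<integral>\<^sup>+x\<in>U. ennreal (tuple_abs (f x) powr p) \<partial>lebesgue)
        + (\<integral>\<^sup>+x\<in>U. ennreal (abs_deriv U f x powr p) \<partial>lebesgue))"
  proof -
    \<comment> \<open>(C) is (B) with \<epsilon> = 1 for \<open>f\<close> and the zero tuple, whose
      trace is zero by (A) and whose derivative vanishes.\<close>
    define z :: "real^'m \<Rightarrow> ('h, 'q) unordered_tuple" where "z = (\<lambda>_. unordered (\<lambda>_. 0))"
    have z_eq: "z x = unordered (\<lambda>_. 0)" for x by (simp add: z_def)
    have "0-lipschitz_on (closure U) z" by (rule lipschitz_onI) (simp_all add: z_def)
    note z = Lipschitz[OF this]
    obtain \<theta> where \<theta>: "0 < \<theta>" "\<forall>f1\<in>sobolev p U. \<forall>f2\<in>sobolev p U.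
      (\<integral>\<^sup>+x\<in>S. ennreal (dist (\<T> f1 x) (\<T> f2 x) powr p) \<partial>?H)
      \<le> ennreal \<theta> * (\<integral>\<^sup>+x\<in>U. ennreal (dist (f1 x) (f2 x) powr p) \<partial>lebesgue)
        + ennreal 1 * ((\<integral>\<^sup>+x\<in>U. ennreal (abs_deriv U f1 x powr p) \<partial>lebesgue)
            + (\<integral>\<^sup>+x\<in>U. ennreal (abs_deriv U f2 x powr p) \<partial>lebesgue))"
      using B[OF zero_less_one] by blast
    have 0: "(\<integral>\<^sup>+x\<in>U. ennreal (abs_deriv U (restrict z U) x powr p) \<partial>lebesgue) = (\<integral>\<^sup>+x. 0 \<partial>(lebesgue :: (real^'m) measure))"
      unfolding z_def by (intro nn_integral_cong) (auto simp: indicator_def abs_deriv_zero[OF open_U])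
    have S_eq: "(\<integral>\<^sup>+x\<in>S. ennreal (dist (\<T> f x) (\<T> (restrict z U) x) powr p) \<partial>?H)
      = (\<integral>\<^sup>+x\<in>S. ennreal (tuple_abs (\<T> f x) powr p) \<partial>?H)" for f
      by (intro nn_integral_cong) (auto simp: indicator_def z(2) z_eq tuple_abs_def)
    have U_eq: "(\<integral>\<^sup>+x\<in>U. ennreal (dist (f x) (restrict z U x) powr p) \<partial>lebesgue)
      = (\<integral>\<^sup>+x\<in>U. ennreal (tuple_abs (f x) powr p) \<partial>lebesgue)" for f
      by (intro nn_integral_cong) (auto simp: indicator_def z_eq tuple_abs_def)
    show ?thesis
    proof (intro exI[of _ "\<theta> + 1"] conjI ballI)
      show "0 < \<theta> + 1" using \<theta>(1) by simp
      fix f :: "real^'m \<Rightarrow> ('h, 'q) unordered_tuple" assume "f \<in> sobolev p U"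
      from \<theta>(2)[rule_format, OF this z(1)]
      have "(\<integral>\<^sup>+x\<in>S. ennreal (tuple_abs (\<T> f x) powr p) \<partial>?H)
        \<le> ennreal \<theta> * (\<integral>\<^sup>+x\<in>U. ennreal (tuple_abs (f x) powr p) \<partial>lebesgue)
          + ennreal 1 * (\<integral>\<^sup>+x\<in>U. ennreal (abs_deriv U f x powr p) \<partial>lebesgue)"
        unfolding S_eq U_eq 0 by simp
      also have "\<dots> \<le> ennreal (\<theta> + 1) * (\<integral>\<^sup>+x\<in>U. ennreal (tuple_abs (f x) powr p) \<partial>lebesgue)
          + ennreal (\<theta> + 1) * (\<integral>\<^sup>+x\<in>U. ennreal (abs_deriv U f x powr p) \<partial>lebesgue)"
        using \<theta>(1) by (intro add_mono mult_right_mono ennreal_leI) auto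
      finally show "(\<integral>\<^sup>+x\<in>S. ennreal (tuple_abs (\<T> f x) powr p) \<partial>?H)
        \<le> ennreal (\<theta> + 1) * ((\<integral>\<^sup>+x\<in>U. ennreal (tuple_abs (f x) powr p) \<partial>lebesgue)
          + (\<integral>\<^sup>+x\<in>U. ennreal (abs_deriv U f x powr p) \<partial>lebesgue))"
        by (simp only: distrib_left)
    qed
  qed
  then show ?thesis
    unfolding frontier using maps Lipschitz B by (intro exI[of _ \<T>] conjI allI impI ballI) blast+
qed

end
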